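(* Let $G$ be a finite group, and let $j\colon \mathcal D(G)\to \mathbf B_\bullet(G)$ be the bivariant functor from finite left $G$-sets to the additive completion of the conjugation biset category of $G$. If $F\colon\mathbf B_\bullet(G)\to\mathcal Ab$ is an additive functor, then $F\circ j\colon\mathcal D(G)\to\mathcal Ab$ is a conjugation invariant Mackey functor. Conversely, any conjugation invariant Mackey functor $\mathcal M\colon\mathcal D(G)\to\mathcal Ab$ factors uniquely through an additive functor out of $\mathbf B_\bullet(G)$; that is, there is a unique additive functor $F\colon\mathbf B_\bullet(G)\to\mathcal Ab$ with $\mathcal M=F\circ j$.
   Context: $G$ is a finite group; $\mathcal Ab$ is the category of abelian groups; $\mathcal D(G)$ is the category of finite left $G$-sets and $G$-maps. Bivariant functor. A bivariant functor $\mathcal M=(\mathcal M_*,\mathcal M^* )$ is a pair consisting of a covariant functor $\mathcal M_*$ and a contravariant functor $\mathcal M^*$ which agree on objects (write $\mathcal M(S)$ for the common value). For a morphism $\varphi$ write $\varphi_{\mathcal M}=\mathcal M_*(\varphi)$ and $\varphi^{\mathcal M}=\mathcal M^*(\varphi)$. Mackey functor. A Mackey functor is a bivariant functor $\mathcal M\colon\mathcal D(G)\to\mathcal Ab$ such that: (M1) for every pullback square of finite $G$-sets with $\Psi\colon S\to S_1$, $\Phi\colon S\to S_2$, $\varphi\colon S_1\to T$, $\psi\colon S_2\to T$, one has $\varphi^{\mathcal M}\circ\psi_{\mathcal M}=\Psi_{\mathcal M}\circ\Phi^{\mathcal M}$; (M2) the embeddings of $S_1,S_2$ in $S_1\sqcup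 S_2$ induce an isomorphism $\mathcal M^*(S_1\sqcup S_2)\to\mathcal M^*(S_1)\oplus\mathcal M^*(S_2)$, and $\mathcal M(\emptyset)=0$. Conjugation invariance. $\mathcal M$ is conjugation invariant if for every subgroup $H\subseteq G$ and every $z\in C_G(H)$ (the centralizer), the $G$-map $\varphi_z\colon G/H\to G/H$, $eH\mapsto zH$, satisfies $\mathcal M_*(\varphi_z)=\mathrm{id}$. Bisets. For subgroups $H_1,H_2\subseteq G$, a finite $H_2$-$H_1$ biset is a finite set with commuting left $H_2$- and right $H_1$-actions; it is bifree if both actions are free, and indecomposable if it is nonempty and $X=H_2xH_1$ for some $x$. For a bifree biset $X$ and $x\in X$ put $L_x=\{h_2\in H_2: h_2x\in xH_1\}$, let $\gamma_{X,x}(h_2)$ be the unique $h_1\in H_1$ with $h_2x=xh_1$ for $h_2\in L_x$, and let $K_x=\gamma_{X,x}(L_x)\subseteq H_1$; then $\gamma_{X,x}\colon L_x\to K_x$ is an isomorphism of groups. A bifree biset $X$ is a conjugation biset if for each $x\in X$ there is $g\in G$ with $g^{-1}L_xg=K_x$ and $\gamma_{X,x}(h)=g^{-1}hg$ for all $h\in L_x$ (it suffices to check one $x$ in each component $H_2xH_1$). The category $\mathbf B_\bullet(G)$. $\mathbf B(G)$ has the subgroups of $G$ as objects, and $\mathrm{Hom}_{\mathbf B(G)}(H_1,H_2)$ is the Grothendieck group, under disjoint union, of isomorphism classes of finite $H_2$-$H_1$ conjugation bisets; composition is induced by the balanced product $X\circ Y=X\times_{H_2}Y$ for $X$ an $H_3$-$H_2$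 biset and $Y$ an $H_2$-$H_1$ biset. $\mathbf B_\bullet(G)$ is the free additive completion of $\mathbf B(G)$: objects are finite ordered tuples of subgroups of $G$ (including the empty tuple), and morphisms are matrices of morphisms of $\mathbf B(G)$. The bivariant functor $j=(j_*,j^* )$. Choose for each finite $G$-set $S$ an ordered list $b_1,\dots,b_k$ of base points, one in each $G$-orbit (the choice being made compatibly with disjoint unions, the list for $S\sqcup T$ being the concatenation of those for $S$ and $T$); let $H_i$ be the stabilizer of $b_i$ and put $j(S)=(H_1,\dots,H_k)$. Let $\varphi\colon S\to T$ be a $G$-map, let $c_1,\dots,c_m$ be the base points of $T$ with stabilizers $K_1,\dots,K_m$, and write $\varphi(b_i)=g_ic_{f(i)}$ with $g_i\in G$, so that $g_i^{-1}H_ig_i\subseteq K_{f(i)}$. The component of $j_*(\varphi)$ from $H_i$ to $K_{f(i)}$ is the set $K_{f(i)}$, as a $K_{f(i)}$-$H_i$ biset with actions $k'\cdot k\cdot h=k'k\,(g_i^{-1}hg_i)$; all other components are $0$ (the class of the empty biset). The component of $j^*(\varphi)$ from $K_{f(i)}$ to $H_i$ is the set $K_{f(i)}$, as an $H_i$-$K_{f(i)}$ biset with actions $h\cdot k\cdot k'=(g_i^{-1}hg_i)kk'$; all other components are $0$. $F\circ j$ denotes the bivariant functor $(F\circ j_*,F\circ j^* )$.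
   Formalization: "M = F∘j" is read as an isomorphism of bivariant functors and "unique" as unique up to a unique compatible natural isomorphism, since strict equality fails: different one-point G-sets have the same image under j, but M may take different (isomorphic) groups on them. *)

theory Defs
  imports "HOL-Algebra.Group_Action" "Jordan_Normal_Form.Matrix"
begin

section \<open>Categories, functors, bivariant functors\<close>

text \<open>\<open>Cmp C A B D g f\<close> is the composite of \<open>f : A \<rightarrow> B\<close> and \<open>g : B \<rightarrow> D\<close>. Hom-sets need not be
  disjoint, hence the explicit source and target arguments.\<close>

record ('o, 'm) cat =
  Ob :: "'o set"
  Mor :: "'o \<Rightarrow> 'o \<Rightarrow> 'm set"
  Idn :: "'o \<Rightarrow> 'm"
  Cmp :: "'o \<Rightarrow> 'o \<Rightarrow> 'o \<Rightarrow> 'm \<Rightarrow> 'm \<Rightarrow> 'm"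

text \<open>The addition on Hom-sets is recorded as a (multiplicatively written) \<open>monoid\<close> record
  with carrier \<open>Mor A B\<close>.\<close>

record ('o, 'm) addcat = "('o, 'm) cat" +
  HGrp :: "'o \<Rightarrow> 'o \<Rightarrow> 'm monoid"

record ('o, 'm, 'p, 'n) func =
  FOb :: "'o \<Rightarrow> 'p"
  FMor :: "'o \<Rightarrow> 'o \<Rightarrow> 'm \<Rightarrow> 'n"

definition is_functor ::
  "('o, 'm, 'y) cat_scheme \<Rightarrow> ('p, 'n, 'z) cat_scheme \<Rightarrow> ('o, 'm, 'p, 'n) func \<Rightarrow> bool" where
  "is_functor C D F \<longleftrightarrow>
     (\<forall>A\<in>Ob C. FOb F A \<in> Ob D) \<and>
     (\<forall>A\<in>Ob C. \<forall>B\<in>Ob C. \<forall>f\<in>Mor C A B. FMor F A B f \<in> Mor D (FOb F A) (FOb F B)) \<and>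
     (\<forall>A\<in>Ob C. FMor F A A (Idn C A) = Idn D (FOb F A)) \<and>
     (\<forall>A\<in>Ob C. \<forall>B\<in>Ob C. \<forall>E\<in>Ob C. \<forall>f\<in>Mor C A B. \<forall>g\<in>Mor C B E.
        FMor F A E (Cmp C A B E g f) =
          Cmp D (FOb F A) (FOb F B) (FOb F E) (FMor F B E g) (FMor F A B f))"

text \<open>For a contravariant functor \<open>FMor F A B f\<close> is the morphism \<open>F(B) \<rightarrow> F(A)\<close> induced by
  \<open>f : A \<rightarrow> B\<close>.\<close>

definition is_cofunctor ::
  "('o, 'm, 'y) cat_scheme \<Rightarrow> ('p, 'n, 'z) cat_scheme \<Rightarrow> ('o, 'm, 'p, 'n) func \<Rightarrow> bool" where
  "is_cofunctor C D F \<longleftrightarrow>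
     (\<forall>A\<in>Ob C. FOb F A \<in> Ob D) \<and>
     (\<forall>A\<in>Ob C. \<forall>B\<in>Ob C. \<forall>f\<in>Mor C A B. FMor F A B f \<in> Mor D (FOb F B) (FOb F A)) \<and>
     (\<forall>A\<in>Ob C. FMor F A A (Idn C A) = Idn D (FOb F A)) \<and>
     (\<forall>A\<in>Ob C. \<forall>B\<in>Ob C. \<forall>E\<in>Ob C. \<forall>f\<in>Mor C A B. \<forall>g\<in>Mor C B E.
        FMor F A E (Cmp C A B E g f) =
          Cmp D (FOb F E) (FOb F B) (FOb F A) (FMor F A B f) (FMor F B E g))"

definition additive_functor ::
  "('o, 'm, 'y) addcat_scheme \<Rightarrow> ('p, 'n, 'z) addcat_scheme \<Rightarrow> ('o, 'm, 'p, 'n) func \<Rightarrow> bool" where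
  "additive_functor C D F \<longleftrightarrow> is_functor C D F \<and>
     (\<forall>A\<in>Ob C. \<forall>B\<in>Ob C. FMor F A B \<in> hom (HGrp C A B) (HGrp D (FOb F A) (FOb F B)))"

definition isos :: "('o, 'm, 'y) cat_scheme \<Rightarrow> 'o \<Rightarrow> 'o \<Rightarrow> 'm set" where
  "isos C A B = {f \<in> Mor C A B. \<exists>g\<in>Mor C B A. Cmp C A B A g f = Idn C A \<and> Cmp C B A B f g = Idn C B}"

definition natural_iso ::
  "('o, 'm, 'y) cat_scheme \<Rightarrow> ('p, 'n, 'z) cat_scheme \<Rightarrow>
   ('o, 'm, 'p, 'n) func \<Rightarrow> ('o, 'm, 'p, 'n) func \<Rightarrow> ('o \<Rightarrow> 'n) \<Rightarrow> bool" where
  "natural_iso C D F F' \<eta> \<longleftrightarrow>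
     (\<forall>A\<in>Ob C. \<eta> A \<in> isos D (FOb F A) (FOb F' A)) \<and>
     (\<forall>A\<in>Ob C. \<forall>B\<in>Ob C. \<forall>f\<in>Mor C A B.
        Cmp D (FOb F A) (FOb F B) (FOb F' B) (\<eta> B) (FMor F A B f) =
        Cmp D (FOb F A) (FOb F' A) (FOb F' B) (FMor F' A B f) (\<eta> A))"

record ('o, 'm, 'p, 'n) bifunc =
  BOb :: "'o \<Rightarrow> 'p"
  push :: "'o \<Rightarrow> 'o \<Rightarrow> 'm \<Rightarrow> 'n"
  pull :: "'o \<Rightarrow> 'o \<Rightarrow> 'm \<Rightarrow> 'n"

definition bivariant_functor ::
  "('o, 'm, 'y) cat_scheme \<Rightarrow> ('p, 'n, 'z) cat_scheme \<Rightarrow> ('o, 'm, 'p, 'n) bifunc \<Rightarrow> bool" where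
  "bivariant_functor C D M \<longleftrightarrow>
     is_functor C D \<lparr>FOb = BOb M, FMor = push M\<rparr> \<and>
     is_cofunctor C D \<lparr>FOb = BOb M, FMor = pull M\<rparr>"

text \<open>An isomorphism of bivariant functors is a family that is natural for the covariant and for
  the contravariant parts.\<close>

definition bivariant_iso ::
  "('o, 'm, 'y) cat_scheme \<Rightarrow> ('p, 'n, 'z) cat_scheme \<Rightarrow>
   ('o, 'm, 'p, 'n) bifunc \<Rightarrow> ('o, 'm, 'p, 'n) bifunc \<Rightarrow> ('o \<Rightarrow> 'n) \<Rightarrow> bool" where
  "bivariant_iso C D M N \<theta> \<longleftrightarrow>
     (\<forall>S\<in>Ob C. \<theta> S \<in> isos D (BOb M S) (BOb N S)) \<and>
     (\<forall>S\<in>Ob C. \<forall>T\<in>Ob C. \<forall>f\<in>Mor C S T.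
        Cmp D (BOb M S) (BOb M T) (BOb N T) (\<theta> T) (push M S T f) =
        Cmp D (BOb M S) (BOb N S) (BOb N T) (push N S T f) (\<theta> S)) \<and>
     (\<forall>S\<in>Ob C. \<forall>T\<in>Ob C. \<forall>f\<in>Mor C S T.
        Cmp D (BOb M T) (BOb M S) (BOb N S) (\<theta> S) (pull M S T f) =
        Cmp D (BOb M T) (BOb N T) (BOb N S) (pull N S T f) (\<theta> T))"

definition func_bifunc ::
  "('p, 'n, 'q, 'l) func \<Rightarrow> ('o, 'm, 'p, 'n) bifunc \<Rightarrow> ('o, 'm, 'q, 'l) bifunc" where
  "func_bifunc F j = \<lparr>
     BOb = (\<lambda>S. FOb F (BOb j S)),
     push = (\<lambda>S T f. FMor F (BOb j S) (BOb j T) (push j S T f)),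
     pull = (\<lambda>S T f. FMor F (BOb j T) (BOb j S) (pull j S T f))\<rparr>"

definition pullback_square ::
  "('o, 'm, 'y) cat_scheme \<Rightarrow> 'o \<Rightarrow> 'o \<Rightarrow> 'o \<Rightarrow> 'o \<Rightarrow> 'm \<Rightarrow> 'm \<Rightarrow> 'm \<Rightarrow> 'm \<Rightarrow> bool" where
  "pullback_square C S S1 S2 T \<Psi> \<Phi> \<phi> \<psi> \<longleftrightarrow>
     S \<in> Ob C \<and> S1 \<in> Ob C \<and> S2 \<in> Ob C \<and> T \<in> Ob C \<and>
     \<Psi> \<in> Mor C S S1 \<and> \<Phi> \<in> Mor C S S2 \<and> \<phi> \<in> Mor C S1 T \<and> \<psi> \<in> Mor C S2 T \<and>
     Cmp C S S1 T \<phi> \<Psi> = Cmp C S S2 T \<psi> \<Phi> \<and>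
     (\<forall>W\<in>Ob C. \<forall>\<alpha>\<in>Mor C W S1. \<forall>\<beta>\<in>Mor C W S2. Cmp C W S1 T \<phi> \<alpha> = Cmp C W S2 T \<psi> \<beta> \<longrightarrow>
        (\<exists>!\<gamma>. \<gamma> \<in> Mor C W S \<and> Cmp C W S S1 \<Psi> \<gamma> = \<alpha> \<and> Cmp C W S S2 \<Phi> \<gamma> = \<beta>))"

text \<open>Abelian groups with elements in an arbitrary type \<open>'a\<close>. Homomorphisms are taken extensional,
  so that equal morphisms are equal functions.\<close>

definition Ab :: "('a monoid, 'a \<Rightarrow> 'a) addcat" where
  "Ab = \<lparr>
     Ob = {A. comm_group A},
     Mor = (\<lambda>A B. hom A B \<inter> extensional (carrier A)),
     Idn = (\<lambda>A. \<lambda>x\<in>carrier A. x),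
     Cmp = (\<lambda>A B E g f. compose (carrier A) g f),
     HGrp = (\<lambda>A B. \<lparr>carrier = hom A B \<inter> extensional (carrier A),
                    monoid.mult = (\<lambda>f g. \<lambda>x\<in>carrier A. f x \<otimes>\<^bsub>B\<^esub> g x),
                    one = (\<lambda>x\<in>carrier A. \<one>\<^bsub>B\<^esub>)\<rparr>)\<rparr>"

text \<open>Free additive completion: a morphism from a tuple of length \<open>k\<close> to one of length \<open>m\<close> is an
  \<open>m \<times> k\<close> matrix; entry \<open>(i, j)\<close> is the component from the \<open>j\<close>-th source entry to the
  \<open>i\<close>-th target entry. The \<open>finprod\<close> is the sum in the additive Hom-group.\<close>

definition addcompl :: "('o, 'm) addcat \<Rightarrow> ('o list, 'm mat) addcat" where
  "addcompl C = (let Mo = (\<lambda>s t. {A \<in> carrier_mat (length t) (length s).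
       \<forall>i<length t. \<forall>j<length s. A $$ (i, j) \<in> Mor C (s ! j) (t ! i)}) in \<lparr>
     Ob = lists (Ob C),
     Mor = Mo,
     Idn = (\<lambda>s. mat (length s) (length s)
       (\<lambda>(i, j). if i = j then Idn C (s ! i) else \<one>\<^bsub>HGrp C (s ! j) (s ! i)\<^esub>)),
     Cmp = (\<lambda>s t u B A. mat (length u) (length s) (\<lambda>(i, j).
       finprod (HGrp C (s ! j) (u ! i))
         (\<lambda>k. Cmp C (s ! j) (t ! k) (u ! i) (B $$ (i, k)) (A $$ (k, j))) {..<length t})),
     HGrp = (\<lambda>s t. \<lparr>carrier = Mo s t,
       monoid.mult = (\<lambda>A B. mat (length t) (length s)
         (\<lambda>(i, j). A $$ (i, j) \<otimes>\<^bsub>HGrp C (s ! j) (t ! i)\<^esub> B $$ (i, j))),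
       one = mat (length t) (length s) (\<lambda>(i, j). \<one>\<^bsub>HGrp C (s ! j) (t ! i)\<^esub>)\<rparr>)\<rparr>)"


section \<open>Grothendieck groups\<close>

text \<open>The class of \<open>(a, b)\<close> is the formal difference \<open>a - b\<close>.\<close>

definition groth_rel :: "'a monoid \<Rightarrow> (('a \<times> 'a) \<times> ('a \<times> 'a)) set" where
  "groth_rel A = {((a, b), (c, d)). a \<in> carrier A \<and> b \<in> carrier A \<and> c \<in> carrier A \<and> d \<in> carrier A \<and>
     (\<exists>e\<in>carrier A. a \<otimes>\<^bsub>A\<^esub> d \<otimes>\<^bsub>A\<^esub> e = c \<otimes>\<^bsub>A\<^esub> b \<otimes>\<^bsub>A\<^esub> e)}"

definition groth :: "'a monoid \<Rightarrow> ('a \<times> 'a) set monoid" where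
  "groth A = \<lparr>
     carrier = (carrier A \<times> carrier A) // groth_rel A,
     monoid.mult = (\<lambda>P Q. \<Union>(a, b)\<in>P. \<Union>(c, d)\<in>Q. groth_rel A `` {(a \<otimes>\<^bsub>A\<^esub> c, b \<otimes>\<^bsub>A\<^esub> d)}),
     one = groth_rel A `` {(\<one>\<^bsub>A\<^esub>, \<one>\<^bsub>A\<^esub>)}\<rparr>"

definition groth_of :: "'a monoid \<Rightarrow> 'a \<Rightarrow> ('a \<times> 'a) set" where
  "groth_of A a = groth_rel A `` {(a, \<one>\<^bsub>A\<^esub>)}"

text \<open>The biadditive extension of \<open>m\<close> to formal differences:
  \<open>(a - b) \<cdot> (c - d) = (a \<cdot> c + b \<cdot> d) - (a \<cdot> d + b \<cdot> c)\<close>. The value of \<open>m\<close> lies in \<open>A\<close>.\<close>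

definition groth_bilinear ::
  "'a monoid \<Rightarrow> ('b \<Rightarrow> 'c \<Rightarrow> 'a) \<Rightarrow> ('b \<times> 'b) set \<Rightarrow> ('c \<times> 'c) set \<Rightarrow> ('a \<times> 'a) set" where
  "groth_bilinear A m P Q =
     (\<Union>(a, b)\<in>P. \<Union>(c, d)\<in>Q. groth_rel A `` {(m a c \<otimes>\<^bsub>A\<^esub> m b d, m a d \<otimes>\<^bsub>A\<^esub> m b c)})"


section \<open>Conjugation bisets\<close>

record ('g, 'x) biset =
  bpts :: "'x set"
  lact :: "'g \<Rightarrow> 'x \<Rightarrow> 'x"
  ract :: "'x \<Rightarrow> 'g \<Rightarrow> 'x"

text \<open>In all of the following the argument order is \<open>H1 H2\<close> for \<open>H2\<close>-\<open>H1\<close> bisets (left action of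
  \<open>H2\<close>, right action of \<open>H1\<close>), in accordance with \<open>Hom(H1, H2)\<close>.\<close>

definition finite_biset ::
  "('g, 'b) monoid_scheme \<Rightarrow> 'g set \<Rightarrow> 'g set \<Rightarrow> ('g, 'x) biset \<Rightarrow> bool" where
  "finite_biset G H1 H2 X \<longleftrightarrow> finite (bpts X) \<and>
     (\<forall>h\<in>H2. \<forall>x\<in>bpts X. lact X h x \<in> bpts X) \<and>
     (\<forall>x\<in>bpts X. lact X \<one>\<^bsub>G\<^esub> x = x) \<and>
     (\<forall>h\<in>H2. \<forall>h'\<in>H2. \<forall>x\<in>bpts X. lact X (h \<otimes>\<^bsub>G\<^esub> h') x = lact X h (lact X h' x)) \<and>
     (\<forall>h\<in>H1. \<forall>x\<in>bpts X. ract X x h \<in> bpts X) \<and>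
     (\<forall>x\<in>bpts X. ract X x \<one>\<^bsub>G\<^esub> = x) \<and>
     (\<forall>h\<in>H1. \<forall>h'\<in>H1. \<forall>x\<in>bpts X. ract X x (h \<otimes>\<^bsub>G\<^esub> h') = ract X (ract X x h) h') \<and>
     (\<forall>h2\<in>H2. \<forall>h1\<in>H1. \<forall>x\<in>bpts X. ract X (lact X h2 x) h1 = lact X h2 (ract X x h1))"

definition bifree ::
  "('g, 'b) monoid_scheme \<Rightarrow> 'g set \<Rightarrow> 'g set \<Rightarrow> ('g, 'x) biset \<Rightarrow> bool" where
  "bifree G H1 H2 X \<longleftrightarrow>
     (\<forall>h\<in>H2. \<forall>x\<in>bpts X. lact X h x = x \<longrightarrow> h = \<one>\<^bsub>G\<^esub>) \<and>
     (\<forall>h\<in>H1. \<forall>x\<in>bpts X. ract X x h = x \<longrightarrow> h = \<one>\<^bsub>G\<^esub>)"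

definition biset_L :: "'g set \<Rightarrow> 'g set \<Rightarrow> ('g, 'x) biset \<Rightarrow> 'x \<Rightarrow> 'g set" where
  "biset_L H1 H2 X x = {h2 \<in> H2. \<exists>h1\<in>H1. lact X h2 x = ract X x h1}"

definition biset_gamma :: "'g set \<Rightarrow> ('g, 'x) biset \<Rightarrow> 'x \<Rightarrow> 'g \<Rightarrow> 'g" where
  "biset_gamma H1 X x h2 = (THE h1. h1 \<in> H1 \<and> lact X h2 x = ract X x h1)"

definition biset_K :: "'g set \<Rightarrow> 'g set \<Rightarrow> ('g, 'x) biset \<Rightarrow> 'x \<Rightarrow> 'g set" where
  "biset_K H1 H2 X x = biset_gamma H1 X x ` biset_L H1 H2 X x"

definition conj_biset ::
  "('g, 'b) monoid_scheme \<Rightarrow> 'g set \<Rightarrow> 'g set \<Rightarrow> ('g, 'x) biset \<Rightarrow> bool" where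
  "conj_biset G H1 H2 X \<longleftrightarrow> finite_biset G H1 H2 X \<and> bifree G H1 H2 X \<and>
     (\<forall>x\<in>bpts X. \<exists>g\<in>carrier G.
        (\<lambda>h. inv\<^bsub>G\<^esub> g \<otimes>\<^bsub>G\<^esub> h \<otimes>\<^bsub>G\<^esub> g) ` biset_L H1 H2 X x = biset_K H1 H2 X x \<and>
        (\<forall>h\<in>biset_L H1 H2 X x. biset_gamma H1 X x h = inv\<^bsub>G\<^esub> g \<otimes>\<^bsub>G\<^esub> h \<otimes>\<^bsub>G\<^esub> g))"

definition biset_iso :: "'g set \<Rightarrow> 'g set \<Rightarrow> ('g, 'x) biset \<Rightarrow> ('g, 'y) biset \<Rightarrow> bool" where
  "biset_iso H1 H2 X Y \<longleftrightarrow> (\<exists>f. bij_betw f (bpts X) (bpts Y) \<and>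
     (\<forall>h\<in>H2. \<forall>x\<in>bpts X. f (lact X h x) = lact Y h (f x)) \<and>
     (\<forall>h\<in>H1. \<forall>x\<in>bpts X. f (ract X x h) = ract Y (f x) h))"

definition biset_empty :: "('g, 'x) biset" where
  "biset_empty = \<lparr>bpts = {}, lact = (\<lambda>h x. x), ract = (\<lambda>x h. x)\<rparr>"

definition biset_sum :: "('g, 'x) biset \<Rightarrow> ('g, 'y) biset \<Rightarrow> ('g, 'x + 'y) biset" where
  "biset_sum X Y = \<lparr>
     bpts = bpts X <+> bpts Y,
     lact = (\<lambda>h. map_sum (lact X h) (lact Y h)),
     ract = (\<lambda>z h. map_sum (\<lambda>x. ract X x h) (\<lambda>y. ract Y y h) z)\<rparr>"

text \<open>The relation identifies \<open>(x h, y)\<close> with \<open>(x, h y)\<close>; the points of the balanced product are its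
  equivalence classes, on which the actions are the image actions.\<close>

definition balanced_rel ::
  "'g set \<Rightarrow> ('g, 'x) biset \<Rightarrow> ('g, 'y) biset \<Rightarrow> (('x \<times> 'y) \<times> ('x \<times> 'y)) set" where
  "balanced_rel H X Y =
     {((ract X x h, y), (x, lact Y h y)) | x y h. x \<in> bpts X \<and> y \<in> bpts Y \<and> h \<in> H}"

definition balanced_product ::
  "'g set \<Rightarrow> ('g, 'x) biset \<Rightarrow> ('g, 'y) biset \<Rightarrow> ('g, ('x \<times> 'y) set) biset" where
  "balanced_product H X Y = \<lparr>
     bpts = (bpts X \<times> bpts Y) // balanced_rel H X Y,
     lact = (\<lambda>h P. (\<lambda>(x, y). (lact X h x, y)) ` P),
     ract = (\<lambda>P h. (\<lambda>(x, y). (x, ract Y y h)) ` P)\<rparr>"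

text \<open>The isomorphism class of a finite biset with points in any type is represented by the set of
  all isomorphic bisets whose points are natural numbers; every finite biset has such a copy.\<close>

type_synonym 'g biset_class = "('g, nat) biset set"
type_synonym 'g bimor = "('g biset_class \<times> 'g biset_class) set"

definition biset_cls ::
  "('g, 'b) monoid_scheme \<Rightarrow> 'g set \<Rightarrow> 'g set \<Rightarrow> ('g, 'x) biset \<Rightarrow> 'g biset_class" where
  "biset_cls G H1 H2 X = {Y. conj_biset G H1 H2 Y \<and> biset_iso H1 H2 X Y}"

definition conj_biset_monoid ::
  "('g, 'b) monoid_scheme \<Rightarrow> 'g set \<Rightarrow> 'g set \<Rightarrow> 'g biset_class monoid" where
  "conj_biset_monoid G H1 H2 = \<lparr>
     carrier = {biset_cls G H1 H2 X | X :: ('g, nat) biset. conj_biset G H1 H2 X},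
     monoid.mult = (\<lambda>P Q. \<Union>X\<in>P. \<Union>Y\<in>Q. biset_cls G H1 H2 (biset_sum X Y)),
     one = biset_cls G H1 H2 (biset_empty :: ('g, nat) biset)\<rparr>"

definition balanced_cls ::
  "('g, 'b) monoid_scheme \<Rightarrow> 'g set \<Rightarrow> 'g set \<Rightarrow> 'g set \<Rightarrow>
   'g biset_class \<Rightarrow> 'g biset_class \<Rightarrow> 'g biset_class" where
  "balanced_cls G H1 H2 H3 P Q = (\<Union>X\<in>P. \<Union>Y\<in>Q. biset_cls G H1 H3 (balanced_product H2 X Y))"

definition bimor_of ::
  "('g, 'b) monoid_scheme \<Rightarrow> 'g set \<Rightarrow> 'g set \<Rightarrow> ('g, 'x) biset \<Rightarrow> 'g bimor" where
  "bimor_of G H1 H2 X = groth_of (conj_biset_monoid G H1 H2) (biset_cls G H1 H2 X)"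

definition Bcat :: "('g, 'b) monoid_scheme \<Rightarrow> ('g set, 'g bimor) addcat" where
  "Bcat G = \<lparr>
     Ob = {H. subgroup H G},
     Mor = (\<lambda>H1 H2. carrier (groth (conj_biset_monoid G H1 H2))),
     Idn = (\<lambda>H. bimor_of G H H \<lparr>bpts = H, lact = (\<lambda>h x. h \<otimes>\<^bsub>G\<^esub> x), ract = (\<lambda>x h. x \<otimes>\<^bsub>G\<^esub> h)\<rparr>),
     Cmp = (\<lambda>H1 H2 H3. groth_bilinear (conj_biset_monoid G H1 H3) (balanced_cls G H1 H2 H3)),
     HGrp = (\<lambda>H1 H2. groth (conj_biset_monoid G H1 H2))\<rparr>"

abbreviation Bdot :: "('g, 'b) monoid_scheme \<Rightarrow> ('g set list, 'g bimor mat) addcat" where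
  "Bdot G \<equiv> addcompl (Bcat G)"


section \<open>Finite \<open>G\<close>-sets\<close>

text \<open>HOL has no type of all sets. The points of \<open>G\<close>-sets are taken from a type that contains an
  arbitrary type \<open>'p\<close> (\<open>Pt\<close>), the cosets of subgroups of \<open>G\<close> (\<open>Cs\<close>), and is closed under the tags
  of disjoint unions (\<open>InL\<close>, \<open>InR\<close>).\<close>

datatype ('g, 'p) pt = Pt 'p | Cs "'g set" | InL "('g, 'p) pt" | InR "('g, 'p) pt"

record ('g, 'u) gset =
  gpts :: "'u set"
  gact :: "'g \<Rightarrow> 'u \<Rightarrow> 'u"

type_synonym ('g, 'p) Gset = "('g, ('g, 'p) pt) gset"

text \<open>\<open>group_action\<close> makes each \<open>gact S g\<close> an extensional function on the points; with
  extensionality in \<open>g\<close> a \<open>G\<close>-set is determined by its points and its action.\<close>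

definition finite_gset :: "('g, 'b) monoid_scheme \<Rightarrow> ('g, 'u) gset \<Rightarrow> bool" where
  "finite_gset G S \<longleftrightarrow> finite (gpts S) \<and> group_action G (gpts S) (gact S) \<and>
     gact S \<in> extensional (carrier G)"

definition gmaps :: "('g, 'b) monoid_scheme \<Rightarrow> ('g, 'u) gset \<Rightarrow> ('g, 'u) gset \<Rightarrow> ('u \<Rightarrow> 'u) set" where
  "gmaps G S T = {\<phi> \<in> gpts S \<rightarrow>\<^sub>E gpts T.
     \<forall>g\<in>carrier G. \<forall>x\<in>gpts S. \<phi> (gact S g x) = gact T g (\<phi> x)}"

definition DG :: "('g, 'b) monoid_scheme \<Rightarrow> (('g, 'p) Gset, ('g, 'p) pt \<Rightarrow> ('g, 'p) pt) cat" where
  "DG G = \<lparr>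
     Ob = {S. finite_gset G S},
     Mor = gmaps G,
     Idn = (\<lambda>S. \<lambda>x\<in>gpts S. x),
     Cmp = (\<lambda>S T U \<psi> \<phi>. compose (gpts S) \<psi> \<phi>)\<rparr>"

definition gset_empty :: "('g, 'b) monoid_scheme \<Rightarrow> ('g, 'p) Gset" where
  "gset_empty G = \<lparr>gpts = {}, gact = (\<lambda>g\<in>carrier G. \<lambda>x\<in>{}. undefined)\<rparr>"

definition gset_sum :: "('g, 'b) monoid_scheme \<Rightarrow> ('g, 'p) Gset \<Rightarrow> ('g, 'p) Gset \<Rightarrow> ('g, 'p) Gset" where
  "gset_sum G S T = \<lparr>
     gpts = InL ` gpts S \<union> InR ` gpts T,
     gact = (\<lambda>g\<in>carrier G. \<lambda>z\<in>InL ` gpts S \<union> InR ` gpts T.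
       case z of InL x \<Rightarrow> InL (gact S g x) | InR y \<Rightarrow> InR (gact T g y))\<rparr>"

definition gset_inl :: "('g, 'p) Gset \<Rightarrow> ('g, 'p) pt \<Rightarrow> ('g, 'p) pt" where
  "gset_inl S = (\<lambda>x\<in>gpts S. InL x)"

definition gset_inr :: "('g, 'p) Gset \<Rightarrow> ('g, 'p) pt \<Rightarrow> ('g, 'p) pt" where
  "gset_inr T = (\<lambda>y\<in>gpts T. InR y)"

definition coset_gset :: "('g, 'b) monoid_scheme \<Rightarrow> 'g set \<Rightarrow> ('g, 'p) Gset" where
  "coset_gset G H = (let P = {Cs (a <#\<^bsub>G\<^esub> H) | a. a \<in> carrier G} in
     \<lparr>gpts = P,
      gact = (\<lambda>g\<in>carrier G. \<lambda>z\<in>P. case z of Cs A \<Rightarrow> Cs (g <#\<^bsub>G\<^esub> A))\<rparr>)"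


section \<open>Mackey functors\<close>

type_synonym ('g, 'p, 'a) abfunctors =
  "(('g, 'p) Gset, ('g, 'p) pt \<Rightarrow> ('g, 'p) pt, 'a monoid, 'a \<Rightarrow> 'a) bifunc"

definition mackey_functor :: "('g, 'b) monoid_scheme \<Rightarrow> ('g, 'p, 'a) abfunctors \<Rightarrow> bool" where
  "mackey_functor G M \<longleftrightarrow> bivariant_functor (DG G) Ab M \<and>
     (\<forall>S S1 S2 T \<Psi> \<Phi> \<phi> \<psi>. pullback_square (DG G) S S1 S2 T \<Psi> \<Phi> \<phi> \<psi> \<longrightarrow>
        Cmp Ab (BOb M S2) (BOb M T) (BOb M S1) (pull M S1 T \<phi>) (push M S2 T \<psi>) =
        Cmp Ab (BOb M S2) (BOb M S) (BOb M S1) (push M S S1 \<Psi>) (pull M S S2 \<Phi>)) \<and>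
     (\<forall>S1\<in>Ob (DG G). \<forall>S2\<in>Ob (DG G).
        (\<lambda>x. (pull M S1 (gset_sum G S1 S2) (gset_inl S1) x,
              pull M S2 (gset_sum G S1 S2) (gset_inr S2) x))
          \<in> iso (BOb M (gset_sum G S1 S2)) (BOb M S1 \<times>\<times> BOb M S2)) \<and>
     carrier (BOb M (gset_empty G)) = {\<one>\<^bsub>BOb M (gset_empty G)\<^esub>}"

definition conj_invariant :: "('g, 'b) monoid_scheme \<Rightarrow> ('g, 'p, 'a) abfunctors \<Rightarrow> bool" where
  "conj_invariant G M \<longleftrightarrow>
     (\<forall>H z. subgroup H G \<and> z \<in> carrier G \<and> (\<forall>h\<in>H. z \<otimes>\<^bsub>G\<^esub> h = h \<otimes>\<^bsub>G\<^esub> z) \<longrightarrow>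
        (\<forall>\<phi>\<in>Mor (DG G) (coset_gset G H) (coset_gset G H). \<phi> (Cs H) = Cs (z <#\<^bsub>G\<^esub> H) \<longrightarrow>
           push M (coset_gset G H) (coset_gset G H) \<phi> = Idn Ab (BOb M (coset_gset G H))))"


section \<open>The bivariant functor \<open>j\<close>\<close>

definition base_points ::
  "('g, 'b) monoid_scheme \<Rightarrow> (('g, 'p) Gset \<Rightarrow> ('g, 'p) pt list) \<Rightarrow> bool" where
  "base_points G b \<longleftrightarrow>
     (\<forall>S. finite_gset G S \<longrightarrow> set (b S) \<subseteq> gpts S \<and>
        (\<forall>Q\<in>orbits G (gpts S) (gact S). \<exists>!i. i < length (b S) \<and> b S ! i \<in> Q)) \<and>
     (\<forall>S T. finite_gset G S \<longrightarrow> finite_gset G T \<longrightarrow>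
        b (gset_sum G S T) = map InL (b S) @ map InR (b T))"

text \<open>Such choices exist: take the least point of each orbit, in increasing order, for a linear order
  in which the tags satisfy \<open>InL x < InR y\<close>.\<close>

primrec pt_less :: "('p \<Rightarrow> 'p \<Rightarrow> bool) \<Rightarrow> ('g set \<Rightarrow> 'g set \<Rightarrow> bool) \<Rightarrow> ('g, 'p) pt \<Rightarrow> ('g, 'p) pt \<Rightarrow> bool" where
  "pt_less L C (Pt p) v = (case v of Pt q \<Rightarrow> L p q | _ \<Rightarrow> True)"
| "pt_less L C (Cs A) v = (case v of Pt q \<Rightarrow> False | Cs B \<Rightarrow> C A B | _ \<Rightarrow> True)"
| "pt_less L C (InL x) v = (case v of InL y \<Rightarrow> pt_less L C x y | InR y \<Rightarrow> True | _ \<Rightarrow> False)"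
| "pt_less L C (InR x) v = (case v of InR y \<Rightarrow> pt_less L C x y | _ \<Rightarrow> False)"

definition strict_linear :: "('x \<Rightarrow> 'x \<Rightarrow> bool) \<Rightarrow> bool" where
  "strict_linear L \<longleftrightarrow> (\<forall>x. \<not> L x x) \<and> (\<forall>x y z. L x y \<longrightarrow> L y z \<longrightarrow> L x z) \<and> (\<forall>x y. L x y \<or> x = y \<or> L y x)"

lemma strict_linear_ex: "\<exists>L :: 'x \<Rightarrow> 'x \<Rightarrow> bool. strict_linear L"
proof -
  obtain r :: "'x rel" where r: "well_order_on UNIV r" using well_order_on by blast
  have "trans r" "antisym r" "total r"
    using r unfolding well_order_on_def linear_order_on_def partial_order_on_def preorder_on_def by auto
  then have "strict_linear (\<lambda>x y. (x, y) \<in> r \<and> x \<noteq> y)"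
    unfolding strict_linear_def by (auto simp: antisym_def total_on_def dest: transD)
  then show ?thesis by blast
qed

lemma pt_less_linear:
  assumes "strict_linear L" "strict_linear C"
  shows "strict_linear (pt_less L C)"
proof -
  have irr: "\<not> pt_less L C x x" for x
    by (induction x) (use assms in \<open>auto simp: strict_linear_def\<close>)
  have tr: "pt_less L C x y \<longrightarrow> pt_less L C y z \<longrightarrow> pt_less L C x z" for x y z
  proof (induction x arbitrary: y z)
    case (Pt p)
    have "L p q \<longrightarrow> L q r \<longrightarrow> L p r" for q r using assms(1) unfolding strict_linear_def by blast
    then show ?case by (cases y; cases z; simp)
  next
    case (Cs A)
    have "C A B \<longrightarrow> C B D \<longrightarrow> C A D" for B D using assms(2) unfolding strict_linear_def by blast
    then show ?case by (cases y; cases z; simp)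
  next
    case (InL x) show ?case by (cases y; cases z; simp add: InL)
  next
    case (InR x) show ?case by (cases y; cases z; simp add: InR)
  qed
  have tot: "pt_less L C x y \<or> x = y \<or> pt_less L C y x" for x y
  proof (induction x arbitrary: y)
    case (Pt p) then show ?case using assms(1) by (cases y) (auto simp: strict_linear_def)
  next
    case (Cs A) then show ?case using assms(2) by (cases y) (auto simp: strict_linear_def)
  next
    case (InL x) then show ?case by (cases y) auto
  next
    case (InR x) then show ?case by (cases y) auto
  qed
  show ?thesis unfolding strict_linear_def using irr tr tot by blast
qed

lemma base_points_exist:
  fixes G :: "('g, 'b) monoid_scheme"
  assumes "group G"
  shows "\<exists>b :: ('g, 'p) Gset \<Rightarrow> ('g, 'p) pt list. base_points G b"
proof -
  obtain L :: "'p \<Rightarrow> 'p \<Rightarrow> bool" where L: "strict_linear L"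
    using strict_linear_ex by blast
  obtain C :: "'g set \<Rightarrow> 'g set \<Rightarrow> bool" where C: "strict_linear C"
    using strict_linear_ex by blast
  define l where "l = (pt_less L C :: ('g, 'p) pt \<Rightarrow> _)"
  define le where "le x y \<longleftrightarrow> l x y \<or> x = y" for x y
  have sl: "strict_linear l" using pt_less_linear[OF L C] by (simp add: l_def)
  have irr: "\<not> l x x" and tr: "l x y \<Longrightarrow> l y z \<Longrightarrow> l x z" and tot: "l x y \<or> x = y \<or> l y x" for x y z
    using sl unfolding strict_linear_def by blast+
  have lin: "l x y \<longleftrightarrow> le x y \<and> \<not> le y x" "le x x" "le x y \<Longrightarrow> le y z \<Longrightarrow> le x z"
    "le x y \<Longrightarrow> le y x \<Longrightarrow> x = y" "le x y \<or> le y x" for x y z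
    unfolding le_def using irr tr tot by metis+
  have "class.linorder le l"
    by (intro class.linorder.intro class.order.intro class.preorder.intro
          class.order_axioms.intro class.linorder_axioms.intro) (fact lin)+
  then interpret o: linorder le l .
  have lL: "l (InL x) (InL y) = l x y" and lR: "l (InR x) (InR y) = l x y"
    and lLR: "l (InL x) (InR y)" for x y by (simp_all add: l_def)
  define m where "m Q = (THE x. x \<in> Q \<and> (\<forall>y\<in>Q. le x y))" for Q
  have mI: "m Q = x" if "x \<in> Q" "\<forall>y\<in>Q. le x y" for Q x
    unfolding m_def using that by (intro the_equality) (auto intro: o.order.antisym)
  have m: "m Q \<in> Q \<and> (\<forall>y\<in>Q. le (m Q) y)" if "finite Q" "Q \<noteq> {}" for Q
    using o.Min_in[OF that] o.Min_le[OF that(1)] mI by metis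
  define B where "B S = m ` orbits G (gpts S) (gact S)" for S :: "('g, 'p) Gset"
  define b where "b S = (THE xs. sorted_wrt l xs \<and> set xs = B S)" for S :: "('g, 'p) Gset"
  have uniq: "xs = ys" if "sorted_wrt l xs" "sorted_wrt l ys" "set xs = set ys" for xs ys
    using that o.strict_sorted_equal by blast
  have bI: "b S = xs" if "sorted_wrt l xs" "set xs = B S" for S xs
    unfolding b_def using that uniq by (intro the_equality) auto
  have orb: "finite Q \<and> Q \<noteq> {} \<and> Q \<subseteq> gpts S"
    if SQ: "finite_gset G S" "Q \<in> orbits G (gpts S) (gact S)"
    for S :: "('g, 'p) Gset" and Q
  proof -
    interpret a: group_action G "gpts S" "gact S" using that by (simp add: finite_gset_def)
    obtain x where x: "x \<in> gpts S" "Q = orbit G (gact S) x" using SQ by (auto simp: orbits_def)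
    have "Q \<subseteq> gpts S" using x a.element_image by (auto simp: orbit_def)
    moreover have "finite Q" using calculation SQ finite_subset unfolding finite_gset_def by blast
    ultimately show ?thesis using a.orbit_refl[OF x(1)] x(2) by blast
  qed
  have b: "sorted_wrt l (b S) \<and> set (b S) = B S" if S: "finite_gset G S" for S
  proof -
    have "orbits G (gpts S) (gact S) = (\<lambda>x. orbit G (gact S) x) ` gpts S" by (auto simp: orbits_def)
    then have "finite (B S)" using S by (auto simp: B_def finite_gset_def)
    then have "sorted_wrt l (o.sorted_list_of_set (B S)) \<and> set (o.sorted_list_of_set (B S)) = B S"
      by auto
    then show ?thesis using bI by metis
  qed
  have "base_points G b" unfolding base_points_def
  proof (intro conjI allI impI ballI)
    fix S :: "('g, 'p) Gset" assume S: "finite_gset G S"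
    show "set (b S) \<subseteq> gpts S" 
    proof
      fix x assume "x \<in> set (b S)"
      then obtain Q where "Q \<in> orbits G (gpts S) (gact S)" "x = m Q" using b[OF S] by (auto simp: B_def)
      then show "x \<in> gpts S" using orb[OF S] m by blast
    qed
    fix Q assume Q: "Q \<in> orbits G (gpts S) (gact S)"
    interpret a: group_action G "gpts S" "gact S" using S by (simp add: finite_gset_def)
    have "m Q \<in> set (b S)" using b[OF S] Q by (auto simp: B_def)
    then obtain i where i: "i < length (b S)" "b S ! i = m Q" by (auto simp: in_set_conv_nth)
    have dist: "distinct (b S)" using b[OF S] o.strict_sorted_iff by blast
    show "\<exists>!i. i < length (b S) \<and> b S ! i \<in> Q"
    proof (rule ex1I[of _ i])
      show "i < length (b S) \<and> b S ! i \<in> Q" using i m orb[OF S Q] by auto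
      fix k assume k: "k < length (b S) \<and> b S ! k \<in> Q"
      then have "b S ! k \<in> B S" using b[OF S] nth_mem by blast
      then obtain Q' where Q': "Q' \<in> orbits G (gpts S) (gact S)" "b S ! k = m Q'"
        by (auto simp: B_def)
      then have "b S ! k \<in> Q'" using m orb[OF S Q'(1)] by metis
      then have "Q' = Q" using a.disjoint_union[OF Q Q'(1)] k by blast
      then show "k = i" using i k Q' dist by (metis nth_eq_iff_index_eq)
    qed
  next
    fix S T :: "('g, 'p) Gset" assume S: "finite_gset G S" and T: "finite_gset G T"
    interpret s: group_action G "gpts S" "gact S" using S by (simp add: finite_gset_def)
    interpret t: group_action G "gpts T" "gact T" using T by (simp add: finite_gset_def)
    let ?U = "gset_sum G S T"
    have oL: "orbit G (gact ?U) (InL x) = InL ` orbit G (gact S) x" if "x \<in> gpts S" for x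
      using that by (force simp: orbit_def gset_sum_def)
    have oR: "orbit G (gact ?U) (InR x) = InR ` orbit G (gact T) x" if "x \<in> gpts T" for x
      using that by (force simp: orbit_def gset_sum_def)
    have "orbits G (gpts ?U) (gact ?U) = orbit G (gact ?U) ` (InL ` gpts S \<union> InR ` gpts T)"
      by (auto simp: orbits_def gset_sum_def)
    then have orbs: "orbits G (gpts ?U) (gact ?U) =
        (`) InL ` orbits G (gpts S) (gact S) \<union> (`) InR ` orbits G (gpts T) (gact T)"
      unfolding image_Un image_image using oL oR by (auto simp: orbits_def image_iff)
    have mL: "m (InL ` Q) = InL (m Q)" if "finite Q" "Q \<noteq> {}" for Q
      using m[OF that] by (intro mI) (auto simp: le_def lL lR)
    have mR: "m (InR ` Q) = InR (m Q)" if "finite Q" "Q \<noteq> {}" for Q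
      using m[OF that] by (intro mI) (auto simp: le_def lL lR)
    have "m ` (`) InL ` orbits G (gpts S) (gact S) = InL ` B S"
      unfolding B_def image_image using mL orb[OF S] by (intro image_cong) auto
    moreover have "m ` (`) InR ` orbits G (gpts T) (gact T) = InR ` B T"
      unfolding B_def image_image using mR orb[OF T] by (intro image_cong) auto
    ultimately have "B ?U = InL ` B S \<union> InR ` B T"
      unfolding B_def[of ?U] orbs image_Un by simp
    then show "b ?U = map InL (b S) @ map InR (b T)"
      using b[OF S] b[OF T] by (intro bI) (auto simp: sorted_wrt_append sorted_wrt_map lL lR lLR)
  qed
  then show ?thesis by blast
qed
definition stab_list ::
  "('g, 'b) monoid_scheme \<Rightarrow> (('g, 'p) Gset \<Rightarrow> ('g, 'p) pt list) \<Rightarrow> ('g, 'p) Gset \<Rightarrow> 'g set list" where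
  "stab_list G b S = map (stabilizer G (gact S)) (b S)"

text \<open>Some \<open>g\<close> with \<open>y = g c\<close>. The isomorphism classes of the two bisets below do not depend on
  which such \<open>g\<close> is used.\<close>

definition transporter :: "('g, 'b) monoid_scheme \<Rightarrow> ('g, 'u) gset \<Rightarrow> 'u \<Rightarrow> 'u \<Rightarrow> 'g" where
  "transporter G T y c = (SOME g. g \<in> carrier G \<and> y = gact T g c)"

definition push_biset :: "('g, 'b) monoid_scheme \<Rightarrow> 'g \<Rightarrow> 'g set \<Rightarrow> ('g, 'g) biset" where
  "push_biset G g K = \<lparr>bpts = K, lact = (\<lambda>k' k. k' \<otimes>\<^bsub>G\<^esub> k),
     ract = (\<lambda>k h. k \<otimes>\<^bsub>G\<^esub> (inv\<^bsub>G\<^esub> g \<otimes>\<^bsub>G\<^esub> h \<otimes>\<^bsub>G\<^esub> g))\<rparr>"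

definition pull_biset :: "('g, 'b) monoid_scheme \<Rightarrow> 'g \<Rightarrow> 'g set \<Rightarrow> ('g, 'g) biset" where
  "pull_biset G g K = \<lparr>bpts = K, lact = (\<lambda>h k. (inv\<^bsub>G\<^esub> g \<otimes>\<^bsub>G\<^esub> h \<otimes>\<^bsub>G\<^esub> g) \<otimes>\<^bsub>G\<^esub> k),
     ract = (\<lambda>k k'. k \<otimes>\<^bsub>G\<^esub> k')\<rparr>"

text \<open>In \<open>push\<close> the row index \<open>a\<close> runs through the base points of the target \<open>T\<close> and the column
  index \<open>i\<close> through those of \<open>S\<close>; \<open>a = f(i)\<close> means that \<open>\<phi>(b\<^sub>i)\<close> lies in the orbit of \<open>c\<^sub>a\<close>.
  In \<open>pull\<close> rows and columns are exchanged.\<close>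

definition j_functor ::
  "('g, 'b) monoid_scheme \<Rightarrow> (('g, 'p) Gset \<Rightarrow> ('g, 'p) pt list) \<Rightarrow>
   (('g, 'p) Gset, ('g, 'p) pt \<Rightarrow> ('g, 'p) pt, 'g set list, 'g bimor mat) bifunc" where
  "j_functor G b = \<lparr>
     BOb = stab_list G b,
     push = (\<lambda>S T \<phi>. mat (length (b T)) (length (b S)) (\<lambda>(a, i).
       let H = stab_list G b S ! i; K = stab_list G b T ! a; y = \<phi> (b S ! i); c = b T ! a in
       bimor_of G H K
         (if y \<in> orbit G (gact T) c then push_biset G (transporter G T y c) K else biset_empty))),
     pull = (\<lambda>S T \<phi>. mat (length (b S)) (length (b T)) (\<lambda>(i, a).
       let H = stab_list G b S ! i; K = stab_list G b T ! a; y = \<phi> (b S ! i); c = b T ! a in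
       bimor_of G K H
         (if y \<in> orbit G (gact T) c then pull_biset G (transporter G T y c) K else biset_empty)))\<rparr>"

end

theory Submission
  imports Defs
begin

text \<open>
  A finite biset is a conjugation biset if and only if it has a map of bisets to \<open>G\<close>: \<open>\<gamma>\<^sub>X\<^sub>,\<^sub>x\<close> is then
  conjugation by the image of \<open>x\<close>. Therefore a span \<open>q : R \<rightarrow> S\<close>, \<open>p : R \<rightarrow> T\<close> of finite \<open>G\<close>-sets with base
  points \<open>b\<^sub>i\<close> of \<open>S\<close> and \<open>c\<^sub>a\<close> of \<open>T\<close> has a matrix of conjugation bisets
  \<open>{(r, g). p r = c\<^sub>a \<and> q r = g b\<^sub>i}\<close>. All matrices of conjugation bisets arise in this way, pullbacks of spans
  become products of matrices, and \<open>j\<close> sends \<open>\<phi>\<close> to the matrices of \<open>(id, \<phi>)\<close> and \<open>(\<phi>, id)\<close>. This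
  makes \<open>F \<circ> j\<close> a Mackey functor.

  Spans with isomorphic bisets differ by an inner automorphism \<open>r \<mapsto> u(r) r\<close> of \<open>R\<close>, where
  \<open>u(g r) = g u(r) g\<^sup>-\<^sup>1\<close>, and conjugation invariance says that these act trivially. So for a conjugation
  invariant Mackey functor \<open>p\<^sub>* q\<^sup>*\<close> depends only on the matrix of the span; it defines \<open>F\<close>, with the
  value of \<open>M\<close> at the disjoint union of the \<open>G/H\<^sub>i\<close> as the value at \<open>(H\<^sub>1, \<dots>, H\<^sub>k)\<close>. Conversely \<open>F \<circ> j\<close>
  determines \<open>F\<close>, since morphisms are differences of matrices of spans and every tuple is isomorphic
  to one in the image of \<open>j\<close>.\<close>

section \<open>Grothendieck groups\<close>

text \<open>The equation M = F o j can only be meant up to isomorphism: G-sets with the same list of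
  stabilizers have the same image under j, while M may give them different, merely isomorphic
  groups. So F comes with an isomorphism \<open>\<theta>\<close> from M to F o j, and uniqueness is
  a unique natural isomorphism compatible with both \<open>\<theta>\<close>.

  Bisets are tied to base points and to pairs of stabilizers, whereas spans are not, and restriction
  followed by transfer can be applied to a span at once. This is why every statement about bisets is
  moved to spans, with whole matrices treated simultaneously.

  Equality in a Grothendieck group is weaker than isomorphism of bisets: it only yields an
  isomorphism after a common summand has been added. That summand is realised by a span as well, and
  it disappears because the values of M are groups, in which one can cancel. For the same reason
  differences are handled as equations A + R' = R between sums throughout.\<close>

abbreviation fdiff :: "'a monoid \<Rightarrow> 'a \<Rightarrow> 'a \<Rightarrow> ('a \<times> 'a) set" where
  "fdiff A a b \<equiv> groth_rel A `` {(a, b)}"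

text \<open>Operations on classes are defined as unions over all representatives. Such a union
  collapses to the common value once the classes are nonempty and the value is independent of the
  representatives.\<close>

lemma UN2_const:
  assumes "P \<noteq> {}" "Q \<noteq> {}" and eq: "\<And>a b c d. (a, b) \<in> P \<Longrightarrow> (c, d) \<in> Q \<Longrightarrow> f a b c d = k"
  shows "(\<Union>(a, b)\<in>P. \<Union>(c, d)\<in>Q. f a b c d) = k"
proof -
  have "(\<Union>(a, b)\<in>P. \<Union>(c, d)\<in>Q. f a b c d) = (\<Union>x\<in>P. \<Union>y\<in>Q. k)"
    using eq by (intro SUP_cong refl) (auto intro!: SUP_cong)
  then show ?thesis using assms(1,2) by simp
qed

locale groth_monoid = comm_monoid A for A :: "'a monoid" (structure)
begin

lemma equiv_groth_rel: "equiv (carrier A \<times> carrier A) (groth_rel A)"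
proof (rule equivI)
  show "groth_rel A \<subseteq> (carrier A \<times> carrier A) \<times> (carrier A \<times> carrier A)"
    by (auto simp: groth_rel_def)
  show "refl_on (carrier A \<times> carrier A) (groth_rel A)"
    by (auto simp: refl_on_def groth_rel_def)
  show "sym (groth_rel A)"
    by (rule symI) (clarsimp simp: groth_rel_def, metis)
  show "trans (groth_rel A)"
  proof (rule transI, clarify)
    fix a b c d p q
    assume "((a, b), c, d) \<in> groth_rel A" "((c, d), p, q) \<in> groth_rel A"
    then obtain e f where c: "a \<in> carrier A" "b \<in> carrier A" "c \<in> carrier A" "d \<in> carrier A"
      "p \<in> carrier A" "q \<in> carrier A" "e \<in> carrier A" "f \<in> carrier A"
      and 1: "a \<otimes> d \<otimes> e = c \<otimes> b \<otimes> e" and 2: "c \<otimes> q \<otimes> f = p \<otimes> d \<otimes> f"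
      unfolding groth_rel_def by auto
    \<comment> \<open>In the absence of cancellation the middle term \<open>d\<close> has to be
      absorbed into the witness, together with the witnesses \<open>e\<close> and \<open>f\<close>
      of the two given relations.\<close>
    have "a \<otimes> q \<otimes> (d \<otimes> e \<otimes> f) = (a \<otimes> d \<otimes> e) \<otimes> (q \<otimes> f)" using c by (simp add: m_ac)
    also have "\<dots> = (c \<otimes> q \<otimes> f) \<otimes> (b \<otimes> e)" unfolding 1 using c by (simp add: m_ac)
    also have "\<dots> = p \<otimes> b \<otimes> (d \<otimes> e \<otimes> f)" unfolding 2 using c by (simp add: m_ac)
    finally show "((a, b), p, q) \<in> groth_rel A"
      unfolding groth_rel_def using c by (auto intro!: bexI[of _ "d \<otimes> e \<otimes> f"])
  qed
qed

lemma fdiff_eq_iff: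
  assumes "a \<in> carrier A" "b \<in> carrier A" "c \<in> carrier A" "d \<in> carrier A"
  shows "fdiff A a b = fdiff A c d \<longleftrightarrow> (\<exists>e\<in>carrier A. a \<otimes> d \<otimes> e = c \<otimes> b \<otimes> e)"
proof -
  have "fdiff A a b = fdiff A c d \<longleftrightarrow> ((a, b), (c, d)) \<in> groth_rel A"
    using assms by (intro eq_equiv_class_iff[OF equiv_groth_rel]) auto
  then show ?thesis using assms by (auto simp: groth_rel_def)
qed

lemma fdiff_eqI:
  assumes "a \<in> carrier A" "b \<in> carrier A" "c \<in> carrier A" "d \<in> carrier A" "e \<in> carrier A"
    and "a \<otimes> d \<otimes> e = c \<otimes> b \<otimes> e"
  shows "fdiff A a b = fdiff A c d"
  unfolding fdiff_eq_iff[OF assms(1-4)] using assms(5,6) by blast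

lemma fdiff_mem: "a \<in> carrier A \<Longrightarrow> b \<in> carrier A \<Longrightarrow> (a, b) \<in> fdiff A a b"
  using equiv_class_self[OF equiv_groth_rel, of "(a, b)"] by simp

lemma fdiff_memD:
  assumes "(a', b') \<in> fdiff A a b"
  obtains e where "a \<in> carrier A" "b \<in> carrier A" "a' \<in> carrier A" "b' \<in> carrier A" "e \<in> carrier A"
    "a' \<otimes> b \<otimes> e = a \<otimes> b' \<otimes> e"
proof -
  have "a \<in> carrier A \<and> b \<in> carrier A \<and> a' \<in> carrier A \<and> b' \<in> carrier A \<and>
      (\<exists>e\<in>carrier A. a \<otimes> b' \<otimes> e = a' \<otimes> b \<otimes> e)"
    using assms by (simp add: groth_rel_def)
  then show thesis using that by metis
qed

lemma carrier_groth: "carrier (groth A) = (carrier A \<times> carrier A) // groth_rel A"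
  by (simp add: groth_def)

lemma fdiff_closed: "a \<in> carrier A \<Longrightarrow> b \<in> carrier A \<Longrightarrow> fdiff A a b \<in> carrier (groth A)"
  by (auto simp: carrier_groth intro: quotientI)

lemma groth_cases:
  assumes "P \<in> carrier (groth A)"
  obtains a b where "a \<in> carrier A" "b \<in> carrier A" "P = fdiff A a b"
  using assms unfolding carrier_groth by (auto elim!: quotientE)

lemma fdiff_mult:
  assumes "a \<in> carrier A" "b \<in> carrier A" "c \<in> carrier A" "d \<in> carrier A"
  shows "fdiff A a b \<otimes>\<^bsub>groth A\<^esub> fdiff A c d = fdiff A (a \<otimes> c) (b \<otimes> d)"
proof -
  have "fdiff A (a' \<otimes> c') (b' \<otimes> d') = fdiff A (a \<otimes> c) (b \<otimes> d)"
    if ab: "(a', b') \<in> fdiff A a b" and cd: "(c', d') \<in> fdiff A c d" for a' b' c' d'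
  proof -
    obtain e where e: "a \<in> carrier A" "b \<in> carrier A" "a' \<in> carrier A" "b' \<in> carrier A" "e \<in> carrier A"
      "a' \<otimes> b \<otimes> e = a \<otimes> b' \<otimes> e" using ab by (rule fdiff_memD)
    obtain f where f: "c \<in> carrier A" "d \<in> carrier A" "c' \<in> carrier A" "d' \<in> carrier A" "f \<in> carrier A"
      "c' \<otimes> d \<otimes> f = c \<otimes> d' \<otimes> f" using cd by (rule fdiff_memD)
    have "a' \<otimes> c' \<otimes> (b \<otimes> d) \<otimes> (e \<otimes> f) = (a' \<otimes> b \<otimes> e) \<otimes> (c' \<otimes> d \<otimes> f)"
      using assms e(1-5) f(1-5) by (simp add: m_ac)
    also have "\<dots> = a \<otimes> c \<otimes> (b' \<otimes> d') \<otimes> (e \<otimes> f)"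
      unfolding e(6) f(6) using assms e(1-5) f(1-5) by (simp add: m_ac)
    finally show ?thesis using assms e f by (intro fdiff_eqI[of _ _ _ _ "e \<otimes> f"]) simp_all
  qed
  moreover have "fdiff A a b \<noteq> {}" "fdiff A c d \<noteq> {}"
    using fdiff_mem assms by fast+
  ultimately show ?thesis
    unfolding groth_def monoid.select_convs by (intro UN2_const)
qed

lemma one_groth: "\<one>\<^bsub>groth A\<^esub> = fdiff A \<one> \<one>"
  by (simp add: groth_def)

lemma comm_group_groth: "comm_group (groth A)"
proof (rule comm_groupI)
  fix x y z assume "x \<in> carrier (groth A)" "y \<in> carrier (groth A)"
  then show "x \<otimes>\<^bsub>groth A\<^esub> y \<in> carrier (groth A)"
    by (elim groth_cases) (simp add: fdiff_mult fdiff_closed)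
next
  show "\<one>\<^bsub>groth A\<^esub> \<in> carrier (groth A)" by (simp add: one_groth fdiff_closed)
next
  fix x y z assume "x \<in> carrier (groth A)" "y \<in> carrier (groth A)" "z \<in> carrier (groth A)"
  then show "x \<otimes>\<^bsub>groth A\<^esub> y \<otimes>\<^bsub>groth A\<^esub> z = x \<otimes>\<^bsub>groth A\<^esub> (y \<otimes>\<^bsub>groth A\<^esub> z)"
    by (elim groth_cases) (simp add: fdiff_mult m_assoc)
next
  fix x y assume "x \<in> carrier (groth A)" "y \<in> carrier (groth A)"
  then show "x \<otimes>\<^bsub>groth A\<^esub> y = y \<otimes>\<^bsub>groth A\<^esub> x"
    by (elim groth_cases) (simp add: fdiff_mult m_comm)
next
  fix x assume "x \<in> carrier (groth A)"
  then show "\<one>\<^bsub>groth A\<^esub> \<otimes>\<^bsub>groth A\<^esub> x = x"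
    by (elim groth_cases) (simp add: one_groth fdiff_mult)
next
  fix x assume "x \<in> carrier (groth A)"
  then obtain a b where x: "a \<in> carrier A" "b \<in> carrier A" "x = fdiff A a b" by (elim groth_cases)
  then have "fdiff A b a \<otimes>\<^bsub>groth A\<^esub> x = \<one>\<^bsub>groth A\<^esub>"
    by (simp add: one_groth fdiff_mult) (rule fdiff_eqI[of _ _ _ _ \<one>], auto simp: m_comm)
  then show "\<exists>y\<in>carrier (groth A). y \<otimes>\<^bsub>groth A\<^esub> x = \<one>\<^bsub>groth A\<^esub>"
    using x fdiff_closed by blast
qed

lemma groth_of_closed: "a \<in> carrier A \<Longrightarrow> groth_of A a \<in> carrier (groth A)"
  by (simp add: groth_of_def fdiff_closed)

lemma groth_of_mult:
  "a \<in> carrier A \<Longrightarrow> b \<in> carrier A \<Longrightarrow> groth_of A (a \<otimes> b) = groth_of A a \<otimes>\<^bsub>groth A\<^esub> groth_of A b"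
  by (simp add: groth_of_def fdiff_mult)

lemma groth_of_one: "groth_of A \<one> = \<one>\<^bsub>groth A\<^esub>"
  by (simp add: groth_of_def one_groth)

lemma groth_of_eq_iff:
  assumes "a \<in> carrier A" "b \<in> carrier A"
  shows "groth_of A a = groth_of A b \<longleftrightarrow> (\<exists>e\<in>carrier A. a \<otimes> e = b \<otimes> e)"
  using assms by (simp add: groth_of_def fdiff_eq_iff)

text \<open>A difference is expressed without inverses, so that classes of bisets, which can only be
  added, stand on both sides of the equation.\<close>

lemma groth_difference:
  assumes "P \<in> carrier (groth A)"
  obtains a b where "a \<in> carrier A" "b \<in> carrier A" "P \<otimes>\<^bsub>groth A\<^esub> groth_of A b = groth_of A a"
proof -
  obtain a b where x: "a \<in> carrier A" "b \<in> carrier A" "P = fdiff A a b" using assms by (elim groth_cases)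
  then have "P \<otimes>\<^bsub>groth A\<^esub> groth_of A b = groth_of A a"
    by (simp add: groth_of_def fdiff_mult) (rule fdiff_eqI[of _ _ _ _ \<one>], auto simp: m_comm)
  then show ?thesis using x that by blast
qed

text \<open>Entries of matrix products are finite sums in the Grothendieck group; this moves such a
  sum back to classes of bisets.\<close>

lemma groth_of_finprod:
  assumes "\<And>i. i < n \<Longrightarrow> f i \<in> carrier A"
  shows "finprod (groth A) (\<lambda>i. groth_of A (f i)) {..<n::nat} = groth_of A (finprod A f {..<n})"
proof -
  interpret g: comm_group "groth A" by (rule comm_group_groth)
  show ?thesis using assms
  proof (induction n)
    case 0 show ?case by (simp add: groth_of_one)
  next
    case (Suc n)
    have c: "f \<in> {..<n} \<rightarrow> carrier A" "f n \<in> carrier A" using Suc.prems by auto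
    then have "finprod (groth A) (\<lambda>i. groth_of A (f i)) {..<Suc n} =
      groth_of A (f n) \<otimes>\<^bsub>groth A\<^esub> groth_of A (finprod A f {..<n})"
      using Suc by (subst lessThan_Suc) (simp add: groth_of_closed Pi_def)
    also have "\<dots> = groth_of A (finprod A f {..<Suc n})"
      using c by (simp add: lessThan_Suc groth_of_mult)
    finally show ?case .
  qed
qed

end

section \<open>Extension of biadditive maps to Grothendieck groups\<close>

locale biadditive = A: groth_monoid A + B: groth_monoid B + C: groth_monoid C
  for A :: "'a monoid" and B :: "'b monoid" and C :: "'c monoid" and m +
  assumes closed: "b \<in> carrier B \<Longrightarrow> c \<in> carrier C \<Longrightarrow> m b c \<in> carrier A"
    and addl: "b \<in> carrier B \<Longrightarrow> b' \<in> carrier B \<Longrightarrow> c \<in> carrier C \<Longrightarrow>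
      m (b \<otimes>\<^bsub>B\<^esub> b') c = m b c \<otimes>\<^bsub>A\<^esub> m b' c"
    and addr: "b \<in> carrier B \<Longrightarrow> c \<in> carrier C \<Longrightarrow> c' \<in> carrier C \<Longrightarrow>
      m b (c \<otimes>\<^bsub>C\<^esub> c') = m b c \<otimes>\<^bsub>A\<^esub> m b c'"
begin

lemma well_defined_left:
  assumes "(a', b') \<in> fdiff B a b" "c \<in> carrier C" "d \<in> carrier C"
  shows "fdiff A (m a' c \<otimes>\<^bsub>A\<^esub> m b' d) (m a' d \<otimes>\<^bsub>A\<^esub> m b' c) =
    fdiff A (m a c \<otimes>\<^bsub>A\<^esub> m b d) (m a d \<otimes>\<^bsub>A\<^esub> m b c)"
proof -
  obtain e where e: "a \<in> carrier B" "b \<in> carrier B" "a' \<in> carrier B" "b' \<in> carrier B" "e \<in> carrier B"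
    "a' \<otimes>\<^bsub>B\<^esub> b \<otimes>\<^bsub>B\<^esub> e = a \<otimes>\<^bsub>B\<^esub> b' \<otimes>\<^bsub>B\<^esub> e" using assms(1) by (rule B.fdiff_memD)
  have x: "m a' x \<otimes>\<^bsub>A\<^esub> m b x \<otimes>\<^bsub>A\<^esub> m e x = m a x \<otimes>\<^bsub>A\<^esub> m b' x \<otimes>\<^bsub>A\<^esub> m e x" if "x \<in> carrier C" for x
  proof -
    have "m (a' \<otimes>\<^bsub>B\<^esub> b \<otimes>\<^bsub>B\<^esub> e) x = m (a \<otimes>\<^bsub>B\<^esub> b' \<otimes>\<^bsub>B\<^esub> e) x" by (simp only: e(6))
    then show ?thesis using e(1-5) that by (simp add: addl)
  qed
  \<comment> \<open>The relation between the two representatives is pushed through \<open>m\<close>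
    twice, once with \<open>c\<close> and once, read backwards, with \<open>d\<close>. The witness
    is the sum of the two images of \<open>e\<close>.\<close>
  have "m a' c \<otimes>\<^bsub>A\<^esub> m b' d \<otimes>\<^bsub>A\<^esub> (m a d \<otimes>\<^bsub>A\<^esub> m b c) \<otimes>\<^bsub>A\<^esub> (m e c \<otimes>\<^bsub>A\<^esub> m e d) =
    (m a' c \<otimes>\<^bsub>A\<^esub> m b c \<otimes>\<^bsub>A\<^esub> m e c) \<otimes>\<^bsub>A\<^esub> (m a d \<otimes>\<^bsub>A\<^esub> m b' d \<otimes>\<^bsub>A\<^esub> m e d)"
    using e assms closed by (simp add: A.m_ac)
  also have "\<dots> = (m a c \<otimes>\<^bsub>A\<^esub> m b' c \<otimes>\<^bsub>A\<^esub> m e c) \<otimes>\<^bsub>A\<^esub> (m a' d \<otimes>\<^bsub>A\<^esub> m b d \<otimes>\<^bsub>A\<^esub> m e d)"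
    using x assms by simp
  also have "\<dots> = m a c \<otimes>\<^bsub>A\<^esub> m b d \<otimes>\<^bsub>A\<^esub> (m a' d \<otimes>\<^bsub>A\<^esub> m b' c) \<otimes>\<^bsub>A\<^esub> (m e c \<otimes>\<^bsub>A\<^esub> m e d)"
    using e assms closed by (simp add: A.m_ac)
  finally show ?thesis
    using e assms closed by (intro A.fdiff_eqI[of _ _ _ _ "m e c \<otimes>\<^bsub>A\<^esub> m e d"]) auto
qed

text \<open>By this symmetry independence of representatives has to be computed in one variable
  only.\<close>

lemma swapped: "biadditive A C B (\<lambda>c b. m b c)"
  by unfold_locales (auto simp: closed addl addr)

lemma well_defined_right:
  assumes "(c', d') \<in> fdiff C c d" "a \<in> carrier B" "b \<in> carrier B"
  shows "fdiff A (m a c' \<otimes>\<^bsub>A\<^esub> m b d') (m a d' \<otimes>\<^bsub>A\<^esub> m b c') =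
    fdiff A (m a c \<otimes>\<^bsub>A\<^esub> m b d) (m a d \<otimes>\<^bsub>A\<^esub> m b c)"
proof -
  have "c \<in> carrier C" "d \<in> carrier C" "c' \<in> carrier C" "d' \<in> carrier C"
    using C.fdiff_memD[OF assms(1)] by metis+
  then show ?thesis
    using biadditive.well_defined_left[OF swapped assms] assms closed by (simp add: A.m_comm)
qed

lemma bilinear_fdiff:
  assumes "a \<in> carrier B" "b \<in> carrier B" "c \<in> carrier C" "d \<in> carrier C"
  shows "groth_bilinear A m (fdiff B a b) (fdiff C c d) =
    fdiff A (m a c \<otimes>\<^bsub>A\<^esub> m b d) (m a d \<otimes>\<^bsub>A\<^esub> m b c)"
proof -
  have "fdiff A (m a' c' \<otimes>\<^bsub>A\<^esub> m b' d') (m a' d' \<otimes>\<^bsub>A\<^esub> m b' c') =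
    fdiff A (m a c \<otimes>\<^bsub>A\<^esub> m b d) (m a d \<otimes>\<^bsub>A\<^esub> m b c)"
    if ab: "(a', b') \<in> fdiff B a b" and cd: "(c', d') \<in> fdiff C c d" for a' b' c' d'
  proof -
    have "c' \<in> carrier C" "d' \<in> carrier C" using C.fdiff_memD[OF cd] by metis+
    then show ?thesis using well_defined_left[OF ab] well_defined_right[OF cd] assms by simp
  qed
  moreover have "fdiff B a b \<noteq> {}" "fdiff C c d \<noteq> {}"
    using B.fdiff_mem C.fdiff_mem assms by fast+
  ultimately show ?thesis
    unfolding groth_bilinear_def by (intro UN2_const)
qed

lemma bilinear_closed:
  assumes "P \<in> carrier (groth B)" "Q \<in> carrier (groth C)"
  shows "groth_bilinear A m P Q \<in> carrier (groth A)"
  using assms by (elim B.groth_cases C.groth_cases) (simp add: bilinear_fdiff closed A.fdiff_closed)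

lemma bilinear_addl:
  assumes "P \<in> carrier (groth B)" "P' \<in> carrier (groth B)" "Q \<in> carrier (groth C)"
  shows "groth_bilinear A m (P \<otimes>\<^bsub>groth B\<^esub> P') Q =
    groth_bilinear A m P Q \<otimes>\<^bsub>groth A\<^esub> groth_bilinear A m P' Q"
  using assms
  by (elim B.groth_cases C.groth_cases)
     (simp add: bilinear_fdiff B.fdiff_mult A.fdiff_mult closed addl A.m_ac)

lemma bilinear_addr:
  assumes "P \<in> carrier (groth B)" "Q \<in> carrier (groth C)" "Q' \<in> carrier (groth C)"
  shows "groth_bilinear A m P (Q \<otimes>\<^bsub>groth C\<^esub> Q') =
    groth_bilinear A m P Q \<otimes>\<^bsub>groth A\<^esub> groth_bilinear A m P Q'"
  using assms
  by (elim B.groth_cases C.groth_cases)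
     (simp add: bilinear_fdiff C.fdiff_mult A.fdiff_mult closed addr A.m_ac)

text \<open>The extra terms in the formula for formal differences are idempotent, hence trivial in the
  Grothendieck group.\<close>

lemma bilinear_groth_of:
  assumes a: "a \<in> carrier B" and c: "c \<in> carrier C"
  shows "groth_bilinear A m (groth_of B a) (groth_of C c) = groth_of A (m a c)"
proof -
  let ?i = "m \<one>\<^bsub>B\<^esub> \<one>\<^bsub>C\<^esub>" and ?j = "m a \<one>\<^bsub>C\<^esub>" and ?k = "m \<one>\<^bsub>B\<^esub> c"
  have ijk: "?i \<in> carrier A" "?j \<in> carrier A" "?k \<in> carrier A" "m a c \<in> carrier A" using a c closed by auto
  have i: "?i = ?i \<otimes>\<^bsub>A\<^esub> ?i" and j: "?j = ?j \<otimes>\<^bsub>A\<^esub> ?j" and k: "?k = ?k \<otimes>\<^bsub>A\<^esub> ?k"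
    using addl[of "\<one>\<^bsub>B\<^esub>" "\<one>\<^bsub>B\<^esub>"] addr[of _ "\<one>\<^bsub>C\<^esub>" "\<one>\<^bsub>C\<^esub>"] a c by auto
  have "m a c \<otimes>\<^bsub>A\<^esub> ?i \<otimes>\<^bsub>A\<^esub> \<one>\<^bsub>A\<^esub> \<otimes>\<^bsub>A\<^esub> (?i \<otimes>\<^bsub>A\<^esub> ?j \<otimes>\<^bsub>A\<^esub> ?k) =
      m a c \<otimes>\<^bsub>A\<^esub> ((?i \<otimes>\<^bsub>A\<^esub> ?i) \<otimes>\<^bsub>A\<^esub> ?j \<otimes>\<^bsub>A\<^esub> ?k)"
    using ijk by (simp add: A.m_ac)
  also have "\<dots> = m a c \<otimes>\<^bsub>A\<^esub> (?i \<otimes>\<^bsub>A\<^esub> (?j \<otimes>\<^bsub>A\<^esub> ?j) \<otimes>\<^bsub>A\<^esub> (?k \<otimes>\<^bsub>A\<^esub> ?k))"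
    by (simp flip: i j k)
  also have "\<dots> = m a c \<otimes>\<^bsub>A\<^esub> (?j \<otimes>\<^bsub>A\<^esub> ?k) \<otimes>\<^bsub>A\<^esub> (?i \<otimes>\<^bsub>A\<^esub> ?j \<otimes>\<^bsub>A\<^esub> ?k)"
    using ijk by (simp add: A.m_ac)
  finally have "fdiff A (m a c \<otimes>\<^bsub>A\<^esub> ?i) (?j \<otimes>\<^bsub>A\<^esub> ?k) = fdiff A (m a c) \<one>\<^bsub>A\<^esub>"
    using ijk by (intro A.fdiff_eqI[of _ _ _ _ "?i \<otimes>\<^bsub>A\<^esub> ?j \<otimes>\<^bsub>A\<^esub> ?k"]) auto
  then show ?thesis unfolding groth_of_def using a c by (simp add: bilinear_fdiff)
qed

end

section \<open>Conjugation bisets\<close>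

lemma UN_UN_const:
  assumes "P \<noteq> {}" "Q \<noteq> {}" "\<And>x y. x \<in> P \<Longrightarrow> y \<in> Q \<Longrightarrow> f x y = k"
  shows "(\<Union>x\<in>P. \<Union>y\<in>Q. f x y) = k"
proof -
  have "(\<Union>x\<in>P. \<Union>y\<in>Q. f x y) = (\<Union>x\<in>P. \<Union>y\<in>Q. k)"
    using assms(3) by (intro SUP_cong refl) auto
  then show ?thesis using assms(1,2) by simp
qed

lemma finite_bisetD:
  assumes "finite_biset G H1 H2 X"
  shows "finite (bpts X)"
    and "h \<in> H2 \<Longrightarrow> x \<in> bpts X \<Longrightarrow> lact X h x \<in> bpts X"
    and "x \<in> bpts X \<Longrightarrow> lact X \<one>\<^bsub>G\<^esub> x = x"
    and "h \<in> H2 \<Longrightarrow> h' \<in> H2 \<Longrightarrow> x \<in> bpts X \<Longrightarrow> lact X (h \<otimes>\<^bsub>G\<^esub> h') x = lact X h (lact X h' x)"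
    and "k \<in> H1 \<Longrightarrow> x \<in> bpts X \<Longrightarrow> ract X x k \<in> bpts X"
    and "x \<in> bpts X \<Longrightarrow> ract X x \<one>\<^bsub>G\<^esub> = x"
    and "k \<in> H1 \<Longrightarrow> k' \<in> H1 \<Longrightarrow> x \<in> bpts X \<Longrightarrow> ract X x (k \<otimes>\<^bsub>G\<^esub> k') = ract X (ract X x k) k'"
    and "h \<in> H2 \<Longrightarrow> k \<in> H1 \<Longrightarrow> x \<in> bpts X \<Longrightarrow> ract X (lact X h x) k = lact X h (ract X x k)"
  using assms unfolding finite_biset_def by blast+

definition biset_hom :: "'g set \<Rightarrow> 'g set \<Rightarrow> ('g, 'x) biset \<Rightarrow> ('g, 'y) biset \<Rightarrow> ('x \<Rightarrow> 'y) \<Rightarrow> bool" where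
  "biset_hom H1 H2 X Y f \<longleftrightarrow> f ` bpts X \<subseteq> bpts Y \<and>
     (\<forall>h\<in>H2. \<forall>x\<in>bpts X. f (lact X h x) = lact Y h (f x)) \<and>
     (\<forall>h\<in>H1. \<forall>x\<in>bpts X. f (ract X x h) = ract Y (f x) h)"

lemma biset_homD:
  assumes "biset_hom H1 H2 X Y f"
  shows "x \<in> bpts X \<Longrightarrow> f x \<in> bpts Y"
    and "h \<in> H2 \<Longrightarrow> x \<in> bpts X \<Longrightarrow> f (lact X h x) = lact Y h (f x)"
    and "k \<in> H1 \<Longrightarrow> x \<in> bpts X \<Longrightarrow> f (ract X x k) = ract Y (f x) k"
  using assms unfolding biset_hom_def by blast+

lemma biset_homI:
  assumes "\<And>x. x \<in> bpts X \<Longrightarrow> f x \<in> bpts Y"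
    and "\<And>h x. h \<in> H2 \<Longrightarrow> x \<in> bpts X \<Longrightarrow> f (lact X h x) = lact Y h (f x)"
    and "\<And>k x. k \<in> H1 \<Longrightarrow> x \<in> bpts X \<Longrightarrow> f (ract X x k) = ract Y (f x) k"
  shows "biset_hom H1 H2 X Y f"
  using assms unfolding biset_hom_def by blast

lemma biset_iso_hom:
  "biset_iso H1 H2 X Y \<longleftrightarrow> (\<exists>f. bij_betw f (bpts X) (bpts Y) \<and> biset_hom H1 H2 X Y f)"
  unfolding biset_iso_def biset_hom_def by (auto simp: bij_betw_def)

lemma biset_isoI:
  assumes "inj_on f (bpts X)" "bpts Y \<subseteq> f ` bpts X" "biset_hom H1 H2 X Y f"
  shows "biset_iso H1 H2 X Y"
  unfolding biset_iso_hom using assms by (auto simp: bij_betw_def biset_hom_def)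

lemma biset_isoE:
  assumes "biset_iso H1 H2 X Y"
  obtains f where "bij_betw f (bpts X) (bpts Y)" "biset_hom H1 H2 X Y f"
  using assms unfolding biset_iso_hom by blast

lemma biset_iso_trans:
  assumes "biset_iso H1 H2 X Y" "biset_iso H1 H2 Y Z" shows "biset_iso H1 H2 X Z"
proof -
  obtain f where f: "bij_betw f (bpts X) (bpts Y)" "biset_hom H1 H2 X Y f" using assms(1) by (rule biset_isoE)
  obtain g where g: "bij_betw g (bpts Y) (bpts Z)" "biset_hom H1 H2 Y Z g" using assms(2) by (rule biset_isoE)
  have "bij_betw (g \<circ> f) (bpts X) (bpts Z)" using bij_betw_trans[OF f(1) g(1)] .
  moreover have "biset_hom H1 H2 X Z (g \<circ> f)"
    by (intro biset_homI) (simp_all add: biset_homD[OF f(2)] biset_homD[OF g(2)])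
  ultimately show ?thesis unfolding biset_iso_hom by blast
qed

lemma biset_hom_inv_into:
  assumes "finite_biset G H1 H2 X" "bij_betw f (bpts X) (bpts Y)" "biset_hom H1 H2 X Y f"
  shows "biset_hom H1 H2 Y X (inv_into (bpts X) f)"
proof (rule biset_homI)
  let ?g = "inv_into (bpts X) f"
  note X = finite_bisetD[OF assms(1)]
  fix y assume "y \<in> bpts Y"
  then have y: "?g y \<in> bpts X" "f (?g y) = y"
    using assms(2) by (auto simp: bij_betw_def inv_into_into f_inv_into_f)
  then show "?g y \<in> bpts X" by simp
  have inj: "inj_on f (bpts X)" using assms(2) by (simp add: bij_betw_def)
  show "?g (lact Y h y) = lact X h (?g y)" if "h \<in> H2" for h
    using inv_into_f_f[OF inj X(2)[OF that y(1)]] biset_homD(2)[OF assms(3) that y(1)] y(2) by simp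
  show "?g (ract Y y h) = ract X (?g y) h" if "h \<in> H1" for h
    using inv_into_f_f[OF inj X(5)[OF that y(1)]] biset_homD(3)[OF assms(3) that y(1)] y(2) by simp
qed

lemma biset_iso_sym:
  assumes "finite_biset G H1 H2 X" "biset_iso H1 H2 X Y"
  shows "biset_iso H1 H2 Y X"
proof -
  obtain f where f: "bij_betw f (bpts X) (bpts Y)" "biset_hom H1 H2 X Y f" using assms(2) by (rule biset_isoE)
  then show ?thesis
    using biset_hom_inv_into[OF assms(1) f] bij_betw_inv_into unfolding biset_iso_hom by blast
qed

lemma finite_biset_transport:
  assumes "finite_biset G H1 H2 X" "inj_on e (bpts X)"
  shows "\<exists>Y. finite_biset G H1 H2 Y \<and> bpts Y = e ` bpts X \<and> biset_hom H1 H2 X Y e"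
proof -
  note X = finite_bisetD[OF assms(1)]
  define d where "d = inv_into (bpts X) e"
  have d: "d (e x) = x" if "x \<in> bpts X" for x using that assms(2) by (simp add: d_def)
  define Y where "Y = \<lparr>bpts = e ` bpts X, lact = (\<lambda>h y. e (lact X h (d y))), ract = (\<lambda>y h. e (ract X (d y) h))\<rparr>"
  have "finite_biset G H1 H2 Y"
    unfolding finite_biset_def using X by (simp add: Y_def d)
  moreover have "biset_hom H1 H2 X Y e" by (rule biset_homI) (auto simp: Y_def d)
  ultimately show ?thesis by (intro exI[of _ Y]) (simp add: Y_def)
qed

definition biset_restr :: "('g, 'x) biset \<Rightarrow> ('x \<Rightarrow> bool) \<Rightarrow> ('g, 'x) biset" where
  "biset_restr X A = X\<lparr>bpts := {x \<in> bpts X. A x}\<rparr>"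

lemma biset_restr_simps [simp]:
  "bpts (biset_restr X A) = {x \<in> bpts X. A x}" "lact (biset_restr X A) = lact X"
  "ract (biset_restr X A) = ract X"
  by (simp_all add: biset_restr_def)

lemma biset_sum_simps [simp]:
  "bpts (biset_sum X Y) = bpts X <+> bpts Y"
  "lact (biset_sum X Y) h (Inl x) = Inl (lact X h x)" "lact (biset_sum X Y) h (Inr y) = Inr (lact Y h y)"
  "ract (biset_sum X Y) (Inl x) h = Inl (ract X x h)" "ract (biset_sum X Y) (Inr y) h = Inr (ract Y y h)"
  by (simp_all add: biset_sum_def)

lemma biset_iso_sum:
  assumes "biset_iso H1 H2 X X'" "biset_iso H1 H2 Y Y'"
  shows "biset_iso H1 H2 (biset_sum X Y) (biset_sum X' Y')"
proof -
  obtain f where f: "bij_betw f (bpts X) (bpts X')" "biset_hom H1 H2 X X' f" using assms(1) by (rule biset_isoE)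
  obtain g where g: "bij_betw g (bpts Y) (bpts Y')" "biset_hom H1 H2 Y Y' g" using assms(2) by (rule biset_isoE)
  have "inj_on (map_sum f g) (bpts X <+> bpts Y)"
    using bij_betw_imp_inj_on[OF f(1)] bij_betw_imp_inj_on[OF g(1)]
    by (intro inj_onI, elim PlusE) (auto dest: inj_onD)
  moreover have "bpts X' <+> bpts Y' \<subseteq> map_sum f g ` (bpts X <+> bpts Y)"
    using bij_betw_imp_surj_on[OF f(1), symmetric] bij_betw_imp_surj_on[OF g(1), symmetric]
    by (simp add: Plus_def image_Un image_image)
  moreover have "biset_hom H1 H2 (biset_sum X Y) (biset_sum X' Y') (map_sum f g)"
    by (intro biset_homI) (auto simp: biset_homD[OF f(2)] biset_homD[OF g(2)])
  ultimately show ?thesis by (intro biset_isoI[of "map_sum f g"]) simp_all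
qed

lemma biset_iso_sum_comm: "biset_iso H1 H2 (biset_sum X Y) (biset_sum Y X)"
proof (rule biset_isoI)
  let ?f = "case_sum Inr Inl"
  show "inj_on ?f (bpts (biset_sum X Y))" by (auto simp: inj_on_def)
  show "bpts (biset_sum Y X) \<subseteq> ?f ` bpts (biset_sum X Y)" by (force simp: image_iff)
  show "biset_hom H1 H2 (biset_sum X Y) (biset_sum Y X) ?f" by (rule biset_homI) auto
qed

lemma biset_iso_sum_assoc:
  "biset_iso H1 H2 (biset_sum (biset_sum X Y) Z) (biset_sum X (biset_sum Y Z))"
proof (rule biset_isoI)
  let ?f = "case_sum (case_sum Inl (Inr \<circ> Inl)) (Inr \<circ> Inr)"
  show "inj_on ?f (bpts (biset_sum (biset_sum X Y) Z))" by (auto simp: inj_on_def)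
  show "bpts (biset_sum X (biset_sum Y Z)) \<subseteq> ?f ` bpts (biset_sum (biset_sum X Y) Z)"
    by (force simp: image_iff)
  show "biset_hom H1 H2 (biset_sum (biset_sum X Y) Z) (biset_sum X (biset_sum Y Z)) ?f"
    by (rule biset_homI) auto
qed

lemma biset_iso_sum_empty: "biset_iso H1 H2 (biset_sum biset_empty X) X"
proof (rule biset_isoI)
  let ?f = "case_sum undefined id"
  show "inj_on ?f (bpts (biset_sum biset_empty X))" by (auto simp: inj_on_def biset_empty_def)
  show "bpts X \<subseteq> ?f ` bpts (biset_sum biset_empty X)" by (force simp: image_iff)
  show "biset_hom H1 H2 (biset_sum biset_empty X) X ?f"
    by (rule biset_homI) (auto simp: biset_empty_def)
qed

lemma biset_iso_empty: "bpts X = {} \<Longrightarrow> biset_iso H1 H2 X biset_empty"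
  by (rule biset_isoI[of undefined]) (auto simp: biset_hom_def biset_empty_def)

lemma biset_iso_sum_restr:
  assumes "\<And>x. x \<in> bpts X \<Longrightarrow> \<not> (A x \<and> B x)"
  shows "biset_iso H1 H2 (biset_sum (biset_restr X A) (biset_restr X B)) (biset_restr X (\<lambda>x. A x \<or> B x))"
proof (rule biset_isoI)
  let ?f = "case_sum id id" and ?S = "biset_sum (biset_restr X A) (biset_restr X B)"
  show "inj_on ?f (bpts ?S)" using assms by (auto simp: inj_on_def)
  show "bpts (biset_restr X (\<lambda>x. A x \<or> B x)) \<subseteq> ?f ` bpts ?S" by (force simp: image_iff)
  show "biset_hom H1 H2 ?S (biset_restr X (\<lambda>x. A x \<or> B x)) ?f" by (rule biset_homI) auto
qed

text \<open>Where \<open>conj_biset\<close> asks for an unrelated element at every point, a mark is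
  one equivariant choice for all points. This makes it easy to handle: marks pull back along maps
  and multiply in balanced products.\<close>

definition biset_mark ::
  "('g, 'b) monoid_scheme \<Rightarrow> 'g set \<Rightarrow> 'g set \<Rightarrow> ('g, 'x) biset \<Rightarrow> ('x \<Rightarrow> 'g) \<Rightarrow> bool" where
  "biset_mark G H1 H2 X c \<longleftrightarrow>
     biset_hom H1 H2 X \<lparr>bpts = carrier G, lact = (\<lambda>h x. h \<otimes>\<^bsub>G\<^esub> x), ract = (\<lambda>x h. x \<otimes>\<^bsub>G\<^esub> h)\<rparr> c"

lemma biset_markD:
  assumes "biset_mark G H1 H2 X c"
  shows "x \<in> bpts X \<Longrightarrow> c x \<in> carrier G"
    and "h \<in> H2 \<Longrightarrow> x \<in> bpts X \<Longrightarrow> c (lact X h x) = h \<otimes>\<^bsub>G\<^esub> c x"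
    and "k \<in> H1 \<Longrightarrow> x \<in> bpts X \<Longrightarrow> c (ract X x k) = c x \<otimes>\<^bsub>G\<^esub> k"
  using biset_homD[OF assms[unfolded biset_mark_def]] by simp_all

lemma biset_markI:
  assumes "\<And>x. x \<in> bpts X \<Longrightarrow> c x \<in> carrier G"
    and "\<And>h x. h \<in> H2 \<Longrightarrow> x \<in> bpts X \<Longrightarrow> c (lact X h x) = h \<otimes>\<^bsub>G\<^esub> c x"
    and "\<And>k x. k \<in> H1 \<Longrightarrow> x \<in> bpts X \<Longrightarrow> c (ract X x k) = c x \<otimes>\<^bsub>G\<^esub> k"
  shows "biset_mark G H1 H2 X c"
  unfolding biset_mark_def using assms by (intro biset_homI) auto

context group
begin

lemma mult_inv_cancel:
  "x \<in> carrier G \<Longrightarrow> y \<in> carrier G \<Longrightarrow> x \<otimes> (inv x \<otimes> y) = y"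
  "x \<in> carrier G \<Longrightarrow> y \<in> carrier G \<Longrightarrow> inv x \<otimes> (x \<otimes> y) = y"
  by (simp_all flip: m_assoc)

text \<open>Translations on G are free, hence so are the actions on anything that maps to G.
  Moreover \<open>h x = x h1\<close> becomes \<open>h c(x) = c(x) h1\<close>, which determines
  \<open>h1\<close> as the conjugate of \<open>h\<close> by \<open>c(x)\<close>.\<close>

lemma conj_biset_of_mark:
  assumes H: "subgroup H1 G" "subgroup H2 G" and X: "finite_biset G H1 H2 X" and c: "biset_mark G H1 H2 X c"
  shows "conj_biset G H1 H2 X"
proof -
  note cD = biset_markD[OF c]
  have sub: "\<And>h. h \<in> H1 \<Longrightarrow> h \<in> carrier G" "\<And>h. h \<in> H2 \<Longrightarrow> h \<in> carrier G"
    using H subgroup.mem_carrier by fast+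
  have "bifree G H1 H2 X"
    unfolding bifree_def
  proof (intro conjI ballI impI)
    fix h x assume h: "h \<in> H2" "x \<in> bpts X" "lact X h x = x"
    then show "h = \<one>" using cD(2)[OF h(1,2)] cD(1)[OF h(2)] sub(2)[OF h(1)] r_cancel_one by metis
  next
    fix h x assume h: "h \<in> H1" "x \<in> bpts X" "ract X x h = x"
    then show "h = \<one>" using cD(3)[OF h(1,2)] cD(1)[OF h(2)] sub(1)[OF h(1)] l_cancel_one by metis
  qed
  moreover have "\<exists>g\<in>carrier G. (\<lambda>h. inv g \<otimes> h \<otimes> g) ` biset_L H1 H2 X x = biset_K H1 H2 X x \<and>
      (\<forall>h\<in>biset_L H1 H2 X x. biset_gamma H1 X x h = inv g \<otimes> h \<otimes> g)" if x: "x \<in> bpts X" for x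
  proof -
    have g: "c x \<in> carrier G" using cD x by blast
    have *: "h1 = inv (c x) \<otimes> h \<otimes> c x" if "h \<in> H2" "h1 \<in> H1" "lact X h x = ract X x h1" for h h1
      using that cD(2,3) x sub g by (metis inv_solve_left m_assoc m_closed inv_closed)
    have "biset_gamma H1 X x h = inv (c x) \<otimes> h \<otimes> c x" if h: "h \<in> biset_L H1 H2 X x" for h
    proof -
      obtain h1 where h1: "h \<in> H2" "h1 \<in> H1" "lact X h x = ract X x h1"
        using h unfolding biset_L_def by blast
      have "biset_gamma H1 X x h = h1" unfolding biset_gamma_def
        using h1 * by (intro the_equality) blast+
      then show ?thesis using *[OF h1] by simp
    qed
    then show ?thesis unfolding biset_K_def using g by (intro bexI[of _ "c x"]) (auto intro!: image_cong)
  qed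
  ultimately show ?thesis using X unfolding conj_biset_def by blast
qed

text \<open>In each double orbit one point y is chosen, with a conjugating element g(y), and the
  mark is extended by c(h2 y h1) = h2 g(y) h1. Two expressions of the same point differ by an
  element of L at y, where the conjugation condition gives equal values.\<close>

lemma mark_of_conj_biset:
  assumes H: "subgroup H1 G" "subgroup H2 G" and conj: "conj_biset G H1 H2 X"
  shows "\<exists>c. biset_mark G H1 H2 X c"
proof -
  interpret h1: subgroup H1 G by fact
  interpret h2: subgroup H2 G by fact
  have fX: "finite_biset G H1 H2 X" and free: "bifree G H1 H2 X" using conj by (auto simp: conj_biset_def)
  note X = finite_bisetD[OF fX]
  define tr where "tr x h2 h1 = ract X (lact X h2 x) h1" for x h2 h1
  define orb where "orb x = {tr x h2 h1 |h2 h1. h2 \<in> H2 \<and> h1 \<in> H1}" for x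
  have tr_closed: "tr x h2 h1 \<in> bpts X" if "x \<in> bpts X" "h2 \<in> H2" "h1 \<in> H1" for x h2 h1
    using that by (simp add: tr_def X)
  have tr_tr: "tr (tr x h2 h1) k2 k1 = tr x (k2 \<otimes> h2) (h1 \<otimes> k1)"
    if "x \<in> bpts X" "h2 \<in> H2" "h1 \<in> H1" "k2 \<in> H2" "k1 \<in> H1" for x h2 h1 k2 k1
    using that by (simp add: tr_def X)
  have tr_one: "tr x \<one> \<one> = x" if "x \<in> bpts X" for x using that by (simp add: tr_def X)
  have orb_tr: "orb (tr x h2 h1) = orb x" if x: "x \<in> bpts X" "h2 \<in> H2" "h1 \<in> H1" for x h2 h1
  proof
    show "orb (tr x h2 h1) \<subseteq> orb x"
    proof
      fix y assume "y \<in> orb (tr x h2 h1)"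
      then obtain k2 k1 where k: "k2 \<in> H2" "k1 \<in> H1" "y = tr (tr x h2 h1) k2 k1" unfolding orb_def by blast
      then have "y = tr x (k2 \<otimes> h2) (h1 \<otimes> k1)" using x by (simp add: tr_tr)
      then show "y \<in> orb x" unfolding orb_def using x k by blast
    qed
    show "orb x \<subseteq> orb (tr x h2 h1)"
    proof
      fix y assume "y \<in> orb x"
      then obtain k2 k1 where k: "k2 \<in> H2" "k1 \<in> H1" "y = tr x k2 k1" unfolding orb_def by blast
      then have "y = tr (tr x h2 h1) (k2 \<otimes> inv h2) (inv h1 \<otimes> k1)"
        using x by (simp add: tr_tr m_assoc mult_inv_cancel)
      then show "y \<in> orb (tr x h2 h1)" unfolding orb_def mem_Collect_eq using x(2,3) k(1,2)
        by (intro exI[of _ "k2 \<otimes> inv h2"] exI[of _ "inv h1 \<otimes> k1"]) simp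
    qed
  qed
  \<comment> \<open>The choice depends only on the set \<open>orb x\<close>, hence it is constant
    along each double orbit.\<close>
  define rep where "rep x = (SOME y. y \<in> orb x)" for x
  have rep: "rep x \<in> orb x" if "x \<in> bpts X" for x
  proof -
    have "x \<in> orb x" unfolding orb_def mem_Collect_eq
      using tr_one[OF that] by (intro exI[of _ \<one>]) simp
    then show ?thesis unfolding rep_def by (rule someI)
  qed
  have rep_pts: "rep x \<in> bpts X" and ex: "\<exists>h2 h1. h2 \<in> H2 \<and> h1 \<in> H1 \<and> x = tr (rep x) h2 h1" if x: "x \<in> bpts X" for x
  proof -
    obtain h2 h1 where h: "h2 \<in> H2" "h1 \<in> H1" "rep x = tr x h2 h1" using rep[OF x] unfolding orb_def by blast
    then show "rep x \<in> bpts X" using x tr_closed by simp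
    have "tr (rep x) (inv h2) (inv h1) = x" using h x by (simp add: tr_tr tr_one)
    then show "\<exists>h2 h1. h2 \<in> H2 \<and> h1 \<in> H1 \<and> x = tr (rep x) h2 h1" using h by (metis h1.m_inv_closed h2.m_inv_closed)
  qed
  have "\<forall>x\<in>bpts X. \<exists>g\<in>carrier G. \<forall>h\<in>biset_L H1 H2 X x. biset_gamma H1 X x h = inv g \<otimes> h \<otimes> g"
    using conj unfolding conj_biset_def by blast
  then obtain g where g: "\<And>x. x \<in> bpts X \<Longrightarrow> g x \<in> carrier G"
    "\<And>x h. x \<in> bpts X \<Longrightarrow> h \<in> biset_L H1 H2 X x \<Longrightarrow> biset_gamma H1 X x h = inv (g x) \<otimes> h \<otimes> g x" by metis
  \<comment> \<open>Freeness of the right action leaves only one candidate for the definite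
    description in \<open>biset_gamma\<close>.\<close>
  have gam: "a = inv (g x) \<otimes> h \<otimes> g x" if x: "x \<in> bpts X" "h \<in> H2" "a \<in> H1" "lact X h x = ract X x a" for x h a
  proof -
    have "b = a" if b: "b \<in> H1" "ract X x b = ract X x a" for b
    proof -
      have "ract X x (b \<otimes> inv a) = ract X (ract X x a) (inv a)" using x b by (simp add: X)
      also have "\<dots> = ract X x (a \<otimes> inv a)" using x h1.m_inv_closed by (intro X(7)[symmetric])
      also have "\<dots> = x" using x by (simp add: X)
      finally have "b \<otimes> inv a = \<one>" using free x b unfolding bifree_def by auto
      then show ?thesis using b x by (metis h1.mem_carrier inv_closed inv_equality inv_inv)
    qed
    then have "biset_gamma H1 X x h = a" unfolding biset_gamma_def using x by (intro the_equality) auto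
    moreover have "h \<in> biset_L H1 H2 X x" using x unfolding biset_L_def by blast
    ultimately show ?thesis using g(2) x by metis
  qed
  \<comment> \<open>The extension is well defined: from \<open>h2 x h1 = k2 x k1\<close> one gets
    that \<open>inv k2 h2\<close> lies in L at x, with image \<open>k1 inv h1\<close>.\<close>
  have key: "h2 \<otimes> g x \<otimes> h1 = k2 \<otimes> g x \<otimes> k1"
    if x: "x \<in> bpts X" "h2 \<in> H2" "h1 \<in> H1" "k2 \<in> H2" "k1 \<in> H1" "tr x h2 h1 = tr x k2 k1" for x h2 h1 k2 k1
  proof -
    have "tr (tr x h2 h1) (inv k2) (inv h1) = tr (tr x k2 k1) (inv k2) (inv h1)" using x(6) by simp
    then have "tr x (inv k2 \<otimes> h2) \<one> = tr x \<one> (k1 \<otimes> inv h1)" using x(1-5) by (simp add: tr_tr)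
    then have "lact X (inv k2 \<otimes> h2) x = ract X x (k1 \<otimes> inv h1)"
      using x(1-5) unfolding tr_def by (metis X(2,3,6) h2.m_closed h2.m_inv_closed)
    then have "k1 \<otimes> inv h1 = inv (g x) \<otimes> (inv k2 \<otimes> h2) \<otimes> g x" using x gam by simp
    then have "k2 \<otimes> g x \<otimes> (k1 \<otimes> inv h1) \<otimes> h1 = k2 \<otimes> g x \<otimes> (inv (g x) \<otimes> (inv k2 \<otimes> h2) \<otimes> g x) \<otimes> h1" by simp
    moreover have "k2 \<otimes> g x \<otimes> (inv (g x) \<otimes> (inv k2 \<otimes> h2) \<otimes> g x) \<otimes> h1 = h2 \<otimes> g x \<otimes> h1"
      using x(1-5) g(1) by (simp add: m_assoc mult_inv_cancel)
    moreover have "k2 \<otimes> g x \<otimes> (k1 \<otimes> inv h1) \<otimes> h1 = k2 \<otimes> g x \<otimes> k1"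
      using x(1-5) g(1) by (simp add: m_assoc)
    ultimately show ?thesis by simp
  qed
  from ex obtain p q where pq: "\<And>x. x \<in> bpts X \<Longrightarrow> p x \<in> H2" "\<And>x. x \<in> bpts X \<Longrightarrow> q x \<in> H1"
    "\<And>x. x \<in> bpts X \<Longrightarrow> x = tr (rep x) (p x) (q x)" by metis
  define c where "c x = p x \<otimes> g (rep x) \<otimes> q x" for x
  have c_tr: "c (tr x h2 h1) = h2 \<otimes> c x \<otimes> h1" if x: "x \<in> bpts X" "h2 \<in> H2" "h1 \<in> H1" for x h2 h1
  proof -
    let ?y = "tr x h2 h1"
    have y: "?y \<in> bpts X" using x by (rule tr_closed)
    have rep_eq: "rep ?y = rep x" unfolding rep_def orb_tr[OF x] ..
    have "tr (rep x) (p ?y) (q ?y) = tr (rep x) (h2 \<otimes> p x) (q x \<otimes> h1)"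
      using pq(3)[OF y] pq(3)[OF x(1)] tr_tr[OF rep_pts[OF x(1)] pq(1,2)[OF x(1)] x(2,3)] rep_eq by metis
    then have "p ?y \<otimes> g (rep x) \<otimes> q ?y = h2 \<otimes> p x \<otimes> g (rep x) \<otimes> (q x \<otimes> h1)"
      using x y pq(1,2) rep_pts by (intro key) auto
    also have "\<dots> = h2 \<otimes> c x \<otimes> h1"
      unfolding c_def using x pq(1,2) rep_pts g(1) by (simp add: m_assoc)
    finally show ?thesis unfolding c_def rep_eq .
  qed
  have cc: "c x \<in> carrier G" if "x \<in> bpts X" for x
    unfolding c_def using that pq rep_pts g by simp
  have "biset_mark G H1 H2 X c"
  proof (rule biset_markI)
    show "c (lact X h x) = h \<otimes> c x" if "h \<in> H2" "x \<in> bpts X" for h x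
      using c_tr[of x h \<one>] that cc by (simp add: tr_def X)
    show "c (ract X x h) = c x \<otimes> h" if "h \<in> H1" "x \<in> bpts X" for h x
      using c_tr[of x \<one> h] that cc by (simp add: tr_def X)
  qed (fact cc)
  then show ?thesis by blast
qed

lemma biset_mark_hom:
  "biset_hom H1 H2 X Y f \<Longrightarrow> biset_mark G H1 H2 Y c \<Longrightarrow> biset_mark G H1 H2 X (c \<circ> f)"
  by (rule biset_markI) (simp_all add: biset_homD biset_markD)

lemma conj_bisetD: "conj_biset G H1 H2 X \<Longrightarrow> finite_biset G H1 H2 X"
  by (simp add: conj_biset_def)

text \<open>A mark of \<open>Y\<close> composed with \<open>f\<close> is a mark of \<open>X\<close>;
  the conjugation condition itself would be awkward to transport.\<close>

lemma conj_biset_pullback: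
  assumes H: "subgroup H1 G" "subgroup H2 G" and Y: "conj_biset G H1 H2 Y"
    and X: "finite_biset G H1 H2 X" and f: "biset_hom H1 H2 X Y f"
  shows "conj_biset G H1 H2 X"
proof -
  obtain c where "biset_mark G H1 H2 Y c" using mark_of_conj_biset[OF H Y] by blast
  then have "biset_mark G H1 H2 X (c \<circ> f)" by (rule biset_mark_hom[OF f])
  then show ?thesis by (rule conj_biset_of_mark[OF H X])
qed

text \<open>A class consists of bisets on natural numbers only, so this is what makes the class of a
  biset on any other type nonempty and meaningful.\<close>

lemma conj_biset_nat_copy:
  assumes H: "subgroup H1 G" "subgroup H2 G" and X: "conj_biset G H1 H2 X"
  shows "\<exists>Y :: ('a, nat) biset. conj_biset G H1 H2 Y \<and> biset_iso H1 H2 X Y"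
proof -
  note fX = conj_bisetD[OF X]
  obtain e :: "_ \<Rightarrow> nat" where e: "inj_on e (bpts X)"
    using finite_imp_inj_to_nat_seg[OF finite_bisetD(1)[OF fX]] by blast
  obtain Y :: "('a, nat) biset" where Y: "finite_biset G H1 H2 Y" "bpts Y = e ` bpts X" "biset_hom H1 H2 X Y e"
    using finite_biset_transport[OF fX e] by blast
  have bij: "bij_betw e (bpts X) (bpts Y)" using e Y(2) by (simp add: bij_betw_def)
  then have "biset_hom H1 H2 Y X (inv_into (bpts X) e)" using fX Y(3) by (intro biset_hom_inv_into)
  then have "conj_biset G H1 H2 Y" by (rule conj_biset_pullback[OF H X Y(1)])
  moreover have "biset_iso H1 H2 X Y" using bij Y(3) unfolding biset_iso_hom by blast
  ultimately show ?thesis by blast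
qed

section \<open>Isomorphism classes and their monoid\<close>

lemma biset_cls_eqI:
  assumes "finite_biset G H1 H2 X" "biset_iso H1 H2 X X'"
  shows "biset_cls G H1 H2 X = biset_cls G H1 H2 X'"
  unfolding biset_cls_def
  using biset_iso_trans[OF assms(2)] biset_iso_trans[OF biset_iso_sym[OF assms]] by blast

lemma biset_clsD:
  "Y \<in> biset_cls G H1 H2 X \<Longrightarrow> conj_biset G H1 H2 Y" "Y \<in> biset_cls G H1 H2 X \<Longrightarrow> biset_iso H1 H2 X Y"
  by (simp_all add: biset_cls_def)

lemma biset_cls_nonempty:
  "subgroup H1 G \<Longrightarrow> subgroup H2 G \<Longrightarrow> conj_biset G H1 H2 X \<Longrightarrow> biset_cls G H1 H2 X \<noteq> {}"
  unfolding biset_cls_def using conj_biset_nat_copy by blast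

lemma biset_cls_eqD:
  assumes H: "subgroup H1 G" "subgroup H2 G" and X: "conj_biset G H1 H2 X" and X': "conj_biset G H1 H2 X'"
    and eq: "biset_cls G H1 H2 X = biset_cls G H1 H2 X'"
  shows "biset_iso H1 H2 X X'"
proof -
  obtain Y where Y: "Y \<in> biset_cls G H1 H2 X" using biset_cls_nonempty[OF H X] by blast
  then have "biset_iso H1 H2 X Y" "biset_iso H1 H2 X' Y" unfolding eq[symmetric] using eq by (auto dest: biset_clsD)
  then show ?thesis using biset_iso_sym[OF conj_bisetD[OF X']] biset_iso_trans by blast
qed

lemma biset_cls_closed:
  assumes H: "subgroup H1 G" "subgroup H2 G" and X: "conj_biset G H1 H2 X"
  shows "biset_cls G H1 H2 X \<in> carrier (conj_biset_monoid G H1 H2)"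
proof -
  obtain Y :: "('a, nat) biset" where Y: "conj_biset G H1 H2 Y" "biset_iso H1 H2 X Y"
    using conj_biset_nat_copy[OF assms] by blast
  have "biset_cls G H1 H2 X = biset_cls G H1 H2 Y" by (rule biset_cls_eqI[OF conj_bisetD[OF X] Y(2)])
  then show ?thesis using Y(1) unfolding conj_biset_monoid_def by auto
qed

lemma conj_biset_monoid_cases:
  assumes "P \<in> carrier (conj_biset_monoid G H1 H2)"
  obtains X :: "('a, nat) biset" where "conj_biset G H1 H2 X" "P = biset_cls G H1 H2 X"
  using assms unfolding conj_biset_monoid_def by auto

lemma conj_biset_sum:
  assumes H: "subgroup H1 G" "subgroup H2 G" and X: "conj_biset G H1 H2 X" and Y: "conj_biset G H1 H2 Y"
  shows "conj_biset G H1 H2 (biset_sum X Y)"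
proof -
  obtain c where c: "biset_mark G H1 H2 X c" using mark_of_conj_biset[OF H X] by blast
  obtain d where d: "biset_mark G H1 H2 Y d" using mark_of_conj_biset[OF H Y] by blast
  have "finite_biset G H1 H2 (biset_sum X Y)"
    unfolding finite_biset_def
    by (auto simp: finite_bisetD[OF conj_bisetD[OF X]] finite_bisetD[OF conj_bisetD[OF Y]])
  moreover have "biset_mark G H1 H2 (biset_sum X Y) (case_sum c d)"
    by (rule biset_markI) (auto simp: biset_markD[OF c] biset_markD[OF d])
  ultimately show ?thesis by (rule conj_biset_of_mark[OF H])
qed

lemma conj_biset_empty:
  assumes H: "subgroup H1 G" "subgroup H2 G"
  shows "conj_biset G H1 H2 biset_empty"
proof -
  have "finite_biset G H1 H2 biset_empty" by (simp add: finite_biset_def biset_empty_def)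
  moreover have "biset_mark G H1 H2 biset_empty undefined"
    by (rule biset_markI) (simp_all add: biset_empty_def)
  ultimately show ?thesis by (rule conj_biset_of_mark[OF H])
qed

lemma conj_biset_restr:
  assumes H: "subgroup H1 G" "subgroup H2 G" and X: "conj_biset G H1 H2 X"
    and A: "\<And>h x. h \<in> H2 \<Longrightarrow> x \<in> bpts X \<Longrightarrow> A x \<Longrightarrow> A (lact X h x)"
      "\<And>h x. h \<in> H1 \<Longrightarrow> x \<in> bpts X \<Longrightarrow> A x \<Longrightarrow> A (ract X x h)"
  shows "conj_biset G H1 H2 (biset_restr X A)"
proof (rule conj_biset_pullback[OF H X])
  show "finite_biset G H1 H2 (biset_restr X A)"
    unfolding finite_biset_def using finite_bisetD[OF conj_bisetD[OF X]] A by simp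
  show "biset_hom H1 H2 (biset_restr X A) X (\<lambda>x. x)" by (rule biset_homI) simp_all
qed

lemma biset_cls_mult:
  assumes H: "subgroup H1 G" "subgroup H2 G" and X: "conj_biset G H1 H2 X" and Y: "conj_biset G H1 H2 Y"
  shows "biset_cls G H1 H2 X \<otimes>\<^bsub>conj_biset_monoid G H1 H2\<^esub> biset_cls G H1 H2 Y = biset_cls G H1 H2 (biset_sum X Y)"
  unfolding conj_biset_monoid_def monoid.select_convs
proof (rule UN_UN_const)
  fix X' Y' assume "X' \<in> biset_cls G H1 H2 X" "Y' \<in> biset_cls G H1 H2 Y"
  then have "biset_iso H1 H2 (biset_sum X Y) (biset_sum X' Y')"
    by (intro biset_iso_sum biset_clsD)
  then show "biset_cls G H1 H2 (biset_sum X' Y') = biset_cls G H1 H2 (biset_sum X Y)"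
    by (rule biset_cls_eqI[OF conj_bisetD[OF conj_biset_sum[OF assms]], symmetric])
qed (intro biset_cls_nonempty assms)+

lemma one_conj_biset_monoid:
  "\<one>\<^bsub>conj_biset_monoid G H1 H2\<^esub> = biset_cls G H1 H2 (biset_empty :: ('a, nat) biset)"
  by (simp add: conj_biset_monoid_def)

lemma biset_cls_empty:
  assumes H: "subgroup H1 G" "subgroup H2 G" and X: "finite_biset G H1 H2 X" "bpts X = {}"
  shows "biset_cls G H1 H2 X = \<one>\<^bsub>conj_biset_monoid G H1 H2\<^esub>"
  unfolding one_conj_biset_monoid by (rule biset_cls_eqI[OF X(1) biset_iso_empty[OF X(2)]])

lemma groth_monoid_conj_biset:
  assumes H: "subgroup H1 G" "subgroup H2 G"
  shows "groth_monoid (conj_biset_monoid G H1 H2)"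
proof -
  let ?M = "conj_biset_monoid G H1 H2"
  note [simp] = conj_bisetD conj_biset_sum[OF H] conj_biset_empty[OF H] biset_cls_mult[OF H]
  note cls = biset_cls_closed[OF H]
  have "comm_monoid ?M"
  proof (rule comm_monoidI)
    fix P Q R assume P: "P \<in> carrier ?M" and Q: "Q \<in> carrier ?M" and R: "R \<in> carrier ?M"
    obtain X :: "('a, nat) biset" where X: "conj_biset G H1 H2 X" "P = biset_cls G H1 H2 X"
      using P by (rule conj_biset_monoid_cases)
    obtain Y :: "('a, nat) biset" where Y: "conj_biset G H1 H2 Y" "Q = biset_cls G H1 H2 Y"
      using Q by (rule conj_biset_monoid_cases)
    obtain Z :: "('a, nat) biset" where Z: "conj_biset G H1 H2 Z" "R = biset_cls G H1 H2 Z"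
      using R by (rule conj_biset_monoid_cases)
    show "P \<otimes>\<^bsub>?M\<^esub> Q \<otimes>\<^bsub>?M\<^esub> R = P \<otimes>\<^bsub>?M\<^esub> (Q \<otimes>\<^bsub>?M\<^esub> R)"
      unfolding X Y Z using X(1) Y(1) Z(1) by (simp add: biset_cls_eqI[OF _ biset_iso_sum_assoc])
  next
    fix P Q assume P: "P \<in> carrier ?M" and Q: "Q \<in> carrier ?M"
    obtain X :: "('a, nat) biset" where X: "conj_biset G H1 H2 X" "P = biset_cls G H1 H2 X"
      using P by (rule conj_biset_monoid_cases)
    obtain Y :: "('a, nat) biset" where Y: "conj_biset G H1 H2 Y" "Q = biset_cls G H1 H2 Y"
      using Q by (rule conj_biset_monoid_cases)
    show "P \<otimes>\<^bsub>?M\<^esub> Q \<in> carrier ?M" unfolding X Y using X(1) Y(1) by (simp add: cls)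
    have "biset_cls G H1 H2 (biset_sum X Y) = biset_cls G H1 H2 (biset_sum Y X)"
      using X(1) Y(1) by (intro biset_cls_eqI[OF _ biset_iso_sum_comm]) simp
    then show "P \<otimes>\<^bsub>?M\<^esub> Q = Q \<otimes>\<^bsub>?M\<^esub> P" unfolding X Y using X(1) Y(1) by simp
  next
    show "\<one>\<^bsub>?M\<^esub> \<in> carrier ?M" by (simp add: one_conj_biset_monoid cls)
  next
    fix P assume P: "P \<in> carrier ?M"
    obtain X :: "('a, nat) biset" where X: "conj_biset G H1 H2 X" "P = biset_cls G H1 H2 X"
      using P by (rule conj_biset_monoid_cases)
    show "\<one>\<^bsub>?M\<^esub> \<otimes>\<^bsub>?M\<^esub> P = P"
      unfolding X one_conj_biset_monoid using X(1) by (simp add: biset_cls_eqI[OF _ biset_iso_sum_empty])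
  qed
  then show ?thesis by (rule groth_monoid.intro)
qed

text \<open>It will be applied with \<open>d\<close> the index of the orbit in the middle foot of a
  composite span: the sum over the middle index in a matrix product is then one single
  biset.\<close>

lemma biset_cls_partition:
  assumes H: "subgroup H1 G" "subgroup H2 G" and X: "conj_biset G H1 H2 X"
    and d: "\<And>h x. h \<in> H2 \<Longrightarrow> x \<in> bpts X \<Longrightarrow> d (lact X h x) = d x"
      "\<And>h x. h \<in> H1 \<Longrightarrow> x \<in> bpts X \<Longrightarrow> d (ract X x h) = d x"
    and n: "\<And>x. x \<in> bpts X \<Longrightarrow> d x < (n::nat)"
  shows "biset_cls G H1 H2 X =
    finprod (conj_biset_monoid G H1 H2) (\<lambda>a. biset_cls G H1 H2 (biset_restr X (\<lambda>x. d x = a))) {..<n}"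
proof -
  let ?M = "conj_biset_monoid G H1 H2"
  interpret M: groth_monoid ?M by (rule groth_monoid_conj_biset[OF H])
  have r: "conj_biset G H1 H2 (biset_restr X (\<lambda>x. A (d x)))" for A
    using d by (intro conj_biset_restr[OF H X]) simp_all
  have "biset_cls G H1 H2 (biset_restr X (\<lambda>x. d x < m)) =
      finprod ?M (\<lambda>a. biset_cls G H1 H2 (biset_restr X (\<lambda>x. d x = a))) {..<m}" for m
  proof (induction m)
    case 0
    show ?case using r[of "\<lambda>i. False"] by (simp add: biset_cls_empty[OF H] conj_bisetD)
  next
    case (Suc m)
    have "biset_restr X (\<lambda>x. d x < Suc m) = biset_restr X (\<lambda>x. d x = m \<or> d x < m)"
      by (simp add: less_Suc_eq disj_commute)
    then have "biset_cls G H1 H2 (biset_restr X (\<lambda>x. d x < Suc m)) =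
        biset_cls G H1 H2 (biset_sum (biset_restr X (\<lambda>x. d x = m)) (biset_restr X (\<lambda>x. d x < m)))"
      using biset_cls_eqI[OF conj_bisetD[OF conj_biset_sum[OF H r[of "\<lambda>i. i = m"] r[of "\<lambda>i. i < m"]]] biset_iso_sum_restr]
      by simp
    also have "\<dots> = biset_cls G H1 H2 (biset_restr X (\<lambda>x. d x = m)) \<otimes>\<^bsub>?M\<^esub>
        finprod ?M (\<lambda>a. biset_cls G H1 H2 (biset_restr X (\<lambda>x. d x = a))) {..<m}"
      unfolding Suc[symmetric] by (rule biset_cls_mult[OF H r r, symmetric])
    also have "\<dots> = finprod ?M (\<lambda>a. biset_cls G H1 H2 (biset_restr X (\<lambda>x. d x = a))) {..<Suc m}"
      unfolding lessThan_Suc using biset_cls_closed[OF H r] by (intro M.finprod_insert[symmetric]) auto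
    finally show ?case .
  qed
  moreover have "biset_restr X (\<lambda>x. d x < n) = X"
    using n by (simp add: biset_restr_def set_eq_iff conj_commute cong: conj_cong)
  ultimately show ?thesis by metis
qed

end

subsection \<open>Balanced products\<close>

locale balanced = group G for G (structure) +
  fixes H1 H2 H3 and X :: "('a, 'x) biset" and Y :: "('a, 'y) biset"
  assumes H: "subgroup H1 G" "subgroup H2 G" "subgroup H3 G"
    and X: "finite_biset G H2 H3 X" and Y: "finite_biset G H1 H2 Y"
begin

abbreviation "brel \<equiv> balanced_rel H2 X Y"

lemma brel_iff: "(p, (x, y)) \<in> brel \<longleftrightarrow>
    x \<in> bpts X \<and> (\<exists>h\<in>H2. \<exists>y'\<in>bpts Y. p = (ract X x h, y') \<and> y = lact Y h y')"
  unfolding balanced_rel_def by auto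

text \<open>A class is one orbit of \<open>H2\<close> under
  \<open>h . (x, y) = (x inv h, h y)\<close>. In this form image actions and functions on classes
  can be computed elementwise.\<close>

lemma brel_class:
  assumes x: "x \<in> bpts X" and y: "y \<in> bpts Y"
  shows "brel `` {(x, y)} = (\<lambda>h. (ract X x (inv h), lact Y h y)) ` H2"
proof -
  interpret H2: subgroup H2 G by (rule H(2))
  note D = finite_bisetD[OF X] finite_bisetD[OF Y]
  show ?thesis
  proof (intro equalityI subsetI)
    fix p assume "p \<in> brel `` {(x, y)}"
    then obtain u h where p: "p = (u, lact Y h y)" "u \<in> bpts X" "h \<in> H2" "x = ract X u h"
      unfolding balanced_rel_def by blast
    have "ract X x (inv h) = u" using p by (simp flip: D(7) add: D(6))
    then show "p \<in> (\<lambda>h. (ract X x (inv h), lact Y h y)) ` H2" using p by blast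
  next
    fix p assume "p \<in> (\<lambda>h. (ract X x (inv h), lact Y h y)) ` H2"
    then obtain h where h: "h \<in> H2" "p = (ract X x (inv h), lact Y h y)" by blast
    have "ract X (ract X x (inv h)) h = x" using h(1) x by (simp flip: D(7) add: D(6))
    then have "((x, y), p) \<in> brel" unfolding h(2) brel_iff
      using h(1) x y D(5) by (intro conjI bexI[of _ h] bexI[of _ y]) simp_all
    then show "p \<in> brel `` {(x, y)}" by blast
  qed
qed

text \<open>One step of the identification already gives an equivalence: the unit, inverses and
  products of \<open>H2\<close> provide reflexivity, symmetry and transitivity.\<close>

lemma brel_equiv: "equiv (bpts X \<times> bpts Y) brel"
proof (rule equivI)
  interpret H2: subgroup H2 G by (rule H(2))
  note D = finite_bisetD[OF X] finite_bisetD[OF Y]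
  show "brel \<subseteq> (bpts X \<times> bpts Y) \<times> (bpts X \<times> bpts Y)"
    unfolding balanced_rel_def using D by auto
  show "refl_on (bpts X \<times> bpts Y) brel"
  proof (rule refl_onI, clarify)
    fix x y assume "x \<in> bpts X" "y \<in> bpts Y"
    then show "((x, y), (x, y)) \<in> brel"
      unfolding brel_iff by (intro conjI bexI[of _ \<one>] bexI[of _ y]) (simp_all add: D)
  qed
  show "sym brel"
  proof (rule symI, clarify)
    fix x y u v assume "((x, y), (u, v)) \<in> brel"
    then obtain h where h: "u \<in> bpts X" "h \<in> H2" "y \<in> bpts Y" "x = ract X u h" "v = lact Y h y"
      unfolding brel_iff by blast
    have "u = ract X x (inv h)" unfolding h(4) using h by (simp flip: D(7) add: D(6))
    moreover have "y = lact Y (inv h) v" unfolding h(5) using h by (simp flip: D(12) add: D(11))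
    ultimately show "((u, v), (x, y)) \<in> brel" unfolding brel_iff
      using h D(5,10) by (intro conjI bexI[of _ "inv h"] bexI[of _ v]) simp_all
  qed
  show "trans brel"
  proof (rule transI, clarify)
    fix a b x y u v assume "((a, b), (x, y)) \<in> brel" "((x, y), (u, v)) \<in> brel"
    then obtain h k where h: "x \<in> bpts X" "h \<in> H2" "b \<in> bpts Y" "a = ract X x h" "y = lact Y h b"
      and k: "u \<in> bpts X" "k \<in> H2" "y \<in> bpts Y" "x = ract X u k" "v = lact Y k y"
      unfolding brel_iff by blast
    have "a = ract X u (k \<otimes> h)" "v = lact Y (k \<otimes> h) b" using h k by (simp_all add: D)
    then show "((a, b), (u, v)) \<in> brel" unfolding brel_iff
      using h k by (intro conjI bexI[of _ "k \<otimes> h"] bexI[of _ b]) simp_all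
  qed
qed

abbreviation "bal \<equiv> balanced_product H2 X Y"

lemma bal_cases:
  assumes "P \<in> bpts bal"
  obtains x y where "x \<in> bpts X" "y \<in> bpts Y" "P = brel `` {(x, y)}"
  using assms unfolding balanced_product_def by (auto elim!: quotientE)

lemma bal_mem: "x \<in> bpts X \<Longrightarrow> y \<in> bpts Y \<Longrightarrow> brel `` {(x, y)} \<in> bpts bal"
  unfolding balanced_product_def by (auto intro!: quotientI)

lemma bal_eq_iff:
  assumes "x \<in> bpts X" "y \<in> bpts Y" "x' \<in> bpts X" "y' \<in> bpts Y"
  shows "brel `` {(x, y)} = brel `` {(x', y')} \<longleftrightarrow> (\<exists>h\<in>H2. x = ract X x' h \<and> y' = lact Y h y)"
proof -
  have "brel `` {(x, y)} = brel `` {(x', y')} \<longleftrightarrow> ((x, y), (x', y')) \<in> brel"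
    using assms by (intro eq_equiv_class_iff[OF brel_equiv]) auto
  then show ?thesis unfolding brel_iff using assms by auto
qed

lemma bal_move:
  assumes "x \<in> bpts X" "y \<in> bpts Y" "h \<in> H2"
  shows "brel `` {(ract X x h, y)} = brel `` {(x, lact Y h y)}"
  using assms finite_bisetD[OF X] finite_bisetD[OF Y] by (subst bal_eq_iff) auto

lemma lact_bal:
  assumes "x \<in> bpts X" "y \<in> bpts Y" "k \<in> H3"
  shows "lact bal k (brel `` {(x, y)}) = brel `` {(lact X k x, y)}"
proof -
  interpret H2: subgroup H2 G by (rule H(2))
  have "lact X k x \<in> bpts X" using assms finite_bisetD[OF X] by simp
  then show ?thesis
    unfolding balanced_product_def biset.select_convs
    using assms finite_bisetD(8)[OF X] by (simp add: brel_class image_image cong: image_cong)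
qed

lemma ract_bal:
  assumes "x \<in> bpts X" "y \<in> bpts Y" "k \<in> H1"
  shows "ract bal (brel `` {(x, y)}) k = brel `` {(x, ract Y y k)}"
proof -
  have "ract Y y k \<in> bpts Y" using assms finite_bisetD[OF Y] by simp
  then show ?thesis
    unfolding balanced_product_def biset.select_convs
    using assms finite_bisetD(8)[OF Y] by (simp add: brel_class image_image cong: image_cong)
qed

lemma finite_bal: "finite_biset G H1 H3 bal"
proof -
  note D = finite_bisetD[OF X] finite_bisetD[OF Y]
  have "brel \<subseteq> (bpts X \<times> bpts Y) \<times> (bpts X \<times> bpts Y)"
    by (rule equiv_type[OF brel_equiv])
  then have "finite (bpts bal)"
    unfolding balanced_product_def biset.select_convs using D(1,9) by (intro finite_quotient) simp_all
  moreover have "lact bal h P \<in> bpts bal" "h' \<in> H3 \<Longrightarrow> lact bal (h \<otimes> h') P = lact bal h (lact bal h' P)"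
    if "P \<in> bpts bal" "h \<in> H3" for P h h'
    using that subgroup.m_closed[OF H(3)] by (auto elim!: bal_cases simp: lact_bal bal_mem D)
  moreover have "ract bal P h \<in> bpts bal" "h' \<in> H1 \<Longrightarrow> ract bal P (h \<otimes> h') = ract bal (ract bal P h) h'"
    if "P \<in> bpts bal" "h \<in> H1" for P h h'
    using that subgroup.m_closed[OF H(1)] by (auto elim!: bal_cases simp: ract_bal bal_mem D)
  moreover have "lact bal \<one> P = P" "ract bal P \<one> = P" if "P \<in> bpts bal" for P
    using that subgroup.one_closed[OF H(3)] subgroup.one_closed[OF H(1)]
    by (auto elim!: bal_cases simp: lact_bal ract_bal D)
  moreover have "ract bal (lact bal h P) k = lact bal h (ract bal P k)" if "P \<in> bpts bal" "h \<in> H3" "k \<in> H1" for P h k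
    using that by (auto elim!: bal_cases simp: ract_bal lact_bal D)
  ultimately show ?thesis unfolding finite_biset_def by simp
qed

text \<open>The form in which maps out of a balanced product are constructed: \<open>f\<close> is
  given on pairs, is constant on classes by \<open>bal\<close>, and has exactly the classes as
  fibres by \<open>inj\<close>.\<close>

lemma bal_isoI:
  assumes f: "\<And>x y. x \<in> bpts X \<Longrightarrow> y \<in> bpts Y \<Longrightarrow> f x y \<in> bpts Z"
    and surj: "\<And>z. z \<in> bpts Z \<Longrightarrow> \<exists>x\<in>bpts X. \<exists>y\<in>bpts Y. z = f x y"
    and bal: "\<And>x y h. x \<in> bpts X \<Longrightarrow> y \<in> bpts Y \<Longrightarrow> h \<in> H2 \<Longrightarrow> f (ract X x h) y = f x (lact Y h y)"
    and inj: "\<And>x y x' y'. x \<in> bpts X \<Longrightarrow> y \<in> bpts Y \<Longrightarrow> x' \<in> bpts X \<Longrightarrow> y' \<in> bpts Y \<Longrightarrow> f x y = f x' y' \<Longrightarrow>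
       \<exists>h\<in>H2. x = ract X x' h \<and> y' = lact Y h y"
    and l: "\<And>x y k. x \<in> bpts X \<Longrightarrow> y \<in> bpts Y \<Longrightarrow> k \<in> H3 \<Longrightarrow> f (lact X k x) y = lact Z k (f x y)"
    and r: "\<And>x y k. x \<in> bpts X \<Longrightarrow> y \<in> bpts Y \<Longrightarrow> k \<in> H1 \<Longrightarrow> f x (ract Y y k) = ract Z (f x y) k"
  shows "biset_iso H1 H3 bal Z"
proof -
  note D = finite_bisetD[OF X] finite_bisetD[OF Y]
  interpret H2: subgroup H2 G by (rule H(2))
  \<comment> \<open>The image of a class under \<open>f\<close> is a singleton, whose element is the
    value of the induced map.\<close>
  define F where "F P = the_elem ((\<lambda>(x, y). f x y) ` P)" for P
  have F: "F (brel `` {(x, y)}) = f x y" if xy: "x \<in> bpts X" "y \<in> bpts Y" for x y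
  proof -
    have "f (ract X x (inv h)) (lact Y h y) = f x y" if "h \<in> H2" for h
      using bal[of "ract X x (inv h)" y h, symmetric] that xy by (simp flip: D(7) add: D(5,6))
    moreover have ne: "H2 \<noteq> {}" using H2.one_closed by blast
    ultimately have "(\<lambda>(x, y). f x y) ` (brel `` {(x, y)}) = {f x y}"
      unfolding brel_class[OF xy] image_image using ne
      by (auto simp: image_constant_conv cong: image_cong)
    then show ?thesis by (simp add: F_def)
  qed
  show ?thesis
  proof (rule biset_isoI)
    show "inj_on F (bpts bal)"
    proof (rule inj_onI)
      fix P Q assume P: "P \<in> bpts bal" and Q: "Q \<in> bpts bal" and eq: "F P = F Q"
      obtain x y where x: "x \<in> bpts X" "y \<in> bpts Y" "P = brel `` {(x, y)}" using P by (rule bal_cases)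
      obtain x' y' where x': "x' \<in> bpts X" "y' \<in> bpts Y" "Q = brel `` {(x', y')}" using Q by (rule bal_cases)
      have "f x y = f x' y'" using eq x x' F by simp
      then show "P = Q" unfolding x(3) x'(3) using inj x x' by (subst bal_eq_iff) blast+
    qed
    show "bpts Z \<subseteq> F ` bpts bal"
    proof
      fix z assume "z \<in> bpts Z"
      then obtain x y where "x \<in> bpts X" "y \<in> bpts Y" "z = f x y" using surj by blast
      then have "z = F (brel `` {(x, y)})" "brel `` {(x, y)} \<in> bpts bal" using F bal_mem by simp_all
      then show "z \<in> F ` bpts bal" by blast
    qed
    show "biset_hom H1 H3 bal Z F"
      by (rule biset_homI) (auto elim!: bal_cases simp: F f l r lact_bal ract_bal D)
  qed
qed

text \<open>Multiply the marks: c(x h) d(y) = c(x) h d(y) = c(x) d(h y), so the product is constant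
  on classes and is a mark of the balanced product.\<close>

lemma conj_bal:
  assumes "conj_biset G H2 H3 X" "conj_biset G H1 H2 Y"
  shows "conj_biset G H1 H3 bal"
proof -
  note D = finite_bisetD[OF X] finite_bisetD[OF Y]
  interpret H1: subgroup H1 G by (rule H(1))
  interpret H2: subgroup H2 G by (rule H(2))
  interpret H3: subgroup H3 G by (rule H(3))
  obtain c where c: "biset_mark G H2 H3 X c" using mark_of_conj_biset[OF H(2,3) assms(1)] by blast
  obtain d where d: "biset_mark G H1 H2 Y d" using mark_of_conj_biset[OF H(1,2) assms(2)] by blast
  note M = biset_markD[OF c] biset_markD[OF d]
  define F where "F P = the_elem ((\<lambda>(x, y). c x \<otimes> d y) ` P)" for P
  have F: "F (brel `` {(x, y)}) = c x \<otimes> d y" if xy: "x \<in> bpts X" "y \<in> bpts Y" for x y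
  proof -
    have "c (ract X x (inv h)) \<otimes> d (lact Y h y) = c x \<otimes> d y" if "h \<in> H2" for h
      using that xy by (simp add: M m_assoc mult_inv_cancel)
    moreover have ne: "H2 \<noteq> {}" using H2.one_closed by blast
    ultimately have "(\<lambda>(x, y). c x \<otimes> d y) ` (brel `` {(x, y)}) = {c x \<otimes> d y}"
      unfolding brel_class[OF xy] image_image using ne
      by (auto simp: image_constant_conv cong: image_cong)
    then show ?thesis by (simp add: F_def)
  qed
  have "biset_mark G H1 H3 bal F"
    by (rule biset_markI) (auto elim!: bal_cases simp: F lact_bal ract_bal D M m_assoc)
  then show ?thesis by (rule conj_biset_of_mark[OF H(1,3) finite_bal])
qed

end

context group
begin

lemma balanced_iso:
  assumes H: "subgroup H1 G" "subgroup H2 G" "subgroup H3 G"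
    and X: "finite_biset G H2 H3 X" "finite_biset G H2 H3 X'" and Y: "finite_biset G H1 H2 Y" "finite_biset G H1 H2 Y'"
    and iso: "biset_iso H2 H3 X X'" "biset_iso H1 H2 Y Y'"
  shows "biset_iso H1 H3 (balanced_product H2 X Y) (balanced_product H2 X' Y')"
proof -
  interpret b: balanced G H1 H2 H3 X Y by (intro balanced.intro balanced_axioms.intro is_group) fact+
  interpret b': balanced G H1 H2 H3 X' Y' by (intro balanced.intro balanced_axioms.intro is_group) fact+
  obtain f where f: "bij_betw f (bpts X) (bpts X')" "biset_hom H2 H3 X X' f" using iso(1) by (rule biset_isoE)
  obtain g where g: "bij_betw g (bpts Y) (bpts Y')" "biset_hom H1 H2 Y Y' g" using iso(2) by (rule biset_isoE)
  note D = finite_bisetD[OF X(1)] finite_bisetD[OF Y(1)] biset_homD[OF f(2)] biset_homD[OF g(2)]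
  show ?thesis
  proof (rule b.bal_isoI)
    let ?F = "\<lambda>x y. b'.brel `` {(f x, g y)}"
    show "\<exists>x\<in>bpts X. \<exists>y\<in>bpts Y. z = ?F x y" if zb: "z \<in> bpts b'.bal" for z
    proof -
      obtain x y where z: "x \<in> bpts X'" "y \<in> bpts Y'" "z = b'.brel `` {(x, y)}" using zb by (rule b'.bal_cases)
      have "x \<in> f ` bpts X" "y \<in> g ` bpts Y" using z f(1) g(1) by (simp_all add: bij_betw_def)
      then show ?thesis using z(3) by blast
    qed
    show "?F (ract X x h) y = ?F x (lact Y h y)" if "x \<in> bpts X" "y \<in> bpts Y" "h \<in> H2" for x y h
      using that by (subst b'.bal_eq_iff) (auto simp: D finite_bisetD[OF X(2)] finite_bisetD[OF Y(2)])
    show "\<exists>h\<in>H2. x = ract X x' h \<and> y' = lact Y h y"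
      if xy: "x \<in> bpts X" "y \<in> bpts Y" "x' \<in> bpts X" "y' \<in> bpts Y" "?F x y = ?F x' y'" for x y x' y'
    proof -
      obtain h where h: "h \<in> H2" "f x = ract X' (f x') h" "g y' = lact Y' h (g y)"
        using xy by (subst (asm) b'.bal_eq_iff) (auto simp: D)
      then have "f x = f (ract X x' h)" "g y' = g (lact Y h y)" using xy by (simp_all add: D)
      then have "x = ract X x' h" "y' = lact Y h y"
        using f(1) g(1) xy h(1) D(2,5,10,13) unfolding bij_betw_def by (meson inj_onD)+
      then show ?thesis using h(1) by blast
    qed
  qed (simp_all add: b'.bal_mem b'.lact_bal b'.ract_bal D)
qed

lemma balanced_sum_left:
  assumes H: "subgroup H1 G" "subgroup H2 G" "subgroup H3 G"
    and X: "finite_biset G H2 H3 X" "finite_biset G H2 H3 X'" "finite_biset G H2 H3 (biset_sum X X')"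
    and Y: "finite_biset G H1 H2 Y"
  shows "biset_iso H1 H3 (balanced_product H2 (biset_sum X X') Y)
    (biset_sum (balanced_product H2 X Y) (balanced_product H2 X' Y))"
proof -
  interpret s: balanced G H1 H2 H3 "biset_sum X X'" Y by (intro balanced.intro balanced_axioms.intro is_group) fact+
  interpret b: balanced G H1 H2 H3 X Y by (intro balanced.intro balanced_axioms.intro is_group) fact+
  interpret b': balanced G H1 H2 H3 X' Y by (intro balanced.intro balanced_axioms.intro is_group) fact+
  note D = finite_bisetD[OF X(1)] finite_bisetD[OF X(2)] finite_bisetD[OF Y]
  show ?thesis
  proof (rule s.bal_isoI)
    let ?f = "\<lambda>x y. case x of Inl u \<Rightarrow> Inl (b.brel `` {(u, y)}) | Inr u \<Rightarrow> Inr (b'.brel `` {(u, y)})"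
    show "\<exists>x\<in>bpts (biset_sum X X'). \<exists>y\<in>bpts Y. z = ?f x y" if "z \<in> bpts (biset_sum (balanced_product H2 X Y) (balanced_product H2 X' Y))" for z
      using that by (auto elim!: b.bal_cases b'.bal_cases simp: Plus_def bex_Un)
    show "\<exists>h\<in>H2. x = ract (biset_sum X X') x' h \<and> y' = lact Y h y"
      if "x \<in> bpts (biset_sum X X')" "y \<in> bpts Y" "x' \<in> bpts (biset_sum X X')" "y' \<in> bpts Y" "?f x y = ?f x' y'" for x y x' y'
      using that by (auto simp: b.bal_eq_iff b'.bal_eq_iff)
  qed (auto elim!: b.bal_cases b'.bal_cases simp: b.bal_mem b'.bal_mem b.lact_bal b'.lact_bal
      b.ract_bal b'.ract_bal b.bal_move b'.bal_move D)
qed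

lemma balanced_sum_right:
  assumes H: "subgroup H1 G" "subgroup H2 G" "subgroup H3 G"
    and X: "finite_biset G H2 H3 X"
    and Y: "finite_biset G H1 H2 Y" "finite_biset G H1 H2 Y'" "finite_biset G H1 H2 (biset_sum Y Y')"
  shows "biset_iso H1 H3 (balanced_product H2 X (biset_sum Y Y'))
    (biset_sum (balanced_product H2 X Y) (balanced_product H2 X Y'))"
proof -
  interpret s: balanced G H1 H2 H3 X "biset_sum Y Y'" by (intro balanced.intro balanced_axioms.intro is_group) fact+
  interpret b: balanced G H1 H2 H3 X Y by (intro balanced.intro balanced_axioms.intro is_group) fact+
  interpret b': balanced G H1 H2 H3 X Y' by (intro balanced.intro balanced_axioms.intro is_group) fact+
  note D = finite_bisetD[OF X(1)] finite_bisetD[OF Y(1)] finite_bisetD[OF Y(2)]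
  show ?thesis
  proof (rule s.bal_isoI)
    let ?f = "\<lambda>x y. case y of Inl u \<Rightarrow> Inl (b.brel `` {(x, u)}) | Inr u \<Rightarrow> Inr (b'.brel `` {(x, u)})"
    show "\<exists>x\<in>bpts X. \<exists>y\<in>bpts (biset_sum Y Y'). z = ?f x y" if "z \<in> bpts (biset_sum (balanced_product H2 X Y) (balanced_product H2 X Y'))" for z
      using that by (auto elim!: b.bal_cases b'.bal_cases simp: Plus_def bex_Un)
    show "\<exists>h\<in>H2. x = ract X x' h \<and> y' = lact (biset_sum Y Y') h y"
      if "x \<in> bpts X" "y \<in> bpts (biset_sum Y Y')" "x' \<in> bpts X" "y' \<in> bpts (biset_sum Y Y')" "?f x y = ?f x' y'" for x y x' y'
      using that by (auto simp: b.bal_eq_iff b'.bal_eq_iff)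
  qed (auto elim!: b.bal_cases b'.bal_cases simp: b.bal_mem b'.bal_mem b.lact_bal b'.lact_bal
      b.ract_bal b'.ract_bal b.bal_move b'.bal_move D)
qed

lemma balanced_cls_cls:
  assumes H: "subgroup H1 G" "subgroup H2 G" "subgroup H3 G"
    and X: "conj_biset G H2 H3 X" and Y: "conj_biset G H1 H2 Y"
  shows "balanced_cls G H1 H2 H3 (biset_cls G H2 H3 X) (biset_cls G H1 H2 Y) =
    biset_cls G H1 H3 (balanced_product H2 X Y)"
  unfolding balanced_cls_def
proof (rule UN_UN_const)
  interpret b: balanced G H1 H2 H3 X Y by (intro balanced.intro balanced_axioms.intro is_group H conj_bisetD X Y)
  fix X' Y' assume a: "X' \<in> biset_cls G H2 H3 X" "Y' \<in> biset_cls G H1 H2 Y"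
  have "biset_iso H1 H3 (balanced_product H2 X Y) (balanced_product H2 X' Y')"
    using H a X Y by (intro balanced_iso) (auto dest: biset_clsD conj_bisetD)
  then show "biset_cls G H1 H3 (balanced_product H2 X' Y') = biset_cls G H1 H3 (balanced_product H2 X Y)"
    by (rule biset_cls_eqI[OF b.finite_bal, symmetric])
qed (intro biset_cls_nonempty assms)+

lemma conj_balanced:
  assumes H: "subgroup H1 G" "subgroup H2 G" "subgroup H3 G"
    and X: "conj_biset G H2 H3 X" and Y: "conj_biset G H1 H2 Y"
  shows "conj_biset G H1 H3 (balanced_product H2 X Y)"
proof -
  interpret b: balanced G H1 H2 H3 X Y by (intro balanced.intro balanced_axioms.intro is_group H conj_bisetD X Y)
  show ?thesis using X Y by (rule b.conj_bal)
qed

text \<open>Balanced products distribute over disjoint unions on either side. By the previous part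
  the composition of the biset category is therefore biadditive and agrees with balanced products on
  classes of actual bisets.\<close>

lemma biadditive_balanced:
  assumes H: "subgroup H1 G" "subgroup H2 G" "subgroup H3 G"
  shows "biadditive (conj_biset_monoid G H1 H3) (conj_biset_monoid G H2 H3) (conj_biset_monoid G H1 H2)
    (balanced_cls G H1 H2 H3)"
proof (intro biadditive.intro biadditive_axioms.intro groth_monoid_conj_biset H)
  fix P Q assume P: "P \<in> carrier (conj_biset_monoid G H2 H3)" and Q: "Q \<in> carrier (conj_biset_monoid G H1 H2)"
  obtain X :: "('a, nat) biset" where X: "conj_biset G H2 H3 X" "P = biset_cls G H2 H3 X"
    using P by (rule conj_biset_monoid_cases)
  obtain Y :: "('a, nat) biset" where Y: "conj_biset G H1 H2 Y" "Q = biset_cls G H1 H2 Y"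
    using Q by (rule conj_biset_monoid_cases)
  show "balanced_cls G H1 H2 H3 P Q \<in> carrier (conj_biset_monoid G H1 H3)"
    unfolding X Y balanced_cls_cls[OF H X(1) Y(1)] by (intro biset_cls_closed H conj_balanced X Y)
next
  fix P P' Q assume P: "P \<in> carrier (conj_biset_monoid G H2 H3)" "P' \<in> carrier (conj_biset_monoid G H2 H3)"
    and Q: "Q \<in> carrier (conj_biset_monoid G H1 H2)"
  obtain X :: "('a, nat) biset" where X: "conj_biset G H2 H3 X" "P = biset_cls G H2 H3 X"
    using P(1) by (rule conj_biset_monoid_cases)
  obtain X' :: "('a, nat) biset" where X': "conj_biset G H2 H3 X'" "P' = biset_cls G H2 H3 X'"
    using P(2) by (rule conj_biset_monoid_cases)
  obtain Y :: "('a, nat) biset" where Y: "conj_biset G H1 H2 Y" "Q = biset_cls G H1 H2 Y"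
    using Q by (rule conj_biset_monoid_cases)
  note S = conj_biset_sum[OF H(2,3) X(1) X'(1)]
  show "balanced_cls G H1 H2 H3 (P \<otimes>\<^bsub>conj_biset_monoid G H2 H3\<^esub> P') Q =
      balanced_cls G H1 H2 H3 P Q \<otimes>\<^bsub>conj_biset_monoid G H1 H3\<^esub> balanced_cls G H1 H2 H3 P' Q"
    unfolding X(2) X'(2) Y(2) biset_cls_mult[OF H(2,3) X(1) X'(1)]
      balanced_cls_cls[OF H X(1) Y(1)] balanced_cls_cls[OF H X'(1) Y(1)] balanced_cls_cls[OF H S Y(1)]
      biset_cls_mult[OF H(1,3) conj_balanced[OF H X(1) Y(1)] conj_balanced[OF H X'(1) Y(1)]]
    by (intro biset_cls_eqI balanced_sum_left H conj_bisetD conj_balanced X X' Y S)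
next
  fix P Q Q' assume P: "P \<in> carrier (conj_biset_monoid G H2 H3)"
    and Q: "Q \<in> carrier (conj_biset_monoid G H1 H2)" "Q' \<in> carrier (conj_biset_monoid G H1 H2)"
  obtain X :: "('a, nat) biset" where X: "conj_biset G H2 H3 X" "P = biset_cls G H2 H3 X"
    using P by (rule conj_biset_monoid_cases)
  obtain Y :: "('a, nat) biset" where Y: "conj_biset G H1 H2 Y" "Q = biset_cls G H1 H2 Y"
    using Q(1) by (rule conj_biset_monoid_cases)
  obtain Y' :: "('a, nat) biset" where Y': "conj_biset G H1 H2 Y'" "Q' = biset_cls G H1 H2 Y'"
    using Q(2) by (rule conj_biset_monoid_cases)
  note S = conj_biset_sum[OF H(1,2) Y(1) Y'(1)]
  show "balanced_cls G H1 H2 H3 P (Q \<otimes>\<^bsub>conj_biset_monoid G H1 H2\<^esub> Q') =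
      balanced_cls G H1 H2 H3 P Q \<otimes>\<^bsub>conj_biset_monoid G H1 H3\<^esub> balanced_cls G H1 H2 H3 P Q'"
    unfolding X(2) Y(2) Y'(2) biset_cls_mult[OF H(1,2) Y(1) Y'(1)]
      balanced_cls_cls[OF H X(1) Y(1)] balanced_cls_cls[OF H X(1) Y'(1)] balanced_cls_cls[OF H X(1) S]
      biset_cls_mult[OF H(1,3) conj_balanced[OF H X(1) Y(1)] conj_balanced[OF H X(1) Y'(1)]]
    by (intro biset_cls_eqI balanced_sum_right H conj_bisetD conj_balanced X Y' Y S)
qed

end

section \<open>Finite G-sets with base points\<close>

locale fin_group = group G for G (structure) +
  assumes finite_carrier: "finite (carrier G)"
begin

abbreviation "stab S x \<equiv> stabilizer G (gact S) x"

lemma gsetD: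
  assumes "finite_gset G S"
  shows "finite (gpts S)"
    and "g \<in> carrier G \<Longrightarrow> x \<in> gpts S \<Longrightarrow> gact S g x \<in> gpts S"
    and "x \<in> gpts S \<Longrightarrow> gact S \<one> x = x"
    and "g \<in> carrier G \<Longrightarrow> h \<in> carrier G \<Longrightarrow> x \<in> gpts S \<Longrightarrow> gact S (g \<otimes> h) x = gact S g (gact S h x)"
    and "g \<in> carrier G \<Longrightarrow> x \<in> gpts S \<Longrightarrow> gact S (inv g) (gact S g x) = x"
    and "g \<in> carrier G \<Longrightarrow> x \<in> gpts S \<Longrightarrow> gact S g (gact S (inv g) x) = x"
    and "x \<in> gpts S \<Longrightarrow> subgroup (stab S x) G"
proof -
  interpret a: group_action G "gpts S" "gact S" using assms by (simp add: finite_gset_def)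
  show "finite (gpts S)" using assms by (simp add: finite_gset_def)
  show 1: "gact S g x \<in> gpts S" if "g \<in> carrier G" "x \<in> gpts S" for g x
    using a.element_image[OF that] by simp
  show 2: "gact S \<one> x = x" if "x \<in> gpts S" for x
    using fun_cong[OF a.id_eq_one, of x] that by simp
  show 3: "gact S (g \<otimes> h) x = gact S g (gact S h x)"
    if "g \<in> carrier G" "h \<in> carrier G" "x \<in> gpts S" for g h x
    using a.composition_rule[OF that(3,1,2)] .
  show "gact S (inv g) (gact S g x) = x" "gact S g (gact S (inv g) x) = x"
    if "g \<in> carrier G" "x \<in> gpts S" for g x
    using that 3[of "inv g" g x] 3[of g "inv g" x] 2 by simp_all
  show "subgroup (stab S x) G" if "x \<in> gpts S" for x
    using a.stabilizer_subgroup[OF that] .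
qed

lemma stab_iff: "g \<in> stab S x \<longleftrightarrow> g \<in> carrier G \<and> gact S g x = x"
  by (simp add: stabilizer_def)

definition mk_gset :: "'u set \<Rightarrow> ('a \<Rightarrow> 'u \<Rightarrow> 'u) \<Rightarrow> ('a, 'u) gset" where
  "mk_gset E act = \<lparr>gpts = E, gact = (\<lambda>g\<in>carrier G. \<lambda>x\<in>E. act g x)\<rparr>"

lemma mk_gset_simps [simp]:
  "gpts (mk_gset E act) = E"
  "g \<in> carrier G \<Longrightarrow> x \<in> E \<Longrightarrow> gact (mk_gset E act) g x = act g x"
  by (simp_all add: mk_gset_def)

lemma finite_mk_gset:
  assumes "finite E" and cl: "\<And>g x. g \<in> carrier G \<Longrightarrow> x \<in> E \<Longrightarrow> act g x \<in> E"
    and one: "\<And>x. x \<in> E \<Longrightarrow> act \<one> x = x"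
    and mult: "\<And>g h x. g \<in> carrier G \<Longrightarrow> h \<in> carrier G \<Longrightarrow> x \<in> E \<Longrightarrow> act (g \<otimes> h) x = act g (act h x)"
  shows "finite_gset G (mk_gset E act)"
proof -
  have inv: "act (inv g) (act g x) = x" "act g (act (inv g) x) = x" if "g \<in> carrier G" "x \<in> E" for g x
    using that mult[of "inv g" g x] mult[of g "inv g" x] one by simp_all
  have bij: "restrict (act g) E \<in> Bij E" if g: "g \<in> carrier G" for g
  proof -
    have "bij_betw (restrict (act g) E) E E"
      using g cl inv inv_closed[OF g]
      by (intro bij_betwI[of _ _ _ "act (inv g)"]) auto
    then show ?thesis by (simp add: Bij_def)
  qed
  have "group_hom G (BijGroup E) (gact (mk_gset E act))"
  proof (intro group_hom.intro group_hom_axioms.intro homI is_group group_BijGroup)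
    show "gact (mk_gset E act) g \<in> carrier (BijGroup E)" if "g \<in> carrier G" for g
      using bij[OF that] that by (simp add: BijGroup_def mk_gset_def)
    show "gact (mk_gset E act) (g \<otimes> h) = gact (mk_gset E act) g \<otimes>\<^bsub>BijGroup E\<^esub> gact (mk_gset E act) h"
      if "g \<in> carrier G" "h \<in> carrier G" for g h
      using that bij cl mult by (auto simp: BijGroup_def mk_gset_def compose_def)
  qed
  then show ?thesis
    unfolding finite_gset_def group_action_def using assms(1) by (simp add: mk_gset_def)
qed

text \<open>The type of points is infinite whatever its parameters are, because iterated tags on one
  point stay distinct. So it has room for every finite G-set.\<close>

lemma ex_inj_pt:
  assumes "finite E"
  shows "\<exists>e :: 'u \<Rightarrow> ('a, 'p) pt. inj_on e E"
proof -
  obtain f :: "'u \<Rightarrow> nat" where f: "inj_on f E" using finite_imp_inj_to_nat_seg[OF assms] by blast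
  \<comment> \<open>Any starting point that is not itself of the form \<open>InL\<close> would do;
    \<open>Cs {}\<close> exists for every choice of types.\<close>
  define t where "t n = (InL ^^ n) (Cs {} :: ('a, 'p) pt)" for n :: nat
  have "t m = t n \<longrightarrow> m = n" for m n
  proof (induction m arbitrary: n)
    case 0 show ?case by (cases n) (simp_all add: t_def)
  next
    case (Suc m) then show ?case by (cases n) (simp_all add: t_def)
  qed
  then have "inj t" by (simp add: inj_on_def)
  then have "inj_on (t \<circ> f) E" using f by (intro comp_inj_on) (auto intro: inj_on_subset)
  then show ?thesis by blast
qed

text \<open>Pullbacks and quotients are naturally sets of pairs or of classes, of another type than
  the points of the category. This copies such an action to an object of the category.\<close>

lemma gset_realize:
  assumes "finite E" and cl: "\<And>g x. g \<in> carrier G \<Longrightarrow> x \<in> E \<Longrightarrow> act g x \<in> E"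
    and one: "\<And>x. x \<in> E \<Longrightarrow> act \<one> x = x"
    and mult: "\<And>g h x. g \<in> carrier G \<Longrightarrow> h \<in> carrier G \<Longrightarrow> x \<in> E \<Longrightarrow> act (g \<otimes> h) x = act g (act h x)"
  shows "\<exists>(R :: ('a, 'p) Gset) e. finite_gset G R \<and> inj_on e E \<and> gpts R = e ` E \<and>
     (\<forall>g\<in>carrier G. \<forall>x\<in>E. gact R g (e x) = e (act g x))"
proof -
  obtain e :: "_ \<Rightarrow> ('a, 'p) pt" where e: "inj_on e E" using ex_inj_pt[OF assms(1)] by blast
  define d where "d = inv_into E e"
  have d: "d (e x) = x" if "x \<in> E" for x using that e by (simp add: d_def)
  let ?R = "mk_gset (e ` E) (\<lambda>g y. e (act g (d y)))"
  have "finite_gset G ?R" using assms by (intro finite_mk_gset) (auto simp: d)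
  then show ?thesis using e by (intro exI[of _ ?R] exI[of _ e]) (simp add: d)
qed

lemma gmapsD:
  assumes "\<phi> \<in> gmaps G S T"
  shows "x \<in> gpts S \<Longrightarrow> \<phi> x \<in> gpts T"
    and "g \<in> carrier G \<Longrightarrow> x \<in> gpts S \<Longrightarrow> \<phi> (gact S g x) = gact T g (\<phi> x)"
  using assms unfolding gmaps_def by auto

lemma gmapsI:
  assumes "\<phi> \<in> extensional (gpts S)" "\<And>x. x \<in> gpts S \<Longrightarrow> \<phi> x \<in> gpts T"
    "\<And>g x. g \<in> carrier G \<Longrightarrow> x \<in> gpts S \<Longrightarrow> \<phi> (gact S g x) = gact T g (\<phi> x)"
  shows "\<phi> \<in> gmaps G S T"
  using assms unfolding gmaps_def by (auto simp: PiE_def)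

lemma gmaps_eqI:
  assumes "\<phi> \<in> gmaps G S T" "\<psi> \<in> gmaps G S T'" "\<And>x. x \<in> gpts S \<Longrightarrow> \<phi> x = \<psi> x"
  shows "\<phi> = \<psi>"
  using assms unfolding gmaps_def by (auto simp: PiE_def intro: extensionalityI[of _ "gpts S"])

definition gid :: "('a, 'p) Gset \<Rightarrow> ('a, 'p) pt \<Rightarrow> ('a, 'p) pt" where
  "gid S = (\<lambda>x\<in>gpts S. x)"

lemma gid_apply [simp]: "x \<in> gpts S \<Longrightarrow> gid S x = x"
  by (simp add: gid_def)

lemma gid_gmaps: "finite_gset G S \<Longrightarrow> gid S \<in> gmaps G S S"
  by (rule gmapsI) (auto simp: gid_def gsetD)

lemma compose_gmaps:
  assumes "finite_gset G S" "\<phi> \<in> gmaps G S T" "\<psi> \<in> gmaps G T U"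
  shows "compose (gpts S) \<psi> \<phi> \<in> gmaps G S U"
  using assms(1) by (intro gmapsI)
    (auto simp: compose_eq gmapsD[OF assms(2)] gmapsD[OF assms(3)] gsetD compose_def)

text \<open>Base points of a single G-set, independent of the global choice \<open>b\<close>.
  Standard G-sets carry base points of their own, and the two kinds will have to be
  exchanged.\<close>

definition based :: "('a, 'p) Gset \<Rightarrow> ('a, 'p) pt list \<Rightarrow> bool" where
  "based S b \<longleftrightarrow> finite_gset G S \<and> set b \<subseteq> gpts S \<and>
     (\<forall>x\<in>gpts S. \<exists>!i. i < length b \<and> (\<exists>g\<in>carrier G. x = gact S g (b ! i)))"

definition bidx :: "('a, 'p) Gset \<Rightarrow> ('a, 'p) pt list \<Rightarrow> ('a, 'p) pt \<Rightarrow> nat" where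
  "bidx S b x = (THE i. i < length b \<and> (\<exists>g\<in>carrier G. x = gact S g (b ! i)))"

lemma based_gset: "based S b \<Longrightarrow> finite_gset G S"
  by (simp add: based_def)

lemma based_nth: "based S b \<Longrightarrow> i < length b \<Longrightarrow> b ! i \<in> gpts S"
  unfolding based_def using nth_mem by blast

lemma bidx:
  assumes "based S b" "x \<in> gpts S"
  shows "bidx S b x < length b \<and> (\<exists>g\<in>carrier G. x = gact S g (b ! bidx S b x))"
  unfolding bidx_def by (rule theI') (use assms in \<open>simp add: based_def\<close>)

lemma bidx_eq:
  assumes "based S b" "i < length b" "g \<in> carrier G"
  shows "bidx S b (gact S g (b ! i)) = i"
proof -
  have "gact S g (b ! i) \<in> gpts S"
    using based_nth[OF assms(1,2)] based_gset[OF assms(1)] assms(3) by (simp add: gsetD)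
  then have "\<exists>!k. k < length b \<and> (\<exists>h\<in>carrier G. gact S g (b ! i) = gact S h (b ! k))"
    using assms(1) by (simp add: based_def)
  then show ?thesis unfolding bidx_def using assms(2,3) by (intro the1_equality) auto
qed

lemma bidx_act:
  assumes S: "based S b" and "x \<in> gpts S" "g \<in> carrier G"
  shows "bidx S b (gact S g x) = bidx S b x"
proof -
  obtain h where h: "h \<in> carrier G" "x = gact S h (b ! bidx S b x)" and i: "bidx S b x < length b"
    using bidx[OF assms(1,2)] by blast
  have "gact S g x = gact S (g \<otimes> h) (b ! bidx S b x)"
    using h assms(3) based_nth[OF S i] by (simp add: gsetD[OF based_gset[OF S]])
  then show ?thesis using bidx_eq[OF S i, of "g \<otimes> h"] h(1) assms(3) by simp
qed

lemma bidx_nth: "based S b \<Longrightarrow> i < length b \<Longrightarrow> bidx S b (b ! i) = i"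
  using bidx_eq[of S b i \<one>] gsetD(3)[OF based_gset[of S b] based_nth[of S b i]] by simp

definition stabs :: "('a, 'p) Gset \<Rightarrow> ('a, 'p) pt list \<Rightarrow> 'a set list" where
  "stabs S b = map (stabilizer G (gact S)) b"

lemma length_stabs [simp]: "length (stabs S b) = length b"
  by (simp add: stabs_def)

lemma stabs_nth [simp]: "i < length b \<Longrightarrow> stabs S b ! i = stab S (b ! i)"
  by (simp add: stabs_def)

lemma subgroup_stab: "based S b \<Longrightarrow> i < length b \<Longrightarrow> subgroup (stab S (b ! i)) G"
  using gsetD(7)[OF based_gset based_nth] .

section \<open>Spans of G-sets and matrices of bisets\<close>

text \<open>A span is read as a morphism from \<open>S\<close> to \<open>T\<close>: the left leg
  \<open>q\<close> stands for restriction and the right leg \<open>p\<close> for transfer.\<close>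

definition gspan where
  "gspan S R T q p \<longleftrightarrow> finite_gset G S \<and> finite_gset G R \<and> finite_gset G T \<and> q \<in> gmaps G R S \<and> p \<in> gmaps G R T"

lemma gspanD:
  assumes "gspan S R T q p"
  shows "finite_gset G S" "finite_gset G R" "finite_gset G T" "q \<in> gmaps G R S" "p \<in> gmaps G R T"
  using assms by (simp_all add: gspan_def)

text \<open>The \<open>(stab y)\<close>-\<open>(stab x)\<close> biset of a span \<open>S \<leftarrow> R \<rightarrow> T\<close>. Its projection to \<open>G\<close> is a map of
  bisets, which makes it a conjugation biset.\<close>

definition span_biset ::
  "('a, 'p) Gset \<Rightarrow> ('a, 'p) Gset \<Rightarrow> (('a, 'p) pt \<Rightarrow> ('a, 'p) pt) \<Rightarrow> (('a, 'p) pt \<Rightarrow> ('a, 'p) pt) \<Rightarrow>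
   ('a, 'p) pt \<Rightarrow> ('a, 'p) pt \<Rightarrow> ('a, ('a, 'p) pt \<times> 'a) biset" where
  "span_biset S R q p x y = \<lparr>
     bpts = {(r, g). r \<in> gpts R \<and> g \<in> carrier G \<and> p r = y \<and> q r = gact S g x},
     lact = (\<lambda>k (r, g). (gact R k r, k \<otimes> g)),
     ract = (\<lambda>(r, g) h. (r, g \<otimes> h))\<rparr>"

lemma span_biset_simps [simp]:
  "(r, g) \<in> bpts (span_biset S R q p x y) \<longleftrightarrow> r \<in> gpts R \<and> g \<in> carrier G \<and> p r = y \<and> q r = gact S g x"
  "lact (span_biset S R q p x y) k (r, g) = (gact R k r, k \<otimes> g)"
  "ract (span_biset S R q p x y) (r, g) h = (r, g \<otimes> h)"
  by (simp_all add: span_biset_def)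

lemma conj_span_biset:
  assumes R: "gspan S R T q p" and x: "x \<in> gpts S" and y: "y \<in> gpts T"
  shows "conj_biset G (stab S x) (stab T y) (span_biset S R q p x y)"
proof (rule conj_biset_of_mark)
  note D = gsetD[OF gspanD(1)[OF R]] gsetD[OF gspanD(2)[OF R]] gsetD[OF gspanD(3)[OF R]]
    gmapsD[OF gspanD(4)[OF R]] gmapsD[OF gspanD(5)[OF R]]
  show "subgroup (stab S x) G" "subgroup (stab T y) G" using x y by (simp_all add: D)
  have "bpts (span_biset S R q p x y) \<subseteq> gpts R \<times> carrier G" by auto
  then have "finite (bpts (span_biset S R q p x y))"
    using D finite_carrier by (meson finite_SigmaI finite_subset)
  then show "finite_biset G (stab S x) (stab T y) (span_biset S R q p x y)"
    unfolding finite_biset_def using x y by (auto simp: stab_iff D m_assoc)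
  show "biset_mark G (stab S x) (stab T y) (span_biset S R q p x y) snd"
    by (rule biset_markI) (auto simp: stab_iff)
qed

lemmas finite_span_biset = conj_bisetD[OF conj_span_biset]

definition smat where
  "smat S b T c R q p = mat (length c) (length b)
     (\<lambda>(a, i). bimor_of G (stab S (b ! i)) (stab T (c ! a)) (span_biset S R q p (b ! i) (c ! a)))"

lemma smat_dim [simp]: "dim_row (smat S b T c R q p) = length c" "dim_col (smat S b T c R q p) = length b"
  by (simp_all add: smat_def)

lemma smat_nth [simp]: "a < length c \<Longrightarrow> i < length b \<Longrightarrow> smat S b T c R q p $$ (a, i) =
    bimor_of G (stab S (b ! i)) (stab T (c ! a)) (span_biset S R q p (b ! i) (c ! a))"
  by (simp add: smat_def)

lemma bimor_of_eqI:
  "finite_biset G H1 H2 X \<Longrightarrow> biset_iso H1 H2 X Y \<Longrightarrow> bimor_of G H1 H2 X = bimor_of G H1 H2 Y"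
  unfolding bimor_of_def using biset_cls_eqI by metis

lemma bimor_of_closed:
  "subgroup H1 G \<Longrightarrow> subgroup H2 G \<Longrightarrow> conj_biset G H1 H2 X \<Longrightarrow>
    bimor_of G H1 H2 X \<in> carrier (groth (conj_biset_monoid G H1 H2))"
  unfolding bimor_of_def
  by (intro groth_monoid.groth_of_closed groth_monoid_conj_biset biset_cls_closed)

lemma bimor_of_empty:
  assumes "subgroup H1 G" "subgroup H2 G" "finite_biset G H1 H2 X" "bpts X = {}"
  shows "bimor_of G H1 H2 X = \<one>\<^bsub>groth (conj_biset_monoid G H1 H2)\<^esub>"
  unfolding bimor_of_def biset_cls_empty[OF assms]
  by (rule groth_monoid.groth_of_one[OF groth_monoid_conj_biset[OF assms(1,2)]])

lemma smat_eqI: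
  assumes "based S b" "based T c" "gspan S R T q p"
    and "\<And>a i. a < length c \<Longrightarrow> i < length b \<Longrightarrow>
      biset_iso (stab S (b ! i)) (stab T (c ! a)) (span_biset S R q p (b ! i) (c ! a)) (Y a i)"
  shows "smat S b T c R q p = mat (length c) (length b)
     (\<lambda>(a, i). bimor_of G (stab S (b ! i)) (stab T (c ! a)) (Y a i))"
  using assms(4) finite_span_biset[OF assms(3) based_nth[OF assms(1)] based_nth[OF assms(2)]]
  by (intro eq_matI) (simp_all add: bimor_of_eqI)

section \<open>The Hom groups and the composition of the additive completion\<close>

abbreviation "tuples \<equiv> Ob (Bdot G)"
abbreviation "BHom \<equiv> HGrp (Bdot G)"
abbreviation "bcomp \<equiv> Cmp (Bdot G)"

lemma Bdot_Mor:
  "Mor (Bdot G) s t = carrier (BHom s t)"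
  by (simp add: addcompl_def Let_def)

lemma Bdot_carrier:
  "A \<in> carrier (BHom s t) \<longleftrightarrow> A \<in> carrier_mat (length t) (length s) \<and>
     (\<forall>i<length t. \<forall>j<length s. A $$ (i, j) \<in> carrier (groth (conj_biset_monoid G (s ! j) (t ! i))))"
  by (simp add: addcompl_def Let_def Bcat_def)

lemma Bdot_Ob: "tuples = lists {H. subgroup H G}"
  by (simp add: addcompl_def Let_def Bcat_def)

lemma smat_closed:
  assumes "based S b" "based T c" "gspan S R T q p"
  shows "smat S b T c R q p \<in> carrier (BHom (stabs S b) (stabs T c))"
  unfolding Bdot_carrier carrier_mat_def
  using bimor_of_closed[OF subgroup_stab[OF assms(1)] subgroup_stab[OF assms(2)]
      conj_span_biset[OF assms(3) based_nth[OF assms(1)] based_nth[OF assms(2)]]]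
  by simp

lemma Bdot_mult:
  "A \<otimes>\<^bsub>BHom s t\<^esub> B = mat (length t) (length s)
     (\<lambda>(i, j). A $$ (i, j) \<otimes>\<^bsub>groth (conj_biset_monoid G (s ! j) (t ! i))\<^esub> B $$ (i, j))"
  by (simp add: addcompl_def Let_def Bcat_def)

lemma Bdot_one:
  "\<one>\<^bsub>BHom s t\<^esub> = mat (length t) (length s) (\<lambda>(i, j). \<one>\<^bsub>groth (conj_biset_monoid G (s ! j) (t ! i))\<^esub>)"
  by (simp add: addcompl_def Let_def Bcat_def)

lemma Bdot_Cmp:
  "bcomp s t u B A = mat (length u) (length s) (\<lambda>(i, j).
     finprod (groth (conj_biset_monoid G (s ! j) (u ! i)))
       (\<lambda>k. groth_bilinear (conj_biset_monoid G (s ! j) (u ! i)) (balanced_cls G (s ! j) (t ! k) (u ! i))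
              (B $$ (i, k)) (A $$ (k, j))) {..<length t})"
  by (simp add: addcompl_def Let_def Bcat_def)

lemma Bdot_Ob_nth: "s \<in> tuples \<Longrightarrow> i < length s \<Longrightarrow> subgroup (s ! i) G"
  by (auto simp: Bdot_Ob in_lists_conv_set)

lemma comm_group_Hom:
  "subgroup H1 G \<Longrightarrow> subgroup H2 G \<Longrightarrow> comm_group (groth (conj_biset_monoid G H1 H2))"
  by (intro groth_monoid.comm_group_groth groth_monoid_conj_biset)

lemma comm_group_Bdot:
  assumes s: "s \<in> tuples" and t: "t \<in> tuples"
  shows "comm_group (BHom s t)"
proof -
  let ?M = "\<lambda>i j. groth (conj_biset_monoid G (s ! j) (t ! i))" and ?H = "BHom s t"
  have M: "comm_group (?M i j)" if "i < length t" "j < length s" for i j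
    using that s t by (intro comm_group_Hom) (simp_all add: Bdot_Ob_nth)
  have g: "group (?M i j)" "comm_monoid (?M i j)" "monoid (?M i j)" if "i < length t" "j < length s" for i j
    using comm_group.axioms[OF M[OF that]] group.is_monoid by blast+
  show ?thesis
  proof (rule comm_groupI)
    fix A B C assume A: "A \<in> carrier ?H" and B: "B \<in> carrier ?H" and C: "C \<in> carrier ?H"
    show "A \<otimes>\<^bsub>?H\<^esub> B \<in> carrier ?H"
      using A B g unfolding Bdot_carrier Bdot_mult by (auto intro!: monoid.m_closed)
    show "A \<otimes>\<^bsub>?H\<^esub> B \<otimes>\<^bsub>?H\<^esub> C = A \<otimes>\<^bsub>?H\<^esub> (B \<otimes>\<^bsub>?H\<^esub> C)"
      using A B C g unfolding Bdot_carrier Bdot_mult by (intro eq_matI) (simp_all add: monoid.m_assoc)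
    show "A \<otimes>\<^bsub>?H\<^esub> B = B \<otimes>\<^bsub>?H\<^esub> A"
      using A B g unfolding Bdot_carrier Bdot_mult by (intro eq_matI) (simp_all add: comm_monoid.m_comm)
    show "\<one>\<^bsub>?H\<^esub> \<otimes>\<^bsub>?H\<^esub> A = A"
      using A g unfolding Bdot_carrier Bdot_mult Bdot_one by (intro eq_matI) (auto simp: monoid.l_one)
    show "\<exists>y\<in>carrier ?H. y \<otimes>\<^bsub>?H\<^esub> A = \<one>\<^bsub>?H\<^esub>"
    proof
      let ?y = "mat (length t) (length s) (\<lambda>(i, j). inv\<^bsub>?M i j\<^esub> (A $$ (i, j)))"
      show "?y \<in> carrier ?H" using A g unfolding Bdot_carrier by (auto intro!: group.inv_closed)
      show "?y \<otimes>\<^bsub>?H\<^esub> A = \<one>\<^bsub>?H\<^esub>"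
        using A g unfolding Bdot_carrier Bdot_mult Bdot_one by (intro eq_matI) (auto simp: group.l_inv)
    qed
  next
    show "\<one>\<^bsub>?H\<^esub> \<in> carrier ?H"
      using g unfolding Bdot_carrier Bdot_one by (auto intro!: monoid.one_closed)
  qed
qed

lemma Bdot_bilinear_closed:
  assumes s: "s \<in> tuples" and t: "t \<in> tuples" and u: "u \<in> tuples"
    and A: "A \<in> carrier (BHom s t)" and B: "B \<in> carrier (BHom t u)"
    and i: "i < length u" and j: "j < length s" and k: "k < length t"
  shows "groth_bilinear (conj_biset_monoid G (s ! j) (u ! i)) (balanced_cls G (s ! j) (t ! k) (u ! i))
              (B $$ (i, k)) (A $$ (k, j)) \<in> carrier (groth (conj_biset_monoid G (s ! j) (u ! i)))"
  using A B i j k s t u unfolding Bdot_carrier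
  by (intro biadditive.bilinear_closed[OF biadditive_balanced]) (simp_all add: Bdot_Ob_nth)

lemma Bdot_Cmp_addl:
  assumes s: "s \<in> tuples" and t: "t \<in> tuples" and u: "u \<in> tuples"
    and A: "A \<in> carrier (BHom s t)" and B: "B \<in> carrier (BHom t u)" "B' \<in> carrier (BHom t u)"
  shows "bcomp s t u (B \<otimes>\<^bsub>BHom t u\<^esub> B') A =
    bcomp s t u B A \<otimes>\<^bsub>BHom s u\<^esub> bcomp s t u B' A"
proof (rule eq_matI)
  fix i j assume "i < dim_row (bcomp s t u B A \<otimes>\<^bsub>BHom s u\<^esub> bcomp s t u B' A)"
    "j < dim_col (bcomp s t u B A \<otimes>\<^bsub>BHom s u\<^esub> bcomp s t u B' A)"
  then have ij: "i < length u" "j < length s" by (simp_all add: Bdot_mult)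
  let ?M = "groth (conj_biset_monoid G (s ! j) (u ! i))"
  let ?b = "\<lambda>k. groth_bilinear (conj_biset_monoid G (s ! j) (u ! i)) (balanced_cls G (s ! j) (t ! k) (u ! i))"
  interpret M: comm_group ?M using ij s u by (intro comm_group_Hom Bdot_Ob_nth)
  note cl = Bdot_bilinear_closed[OF s t u A _ ij]
  have "?b k ((B \<otimes>\<^bsub>BHom t u\<^esub> B') $$ (i, k)) (A $$ (k, j)) =
      ?b k (B $$ (i, k)) (A $$ (k, j)) \<otimes>\<^bsub>?M\<^esub> ?b k (B' $$ (i, k)) (A $$ (k, j))" if "k < length t" for k
    using A B ij that s t u unfolding Bdot_carrier Bdot_mult
    by (simp add: biadditive.bilinear_addl[OF biadditive_balanced] Bdot_Ob_nth)
  then have "finprod ?M (\<lambda>k. ?b k ((B \<otimes>\<^bsub>BHom t u\<^esub> B') $$ (i, k)) (A $$ (k, j))) {..<length t} =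
      finprod ?M (\<lambda>k. ?b k (B $$ (i, k)) (A $$ (k, j)) \<otimes>\<^bsub>?M\<^esub> ?b k (B' $$ (i, k)) (A $$ (k, j))) {..<length t}"
    using cl[OF B(1)] cl[OF B(2)] by (intro M.finprod_cong') auto
  then show "bcomp s t u (B \<otimes>\<^bsub>BHom t u\<^esub> B') A $$ (i, j) =
      (bcomp s t u B A \<otimes>\<^bsub>BHom s u\<^esub> bcomp s t u B' A) $$ (i, j)"
    using ij cl[OF B(1)] cl[OF B(2)] by (simp add: Bdot_Cmp Bdot_mult[of s u] M.finprod_multf Pi_def)
qed (simp_all add: Bdot_Cmp Bdot_mult)

lemma Bdot_Cmp_addr:
  assumes s: "s \<in> tuples" and t: "t \<in> tuples" and u: "u \<in> tuples"
    and A: "A \<in> carrier (BHom s t)" "A' \<in> carrier (BHom s t)" and B: "B \<in> carrier (BHom t u)"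
  shows "bcomp s t u B (A \<otimes>\<^bsub>BHom s t\<^esub> A') =
    bcomp s t u B A \<otimes>\<^bsub>BHom s u\<^esub> bcomp s t u B A'"
proof (rule eq_matI)
  fix i j assume "i < dim_row (bcomp s t u B A \<otimes>\<^bsub>BHom s u\<^esub> bcomp s t u B A')"
    "j < dim_col (bcomp s t u B A \<otimes>\<^bsub>BHom s u\<^esub> bcomp s t u B A')"
  then have ij: "i < length u" "j < length s" by (simp_all add: Bdot_mult)
  let ?M = "groth (conj_biset_monoid G (s ! j) (u ! i))"
  let ?b = "\<lambda>k. groth_bilinear (conj_biset_monoid G (s ! j) (u ! i)) (balanced_cls G (s ! j) (t ! k) (u ! i))"
  interpret M: comm_group ?M using ij s u by (intro comm_group_Hom Bdot_Ob_nth)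
  note cl = Bdot_bilinear_closed[OF s t u _ B ij]
  have "?b k (B $$ (i, k)) ((A \<otimes>\<^bsub>BHom s t\<^esub> A') $$ (k, j)) =
      ?b k (B $$ (i, k)) (A $$ (k, j)) \<otimes>\<^bsub>?M\<^esub> ?b k (B $$ (i, k)) (A' $$ (k, j))" if "k < length t" for k
    using A B ij that s t u unfolding Bdot_carrier Bdot_mult
    by (simp add: biadditive.bilinear_addr[OF biadditive_balanced] Bdot_Ob_nth)
  then have "finprod ?M (\<lambda>k. ?b k (B $$ (i, k)) ((A \<otimes>\<^bsub>BHom s t\<^esub> A') $$ (k, j))) {..<length t} =
      finprod ?M (\<lambda>k. ?b k (B $$ (i, k)) (A $$ (k, j)) \<otimes>\<^bsub>?M\<^esub> ?b k (B $$ (i, k)) (A' $$ (k, j))) {..<length t}"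
    using cl[OF A(1)] cl[OF A(2)] by (intro M.finprod_cong') auto
  then show "bcomp s t u B (A \<otimes>\<^bsub>BHom s t\<^esub> A') $$ (i, j) =
      (bcomp s t u B A \<otimes>\<^bsub>BHom s u\<^esub> bcomp s t u B A') $$ (i, j)"
    using ij cl[OF A(1)] cl[OF A(2)] by (simp add: Bdot_Cmp Bdot_mult[of s u] M.finprod_multf Pi_def)
qed (simp_all add: Bdot_Cmp Bdot_mult)

section \<open>Composition of spans and products of matrices\<close>

definition gset_pullback where
  "gset_pullback P R R' T p q' u v \<longleftrightarrow>
     finite_gset G P \<and> u \<in> gmaps G P R \<and> v \<in> gmaps G P R' \<and> (\<forall>z\<in>gpts P. p (u z) = q' (v z)) \<and>
     (\<forall>r\<in>gpts R. \<forall>r'\<in>gpts R'. p r = q' r' \<longrightarrow> (\<exists>!z. z \<in> gpts P \<and> u z = r \<and> v z = r'))"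

lemma gset_pullbackD:
  assumes "gset_pullback P R R' T p q' u v"
  shows "finite_gset G P" "u \<in> gmaps G P R" "v \<in> gmaps G P R'"
    and "z \<in> gpts P \<Longrightarrow> p (u z) = q' (v z)"
    and "r \<in> gpts R \<Longrightarrow> r' \<in> gpts R' \<Longrightarrow> p r = q' r' \<Longrightarrow> \<exists>!z. z \<in> gpts P \<and> u z = r \<and> v z = r'"
  using assms unfolding gset_pullback_def by blast+

lemma gspan_pullback:
  assumes "gspan S R T q p" "gspan T R' W q' p'" "gset_pullback P R R' T p q' u v"
  shows "gspan S P W (compose (gpts P) q u) (compose (gpts P) p' v)"
  using gspanD[OF assms(1)] gspanD[OF assms(2)] gset_pullbackD(1-3)[OF assms(3)]
  unfolding gspan_def by (auto intro: compose_gmaps)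

text \<open>Points (r', g') and (r, g) of the two bisets have \<open>g' r\<close> and r' over the
  same point of \<open>T\<close>, so they give a point of the pullback, with second component g' g.
  That point lies over the orbit of \<open>c ! a\<close>, whence the restriction on the right: a
  single middle base point sees only this part of the pullback.\<close>

lemma span_balanced:
  assumes R: "gspan S R T q p" and R': "gspan T R' W q' p'" and P: "gset_pullback P R R' T p q' u v"
    and x: "x \<in> gpts S" and w: "w \<in> gpts W" and T: "based T c" and a: "a < length c"
  shows "biset_iso (stab S x) (stab W w)
    (balanced_product (stab T (c ! a)) (span_biset T R' q' p' (c ! a) w) (span_biset S R q p x (c ! a)))
    (biset_restr (span_biset S P (compose (gpts P) q u) (compose (gpts P) p' v) x w)
      (\<lambda>(z, g). bidx T c (p (u z)) = a))"
proof -
  note DR = gsetD[OF gspanD(2)[OF R]] and DR' = gsetD[OF gspanD(2)[OF R']] and DT = gsetD[OF gspanD(3)[OF R]]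
    and DS = gsetD[OF gspanD(1)[OF R]] and DW = gsetD[OF gspanD(3)[OF R']] and DP = gsetD[OF gset_pullbackD(1)[OF P]]
  note q = gmapsD[OF gspanD(4)[OF R]] and p = gmapsD[OF gspanD(5)[OF R]]
    and q' = gmapsD[OF gspanD(4)[OF R']] and p' = gmapsD[OF gspanD(5)[OF R']]
    and u = gmapsD[OF gset_pullbackD(2)[OF P]] and v = gmapsD[OF gset_pullbackD(3)[OF P]]
  note com = gset_pullbackD(4)[OF P]
  have c: "c ! a \<in> gpts T" using based_nth[OF T a] .
  define Z where "Z r r' = (THE z. z \<in> gpts P \<and> u z = r \<and> v z = r')" for r r'
  have Z: "Z r r' \<in> gpts P \<and> u (Z r r') = r \<and> v (Z r r') = r'"
    if "r \<in> gpts R" "r' \<in> gpts R'" "p r = q' r'" for r r'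
    unfolding Z_def by (rule theI') (rule gset_pullbackD(5)[OF P that])
  have Zeq: "Z r r' = z" if "z \<in> gpts P" "u z = r" "v z = r'" for z r r'
    unfolding Z_def using that gset_pullbackD(5)[OF P u(1)[OF that(1)] v(1)[OF that(1)] com[OF that(1)]]
    by (intro the1_equality) auto
  have Zact: "Z (gact R g r) (gact R' g r') = gact P g (Z r r')"
    if "r \<in> gpts R" "r' \<in> gpts R'" "p r = q' r'" "g \<in> carrier G" for r r' g
    using Z[OF that(1-3)] that(4) by (intro Zeq) (simp_all add: DP u v)
  let ?X = "span_biset T R' q' p' (c ! a) w" and ?Y = "span_biset S R q p x (c ! a)"
  let ?B = "biset_restr (span_biset S P (compose (gpts P) q u) (compose (gpts P) p' v) x w)
      (\<lambda>(z, g). bidx T c (p (u z)) = a)"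
  interpret b: balanced G "stab S x" "stab T (c ! a)" "stab W w" ?X ?Y
    by (intro balanced.intro balanced_axioms.intro is_group finite_span_biset[OF R'] finite_span_biset[OF R]
        DS(7) DT(7) DW(7) x c w)
  have pt: "gact R g' r \<in> gpts R" "p (gact R g' r) = q' r'" "p' r' = w" "q (gact R g' r) = gact S (g' \<otimes> g) x"
     "p (gact R g' r) = gact T g' (c ! a)" "g \<in> carrier G" "g' \<in> carrier G" "r' \<in> gpts R'" "r \<in> gpts R"
     "q' r' = gact T g' (c ! a)" "p r = c ! a" "q r = gact S g x"
    if "(r', g') \<in> bpts ?X" "(r, g) \<in> bpts ?Y" for r' g' r g
    using that x by (auto simp: DR p q DS)
  show ?thesis
  proof (rule b.bal_isoI)
    let ?f = "\<lambda>(r', g') (r, g). (Z (gact R g' r) r', g' \<otimes> g)"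
    show "?f X Y \<in> bpts ?B" if "X \<in> bpts ?X" "Y \<in> bpts ?Y" for X Y
    proof -
      obtain r' g' r g where XY: "X = (r', g')" "Y = (r, g)" by (metis surj_pair)
      note pt = pt[OF that[unfolded XY]]
      show ?thesis
        unfolding XY using pt Z[OF pt(1) pt(8) pt(2)] bidx_eq[OF T a pt(7)]
        by (simp add: compose_eq)
    qed
    show "\<exists>X\<in>bpts ?X. \<exists>Y\<in>bpts ?Y. z = ?f X Y" if "z \<in> bpts ?B" for z
    proof -
      obtain s g where z: "z = (s, g)" by (metis surj_pair)
      have s: "s \<in> gpts P" "g \<in> carrier G" "p' (v s) = w" "q (u s) = gact S g x" "bidx T c (p (u s)) = a"
        using that unfolding z by (auto simp: compose_eq)
      \<comment> \<open>An element \<open>k\<close> that carries \<open>c ! a\<close> to the middle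
        point splits g as k times (inv k) g; the two factors are the second components of a
        preimage.\<close>
      obtain k where k: "k \<in> carrier G" "p (u s) = gact T k (c ! a)"
        using bidx[OF T p(1)[OF u(1)[OF s(1)]]] s(5) by blast
      have "(v s, k) \<in> bpts ?X" using s k com[OF s(1)] by (simp add: v)
      moreover have "(gact R (inv k) (u s), inv k \<otimes> g) \<in> bpts ?Y"
        using s k c x by (simp add: DR u p q DT DS)
      moreover have "z = ?f (v s, k) (gact R (inv k) (u s), inv k \<otimes> g)"
        unfolding z using s k by (simp add: DR u mult_inv_cancel Zeq)
      ultimately show ?thesis by blast
    qed
    show "?f (ract ?X X h) Y = ?f X (lact ?Y h Y)"
      if "X \<in> bpts ?X" "Y \<in> bpts ?Y" "h \<in> stab T (c ! a)" for X Y h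
      using that by (cases X; cases Y) (simp add: stab_iff DR m_assoc)
    show "?f (lact ?X k X) Y = lact ?B k (?f X Y)"
      if XY: "X \<in> bpts ?X" "Y \<in> bpts ?Y" "k \<in> stab W w" for X Y k
    proof -
      obtain r' g' r g where eq: "X = (r', g')" "Y = (r, g)" by (metis surj_pair)
      note pt = pt[OF XY(1,2)[unfolded eq]]
      show ?thesis unfolding eq using pt XY(3) Zact[OF pt(1) pt(8) pt(2), of k]
        by (simp add: stab_iff DR m_assoc)
    qed
    show "?f X (ract ?Y Y k) = ract ?B (?f X Y) k"
      if "X \<in> bpts ?X" "Y \<in> bpts ?Y" "k \<in> stab S x" for X Y k
      using that by (cases X; cases Y) (simp add: stab_iff m_assoc)
    show "\<exists>h\<in>stab T (c ! a). X = ract ?X X' h \<and> Y' = lact ?Y h Y"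
      if mem: "X \<in> bpts ?X" "Y \<in> bpts ?Y" "X' \<in> bpts ?X" "Y' \<in> bpts ?Y" and eq: "?f X Y = ?f X' Y'" for X Y X' Y'
    proof -
      obtain r1' g1' r1 g1 where 1: "X = (r1', g1')" "Y = (r1, g1)" by (metis surj_pair)
      obtain r2' g2' r2 g2 where 2: "X' = (r2', g2')" "Y' = (r2, g2)" by (metis surj_pair)
      note p1 = pt[OF mem(1,2)[unfolded 1]] and p2 = pt[OF mem(3,4)[unfolded 2]]
      have Zs: "Z (gact R g1' r1) r1' = Z (gact R g2' r2) r2'" and gg: "g1' \<otimes> g1 = g2' \<otimes> g2"
        using eq unfolding 1 2 by simp_all
      have r: "r1' = r2'" "gact R g1' r1 = gact R g2' r2"
        using Z[OF p1(1) p1(8) p1(2)] Z[OF p2(1) p2(8) p2(2)] Zs by metis+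
      \<comment> \<open>Two splittings of the same second component differ by this element. It fixes
        \<open>c ! a\<close> because both middle points are the image of the same point of
        \<open>R'\<close>.\<close>
      let ?h = "inv g2' \<otimes> g1'"
      have "gact T ?h (c ! a) = gact T (inv g2') (gact T g2' (c ! a))"
        using p1(7,10) p2(7,10) r(1) c by (simp add: DT)
      then have h: "?h \<in> stab T (c ! a)" using c p1(7) p2(7) by (simp add: stab_iff DT)
      have "r2 = gact R ?h r1"
        using r(2) p1(7,9) p2(7,9) by (simp add: DR)
      moreover have "g2 = ?h \<otimes> g1" using gg p1(6,7) p2(6,7) by (simp add: m_assoc mult_inv_cancel)
      moreover have "g1' = g2' \<otimes> ?h" using p1(7) p2(7) by (simp add: mult_inv_cancel)
      ultimately show ?thesis unfolding 1 2 using h r(1) by (intro bexI[of _ ?h]) simp_all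
    qed
  qed
qed

text \<open>The summand of the matrix product at the middle index a is the part of the pullback
  biset over the orbit of \<open>c ! a\<close>, by \<open>span_balanced\<close>. Summing over a puts
  the parts together, by \<open>biset_cls_partition\<close>.\<close>

lemma smat_comp:
  assumes S: "based S b" and T: "based T c" and W: "based W d"
    and R: "gspan S R T q p" and R': "gspan T R' W q' p'" and P: "gset_pullback P R R' T p q' u v"
  shows "bcomp (stabs S b) (stabs T c) (stabs W d) (smat T c W d R' q' p') (smat S b T c R q p) =
    smat S b W d P (compose (gpts P) q u) (compose (gpts P) p' v)"
proof (rule eq_matI)
  fix l i assume "l < dim_row (smat S b W d P (compose (gpts P) q u) (compose (gpts P) p' v))"
    "i < dim_col (smat S b W d P (compose (gpts P) q u) (compose (gpts P) p' v))"
  then have l: "l < length d" and i: "i < length b" by simp_all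
  let ?Hi = "stab S (b ! i)" and ?Hl = "stab W (d ! l)" and ?Ha = "\<lambda>a. stab T (c ! a)"
  let ?M = "conj_biset_monoid G ?Hi ?Hl"
  note H = subgroup_stab[OF S i] subgroup_stab[OF W l] and Ha = subgroup_stab[OF T]
  let ?X = "\<lambda>a. span_biset T R' q' p' (c ! a) (d ! l)" and ?Y = "\<lambda>a. span_biset S R q p (b ! i) (c ! a)"
  let ?Z = "span_biset S P (compose (gpts P) q u) (compose (gpts P) p' v) (b ! i) (d ! l)"
  let ?D = "\<lambda>(z, g). bidx T c (p (u z))"
  note X = conj_span_biset[OF R' based_nth[OF T] based_nth[OF W l]]
  note Y = conj_span_biset[OF R based_nth[OF S i] based_nth[OF T]]
  note Z = conj_span_biset[OF gspan_pullback[OF R R' P] based_nth[OF S i] based_nth[OF W l]]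
  note M = groth_monoid_conj_biset[OF H]
  note conjB = conj_balanced[OF H(1) Ha H(2) X Y]
  let ?B = "\<lambda>a. biset_cls G ?Hi ?Hl (balanced_product (?Ha a) (?X a) (?Y a))"
  have B: "?B a = biset_cls G ?Hi ?Hl (biset_restr ?Z (\<lambda>x. ?D x = a))" if "a < length c" for a
    using biset_cls_eqI[OF conj_bisetD[OF conjB[OF that that that]]
        span_balanced[OF R R' P based_nth[OF S i] based_nth[OF W l] T that]]
    by (simp add: split_def)
  have Bcl: "?B a \<in> carrier ?M" if "a < length c" for a
    using conjB[OF that that that] by (intro biset_cls_closed H)
  interpret M: comm_group "groth ?M" by (rule comm_group_Hom[OF H])
  interpret m: groth_monoid ?M by (rule M)
  have "groth_bilinear ?M (balanced_cls G ?Hi (?Ha a) ?Hl) (bimor_of G (?Ha a) ?Hl (?X a)) (bimor_of G ?Hi (?Ha a) (?Y a))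
      = groth_of ?M (?B a)" if a: "a < length c" for a
    unfolding bimor_of_def
      biadditive.bilinear_groth_of[OF biadditive_balanced[OF H(1) Ha[OF a] H(2)]
        biset_cls_closed[OF Ha[OF a] H(2) X[OF a]] biset_cls_closed[OF H(1) Ha[OF a] Y[OF a]]]
    using balanced_cls_cls[OF H(1) Ha[OF a] H(2) X[OF a] Y[OF a]] by simp
  note eq = this
  have "bcomp (stabs S b) (stabs T c) (stabs W d) (smat T c W d R' q' p') (smat S b T c R q p) $$ (l, i) =
      finprod (groth ?M) (\<lambda>k. groth_bilinear ?M (balanced_cls G ?Hi (stabs T c ! k) ?Hl)
        (smat T c W d R' q' p' $$ (l, k)) (smat S b T c R q p $$ (k, i))) {..<length c}"
    using l i by (simp add: Bdot_Cmp)
  also have "\<dots> = finprod (groth ?M) (\<lambda>a. groth_of ?M (?B a)) {..<length c}"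
    using l i eq m.groth_of_closed[OF Bcl] by (intro M.finprod_cong') auto
  also have "\<dots> = groth_of ?M (finprod ?M ?B {..<length c})"
    by (rule m.groth_of_finprod[OF Bcl])
  also have "finprod ?M ?B {..<length c} =
      finprod ?M (\<lambda>a. biset_cls G ?Hi ?Hl (biset_restr ?Z (\<lambda>x. ?D x = a))) {..<length c}"
    using B Bcl by (intro m.finprod_cong') auto
  also have "\<dots> = biset_cls G ?Hi ?Hl ?Z"
  proof (rule biset_cls_partition[OF H Z, symmetric])
    note u = gmapsD[OF gset_pullbackD(2)[OF P]] and p = gmapsD[OF gspanD(5)[OF R]]
    show "?D (lact ?Z h x) = ?D x" if "h \<in> ?Hl" "x \<in> bpts ?Z" for h x
      using that by (cases x) (simp add: stab_iff u p bidx_act[OF T])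
    show "?D (ract ?Z x h) = ?D x" if "h \<in> ?Hi" "x \<in> bpts ?Z" for h x
      using that by (cases x) simp
    show "?D x < length c" if "x \<in> bpts ?Z" for x
      using that bidx[OF T] by (cases x) (simp add: u p)
  qed
  finally show "bcomp (stabs S b) (stabs T c) (stabs W d) (smat T c W d R' q' p') (smat S b T c R q p) $$ (l, i) =
      smat S b W d P (compose (gpts P) q u) (compose (gpts P) p' v) $$ (l, i)"
    using l i by (simp add: bimor_of_def)
qed (simp_all add: Bdot_Cmp)

text \<open>The fibre product is a set of pairs; \<open>gset_realize\<close> brings it back to the
  type of points.\<close>

lemma pullback_exists:
  fixes S T W R R' :: "('a, 'p) Gset"
  assumes R: "gspan S R T q p" and R': "gspan T R' W q' p'"
  shows "\<exists>(P :: ('a, 'p) Gset) u v. gset_pullback P R R' T p q' u v"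
proof -
  note DR = gsetD[OF gspanD(2)[OF R]] and DR' = gsetD[OF gspanD(2)[OF R']]
  note p = gmapsD[OF gspanD(5)[OF R]] and q' = gmapsD[OF gspanD(4)[OF R']]
  define E where "E = {(r, r'). r \<in> gpts R \<and> r' \<in> gpts R' \<and> p r = q' r'}"
  have "E \<subseteq> gpts R \<times> gpts R'" by (auto simp: E_def)
  then have "finite E" using DR(1) DR'(1) by (meson finite_SigmaI finite_subset)
  then have "\<exists>(P :: ('a, 'p) Gset) e. finite_gset G P \<and> inj_on e E \<and> gpts P = e ` E \<and>
     (\<forall>g\<in>carrier G. \<forall>x\<in>E. gact P g (e x) = e ((\<lambda>(r, r'). (gact R g r, gact R' g r')) x))"
    by (rule gset_realize) (auto simp: E_def DR DR' p q')
  then obtain P :: "('a, 'p) Gset" and e where P: "finite_gset G P" "inj_on e E" "gpts P = e ` E"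
    "\<And>g r r'. g \<in> carrier G \<Longrightarrow> (r, r') \<in> E \<Longrightarrow> gact P g (e (r, r')) = e (gact R g r, gact R' g r')" by fastforce
  define d where "d = inv_into E e"
  have d: "d (e x) = x" if "x \<in> E" for x using that P(2) by (simp add: d_def)
  have Ecl: "(gact R g r, gact R' g r') \<in> E" if "(r, r') \<in> E" "g \<in> carrier G" for g r r'
    using that by (simp add: E_def DR DR' p q')
  define u where "u = (\<lambda>z\<in>gpts P. fst (d z))"
  define v where "v = (\<lambda>z\<in>gpts P. snd (d z))"
  have uv: "u (e (r, r')) = r" "v (e (r, r')) = r'" if "(r, r') \<in> E" for r r'
    using that P(3) d[OF that] by (auto simp: u_def v_def)
  have uvP: "u z \<in> gpts R \<and> v z \<in> gpts R' \<and>
      (\<forall>g\<in>carrier G. u (gact P g z) = gact R g (u z) \<and> v (gact P g z) = gact R' g (v z))" if z: "z \<in> gpts P" for z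
  proof -
    obtain r r' where r: "(r, r') \<in> E" "z = e (r, r')" using z P(3) by auto
    then show ?thesis using uv[OF r(1)] uv[OF Ecl[OF r(1)]] P(4) by (auto simp: E_def)
  qed
  then have "u \<in> gmaps G P R" "v \<in> gmaps G P R'"
    by (auto intro!: gmapsI) (simp_all add: u_def v_def)
  moreover have "\<exists>!z. z \<in> gpts P \<and> u z = r \<and> v z = r'" if "r \<in> gpts R" "r' \<in> gpts R'" "p r = q' r'" for r r'
  proof (rule ex1I[of _ "e (r, r')"])
    have E: "(r, r') \<in> E" using that by (simp add: E_def)
    then show "e (r, r') \<in> gpts P \<and> u (e (r, r')) = r \<and> v (e (r, r')) = r'" using P(3) uv by auto
    fix z assume z: "z \<in> gpts P \<and> u z = r \<and> v z = r'"
    then obtain s s' where "(s, s') \<in> E" "z = e (s, s')" using P(3) by auto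
    then show "z = e (r, r')" using z uv by auto
  qed
  moreover have "p (u z) = q' (v z)" if z: "z \<in> gpts P" for z
  proof -
    obtain s s' where "(s, s') \<in> E" "z = e (s, s')" using P(3) z by auto
    then show ?thesis using uv by (simp add: E_def)
  qed
  ultimately have "gset_pullback P R R' T p q' u v" unfolding gset_pullback_def using P(1) by simp
  then show ?thesis by blast
qed

text \<open>When one of the two maps to \<open>T\<close> is an identity, the apex of the other span
  can be kept as the pullback. Composites with transfers and restrictions are then given by spans
  with an unchanged apex.\<close>

lemma pullback_id_left:
  assumes "gspan T R' W q' p'"
  shows "gset_pullback R' T R' T (gid T) q' q' (gid R')"
  unfolding gset_pullback_def
proof (intro conjI ballI impI)
  note q' = gmapsD(1)[OF gspanD(4)[OF assms]]
  show "gid T (q' z) = q' (gid R' z)" if "z \<in> gpts R'" for z using that q' by simp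
  show "\<exists>!z. z \<in> gpts R' \<and> q' z = r \<and> gid R' z = r'"
    if "r \<in> gpts T" "r' \<in> gpts R'" "gid T r = q' r'" for r r'
    using that by (metis gid_apply)
qed (simp_all add: gid_gmaps gspanD[OF assms])

lemma pullback_id_right:
  assumes "gspan S R T q p"
  shows "gset_pullback R R T T p (gid T) (gid R) p"
  unfolding gset_pullback_def
proof (intro conjI ballI impI)
  note p = gmapsD(1)[OF gspanD(5)[OF assms]]
  show "p (gid R z) = gid T (p z)" if "z \<in> gpts R" for z using that p by simp
  show "\<exists>!z. z \<in> gpts R \<and> gid R z = r \<and> p z = r'"
    if "r \<in> gpts R" "r' \<in> gpts T" "p r = gid T r'" for r r'
    using that by (metis gid_apply)
qed (simp_all add: gid_gmaps gspanD[OF assms])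

lemma compose_gid: "q \<in> gmaps G R S \<Longrightarrow> compose (gpts R) q (gid R) = q"
  "p \<in> gmaps G R S \<Longrightarrow> compose (gpts R) (gid S) p = p"
  by (auto simp: gmaps_def compose_def gid_def PiE_def extensional_def fun_eq_iff)

text \<open>On the diagonal the biset is the stabilizer with its translations. Off the diagonal it
  is empty, because different base points lie in different orbits.\<close>

lemma smat_gid:
  assumes S: "based S b"
  shows "smat S b S b S (gid S) (gid S) = Idn (Bdot G) (stabs S b)"
proof -
  note D = gsetD[OF based_gset[OF S]]
  have sp: "gspan S S S (gid S) (gid S)" using based_gset[OF S] by (simp add: gspan_def gid_gmaps)
  have "smat S b S b S (gid S) (gid S) $$ (a, i) = Idn (Bdot G) (stabs S b) $$ (a, i)"
    if a: "a < length b" and i: "i < length b" for a i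
  proof -
    let ?X = "span_biset S S (gid S) (gid S) (b ! i) (b ! a)"
    let ?H = "stab S (b ! i)"
    note fX = finite_span_biset[OF sp based_nth[OF S i] based_nth[OF S a]]
    note H = subgroup_stab[OF S i] subgroup_stab[OF S a]
    show ?thesis
    proof (cases "a = i")
      case True
      let ?Y = "\<lparr>bpts = ?H, lact = (\<lambda>h x. h \<otimes> x), ract = (\<lambda>x h. x \<otimes> h)\<rparr>"
      have "biset_iso ?H ?H ?X ?Y"
      proof (rule biset_isoI[of snd])
        show "inj_on snd (bpts ?X)" using True by (auto simp: inj_on_def)
        show "bpts ?Y \<subseteq> snd ` bpts ?X"
        proof
          fix g assume "g \<in> bpts ?Y"
          then have "(b ! i, g) \<in> bpts ?X" using True based_nth[OF S i] by (simp add: stab_iff)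
          then show "g \<in> snd ` bpts ?X" by (rule image_eqI[of _ snd "(b ! i, g)", rotated]) simp
        qed
        show "biset_hom ?H ?H ?X ?Y snd"
          using True by (intro biset_homI) (auto simp: stab_iff)
      qed
      then show ?thesis
        using True a i bimor_of_eqI[OF fX] by (simp add: addcompl_def Let_def Bcat_def)
    next
      case False
      have "bpts ?X = {}"
      proof (rule ccontr)
        assume "bpts ?X \<noteq> {}"
        then obtain s g where "(s, g) \<in> bpts ?X" by (metis surj_pair all_not_in_conv)
        then have sg: "g \<in> carrier G" "gid S s = b ! a" "gid S s = gact S g (b ! i)"
          unfolding span_biset_simps by blast+
        have "b ! a = gact S g (b ! i)" using sg(2,3) by simp
        then have "bidx S b (b ! a) = i" using bidx_eq[OF S i sg(1)] by simp
        then show False using bidx_nth[OF S a] False by simp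
      qed
      then show ?thesis
        using False a i bimor_of_empty[OF H fX] by (simp add: addcompl_def Let_def Bcat_def)
    qed
  qed
  then show ?thesis
    by (intro eq_matI) (simp_all add: addcompl_def Let_def)
qed

section \<open>Sums of spans\<close>

definition copair :: "('a, 'p) Gset \<Rightarrow> ('a, 'p) Gset \<Rightarrow>
  (('a, 'p) pt \<Rightarrow> ('a, 'p) pt) \<Rightarrow> (('a, 'p) pt \<Rightarrow> ('a, 'p) pt) \<Rightarrow> ('a, 'p) pt \<Rightarrow> ('a, 'p) pt" where
  "copair R R' p p' = (\<lambda>z\<in>gpts (gset_sum G R R'). case z of InL x \<Rightarrow> p x | InR y \<Rightarrow> p' y)"

lemma gset_sum_simps [simp]:
  "gpts (gset_sum G R R') = InL ` gpts R \<union> InR ` gpts R'"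
  "g \<in> carrier G \<Longrightarrow> x \<in> gpts R \<Longrightarrow> gact (gset_sum G R R') g (InL x) = InL (gact R g x)"
  "g \<in> carrier G \<Longrightarrow> y \<in> gpts R' \<Longrightarrow> gact (gset_sum G R R') g (InR y) = InR (gact R' g y)"
  by (simp_all add: gset_sum_def)

lemma copair_simps [simp]:
  "x \<in> gpts R \<Longrightarrow> copair R R' p p' (InL x) = p x"
  "y \<in> gpts R' \<Longrightarrow> copair R R' p p' (InR y) = p' y"
  by (simp_all add: copair_def)

lemma finite_gset_sum:
  assumes "finite_gset G R" "finite_gset G R'"
  shows "finite_gset G (gset_sum G R R')"
proof -
  note D = gsetD[OF assms(1)] gsetD[OF assms(2)]
  have "finite_gset G (mk_gset (InL ` gpts R \<union> InR ` gpts R')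
      (\<lambda>g z. case z of InL x \<Rightarrow> InL (gact R g x) | InR y \<Rightarrow> InR (gact R' g y)))"
    by (rule finite_mk_gset) (auto simp: D)
  then show ?thesis by (simp add: gset_sum_def mk_gset_def)
qed

lemma gmaps_sum:
  assumes "finite_gset G R" "finite_gset G R'"
  shows "p \<in> gmaps G R T \<Longrightarrow> p' \<in> gmaps G R' T \<Longrightarrow> copair R R' p p' \<in> gmaps G (gset_sum G R R') T"
    and "gset_inl R \<in> gmaps G R (gset_sum G R R')" "gset_inr R' \<in> gmaps G R' (gset_sum G R R')"
proof -
  note D = gsetD[OF assms(1)] gsetD[OF assms(2)]
  show "copair R R' p p' \<in> gmaps G (gset_sum G R R') T" if "p \<in> gmaps G R T" "p' \<in> gmaps G R' T"
    by (rule gmapsI) (auto simp: D gmapsD[OF that(1)] gmapsD[OF that(2)], simp add: copair_def)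
  show "gset_inl R \<in> gmaps G R (gset_sum G R R')" "gset_inr R' \<in> gmaps G R' (gset_sum G R R')"
    by (rule gmapsI; auto simp: D gset_inl_def gset_inr_def)+
qed

lemma gspan_sum:
  assumes "gspan S R T q p" "gspan S R' T q' p'"
  shows "gspan S (gset_sum G R R') T (copair R R' q q') (copair R R' p p')"
  using gspanD[OF assms(1)] gspanD[OF assms(2)] unfolding gspan_def
  by (simp add: finite_gset_sum gmaps_sum(1))

lemma span_biset_sum:
  fixes S R R' T :: "('a, 'p) Gset"
  assumes R: "gspan S R T q p" and R': "gspan S R' T q' p'"
  shows "biset_iso H1 (stab T y) (biset_sum (span_biset S R q p x y) (span_biset S R' q' p' x y))
    (span_biset S (gset_sum G R R') (copair R R' q q') (copair R R' p p') x y)"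
proof (rule biset_isoI)
  let ?f = "case_sum (\<lambda>(r, g). (InL r, g)) (\<lambda>(r, g). (InR r, g))"
  let ?X = "biset_sum (span_biset S R q p x y) (span_biset S R' q' p' x y)"
  let ?Y = "span_biset S (gset_sum G R R') (copair R R' q q') (copair R R' p p') x y"
  show "inj_on ?f (bpts ?X)" by (auto simp: inj_on_def)
  show "bpts ?Y \<subseteq> ?f ` bpts ?X"
  proof
    fix z assume z: "z \<in> bpts ?Y"
    obtain s g where sg: "z = (s, g)" by (metis surj_pair)
    have "s \<in> InL ` gpts R \<union> InR ` gpts R'" using z unfolding sg by simp
    then consider r where "s = InL r" "r \<in> gpts R" | r where "s = InR r" "r \<in> gpts R'" by blast
    then show "z \<in> ?f ` bpts ?X"
    proof cases
      case 1 then show ?thesis using z unfolding sg by (intro image_eqI[of _ _ "Inl (r, g)"]) auto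
    next
      case 2 then show ?thesis using z unfolding sg by (intro image_eqI[of _ _ "Inr (r, g)"]) auto
    qed
  qed
  show "biset_hom H1 (stab T y) ?X ?Y ?f"
    by (rule biset_homI) (auto simp: stab_iff)
qed

lemma smat_add:
  assumes S: "based S b" and T: "based T c" and R: "gspan S R T q p" and R': "gspan S R' T q' p'"
  shows "smat S b T c (gset_sum G R R') (copair R R' q q') (copair R R' p p') =
    smat S b T c R q p \<otimes>\<^bsub>BHom (stabs S b) (stabs T c)\<^esub> smat S b T c R' q' p'"
proof (rule eq_matI)
  fix a i assume "a < dim_row (smat S b T c R q p \<otimes>\<^bsub>BHom (stabs S b) (stabs T c)\<^esub> smat S b T c R' q' p')"
    "i < dim_col (smat S b T c R q p \<otimes>\<^bsub>BHom (stabs S b) (stabs T c)\<^esub> smat S b T c R' q' p')"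
  then have a: "a < length c" and i: "i < length b" by (simp_all add: Bdot_mult)
  note H = subgroup_stab[OF S i] subgroup_stab[OF T a]
  note X = conj_span_biset[OF R based_nth[OF S i] based_nth[OF T a]]
  note X' = conj_span_biset[OF R' based_nth[OF S i] based_nth[OF T a]]
  interpret m: groth_monoid "conj_biset_monoid G (stab S (b ! i)) (stab T (c ! a))"
    by (rule groth_monoid_conj_biset[OF H])
  show "smat S b T c (gset_sum G R R') (copair R R' q q') (copair R R' p p') $$ (a, i) =
    (smat S b T c R q p \<otimes>\<^bsub>BHom (stabs S b) (stabs T c)\<^esub> smat S b T c R' q' p') $$ (a, i)"
    using a i biset_cls_closed[OF H X] biset_cls_closed[OF H X']
    by (simp add: Bdot_mult bimor_of_def biset_cls_mult[OF H X X'] flip: m.groth_of_mult)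
      (simp add: biset_cls_eqI[OF conj_bisetD[OF conj_biset_sum[OF H X X']] span_biset_sum[OF R R']])
qed (simp_all add: Bdot_mult)

text \<open>The isomorphism of bisets multiplies the \<open>G\<close>-component by \<open>u\<close>.\<close>

lemma smat_inner:
  assumes S: "based S b" and T: "based T c" and R: "gspan S R T q p" and \<alpha>: "\<alpha> \<in> gmaps G R R"
    and u: "\<And>x. x \<in> gpts R \<Longrightarrow> u x \<in> carrier G" "\<And>x. x \<in> gpts R \<Longrightarrow> \<alpha> x = gact R (u x) x"
      "\<And>x g. x \<in> gpts R \<Longrightarrow> g \<in> carrier G \<Longrightarrow> u (gact R g x) = g \<otimes> u x \<otimes> inv g"
  shows "smat S b T c R q (compose (gpts R) p \<alpha>) = smat S b T c R q p"
proof -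
  note D = gsetD[OF gspanD(1)[OF R]] gsetD[OF gspanD(2)[OF R]] 
  note q = gmapsD[OF gspanD(4)[OF R]] and a = gmapsD[OF \<alpha>]
  \<comment> \<open>At the point u(x) x the conjugation rule gives u(x) u(x) u(x)^-1 = u(x). Hence
    two points with the same image under \<open>\<alpha>\<close> have the same conjugator, which is
    then removed.\<close>
  have uu: "u (\<alpha> x) = u x" if "x \<in> gpts R" for x using that u by (simp add: m_assoc)
  have R': "gspan S R T q (compose (gpts R) p \<alpha>)"
    using gspanD[OF R] \<alpha> by (simp add: gspan_def compose_gmaps)
  have "biset_iso (stab S x) (stab T y) (span_biset S R q (compose (gpts R) p \<alpha>) x y) (span_biset S R q p x y)"
    if x: "x \<in> gpts S" and y: "y \<in> gpts T" for x y
  proof (rule biset_isoI)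
    let ?X = "span_biset S R q (compose (gpts R) p \<alpha>) x y" and ?Y = "span_biset S R q p x y"
    let ?f = "\<lambda>(r, g). (\<alpha> r, u r \<otimes> g)"
    have inj: "r = r'" if "r \<in> gpts R" "r' \<in> gpts R" "\<alpha> r = \<alpha> r'" for r r'
    proof -
      have "u r = u r'" using uu that by metis
      then have "gact R (u r) r = gact R (u r) r'" using u(2) that by metis
      then show ?thesis using D(12)[OF u(1)[OF that(1)]] that by metis
    qed
    show "inj_on ?f (bpts ?X)"
    proof (rule inj_onI)
      fix z z' assume z: "z \<in> bpts ?X" "z' \<in> bpts ?X" "?f z = ?f z'"
      obtain r g r' g' where eq: "z = (r, g)" "z' = (r', g')" by (metis surj_pair)
      have "r = r'" using z unfolding eq by (auto intro: inj)
      then show "z = z'" using z u(1)[of r] unfolding eq by simp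
    qed
    show "bpts ?Y \<subseteq> ?f ` bpts ?X"
    proof
      fix z assume z: "z \<in> bpts ?Y"
      obtain r g where eq: "z = (r, g)" by (metis surj_pair)
      have r: "r \<in> gpts R" "g \<in> carrier G" "p r = y" "q r = gact S g x" using z unfolding eq by simp_all
      \<comment> \<open>Translating by a power of \<open>u r\<close> does not change
        \<open>u\<close>, so \<open>\<alpha>\<close> moves this point back to
        \<open>r\<close>.\<close>
      let ?r = "gact R (inv (u r)) r"
      have ur: "u ?r = u r" using r u(1) by (simp add: u(3) m_assoc mult_inv_cancel)
      have ar: "\<alpha> ?r = r" using u(2)[of ?r] ur r u(1) by (simp add: D)
      have mem: "(?r, inv (u r) \<otimes> g) \<in> bpts ?X"
        using r u(1) x by (simp add: compose_eq D q ar)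
      have "z = ?f (?r, inv (u r) \<otimes> g)" using r u(1) unfolding eq by (simp add: ar ur mult_inv_cancel)
      then show "z \<in> ?f ` bpts ?X" using mem by (rule image_eqI)
    qed
    show "biset_hom (stab S x) (stab T y) ?X ?Y ?f"
    proof (rule biset_homI)
      fix z assume z: "z \<in> bpts ?X"
      obtain r g where eq: "z = (r, g)" by (metis surj_pair)
      have r: "r \<in> gpts R" "g \<in> carrier G" "p (\<alpha> r) = y" "q r = gact S g x"
        using z unfolding eq by (auto simp: compose_eq)
      have "q (\<alpha> r) = gact S (u r \<otimes> g) x" using r(1,2,4) u(1,2) x by (simp add: q D)
      then show "?f z \<in> bpts ?Y" unfolding eq using r u(1) by (simp add: a(1))
      show "?f (lact ?X h z) = lact ?Y h (?f z)" if "h \<in> stab T y" for h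
        unfolding eq using r(1,2) u(1) that by (simp add: stab_iff a u(3) m_assoc mult_inv_cancel)
      show "?f (ract ?X z h) = ract ?Y (?f z) h" if "h \<in> stab S x" for h
        unfolding eq using r(1,2) u(1) that by (simp add: stab_iff m_assoc)
    qed
  qed
  then have "smat S b T c R q (compose (gpts R) p \<alpha>) = mat (length c) (length b)
      (\<lambda>(a, i). bimor_of G (stab S (b ! i)) (stab T (c ! a)) (span_biset S R q p (b ! i) (c ! a)))"
    using based_nth[OF S] based_nth[OF T] by (intro smat_eqI[OF S T R']) blast
  then show ?thesis by (simp only: smat_def)
qed

text \<open>The \<open>G\<close>-set of a conjugation biset \<open>X\<close> with mark \<open>m\<close> is \<open>G \<times>\<^sub>K (X / H)\<close>; its points are
  represented as \<open>K \<times> H\<close>-orbits in \<open>G \<times> X\<close>, and \<open>m\<close> provides the map to the left foot.\<close>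

lemma realize_bisets:
  fixes S T :: "('a, 'p) Gset" and X :: "nat \<Rightarrow> nat \<Rightarrow> ('a, 'x) biset"
  assumes S: "based S b" and T: "based T c"
    and X: "\<And>a i. a < length c \<Longrightarrow> i < length b \<Longrightarrow> conj_biset G (stab S (b ! i)) (stab T (c ! a)) (X a i)"
  shows "\<exists>R q p. gspan S R T q p \<and> (\<forall>a<length c. \<forall>i<length b.
    biset_iso (stab S (b ! i)) (stab T (c ! a)) (X a i) (span_biset S R q p (b ! i) (c ! a)))"
proof -
  let ?H = "\<lambda>i. stab S (b ! i)" and ?K = "\<lambda>a. stab T (c ! a)"
  note DS = gsetD[OF based_gset[OF S]] and DT = gsetD[OF based_gset[OF T]]
  note bS = based_nth[OF S] and cT = based_nth[OF T]
  have sub: "\<And>i. i < length b \<Longrightarrow> subgroup (?H i) G" "\<And>a. a < length c \<Longrightarrow> subgroup (?K a) G"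
    using subgroup_stab[OF S] subgroup_stab[OF T] by blast+
  have "\<forall>a i. \<exists>m. a < length c \<longrightarrow> i < length b \<longrightarrow> biset_mark G (?H i) (?K a) (X a i) m"
    using mark_of_conj_biset[OF sub X] by blast
  then obtain m where m: "\<And>a i. a < length c \<Longrightarrow> i < length b \<Longrightarrow> biset_mark G (?H i) (?K a) (X a i) (m a i)"
    by metis
  note mD = biset_markD[OF m]
  note xD = finite_bisetD[OF conj_bisetD[OF X]]
  \<comment> \<open>One G-set for the whole matrix: the indices \<open>a\<close> and
    \<open>i\<close> keep the contributions of different entries apart.\<close>
  define Z where "Z = {(g, a, i, x). g \<in> carrier G \<and> a < length c \<and> i < length b \<and> x \<in> bpts (X a i)}"
  define cl where "cl = (\<lambda>(g, a, i, x). (\<lambda>(k, h). (g \<otimes> inv k, a, i, lact (X a i) k (ract (X a i) x h))) ` (?K a \<times> ?H i))"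
  have one: "\<one> \<in> ?K a" "\<one> \<in> ?H i" if "a < length c" "i < length b" for a i
    using subgroup.one_closed[OF sub(2)[OF that(1)]] subgroup.one_closed[OF sub(1)[OF that(2)]] .
  have mult: "k \<in> ?K a \<Longrightarrow> k' \<in> ?K a \<Longrightarrow> k \<otimes> k' \<in> ?K a" "h \<in> ?H i \<Longrightarrow> h' \<in> ?H i \<Longrightarrow> h \<otimes> h' \<in> ?H i"
    "k \<in> ?K a \<Longrightarrow> inv k \<in> ?K a" "h \<in> ?H i \<Longrightarrow> inv h \<in> ?H i"
    if "a < length c" "i < length b" for a i k k' h h'
    using subgroup.m_closed[OF sub(2)[OF that(1)]] subgroup.m_closed[OF sub(1)[OF that(2)]]
      subgroup.m_inv_closed[OF sub(2)[OF that(1)]] subgroup.m_inv_closed[OF sub(1)[OF that(2)]] by blast+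
  have cc: "k \<in> ?K a \<Longrightarrow> k \<in> carrier G" "h \<in> ?H i \<Longrightarrow> h \<in> carrier G" for a i k h
    by (simp_all add: stab_iff)
  have cl_self: "(g, a, i, x) \<in> cl (g, a, i, x)" if "(g, a, i, x) \<in> Z" for g a i x
    unfolding cl_def split_conv using that one[of a i]
    by (intro image_eqI[of _ _ "(\<one>, \<one>)"]) (simp_all add: Z_def xD)
  have cl_sub: "cl (g \<otimes> inv k, a, i, lact (X a i) k (ract (X a i) x h)) \<subseteq> cl (g, a, i, x)"
    if z: "(g, a, i, x) \<in> Z" and k: "k \<in> ?K a" and h: "h \<in> ?H i" for g a i x k h
  proof
    have ai: "a < length c" "i < length b" "x \<in> bpts (X a i)" "g \<in> carrier G" using z by (simp_all add: Z_def)
    fix w assume "w \<in> cl (g \<otimes> inv k, a, i, lact (X a i) k (ract (X a i) x h))"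
    then obtain k' h' where kh: "k' \<in> ?K a" "h' \<in> ?H i"
      "w = (g \<otimes> inv k \<otimes> inv k', a, i, lact (X a i) k' (ract (X a i) (lact (X a i) k (ract (X a i) x h)) h'))"
      unfolding cl_def by auto
    have "w = (g \<otimes> inv (k' \<otimes> k), a, i, lact (X a i) (k' \<otimes> k) (ract (X a i) x (h \<otimes> h')))"
      unfolding kh(3) using ai k h kh(1,2) cc by (simp add: xD inv_mult_group m_assoc)
    moreover have "k' \<otimes> k \<in> ?K a" "h \<otimes> h' \<in> ?H i" using mult[OF ai(1,2)] k h kh by blast+
    ultimately show "w \<in> cl (g, a, i, x)" unfolding cl_def by force
  qed
  have Zmv: "(g \<otimes> inv k, a, i, lact (X a i) k (ract (X a i) x h)) \<in> Z"
    if "(g, a, i, x) \<in> Z" "k \<in> ?K a" "h \<in> ?H i" for g a i x k h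
    using that cc by (simp add: Z_def xD)
  have cl_mv: "cl (g \<otimes> inv k, a, i, lact (X a i) k (ract (X a i) x h)) = cl (g, a, i, x)"
    if z: "(g, a, i, x) \<in> Z" and k: "k \<in> ?K a" and h: "h \<in> ?H i" for g a i x k h
  proof
    have ai: "a < length c" "i < length b" "x \<in> bpts (X a i)" "g \<in> carrier G" using z by (simp_all add: Z_def)
    have inv: "inv k \<in> ?K a" "inv h \<in> ?H i" using mult[OF ai(1,2)] k h by blast+
    have "(g \<otimes> inv k \<otimes> inv (inv k), a, i, lact (X a i) (inv k) (ract (X a i) (lact (X a i) k (ract (X a i) x h)) (inv h)))
        = (g \<otimes> inv (inv k \<otimes> k), a, i, lact (X a i) (inv k \<otimes> k) (ract (X a i) x (h \<otimes> inv h)))"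
      using ai k h inv cc by (simp only: xD inv_mult_group m_assoc inv_closed)
    also have "\<dots> = (g, a, i, x)" using ai cc(1)[OF k] cc(2)[OF h] by (simp add: xD)
    finally show "cl (g, a, i, x) \<subseteq> cl (g \<otimes> inv k, a, i, lact (X a i) k (ract (X a i) x h))"
      using cl_sub[OF Zmv[OF z k h] inv] by simp
  qed (rule cl_sub[OF z k h])
  define E where "E = cl ` Z"
  define act where "act g = (`) (\<lambda>(g0, a :: nat, i :: nat, x). (g \<otimes> g0, a, i, x :: 'x))" for g
  have act: "act g (cl (g0, a, i, x)) = cl (g \<otimes> g0, a, i, x)" if "(g0, a, i, x) \<in> Z" "g \<in> carrier G" for g g0 a i x
    unfolding act_def cl_def split_conv image_image
    using that cc(1) by (intro image_cong) (auto simp: Z_def m_assoc)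
  have Zact: "(g \<otimes> g0, a, i, x) \<in> Z" if "(g0, a, i, x) \<in> Z" "g \<in> carrier G" for g g0 a i x
    using that by (simp add: Z_def)
  have "Z \<subseteq> carrier G \<times> (\<Union>a\<in>{..<length c}. {a} \<times> (\<Union>i\<in>{..<length b}. {i} \<times> bpts (X a i)))"
    by (auto simp: Z_def)
  moreover have "finite (carrier G \<times> (\<Union>a\<in>{..<length c}. {a} \<times> (\<Union>i\<in>{..<length b}. {i} \<times> bpts (X a i))))"
    using finite_carrier xD(1) by (intro finite_cartesian_product finite_UN_I) auto
  ultimately have "finite Z" by (rule finite_subset)
  then have "finite E" by (simp add: E_def)
  then have "\<exists>(R :: ('a, 'p) Gset) e. finite_gset G R \<and> inj_on e E \<and> gpts R = e ` E \<and>
     (\<forall>g\<in>carrier G. \<forall>x\<in>E. gact R g (e x) = e (act g x))"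
  proof (rule gset_realize)
    fix P assume "P \<in> E"
    then obtain g0 a i x where P: "(g0, a, i, x) \<in> Z" "P = cl (g0, a, i, x)" by (auto simp: E_def)
    have g0: "g0 \<in> carrier G" using P by (simp add: Z_def)
    show "act \<one> P = P" using P g0 by (simp add: act)
    show "act g P \<in> E" if "g \<in> carrier G" for g
      unfolding E_def using P that Zact[OF P(1) that] by (simp add: act)
    show "act (g \<otimes> h) P = act g (act h P)" if "g \<in> carrier G" "h \<in> carrier G" for g h
      using P that g0 Zact[OF P(1) that(2)] by (simp add: act m_assoc)
  qed
  then obtain R :: "('a, 'p) Gset" and e where R0: "finite_gset G R \<and> inj_on e E \<and> gpts R = e ` E \<and>
     (\<forall>g\<in>carrier G. \<forall>x\<in>E. gact R g (e x) = e (act g x))" by (elim exE) (rule that)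
  have R: "finite_gset G R" "inj_on e E" "gpts R = e ` E"
    "\<And>g P. g \<in> carrier G \<Longrightarrow> P \<in> E \<Longrightarrow> gact R g (e P) = e (act g P)"
    using R0 by simp_all
  \<comment> \<open>Both legs are constant on classes. For the right leg, \<open>k\<close> fixes
    \<open>c ! a\<close>; for the left leg, replacing x by k x h and g by g k^-1 turns g m(x) into g
    m(x) h, and \<open>h\<close> fixes \<open>b ! i\<close>.\<close>
  define pp where "pp P = the_elem ((\<lambda>(g, a, i, x). gact T g (c ! a)) ` P)" for P :: "('a \<times> nat \<times> nat \<times> 'x) set"
  define qq where "qq P = the_elem ((\<lambda>(g, a, i, x). gact S (g \<otimes> m a i x) (b ! i)) ` P)" for P
  have pp: "pp (cl (g, a, i, x)) = gact T g (c ! a)" and qq: "qq (cl (g, a, i, x)) = gact S (g \<otimes> m a i x) (b ! i)"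
    if z: "(g, a, i, x) \<in> Z" for g a i x
  proof -
    have ai: "a < length c" "i < length b" "x \<in> bpts (X a i)" "g \<in> carrier G" using z by (simp_all add: Z_def)
    have 1: "gact T (g \<otimes> inv k) (c ! a) = gact T g (c ! a)" if "k \<in> ?K a" for k
      using mult(3)[OF ai(1,2) that] ai cT by (simp add: DT stab_iff)
    have 2: "gact S (g \<otimes> inv k \<otimes> m a i (lact (X a i) k (ract (X a i) x h))) (b ! i) = gact S (g \<otimes> m a i x) (b ! i)"
      if "k \<in> ?K a" "h \<in> ?H i" for k h
    proof -
      have "g \<otimes> inv k \<otimes> m a i (lact (X a i) k (ract (X a i) x h)) = (g \<otimes> m a i x) \<otimes> h"
        using that ai cc(1)[OF that(1)] cc(2)[OF that(2)] by (simp add: mD xD m_assoc mult_inv_cancel)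
      then show ?thesis using that ai bS by (simp add: DS stab_iff mD)
    qed
    have ne: "cl (g, a, i, x) \<noteq> {}" using cl_self[OF z] by blast
    have "(\<lambda>(g, a, i, x). gact T g (c ! a)) ` cl (g, a, i, x) = {gact T g (c ! a)}"
      using ne 1 unfolding cl_def by (auto simp: image_iff)
    then show "pp (cl (g, a, i, x)) = gact T g (c ! a)" by (simp add: pp_def)
    have "(\<lambda>(g, a, i, x). gact S (g \<otimes> m a i x) (b ! i)) ` cl (g, a, i, x) = {gact S (g \<otimes> m a i x) (b ! i)}"
      using ne 2 unfolding cl_def by (auto simp: image_iff)
    then show "qq (cl (g, a, i, x)) = gact S (g \<otimes> m a i x) (b ! i)" by (simp add: qq_def)
  qed
  define d where "d = inv_into E e"
  have d: "d (e P) = P" if "P \<in> E" for P using that R(2) by (simp add: d_def)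
  define p where "p = (\<lambda>z\<in>gpts R. pp (d z))"
  define q where "q = (\<lambda>z\<in>gpts R. qq (d z))"
  have R_cases: "\<exists>g a i x. (g, a, i, x) \<in> Z \<and> r = e (cl (g, a, i, x))" if "r \<in> gpts R" for r
    using that unfolding R(3) E_def by auto
  have clR: "e (cl z) \<in> gpts R" if "z \<in> Z" for z using that by (simp add: R(3) E_def)
  have p: "p (e (cl (g, a, i, x))) = gact T g (c ! a)" and q: "q (e (cl (g, a, i, x))) = gact S (g \<otimes> m a i x) (b ! i)"
    and gact_R: "h \<in> carrier G \<Longrightarrow> gact R h (e (cl (g, a, i, x))) = e (cl (h \<otimes> g, a, i, x))"
    if z: "(g, a, i, x) \<in> Z" for g a i x h
  proof -
    have E: "cl (g, a, i, x) \<in> E" using z by (simp add: E_def)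
    show "p (e (cl (g, a, i, x))) = gact T g (c ! a)" "q (e (cl (g, a, i, x))) = gact S (g \<otimes> m a i x) (b ! i)"
      using clR[OF z] d[OF E] pp[OF z] qq[OF z] by (simp_all add: p_def q_def)
    show "gact R h (e (cl (g, a, i, x))) = e (cl (h \<otimes> g, a, i, x))" if "h \<in> carrier G"
      using R(4)[OF that E] act[OF z that] by simp
  qed
  have pq: "p r \<in> gpts T \<and> q r \<in> gpts S \<and> (\<forall>h\<in>carrier G. p (gact R h r) = gact T h (p r) \<and> q (gact R h r) = gact S h (q r))"
    if rR: "r \<in> gpts R" for r
  proof -
    obtain g a i x where z: "(g, a, i, x) \<in> Z" "r = e (cl (g, a, i, x))" using R_cases[OF rR] by blast
    have ai: "a < length c" "i < length b" "x \<in> bpts (X a i)" "g \<in> carrier G" using z by (simp_all add: Z_def)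
    show ?thesis unfolding z(2)
      using ai cT bS mD(1)[OF ai(1,2,3)] Zact[OF z(1)] by (simp add: gact_R[OF z(1)] p q z(1) DT DS m_assoc)
  qed
  have "p \<in> gmaps G R T" "q \<in> gmaps G R S"
    using pq by (auto intro!: gmapsI) (simp_all add: p_def q_def)
  then have sp: "gspan S R T q p" using R(1) based_gset[OF S] based_gset[OF T] by (simp add: gspan_def)
  have "biset_iso (?H i) (?K a) (X a i) (span_biset S R q p (b ! i) (c ! a))" if a: "a < length c" and i: "i < length b" for a i
  proof (rule biset_isoI)
    \<comment> \<open>The mark becomes the second component. It is what makes the map injective:
      equality of classes with first component 1 leaves only the ambiguity of \<open>h\<close>, and
      equality of marks forces \<open>h\<close> to be 1.\<close>
    let ?f = "\<lambda>x. (e (cl (\<one>, a, i, x)), m a i x)" and ?Y = "span_biset S R q p (b ! i) (c ! a)"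
    have Z1: "(\<one>, a, i, x) \<in> Z" if "x \<in> bpts (X a i)" for x using a i that by (simp add: Z_def)
    show "inj_on ?f (bpts (X a i))"
    proof (rule inj_onI)
      fix x y assume x: "x \<in> bpts (X a i)" and y: "y \<in> bpts (X a i)" and eq: "?f x = ?f y"
      have "cl (\<one>, a, i, x) = cl (\<one>, a, i, y)" using eq d Z1[OF x] Z1[OF y] by (metis E_def Pair_inject image_eqI)
      then have "(\<one>, a, i, x) \<in> cl (\<one>, a, i, y)" using cl_self[OF Z1[OF x]] by simp
      then obtain k h where kh: "k \<in> ?K a" "h \<in> ?H i" "\<one> = \<one> \<otimes> inv k" "x = lact (X a i) k (ract (X a i) y h)"
        unfolding cl_def by auto
      have k: "k = \<one>" using kh(1,3) cc(1)[OF kh(1)] by (metis inv_closed inv_inv inv_one l_one)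
      have "m a i y \<otimes> h = m a i y" using eq kh(4) y a i kh(2) unfolding k by (simp add: xD mD)
      then have "h = \<one>" using mD(1)[OF a i y] cc(2)[OF kh(2)] by simp
      then show "x = y" using kh(4) k a i y by (simp add: xD)
    qed
    show "bpts ?Y \<subseteq> ?f ` bpts (X a i)"
    proof
      fix z assume z: "z \<in> bpts ?Y"
      obtain r g where rg: "z = (r, g)" by (metis surj_pair)
      have r: "r \<in> gpts R" "g \<in> carrier G" "p r = c ! a" "q r = gact S g (b ! i)"
        using z unfolding rg by simp_all
      obtain g0 a' i' x where w: "(g0, a', i', x) \<in> Z" "r = e (cl (g0, a', i', x))" using R_cases[OF r(1)] by blast
      have w': "a' < length c" "i' < length b" "x \<in> bpts (X a' i')" "g0 \<in> carrier G" using w by (simp_all add: Z_def)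
      note mx = mD(1)[OF w'(1,2,3)]
      have pc: "gact T g0 (c ! a') = c ! a" using r(3) p[OF w(1)] w(2) by simp
      have aa: "a' = a" using bidx_eq[OF T w'(1) w'(4)] bidx_nth[OF T a] pc by simp
      have qc: "gact S (g0 \<otimes> m a' i' x) (b ! i') = gact S g (b ! i)" using r(4) q[OF w(1)] w(2) by simp
      have ii: "i' = i" using bidx_eq[OF S w'(2), of "g0 \<otimes> m a' i' x"] bidx_eq[OF S i r(2)] qc w'(4) mx by simp
      note w' = w'[unfolded aa ii] and mx = mx[unfolded aa ii] and qc = qc[unfolded aa ii]
      have g0: "g0 \<in> ?K a" using pc aa w'(4) by (simp add: stab_iff)
      \<comment> \<open>The representative is moved within its class. Taking k = \<open>g0\<close>
        makes the first component 1, and this \<open>?h\<close> corrects the mark to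
        \<open>g\<close>.\<close>
      let ?n = "g0 \<otimes> m a i x" and ?h = "inv (g0 \<otimes> m a i x) \<otimes> g"
      have n: "?n \<in> carrier G" using w'(4) mx by simp
      have "gact S ?h (b ! i) = gact S (inv ?n) (gact S ?n (b ! i))"
        using qc bS[OF i] n r(2) DS(4)[of "inv ?n" g] by simp
      then have h: "?h \<in> ?H i" using n r(2) bS[OF i] by (simp add: stab_iff DS)
      let ?x = "lact (X a i) g0 (ract (X a i) x ?h)"
      have x: "?x \<in> bpts (X a i)" using g0 h w'(3) a i by (simp add: xD)
      have "r = e (cl (g0 \<otimes> inv g0, a, i, ?x))" using cl_mv[OF w(1)[unfolded aa ii] g0 h] w(2) aa ii by simp
      then have "r = e (cl (\<one>, a, i, ?x))" using w'(4) by simp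
      moreover have "m a i ?x = g0 \<otimes> (m a i x \<otimes> ?h)" using g0 h w'(3) a i by (simp add: mD xD)
      then have "m a i ?x = g" using w'(4) mx r(2) n by (simp add: mult_inv_cancel flip: m_assoc)
      ultimately have "z = ?f ?x" unfolding rg by simp
      then show "z \<in> ?f ` bpts (X a i)" using x by (rule image_eqI)
    qed
    show "biset_hom (?H i) (?K a) (X a i) ?Y ?f"
    proof (rule biset_homI)
      fix x assume x: "x \<in> bpts (X a i)"
      show "?f x \<in> bpts ?Y"
        using clR[OF Z1[OF x]] mD(1)[OF a i x] cT[OF a] by (simp add: p q Z1[OF x] DT)
      show "?f (lact (X a i) k x) = lact ?Y k (?f x)" if k: "k \<in> ?K a" for k
      proof -
        have "(k \<otimes> \<one>, a, i, x) \<in> Z" by (rule Zact[OF Z1[OF x] cc(1)[OF k]])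
        then have "cl (k \<otimes> \<one> \<otimes> inv k, a, i, lact (X a i) k (ract (X a i) x \<one>)) = cl (k \<otimes> \<one>, a, i, x)"
          by (rule cl_mv) (use k one[OF a i] in auto)
        then show ?thesis using x k cc(1)[OF k] a i by (simp add: gact_R[OF Z1[OF x]] mD xD)
      qed
      show "?f (ract (X a i) x h) = ract ?Y (?f x) h" if h: "h \<in> ?H i" for h
        using cl_mv[OF Z1[OF x] one(1)[OF a i] h] x h a i by (simp add: mD xD)
    qed
  qed
  then show ?thesis using sp by blast
qed

lemma realize_classes:
  fixes S T :: "('a, 'p) Gset"
  assumes S: "based S b" and T: "based T c"
    and X: "\<And>a i. a < length c \<Longrightarrow> i < length b \<Longrightarrow> P a i \<in> carrier (conj_biset_monoid G (stab S (b ! i)) (stab T (c ! a)))"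
  shows "\<exists>R q p. gspan S R T q p \<and> (\<forall>a<length c. \<forall>i<length b.
    P a i = biset_cls G (stab S (b ! i)) (stab T (c ! a)) (span_biset S R q p (b ! i) (c ! a)))"
proof -
  have "\<forall>a i. \<exists>X :: ('a, nat) biset. a < length c \<longrightarrow> i < length b \<longrightarrow>
      conj_biset G (stab S (b ! i)) (stab T (c ! a)) X \<and> P a i = biset_cls G (stab S (b ! i)) (stab T (c ! a)) X"
    using conj_biset_monoid_cases[OF X] by metis
  then obtain X :: "nat \<Rightarrow> nat \<Rightarrow> ('a, nat) biset" where X:
    "\<And>a i. a < length c \<Longrightarrow> i < length b \<Longrightarrow> conj_biset G (stab S (b ! i)) (stab T (c ! a)) (X a i)"
    "\<And>a i. a < length c \<Longrightarrow> i < length b \<Longrightarrow> P a i = biset_cls G (stab S (b ! i)) (stab T (c ! a)) (X a i)"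
    by metis
  obtain R q p where R: "gspan S R T q p" "\<And>a i. a < length c \<Longrightarrow> i < length b \<Longrightarrow>
    biset_iso (stab S (b ! i)) (stab T (c ! a)) (X a i) (span_biset S R q p (b ! i) (c ! a))"
    using realize_bisets[OF S T X(1)] by blast
  have "P a i = biset_cls G (stab S (b ! i)) (stab T (c ! a)) (span_biset S R q p (b ! i) (c ! a))"
    if "a < length c" "i < length b" for a i
    using X(2)[OF that] biset_cls_eqI[OF conj_bisetD[OF X(1)[OF that]] R(2)[OF that]] by simp
  then show ?thesis using R(1) by blast
qed

text \<open>Each entry is a difference of two classes. All positive parts are realised by one span
  and all negative parts by another, so the matrix as a whole is a difference of two spans.\<close>

lemma smat_difference:
  fixes S T :: "('a, 'p) Gset"
  assumes S: "based S b" and T: "based T c" and A: "A \<in> carrier (BHom (stabs S b) (stabs T c))"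
  shows "\<exists>R q p R' q' p'. gspan S R T q p \<and> gspan S R' T q' p' \<and>
    A \<otimes>\<^bsub>BHom (stabs S b) (stabs T c)\<^esub> smat S b T c R' q' p' = smat S b T c R q p"
proof -
  let ?M = "\<lambda>a i. conj_biset_monoid G (stab S (b ! i)) (stab T (c ! a))"
  have M: "groth_monoid (?M a i)" if "a < length c" "i < length b" for a i
    using groth_monoid_conj_biset[OF subgroup_stab[OF S that(2)] subgroup_stab[OF T that(1)]] .
  have Ae: "A $$ (a, i) \<in> carrier (groth (?M a i))" if "a < length c" "i < length b" for a i
    using A that unfolding Bdot_carrier by simp
  have "\<forall>a i. \<exists>x y. a < length c \<longrightarrow> i < length b \<longrightarrow> x \<in> carrier (?M a i) \<and> y \<in> carrier (?M a i) \<and>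
      A $$ (a, i) \<otimes>\<^bsub>groth (?M a i)\<^esub> groth_of (?M a i) y = groth_of (?M a i) x"
    using groth_monoid.groth_difference[OF M Ae] by metis
  then obtain x y where xy: "\<And>a i. a < length c \<Longrightarrow> i < length b \<Longrightarrow> x a i \<in> carrier (?M a i)"
    "\<And>a i. a < length c \<Longrightarrow> i < length b \<Longrightarrow> y a i \<in> carrier (?M a i)"
    "\<And>a i. a < length c \<Longrightarrow> i < length b \<Longrightarrow>
      A $$ (a, i) \<otimes>\<^bsub>groth (?M a i)\<^esub> groth_of (?M a i) (y a i) = groth_of (?M a i) (x a i)"
    by metis
  obtain R q p where R: "gspan S R T q p" "\<And>a i. a < length c \<Longrightarrow> i < length b \<Longrightarrow>
    x a i = biset_cls G (stab S (b ! i)) (stab T (c ! a)) (span_biset S R q p (b ! i) (c ! a))"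
    using realize_classes[OF S T xy(1)] by blast
  obtain R' q' p' where R': "gspan S R' T q' p'" "\<And>a i. a < length c \<Longrightarrow> i < length b \<Longrightarrow>
    y a i = biset_cls G (stab S (b ! i)) (stab T (c ! a)) (span_biset S R' q' p' (b ! i) (c ! a))"
    using realize_classes[OF S T xy(2)] by blast
  have "A \<otimes>\<^bsub>BHom (stabs S b) (stabs T c)\<^esub> smat S b T c R' q' p' = smat S b T c R q p"
    using xy(3) R(2) R'(2) by (intro eq_matI) (simp_all add: Bdot_mult bimor_of_def)
  then show ?thesis using R(1) R'(1) by blast
qed

text \<open>Equal entries are isomorphic only after a biset has been added, possibly a different one
  for each entry. The span \<open>E\<close> realises all these additional bisets at the same
  time.\<close>

lemma smat_eqD:
  fixes S T :: "('a, 'p) Gset"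
  assumes S: "based S b" and T: "based T c" and R: "gspan S R T q p" and R': "gspan S R' T q' p'"
    and eq: "smat S b T c R q p = smat S b T c R' q' p'"
  shows "\<exists>E s t. gspan S E T s t \<and> (\<forall>a<length c. \<forall>i<length b.
    biset_iso (stab S (b ! i)) (stab T (c ! a))
      (span_biset S (gset_sum G R E) (copair R E q s) (copair R E p t) (b ! i) (c ! a))
      (span_biset S (gset_sum G R' E) (copair R' E q' s) (copair R' E p' t) (b ! i) (c ! a)))"
proof -
  let ?H = "\<lambda>i. stab S (b ! i)" and ?K = "\<lambda>a. stab T (c ! a)"
  let ?M = "\<lambda>a i. conj_biset_monoid G (?H i) (?K a)"
  note H = subgroup_stab[OF S] and K = subgroup_stab[OF T]
  note sp = conj_span_biset[OF _ based_nth[OF S] based_nth[OF T]]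
  let ?c = "\<lambda>R q p a i. biset_cls G (?H i) (?K a) (span_biset S R q p (b ! i) (c ! a))"
  have "\<exists>e\<in>carrier (?M a i). ?c R q p a i \<otimes>\<^bsub>?M a i\<^esub> e = ?c R' q' p' a i \<otimes>\<^bsub>?M a i\<^esub> e"
    if a: "a < length c" and i: "i < length b" for a i
  proof -
    have "smat S b T c R q p $$ (a, i) = smat S b T c R' q' p' $$ (a, i)" using eq by simp
    then have "groth_of (?M a i) (?c R q p a i) = groth_of (?M a i) (?c R' q' p' a i)"
      using a i by (simp add: bimor_of_def)
    then show ?thesis
      using biset_cls_closed[OF H[OF i] K[OF a] sp[OF R i a]] biset_cls_closed[OF H[OF i] K[OF a] sp[OF R' i a]]
      by (simp add: groth_monoid.groth_of_eq_iff[OF groth_monoid_conj_biset[OF H[OF i] K[OF a]]])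
  qed
  then obtain P where P: "\<And>a i. a < length c \<Longrightarrow> i < length b \<Longrightarrow> P a i \<in> carrier (?M a i)"
    "\<And>a i. a < length c \<Longrightarrow> i < length b \<Longrightarrow> ?c R q p a i \<otimes>\<^bsub>?M a i\<^esub> P a i = ?c R' q' p' a i \<otimes>\<^bsub>?M a i\<^esub> P a i"
    by metis
  obtain E s t where E: "gspan S E T s t" "\<And>a i. a < length c \<Longrightarrow> i < length b \<Longrightarrow> P a i = ?c E s t a i"
    using realize_classes[OF S T P(1)] by blast
  have cls: "?c (gset_sum G R E) (copair R E q s) (copair R E p t) a i = ?c R q p a i \<otimes>\<^bsub>?M a i\<^esub> P a i"
    if R: "gspan S R T q p" and a: "a < length c" and i: "i < length b" for R q p a i
    unfolding E(2)[OF a i] biset_cls_mult[OF H[OF i] K[OF a] sp[OF R i a] sp[OF E(1) i a]]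
    using biset_cls_eqI[OF conj_bisetD[OF conj_biset_sum[OF H[OF i] K[OF a] sp[OF R i a] sp[OF E(1) i a]]]
      span_biset_sum[OF R E(1)]] by simp
  have "biset_iso (?H i) (?K a)
      (span_biset S (gset_sum G R E) (copair R E q s) (copair R E p t) (b ! i) (c ! a))
      (span_biset S (gset_sum G R' E) (copair R' E q' s) (copair R' E p' t) (b ! i) (c ! a))"
    if a: "a < length c" and i: "i < length b" for a i
    using P(2)[OF a i] cls[OF R a i] cls[OF R' a i]
    by (intro biset_cls_eqD[OF H[OF i] K[OF a] sp[OF gspan_sum[OF R E(1)] i a] sp[OF gspan_sum[OF R' E(1)] i a]]) simp
  then show ?thesis using E(1) by blast
qed

section \<open>The functor j in terms of spans\<close>

lemma base_points_based:
  assumes "base_points G b" "finite_gset G S"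
  shows "based S (b S)"
proof -
  interpret a: group_action G "gpts S" "gact S" using assms(2) by (simp add: finite_gset_def)
  note D = gsetD[OF assms(2)]
  have sub: "set (b S) \<subseteq> gpts S" and ex: "\<And>Q. Q \<in> orbits G (gpts S) (gact S) \<Longrightarrow> \<exists>!i. i < length (b S) \<and> b S ! i \<in> Q"
    using assms(1)[unfolded base_points_def, THEN conjunct1, rule_format, OF assms(2)] by blast+
  have "\<exists>!i. i < length (b S) \<and> (\<exists>g\<in>carrier G. x = gact S g (b S ! i))" if x: "x \<in> gpts S" for x
  proof -
    have "orbit G (gact S) x \<in> orbits G (gpts S) (gact S)" using x by (auto simp: orbits_def)
    then have "\<exists>!i. i < length (b S) \<and> b S ! i \<in> orbit G (gact S) x" by (rule ex)
    moreover have "b S ! i \<in> orbit G (gact S) x \<longleftrightarrow> (\<exists>g\<in>carrier G. x = gact S g (b S ! i))" if "i < length (b S)" for i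
    proof -
      have "b S ! i \<in> gpts S" using that sub nth_mem by blast
      then have "b S ! i \<in> orbit G (gact S) x \<longleftrightarrow> x \<in> orbit G (gact S) (b S ! i)"
        using a.orbit_sym x by blast
      then show ?thesis by (auto simp: orbit_def)
    qed
    ultimately show ?thesis by (metis (no_types, lifting))
  qed
  then show ?thesis using sub assms(2) unfolding based_def by blast
qed

lemma stab_list_eq: "stab_list G b S = stabs S (b S)"
  by (simp add: stab_list_def stabs_def)

lemma j_BOb: "BOb (j_functor G b) S = stabs S (b S)"
  by (simp add: j_functor_def stab_list_eq)

lemma gspan_push: "finite_gset G S \<Longrightarrow> finite_gset G T \<Longrightarrow> \<phi> \<in> gmaps G S T \<Longrightarrow> gspan S S T (gid S) \<phi>"
  by (simp add: gspan_def gid_gmaps)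

lemma gspan_pull: "finite_gset G S \<Longrightarrow> finite_gset G T \<Longrightarrow> \<phi> \<in> gmaps G S T \<Longrightarrow> gspan T S S \<phi> (gid S)"
  by (simp add: gspan_def gid_gmaps)

lemma transporter:
  assumes "y \<in> orbit G (gact T) c"
  shows "transporter G T y c \<in> carrier G \<and> y = gact T (transporter G T y c) c"
  unfolding transporter_def by (rule someI_ex) (use assms in \<open>auto simp: orbit_def\<close>)

text \<open>In the biset of the span (id, \<open>\<phi>\<close>) a point (s, g) is determined by g,
  since s = g x. Its existence forces \<open>\<phi>\<close> x into the orbit of c, which accounts
  for the empty entries.\<close>

lemma j_push:
  assumes b: "base_points G b" and S: "finite_gset G S" and T: "finite_gset G T" and \<phi>: "\<phi> \<in> gmaps G S T"
  shows "push (j_functor G b) S T \<phi> = smat S (b S) T (b T) S (gid S) \<phi>"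
proof -
  note bS = base_points_based[OF b S] and bT = base_points_based[OF b T]
  note DS = gsetD[OF S] and DT = gsetD[OF T] and f = gmapsD[OF \<phi>]
  let ?Y = "\<lambda>a i. let y = \<phi> (b S ! i); c = b T ! a in
    if y \<in> orbit G (gact T) c then push_biset G (transporter G T y c) (stab T c) else biset_empty"
  have "biset_iso (stab S (b S ! i)) (stab T (b T ! a)) (span_biset S S (gid S) \<phi> (b S ! i) (b T ! a)) (?Y a i)"
    if a: "a < length (b T)" and i: "i < length (b S)" for a i
  proof -
    let ?c = "b T ! a" and ?x = "b S ! i"
    let ?X = "span_biset S S (gid S) \<phi> ?x ?c"
    have x: "?x \<in> gpts S" and c: "?c \<in> gpts T" using based_nth[OF bS i] based_nth[OF bT a] .
    have X: "s \<in> gpts S \<and> g \<in> carrier G \<and> \<phi> s = ?c \<and> s = gact S g ?x \<and> gact T g (\<phi> ?x) = ?c"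
      if "(s, g) \<in> bpts ?X" for s g
      using that x f by auto
    show ?thesis
    proof (cases "\<phi> ?x \<in> orbit G (gact T) ?c")
      case True
      define t where "t = transporter G T (\<phi> ?x) ?c"
      have t: "t \<in> carrier G" "\<phi> ?x = gact T t ?c" using transporter[OF True] by (simp_all add: t_def)
      let ?Z = "push_biset G t (stab T ?c)"
      have "biset_iso (stab S ?x) (stab T ?c) ?X ?Z"
      proof (rule biset_isoI)
        \<comment> \<open>With t c = \<open>\<phi>\<close> x and c = \<open>\<phi>\<close> (g x),
          the product g t fixes c. Right multiplication by h on g becomes right multiplication by
          the conjugate of h by t.\<close>
        let ?f = "\<lambda>(s, g). g \<otimes> t"
        show "inj_on ?f (bpts ?X)"
        proof (rule inj_onI)
          fix z z' assume z: "z \<in> bpts ?X" "z' \<in> bpts ?X" "?f z = ?f z'"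
          obtain s g s' g' where eq: "z = (s, g)" "z' = (s', g')" by (metis surj_pair)
          have "g = g'" using z(3) X[OF z(1)[unfolded eq]] X[OF z(2)[unfolded eq]] t(1) unfolding eq by simp
          then show "z = z'" using X[OF z(1)[unfolded eq]] X[OF z(2)[unfolded eq]] unfolding eq by simp
        qed
        show "bpts ?Z \<subseteq> ?f ` bpts ?X"
        proof
          fix k assume "k \<in> bpts ?Z"
          then have k: "k \<in> carrier G" "gact T k ?c = ?c" by (simp_all add: push_biset_def stab_iff)
          have "(gact S (k \<otimes> inv t) ?x, k \<otimes> inv t) \<in> bpts ?X"
            using k t x c by (simp add: DS DT f)
          moreover have "k = ?f (gact S (k \<otimes> inv t) ?x, k \<otimes> inv t)" using k t by (simp add: m_assoc)
          ultimately show "k \<in> ?f ` bpts ?X" by (rule rev_image_eqI)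
        qed
        show "biset_hom (stab S ?x) (stab T ?c) ?X ?Z ?f"
        proof (rule biset_homI)
          fix z assume z: "z \<in> bpts ?X"
          obtain s g where eq: "z = (s, g)" by (metis surj_pair)
          note sg = X[OF z[unfolded eq]]
          show "?f z \<in> bpts ?Z" using sg t c unfolding eq by (simp add: push_biset_def stab_iff DT)
          show "?f (lact ?X h z) = lact ?Z h (?f z)" if "h \<in> stab T ?c" for h
            using sg t that unfolding eq by (simp add: push_biset_def stab_iff m_assoc)
          show "?f (ract ?X z h) = ract ?Z (?f z) h" if "h \<in> stab S ?x" for h
            using sg t(1) that unfolding eq by (simp add: push_biset_def stab_iff m_assoc mult_inv_cancel)
        qed
      qed
      then show ?thesis using True by (simp add: Let_def t_def)
    next
      case False
      have "bpts ?X = {}"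
      proof (rule ccontr)
        assume "bpts ?X \<noteq> {}"
        then obtain s g where "(s, g) \<in> bpts ?X" by (metis surj_pair all_not_in_conv)
        note sg = X[OF this]
        have "\<phi> ?x = gact T (inv g) ?c" using sg DT(5)[of g "\<phi> ?x"] f(1)[OF x] by metis
        then show False using False sg unfolding orbit_def by blast
      qed
      then show ?thesis using False by (simp add: Let_def biset_iso_empty)
    qed
  qed
  from smat_eqI[OF bS bT gspan_push[OF S T \<phi>] this] show ?thesis
    unfolding j_functor_def bifunc.select_convs
    by (intro eq_matI) (simp_all add: Let_def stab_list_eq cong: if_cong)
qed

lemma j_pull:
  assumes b: "base_points G b" and S: "finite_gset G S" and T: "finite_gset G T" and \<phi>: "\<phi> \<in> gmaps G S T"
  shows "pull (j_functor G b) S T \<phi> = smat T (b T) S (b S) S \<phi> (gid S)"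
proof -
  note bS = base_points_based[OF b S] and bT = base_points_based[OF b T]
  note DS = gsetD[OF S] and DT = gsetD[OF T] and f = gmapsD[OF \<phi>]
  let ?Y = "\<lambda>i a. let y = \<phi> (b S ! i); c = b T ! a in
    if y \<in> orbit G (gact T) c then pull_biset G (transporter G T y c) (stab T c) else biset_empty"
  have "biset_iso (stab T (b T ! a)) (stab S (b S ! i)) (span_biset T S \<phi> (gid S) (b T ! a) (b S ! i)) (?Y i a)"
    if i: "i < length (b S)" and a: "a < length (b T)" for a i
  proof -
    let ?c = "b T ! a" and ?x = "b S ! i"
    let ?X = "span_biset T S \<phi> (gid S) ?c ?x"
    have x: "?x \<in> gpts S" and c: "?c \<in> gpts T" using based_nth[OF bS i] based_nth[OF bT a] .
    have X: "s = ?x \<and> g \<in> carrier G \<and> \<phi> ?x = gact T g ?c" if "(s, g) \<in> bpts ?X" for s g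
      using that by auto
    show ?thesis
    proof (cases "\<phi> ?x \<in> orbit G (gact T) ?c")
      case True
      define t where "t = transporter G T (\<phi> ?x) ?c"
      have t: "t \<in> carrier G" "\<phi> ?x = gact T t ?c" using transporter[OF True] by (simp_all add: t_def)
      let ?Z = "pull_biset G t (stab T ?c)"
      have "biset_iso (stab T ?c) (stab S ?x) ?X ?Z"
      proof (rule biset_isoI)
        \<comment> \<open>Here g c = \<open>\<phi>\<close> x = t c, so (inv t) g fixes c; the left
          action is conjugated by t.\<close>
        let ?f = "\<lambda>(s, g). inv t \<otimes> g"
        show "inj_on ?f (bpts ?X)"
        proof (rule inj_onI)
          fix z z' assume z: "z \<in> bpts ?X" "z' \<in> bpts ?X" "?f z = ?f z'"
          obtain s g s' g' where eq: "z = (s, g)" "z' = (s', g')" by (metis surj_pair)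
          have "g = g'" using z(3) X[OF z(1)[unfolded eq]] X[OF z(2)[unfolded eq]] t(1) unfolding eq by simp
          then show "z = z'" using X[OF z(1)[unfolded eq]] X[OF z(2)[unfolded eq]] unfolding eq by simp
        qed
        show "bpts ?Z \<subseteq> ?f ` bpts ?X"
        proof
          fix k assume "k \<in> bpts ?Z"
          then have k: "k \<in> carrier G" "gact T k ?c = ?c" by (simp_all add: pull_biset_def stab_iff)
          have "(?x, t \<otimes> k) \<in> bpts ?X" using k t x c by (simp add: DT)
          moreover have "k = ?f (?x, t \<otimes> k)" using k t by (simp add: mult_inv_cancel)
          ultimately show "k \<in> ?f ` bpts ?X" by (rule rev_image_eqI)
        qed
        show "biset_hom (stab T ?c) (stab S ?x) ?X ?Z ?f"
        proof (rule biset_homI)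
          fix z assume z: "z \<in> bpts ?X"
          obtain s g where eq: "z = (s, g)" by (metis surj_pair)
          note sg = X[OF z[unfolded eq]]
          have "gact T (inv t \<otimes> g) ?c = gact T (inv t) (gact T t ?c)"
            using sg t c DT(4)[of "inv t" g ?c] by simp
          then show "?f z \<in> bpts ?Z" using sg t(1) c unfolding eq by (simp add: pull_biset_def stab_iff DT)
          show "?f (lact ?X h z) = lact ?Z h (?f z)" if "h \<in> stab S ?x" for h
            using sg t(1) that unfolding eq by (simp add: pull_biset_def stab_iff m_assoc mult_inv_cancel)
          show "?f (ract ?X z h) = ract ?Z (?f z) h" if "h \<in> stab T ?c" for h
            using sg t(1) that unfolding eq by (simp add: pull_biset_def stab_iff m_assoc)
        qed
      qed
      then show ?thesis using True by (simp add: Let_def t_def)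
    next
      case False
      have "bpts ?X = {}"
      proof (rule ccontr)
        assume "bpts ?X \<noteq> {}"
        then obtain s g where "(s, g) \<in> bpts ?X" by (metis surj_pair all_not_in_conv)
        then show False using False X unfolding orbit_def by blast
      qed
      then show ?thesis using False by (simp add: Let_def biset_iso_empty)
    qed
  qed
  from smat_eqI[OF bT bS gspan_pull[OF S T \<phi>] this] show ?thesis
    unfolding j_functor_def bifunc.select_convs
    by (intro eq_matI) (simp_all add: Let_def stab_list_eq cong: if_cong)
qed

end

section \<open>Standard G-sets\<close>

context fin_group
begin

text \<open>The G-map that sends the i-th base point of \<open>S\<close> to the i-th base point of
  \<open>T\<close>. For equal lists of stabilizers it does not depend on the chosen g and is an
  isomorphism, so a based G-set is determined by its list of stabilizers.\<close>

definition base_map :: "('a, 'p) Gset \<Rightarrow> ('a, 'p) pt list \<Rightarrow> ('a, 'p) Gset \<Rightarrow> ('a, 'p) pt list \<Rightarrow> ('a, 'p) pt \<Rightarrow> ('a, 'p) pt" where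
  "base_map S b T c = (\<lambda>x\<in>gpts S. let i = bidx S b x in
     gact T (SOME g. g \<in> carrier G \<and> x = gact S g (b ! i)) (c ! i))"

lemma base_map_apply:
  assumes S: "based S b" and T: "based T c" and st: "stabs S b = stabs T c" and i: "i < length b" and g: "g \<in> carrier G"
  shows "base_map S b T c (gact S g (b ! i)) = gact T g (c ! i)"
proof -
  note DS = gsetD[OF based_gset[OF S]] and DT = gsetD[OF based_gset[OF T]]
  have len: "length c = length b" using arg_cong[OF st, of length] by simp
  have stab: "stab S (b ! i) = stab T (c ! i)" using arg_cong[OF st, of "\<lambda>l. l ! i"] i len by simp
  have b: "b ! i \<in> gpts S" and c: "c ! i \<in> gpts T" using based_nth[OF S i] based_nth[OF T] i len by simp_all
  \<comment> \<open>The element picked in \<open>base_map\<close> may differ from \<open>g\<close>,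
    but only by an element of the common stabilizer of the two base points.\<close>
  define h where "h = (SOME h. h \<in> carrier G \<and> gact S g (b ! i) = gact S h (b ! i))"
  have h: "h \<in> carrier G \<and> gact S g (b ! i) = gact S h (b ! i)"
    unfolding h_def by (rule someI[of _ g]) (use g in simp)
  have "gact S (inv h \<otimes> g) (b ! i) = b ! i" using h g b by (simp add: DS)
  then have "inv h \<otimes> g \<in> stab T (c ! i)" using h g by (simp add: stab_iff flip: stab)
  then have "gact T h (gact T (inv h \<otimes> g) (c ! i)) = gact T h (c ! i)" by (simp add: stab_iff)
  then have "gact T g (c ! i) = gact T h (c ! i)" using h g c by (simp add: DT)
  then show ?thesis
    unfolding base_map_def using b g bidx_eq[OF S i g] by (simp add: DS Let_def flip: h_def)
qed

lemma base_map_gmaps: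
  assumes S: "based S b" and T: "based T c" and st: "stabs S b = stabs T c"
  shows "base_map S b T c \<in> gmaps G S T"
proof -
  note DS = gsetD[OF based_gset[OF S]] and DT = gsetD[OF based_gset[OF T]]
  have len: "length c = length b" using arg_cong[OF st, of length] by simp
  have "base_map S b T c x \<in> gpts T \<and> (\<forall>h\<in>carrier G. base_map S b T c (gact S h x) = gact T h (base_map S b T c x))"
    if x: "x \<in> gpts S" for x
  proof -
    obtain g where i: "bidx S b x < length b" and g: "g \<in> carrier G" "x = gact S g (b ! bidx S b x)"
      using bidx[OF S x] by blast
    let ?i = "bidx S b x"
    have b: "b ! ?i \<in> gpts S" and c: "c ! ?i \<in> gpts T" using based_nth[OF S i] based_nth[OF T] i len by simp_all
    have "base_map S b T c x = gact T g (c ! ?i)" using base_map_apply[OF S T st i g(1)] g(2) by simp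
    moreover have "base_map S b T c (gact S h x) = gact T (h \<otimes> g) (c ! ?i)" if "h \<in> carrier G" for h
    proof -
      have "gact S h x = gact S (h \<otimes> g) (b ! ?i)" using g that b by (simp add: DS(4))
      then show ?thesis using base_map_apply[OF S T st i, of "h \<otimes> g"] g(1) that by simp
    qed
    ultimately show ?thesis using c g(1) by (simp add: DT)
  qed
  then show ?thesis by (auto intro!: gmapsI) (simp add: base_map_def)
qed

lemma base_map_inverse:
  assumes S: "based S b" and T: "based T c" and st: "stabs S b = stabs T c" and x: "x \<in> gpts S"
  shows "base_map T c S b (base_map S b T c x) = x"
proof -
  obtain g where i: "bidx S b x < length b" and g: "g \<in> carrier G" "x = gact S g (b ! bidx S b x)"
    using bidx[OF S x] by blast
  have "bidx S b x < length c" using arg_cong[OF st, of length] i by simp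
  then show ?thesis
    using base_map_apply[OF S T st i g(1)] base_map_apply[OF T S st[symmetric] _ g(1)] g(2) by metis
qed

lemma base_map_bij:
  assumes S: "based S b" and T: "based T c" and st: "stabs S b = stabs T c"
  shows "bij_betw (base_map S b T c) (gpts S) (gpts T)"
  using base_map_inverse[OF assms] base_map_inverse[OF T S st[symmetric]]
    gmapsD(1)[OF base_map_gmaps[OF assms]] gmapsD(1)[OF base_map_gmaps[OF T S st[symmetric]]]
  by (intro bij_betwI[of _ _ _ "base_map T c S b"]) auto

lemma finite_gset_empty: "finite_gset G (gset_empty G)"
proof -
  have "finite_gset G (mk_gset {} (\<lambda>g x. undefined))" by (rule finite_mk_gset) simp_all
  then show ?thesis by (simp add: gset_empty_def mk_gset_def)
qed

lemma gset_empty_pts [simp]: "gpts (gset_empty G) = {}"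
  by (simp add: gset_empty_def)

lemma coset_gset_pts: "gpts (coset_gset G H) = {Cs (a <# H) |a. a \<in> carrier G}"
  by (simp add: coset_gset_def Let_def)

lemma coset_gset_act:
  assumes H: "subgroup H G" and g: "g \<in> carrier G" and a: "a \<in> carrier G"
  shows "gact (coset_gset G H) g (Cs (a <# H)) = Cs ((g \<otimes> a) <# H)"
proof -
  have "g <# (a <# H) = (g \<otimes> a) <# H" using lcos_m_assoc[OF subgroup.subset[OF H] g a] .
  then show ?thesis using a g by (auto simp: coset_gset_def Let_def)
qed

lemma finite_coset_gset:
  assumes H: "subgroup H G"
  shows "finite_gset G (coset_gset G H :: ('a, 'p) Gset)"
proof -
  let ?P = "{Cs (a <# H) |a. a \<in> carrier G} :: ('a, 'p) pt set"
  have "?P = (\<lambda>a. Cs (a <# H)) ` carrier G" by auto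
  then have fin: "finite ?P" using finite_carrier by simp
  note HH = subgroup.subset[OF H]
  have "finite_gset G (mk_gset ?P (\<lambda>g z. case z of Cs A \<Rightarrow> Cs (g <# A)))"
  proof (rule finite_mk_gset[OF fin])
    fix x assume "x \<in> ?P"
    then obtain a where a: "a \<in> carrier G" "x = Cs (a <# H)" by blast
    show "(case x of Cs A \<Rightarrow> Cs (\<one> <# A)) = x"
      using a lcos_m_assoc[OF HH one_closed a(1)] by simp
    show "(case x of Cs A \<Rightarrow> Cs (g <# A)) \<in> ?P" if "g \<in> carrier G" for g
      using a that lcos_m_assoc[OF HH that a(1)] by auto
    show "(case x of Cs A \<Rightarrow> Cs (g \<otimes> h <# A)) = (case case x of Cs A \<Rightarrow> Cs (h <# A) of Cs A \<Rightarrow> Cs (g <# A))"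
      if "g \<in> carrier G" "h \<in> carrier G" for g h
      using a that lcos_m_assoc[OF HH _ a(1)] lcos_m_assoc[OF HH, of g "h \<otimes> a"] by (simp add: m_assoc)
  qed
  then show ?thesis by (simp add: coset_gset_def mk_gset_def Let_def)
qed

lemma Cs_one: "subgroup H G \<Longrightarrow> \<one> <# H = H"
  using lcos_mult_one subgroup.subset by blast

lemma base_coset_act:
  "subgroup H G \<Longrightarrow> g \<in> carrier G \<Longrightarrow> gact (coset_gset G H) g (Cs H) = Cs (g <# H)"
  using coset_gset_act[of H g \<one>] by (simp add: Cs_one)

lemma lcos_eq_self_iff:
  assumes H: "subgroup H G" and g: "g \<in> carrier G"
  shows "g <# H = H \<longleftrightarrow> g \<in> H"
proof
  show "g \<in> H" if "g <# H = H"
  proof -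
    have "g \<otimes> \<one> \<in> g <# H" unfolding l_coset_def using subgroup.one_closed[OF H] by blast
    then show ?thesis using that g by simp
  qed
  show "g <# H = H" if "g \<in> H"
    using coset_join3[OF g H that] .
qed

lemma based_coset:
  assumes H: "subgroup H G"
  shows "based (coset_gset G H :: ('a, 'p) Gset) [Cs H]" and "stabs (coset_gset G H :: ('a, 'p) Gset) [Cs H] = [H]"
proof -
  let ?S = "coset_gset G H :: ('a, 'p) Gset"
  have mem: "Cs H \<in> gpts ?S" using Cs_one[OF H] unfolding coset_gset_pts by force
  have "\<exists>!i. i < length [Cs H] \<and> (\<exists>g\<in>carrier G. x = gact ?S g ([Cs H] ! i))" if x: "x \<in> gpts ?S" for x
  proof -
    obtain a where "a \<in> carrier G" "x = Cs (a <# H)" using x unfolding coset_gset_pts by blast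
    then have ex: "\<exists>g\<in>carrier G. x = gact ?S g (Cs H)" by (intro bexI[of _ a]) (simp_all add: base_coset_act[OF H])
    have "0 < length [Cs H] \<and> (\<exists>g\<in>carrier G. x = gact ?S g ([Cs H] ! 0))"
      unfolding nth_Cons_0 by (rule conjI[OF _ ex]) simp
    moreover have "i = 0" if "i < length [Cs H] \<and> (\<exists>g\<in>carrier G. x = gact ?S g ([Cs H] ! i))" for i
      using conjunct1[OF that] by simp
    ultimately show ?thesis by (rule ex1I)
  qed
  then show "based ?S [Cs H]" unfolding based_def using mem finite_coset_gset[OF H] by simp
  have "stab ?S (Cs H) = H"
  proof (intro equalityI subsetI)
    fix g assume "g \<in> stab ?S (Cs H)"
    then have "g \<in> carrier G" "gact ?S g (Cs H) = Cs H" by (simp_all only: stab_iff)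
    then show "g \<in> H" by (simp add: base_coset_act[OF H] lcos_eq_self_iff[OF H])
  next
    fix g assume "g \<in> H"
    then show "g \<in> stab ?S (Cs H)"
      using subgroup.mem_carrier[OF H] by (simp add: stab_iff base_coset_act[OF H] lcos_eq_self_iff[OF H])
  qed
  then show "stabs ?S [Cs H] = [H]" by (simp add: stabs_def)
qed

lemma based_sum:
  assumes R: "based R b" and R': "based R' b'"
  shows "based (gset_sum G R R') (map InL b @ map InR b')"
    and "stabs (gset_sum G R R') (map InL b @ map InR b') = stabs R b @ stabs R' b'"
proof -
  let ?S = "gset_sum G R R'" and ?l = "map InL b @ map InR b'"
  have bR: "x \<in> set b \<Longrightarrow> x \<in> gpts R" and bR': "x \<in> set b' \<Longrightarrow> x \<in> gpts R'" for x
    using R R' by (auto simp: based_def)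
  have "stab ?S (InL x) = stab R x" if "x \<in> gpts R" for x using that by (auto simp: stabilizer_def)
  moreover have "stab ?S (InR x) = stab R' x" if "x \<in> gpts R'" for x using that by (auto simp: stabilizer_def)
  ultimately show "stabs ?S ?l = stabs R b @ stabs R' b'" by (simp add: stabs_def bR bR')
  have nL: "?l ! i = InL (b ! i)" if "i < length b" for i using that by (simp add: nth_append)
  have nR: "?l ! i = InR (b' ! (i - length b))" if "\<not> i < length b" "i < length ?l" for i
    using that by (simp add: nth_append)
  have "\<exists>!i. i < length ?l \<and> (\<exists>g\<in>carrier G. z = gact ?S g (?l ! i))" if z: "z \<in> gpts ?S" for z
  proof -
    consider x where "z = InL x" "x \<in> gpts R" | x where "z = InR x" "x \<in> gpts R'" using z by auto
    then show ?thesis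
    proof cases
      case 1
      obtain g where g: "bidx R b x < length b" "g \<in> carrier G" "x = gact R g (b ! bidx R b x)" using bidx[OF R 1(2)] by blast
      show ?thesis
      proof (rule ex1I[of _ "bidx R b x"])
        show "bidx R b x < length ?l \<and> (\<exists>g\<in>carrier G. z = gact ?S g (?l ! bidx R b x))"
          using g 1 based_nth[OF R g(1)] nL[OF g(1)] by (auto intro!: bexI[of _ g])
        fix k assume k: "k < length ?l \<and> (\<exists>g\<in>carrier G. z = gact ?S g (?l ! k))"
        then obtain h where h: "h \<in> carrier G" "z = gact ?S h (?l ! k)" by blast
        have kb: "k < length b"
        proof (rule ccontr)
          assume n: "\<not> k < length b"
          have "k - length b < length b'" using n conjunct1[OF k] by simp
          then show False using h 1 nR[OF n conjunct1[OF k]] based_nth[OF R', of "k - length b"] by simp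
        qed
        then have "x = gact R h (b ! k)" using h 1 nL[OF kb] based_nth[OF R kb] by simp
        then show "k = bidx R b x" using bidx_eq[OF R kb h(1)] by simp
      qed
    next
      case 2
      obtain g where g: "bidx R' b' x < length b'" "g \<in> carrier G" "x = gact R' g (b' ! bidx R' b' x)" using bidx[OF R' 2(2)] by blast
      show ?thesis
      proof (rule ex1I[of _ "length b + bidx R' b' x"])
        show "length b + bidx R' b' x < length ?l \<and> (\<exists>g\<in>carrier G. z = gact ?S g (?l ! (length b + bidx R' b' x)))"
          using g 2 based_nth[OF R' g(1)] by (auto intro!: bexI[of _ g] simp: nth_append)
        fix k assume k: "k < length ?l \<and> (\<exists>g\<in>carrier G. z = gact ?S g (?l ! k))"
        then obtain h where h: "h \<in> carrier G" "z = gact ?S h (?l ! k)" by blast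
        have kb: "\<not> k < length b"
        proof
          assume n: "k < length b"
          then show False using h 2 nL[OF n] based_nth[OF R n] by simp
        qed
        then have kk: "k - length b < length b'" using conjunct1[OF k] by simp
        then have "x = gact R' h (b' ! (k - length b))" using h 2 nR[OF kb] k based_nth[OF R' kk] by simp
        then show "k = length b + bidx R' b' x" using bidx_eq[OF R' kk h(1)] kb by simp
      qed
    qed
  qed
  then show "based ?S ?l"
    unfolding based_def using finite_gset_sum[OF based_gset[OF R] based_gset[OF R']] bR bR' by auto
qed

text \<open>The list of stabilizers at the points picked by \<open>b\<close> need not be a
  prescribed tuple. The disjoint union of the G/H, with the trivial cosets as base points, has
  exactly the given tuple as its list of stabilizers.\<close>

primrec std_gset :: "'a set list \<Rightarrow> ('a, 'p) Gset" where
  "std_gset [] = gset_empty G"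
| "std_gset (H # t) = gset_sum G (coset_gset G H) (std_gset t)"

primrec std_base :: "'a set list \<Rightarrow> ('a, 'p) pt list" where
  "std_base [] = []"
| "std_base (H # t) = map InL [Cs H] @ map InR (std_base t)"

lemma std_gset:
  assumes "t \<in> tuples"
  shows "based (std_gset t :: ('a, 'p) Gset) (std_base t) \<and> stabs (std_gset t :: ('a, 'p) Gset) (std_base t) = t"
  using assms
proof (induction t)
  case Nil
  show ?case by (simp add: based_def stabs_def finite_gset_empty)
next
  case (Cons H t)
  then have H: "subgroup H G" and t: "t \<in> tuples" by (simp_all add: Bdot_Ob)
  have IH: "based (std_gset t :: ('a, 'p) Gset) (std_base t)" "stabs (std_gset t :: ('a, 'p) Gset) (std_base t) = t"
    using Cons.IH[OF t] by simp_all
  then show ?case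
    unfolding std_gset.simps std_base.simps
    using based_sum[OF based_coset(1)[OF H] IH(1)] by (simp only: based_coset(2)[OF H] IH(2) append.simps simp_thms)
qed

lemma stabs_Ob: "based S b \<Longrightarrow> stabs S b \<in> tuples"
  using subgroup_stab by (auto simp: Bdot_Ob in_lists_conv_set in_set_conv_nth)

text \<open>The conjugation rule for \<open>u\<close> is what makes r -> u(r) r equivariant. On G/H
  these are the maps eH -> zH with z in the centralizer of H, where z is the value of
  \<open>u\<close> at the coset H.\<close>

definition inner_map :: "('a, 'p) Gset \<Rightarrow> (('a, 'p) pt \<Rightarrow> ('a, 'p) pt) \<Rightarrow> (('a, 'p) pt \<Rightarrow> 'a) \<Rightarrow> bool" where
  "inner_map R \<alpha> u \<longleftrightarrow> \<alpha> \<in> gmaps G R R \<and> (\<forall>x\<in>gpts R. u x \<in> carrier G \<and> \<alpha> x = gact R (u x) x \<and>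
     (\<forall>g\<in>carrier G. u (gact R g x) = g \<otimes> u x \<otimes> inv g))"

lemma inner_mapD:
  assumes "inner_map R \<alpha> u"
  shows "\<alpha> \<in> gmaps G R R" and "x \<in> gpts R \<Longrightarrow> u x \<in> carrier G" and "x \<in> gpts R \<Longrightarrow> \<alpha> x = gact R (u x) x"
    and "x \<in> gpts R \<Longrightarrow> g \<in> carrier G \<Longrightarrow> u (gact R g x) = g \<otimes> u x \<otimes> inv g"
  using assms unfolding inner_map_def by blast+

lemma inner_map_inj:
  assumes R: "finite_gset G R" and \<alpha>: "inner_map R \<alpha> u" and x: "x \<in> gpts R" "y \<in> gpts R" "\<alpha> x = \<alpha> y"
  shows "x = y"
proof -
  note D = gsetD[OF R] and a = inner_mapD[OF \<alpha>]
  have "u (\<alpha> z) = u z" if "z \<in> gpts R" for z using that a by (simp add: m_assoc)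
  then have "u x = u y" using x by metis
  then have "gact R (u x) x = gact R (u x) y" using x a(3) by metis
  then show ?thesis using D(5)[OF a(2)[OF x(1)]] x(1,2) by metis
qed

end

section \<open>Values of a Mackey functor on spans\<close>

lemma Ab_simps [simp]:
  "Ob Ab = {A. comm_group A}"
  "Mor Ab A B = hom A B \<inter> extensional (carrier A)"
  "Idn Ab A = (\<lambda>x\<in>carrier A. x)"
  "Cmp Ab A B E g f = compose (carrier A) g f"
  "carrier (HGrp Ab A B) = hom A B \<inter> extensional (carrier A)"
  "f \<otimes>\<^bsub>HGrp Ab A B\<^esub> g = (\<lambda>x\<in>carrier A. f x \<otimes>\<^bsub>B\<^esub> g x)"
  by (simp_all add: Ab_def)

lemma DG_simps [simp]:
  "Ob (DG G) = {S. finite_gset G S}"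
  "Mor (DG G) = gmaps G"
  "Cmp (DG G) S T U \<psi> \<phi> = compose (gpts S) \<psi> \<phi>"
  by (simp_all add: DG_def)

context fin_group
begin

lemma DG_Idn [simp]: "Idn (DG G) S = gid S"
  by (simp add: DG_def gid_def)

lemma bivariantD:
  assumes "bivariant_functor (DG G) Ab M"
  shows "finite_gset G S \<Longrightarrow> comm_group (BOb M S)"
    and "finite_gset G S \<Longrightarrow> finite_gset G T \<Longrightarrow> \<phi> \<in> gmaps G S T \<Longrightarrow> push M S T \<phi> \<in> hom (BOb M S) (BOb M T)"
    and "finite_gset G S \<Longrightarrow> finite_gset G T \<Longrightarrow> \<phi> \<in> gmaps G S T \<Longrightarrow> push M S T \<phi> \<in> extensional (carrier (BOb M S))"
    and "finite_gset G S \<Longrightarrow> finite_gset G T \<Longrightarrow> \<phi> \<in> gmaps G S T \<Longrightarrow> pull M S T \<phi> \<in> hom (BOb M T) (BOb M S)"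
    and "finite_gset G S \<Longrightarrow> finite_gset G T \<Longrightarrow> \<phi> \<in> gmaps G S T \<Longrightarrow> pull M S T \<phi> \<in> extensional (carrier (BOb M T))"
    and "finite_gset G S \<Longrightarrow> push M S S (gid S) = (\<lambda>x\<in>carrier (BOb M S). x)"
    and "finite_gset G S \<Longrightarrow> pull M S S (gid S) = (\<lambda>x\<in>carrier (BOb M S). x)"
    and "finite_gset G S \<Longrightarrow> finite_gset G T \<Longrightarrow> finite_gset G U \<Longrightarrow> \<phi> \<in> gmaps G S T \<Longrightarrow> \<psi> \<in> gmaps G T U \<Longrightarrow>
      push M S U (compose (gpts S) \<psi> \<phi>) = compose (carrier (BOb M S)) (push M T U \<psi>) (push M S T \<phi>)"
    and "finite_gset G S \<Longrightarrow> finite_gset G T \<Longrightarrow> finite_gset G U \<Longrightarrow> \<phi> \<in> gmaps G S T \<Longrightarrow> \<psi> \<in> gmaps G T U \<Longrightarrow>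
      pull M S U (compose (gpts S) \<psi> \<phi>) = compose (carrier (BOb M U)) (pull M S T \<phi>) (pull M T U \<psi>)"
  using assms unfolding bivariant_functor_def is_functor_def is_cofunctor_def by auto

text \<open>The axiom (M1) speaks of the universal property in the category; this makes it
  applicable to the fibre products that occur in computations.\<close>

lemma gset_pullback_square:
  assumes "finite_gset G R" "finite_gset G R'" "finite_gset G T" and p: "p \<in> gmaps G R T" and q': "q' \<in> gmaps G R' T"
    and P: "gset_pullback P R R' T p q' u v"
  shows "pullback_square (DG G) P R' R T v u q' p"
proof -
  note D = gset_pullbackD[OF P] and u = gmapsD[OF gset_pullbackD(2)[OF P]] and v = gmapsD[OF gset_pullbackD(3)[OF P]]
  have com: "compose (gpts P) q' v = compose (gpts P) p u"
    by (rule gmaps_eqI[OF compose_gmaps[OF D(1,3) q'] compose_gmaps[OF D(1,2) p]]) (simp add: compose_eq D(4))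
  have univ: "\<exists>!\<gamma>. \<gamma> \<in> gmaps G W P \<and> compose (gpts W) v \<gamma> = \<alpha> \<and> compose (gpts W) u \<gamma> = \<beta>"
    if W: "finite_gset G W" and a: "\<alpha> \<in> gmaps G W R'" and b: "\<beta> \<in> gmaps G W R"
    and eq: "compose (gpts W) q' \<alpha> = compose (gpts W) p \<beta>" for W \<alpha> \<beta>
  proof -
    have pt: "p (\<beta> w) = q' (\<alpha> w)" if "w \<in> gpts W" for w using fun_cong[OF eq, of w] that by (simp add: compose_eq)
    note aD = gmapsD[OF a] and bD = gmapsD[OF b]
    define \<gamma> where "\<gamma> = (\<lambda>w\<in>gpts W. THE z. z \<in> gpts P \<and> u z = \<beta> w \<and> v z = \<alpha> w)"
    have g: "\<gamma> w \<in> gpts P \<and> u (\<gamma> w) = \<beta> w \<and> v (\<gamma> w) = \<alpha> w" if "w \<in> gpts W" for w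
      using theI'[OF D(5)[OF bD(1)[OF that] aD(1)[OF that] pt[OF that]]] that by (simp add: \<gamma>_def)
    have uniq: "z = z'" if "z \<in> gpts P" "z' \<in> gpts P" "u z = u z'" "v z = v z'" for z z'
      using D(5)[OF u(1)[OF that(1)] v(1)[OF that(1)] D(4)[OF that(1)]] that by metis
    have gm: "\<gamma> \<in> gmaps G W P"
    proof (rule gmapsI)
      show "\<gamma> \<in> extensional (gpts W)" by (simp add: \<gamma>_def)
      show "\<gamma> w \<in> gpts P" if "w \<in> gpts W" for w using g[OF that] by blast
      show "\<gamma> (gact W h w) = gact P h (\<gamma> w)" if h: "h \<in> carrier G" "w \<in> gpts W" for h w
      proof (rule uniq)
        note g1 = g[OF h(2)] and g2 = g[OF gsetD(2)[OF W h]]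
        show "\<gamma> (gact W h w) \<in> gpts P" "gact P h (\<gamma> w) \<in> gpts P"
          using g1 g2 gsetD(2)[OF D(1) h(1)] by blast+
        show "u (\<gamma> (gact W h w)) = u (gact P h (\<gamma> w))" using g1 g2 u(2)[OF h(1)] bD(2)[OF h] by simp
        show "v (\<gamma> (gact W h w)) = v (gact P h (\<gamma> w))" using g1 g2 v(2)[OF h(1)] aD(2)[OF h] by simp
      qed
    qed
    have gv: "compose (gpts W) v \<gamma> = \<alpha>"
      by (rule gmaps_eqI[OF compose_gmaps[OF W gm D(3)] a]) (simp add: compose_eq g)
    have gu: "compose (gpts W) u \<gamma> = \<beta>"
      by (rule gmaps_eqI[OF compose_gmaps[OF W gm D(2)] b]) (simp add: compose_eq g)
    have un: "\<delta> = \<gamma>" if d: "\<delta> \<in> gmaps G W P" "compose (gpts W) v \<delta> = \<alpha>" "compose (gpts W) u \<delta> = \<beta>" for \<delta>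
    proof (rule gmaps_eqI[OF d(1) gm])
      fix w assume w: "w \<in> gpts W"
      have "v (\<delta> w) = \<alpha> w" "u (\<delta> w) = \<beta> w" using fun_cong[OF d(2), of w] fun_cong[OF d(3), of w] w by (simp_all add: compose_eq)
      then show "\<delta> w = \<gamma> w" using g[OF w] gmapsD(1)[OF d(1) w] uniq[of "\<delta> w" "\<gamma> w"] by simp
    qed
    show ?thesis
    proof (rule ex1I[of _ \<gamma>])
      show "\<gamma> \<in> gmaps G W P \<and> compose (gpts W) v \<gamma> = \<alpha> \<and> compose (gpts W) u \<gamma> = \<beta>"
        by (intro conjI gm gv gu)
    qed (elim conjE, rule un)
  qed
  show ?thesis
    unfolding pullback_square_def DG_simps mem_Collect_eq
    by (intro conjI ballI impI assms D(1-3) com) (rule univ; (simp only: mem_Collect_eq | assumption))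
qed

end

text \<open>The Mackey formula and the vanishing on the empty G-set, without the axiom on disjoint
  unions. Both directions share this part: for F o j it is proved first, and its consequences then
  help to prove the axiom on disjoint unions.\<close>

locale premackey = fin_group G for G (structure) +
  fixes M :: "('a, 'p, 'v) abfunctors"
  assumes biv: "bivariant_functor (DG G) Ab M"
    and mackey_formula: "finite_gset G R \<Longrightarrow> finite_gset G R' \<Longrightarrow> finite_gset G T \<Longrightarrow>
      p \<in> gmaps G R T \<Longrightarrow> q' \<in> gmaps G R' T \<Longrightarrow> gset_pullback P R R' T p q' u v \<Longrightarrow> x \<in> carrier (BOb M R) \<Longrightarrow>
      pull M R' T q' (push M R T p x) = push M P R' v (pull M P R u x)"
    and val_empty: "x \<in> carrier (BOb M (gset_empty G)) \<Longrightarrow> x = \<one>\<^bsub>BOb M (gset_empty G)\<^esub>"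
begin

abbreviation "V S \<equiv> carrier (BOb M S)"

lemmas comm_group_val = bivariantD(1)[OF biv]
lemmas push_hom = bivariantD(2)[OF biv]
lemmas pull_hom = bivariantD(4)[OF biv]

lemma group_val: "finite_gset G S \<Longrightarrow> group (BOb M S)"
  using comm_group_val comm_group.axioms(2) by blast

lemma push_closed: "finite_gset G S \<Longrightarrow> finite_gset G T \<Longrightarrow> \<phi> \<in> gmaps G S T \<Longrightarrow> x \<in> V S \<Longrightarrow> push M S T \<phi> x \<in> V T"
  using push_hom by (auto simp: hom_def)

lemma pull_closed: "finite_gset G S \<Longrightarrow> finite_gset G T \<Longrightarrow> \<phi> \<in> gmaps G S T \<Longrightarrow> x \<in> V T \<Longrightarrow> pull M S T \<phi> x \<in> V S"
  using pull_hom by (auto simp: hom_def)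

lemma push_mult: "finite_gset G S \<Longrightarrow> finite_gset G T \<Longrightarrow> \<phi> \<in> gmaps G S T \<Longrightarrow> x \<in> V S \<Longrightarrow> y \<in> V S \<Longrightarrow>
    push M S T \<phi> (x \<otimes>\<^bsub>BOb M S\<^esub> y) = push M S T \<phi> x \<otimes>\<^bsub>BOb M T\<^esub> push M S T \<phi> y"
  using push_hom by (auto simp: hom_def)

lemma pull_mult: "finite_gset G S \<Longrightarrow> finite_gset G T \<Longrightarrow> \<phi> \<in> gmaps G S T \<Longrightarrow> x \<in> V T \<Longrightarrow> y \<in> V T \<Longrightarrow>
    pull M S T \<phi> (x \<otimes>\<^bsub>BOb M T\<^esub> y) = pull M S T \<phi> x \<otimes>\<^bsub>BOb M S\<^esub> pull M S T \<phi> y"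
  using pull_hom by (auto simp: hom_def)

lemma push_one: "finite_gset G S \<Longrightarrow> finite_gset G T \<Longrightarrow> \<phi> \<in> gmaps G S T \<Longrightarrow> push M S T \<phi> \<one>\<^bsub>BOb M S\<^esub> = \<one>\<^bsub>BOb M T\<^esub>"
  using hom_one[OF push_hom] group_val by blast

lemma push_gid: "finite_gset G S \<Longrightarrow> x \<in> V S \<Longrightarrow> push M S S (gid S) x = x"
  by (simp add: bivariantD(6)[OF biv])

lemma pull_gid: "finite_gset G S \<Longrightarrow> x \<in> V S \<Longrightarrow> pull M S S (gid S) x = x"
  by (simp add: bivariantD(7)[OF biv])

lemma push_comp: "finite_gset G S \<Longrightarrow> finite_gset G T \<Longrightarrow> finite_gset G U \<Longrightarrow> \<phi> \<in> gmaps G S T \<Longrightarrow> \<psi> \<in> gmaps G T U \<Longrightarrow>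
    x \<in> V S \<Longrightarrow> push M S U (compose (gpts S) \<psi> \<phi>) x = push M T U \<psi> (push M S T \<phi> x)"
  by (simp add: bivariantD(8)[OF biv] compose_eq)

lemma pull_comp: "finite_gset G S \<Longrightarrow> finite_gset G T \<Longrightarrow> finite_gset G U \<Longrightarrow> \<phi> \<in> gmaps G S T \<Longrightarrow> \<psi> \<in> gmaps G T U \<Longrightarrow>
    x \<in> V U \<Longrightarrow> pull M S U (compose (gpts S) \<psi> \<phi>) x = pull M S T \<phi> (pull M T U \<psi> x)"
  by (simp add: bivariantD(9)[OF biv] compose_eq)

text \<open>For an injective map the fibre product of \<open>S\<close> with itself over
  \<open>T\<close> is the diagonal, so the Mackey formula has identities on its other side.\<close>

lemma pull_push_inj:
  assumes S: "finite_gset G S" and T: "finite_gset G T" and f: "\<phi> \<in> gmaps G S T" and inj: "inj_on \<phi> (gpts S)" and x: "x \<in> V S"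
  shows "pull M S T \<phi> (push M S T \<phi> x) = x"
proof -
  have "gset_pullback S S S T \<phi> \<phi> (gid S) (gid S)"
    unfolding gset_pullback_def using S inj by (auto simp: gid_gmaps inj_on_def)
  from mackey_formula[OF S S T f f this x] show ?thesis
    using S x by (simp add: pull_gid push_gid)
qed

text \<open>The fibre product of maps with disjoint images is empty, so the composite passes through
  the trivial group.\<close>

lemma pull_push_disjoint:
  assumes S: "finite_gset G S" and S': "finite_gset G S'" and T: "finite_gset G T"
    and f: "\<phi> \<in> gmaps G S T" and f': "\<phi>' \<in> gmaps G S' T"
    and disj: "\<phi> ` gpts S \<inter> \<phi>' ` gpts S' = {}" and x: "x \<in> V S"
  shows "pull M S' T \<phi>' (push M S T \<phi> x) = \<one>\<^bsub>BOb M S'\<^esub>"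
proof -
  let ?E = "gset_empty G :: ('a, 'p) Gset" and ?u = "\<lambda>_. undefined :: ('a, 'p) pt"
  have u: "?u \<in> gmaps G ?E U" for U :: "('a, 'p) Gset" by (rule gmapsI) (simp_all add: extensional_def)
  have "gset_pullback ?E S S' T \<phi> \<phi>' ?u ?u"
    unfolding gset_pullback_def using u disj finite_gset_empty by auto
  from mackey_formula[OF S S' T f f' this x]
  have "pull M S' T \<phi>' (push M S T \<phi> x) = push M ?E S' ?u (pull M ?E S ?u x)" .
  also have "pull M ?E S ?u x = \<one>\<^bsub>BOb M ?E\<^esub>" by (rule val_empty[OF pull_closed[OF finite_gset_empty S u x]])
  finally show ?thesis by (simp add: push_one[OF finite_gset_empty S' u])
qed

end

locale mackey = fin_group G for G (structure) +
  fixes M :: "('a, 'p, 'v) abfunctors"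
  assumes mackey: "mackey_functor G M" and conj_inv: "conj_invariant G M"

sublocale mackey \<subseteq> premackey
proof
  show "bivariant_functor (DG G) Ab M" using mackey by (simp add: mackey_functor_def)
  show "x = \<one>\<^bsub>BOb M (gset_empty G)\<^esub>" if "x \<in> carrier (BOb M (gset_empty G))" for x
    using mackey that unfolding mackey_functor_def by blast
  fix R R' T P :: "('a, 'p) Gset" and p q' u v x
  assume R: "finite_gset G R" and R': "finite_gset G R'" and T: "finite_gset G T"
    and p: "p \<in> gmaps G R T" and q': "q' \<in> gmaps G R' T"
    and P: "gset_pullback P R R' T p q' u v" and x: "x \<in> carrier (BOb M R)"
  have "\<And>S S1 S2 T \<Psi> \<Phi> \<phi> \<psi>. pullback_square (DG G) S S1 S2 T \<Psi> \<Phi> \<phi> \<psi> \<Longrightarrow>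
        compose (carrier (BOb M S2)) (pull M S1 T \<phi>) (push M S2 T \<psi>) =
        compose (carrier (BOb M S2)) (push M S S1 \<Psi>) (pull M S S2 \<Phi>)"
    using mackey unfolding mackey_functor_def by simp
  from fun_cong[OF this[OF gset_pullback_square[OF R R' T p q' P]], of x]
  show "pull M R' T q' (push M R T p x) = push M P R' v (pull M P R u x)"
    using x by (simp add: compose_eq)
qed

context mackey
begin

text \<open>Restriction to the two summands is injective by (M2). Both sides have the same
  restrictions, by the Mackey formula for the two embeddings.\<close>

lemma val_sum_decompose:
  assumes S: "finite_gset G S" and S': "finite_gset G S'" and x: "x \<in> V (gset_sum G S S')"
  shows "x = push M S (gset_sum G S S') (gset_inl S) (pull M S (gset_sum G S S') (gset_inl S) x) \<otimes>\<^bsub>BOb M (gset_sum G S S')\<^esub>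
    push M S' (gset_sum G S S') (gset_inr S') (pull M S' (gset_sum G S S') (gset_inr S') x)"
proof -
  let ?U = "gset_sum G S S'"
  let ?l = "gset_inl S" and ?r = "gset_inr S'"
  note U = finite_gset_sum[OF S S']
  have l: "?l \<in> gmaps G S ?U" and r: "?r \<in> gmaps G S' ?U" using gmaps_sum(2,3)[OF S S'] by simp_all
  have li: "inj_on ?l (gpts S)" and ri: "inj_on ?r (gpts S')" by (auto simp: inj_on_def gset_inl_def gset_inr_def)
  have lr: "?l ` gpts S \<inter> ?r ` gpts S' = {}" and rl: "?r ` gpts S' \<inter> ?l ` gpts S = {}"
    by (auto simp: gset_inl_def gset_inr_def)
  have "(\<lambda>x. (pull M S ?U ?l x, pull M S' ?U ?r x)) \<in> iso (BOb M ?U) (BOb M S \<times>\<times> BOb M S')"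
    using mackey S S' unfolding mackey_functor_def by simp
  then have inj: "inj_on (\<lambda>x. (pull M S ?U ?l x, pull M S' ?U ?r x)) (V ?U)"
    by (simp add: iso_def bij_betw_def)
  let ?a = "pull M S ?U ?l x" and ?b = "pull M S' ?U ?r x"
  have a: "?a \<in> V S" and b: "?b \<in> V S'" using x S S' U l r by (simp_all add: pull_closed)
  have pa: "push M S ?U ?l ?a \<in> V ?U" and pb: "push M S' ?U ?r ?b \<in> V ?U"
    using a b S S' U l r by (simp_all add: push_closed)
  interpret VU: group "BOb M ?U" by (rule group_val[OF U])
  interpret VS: group "BOb M S" by (rule group_val[OF S])
  interpret VS': group "BOb M S'" by (rule group_val[OF S'])
  have "pull M S ?U ?l (push M S ?U ?l ?a \<otimes>\<^bsub>BOb M ?U\<^esub> push M S' ?U ?r ?b) = ?a"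
    using pull_mult[OF S U l pa pb] pull_push_inj[OF S U l li a] pull_push_disjoint[OF S' S U r l rl b] a by simp
  moreover have "pull M S' ?U ?r (push M S ?U ?l ?a \<otimes>\<^bsub>BOb M ?U\<^esub> push M S' ?U ?r ?b) = ?b"
    using pull_mult[OF S' U r pa pb] pull_push_inj[OF S' U r ri b] pull_push_disjoint[OF S S' U l r lr a] b by simp
  ultimately show ?thesis
    using x pa pb by (intro inj_onD[OF inj]) simp_all
qed

text \<open>Every \<open>y\<close> is a transfer along \<open>\<phi>\<close>, namely of its own
  transfer along the inverse map, which is again a G-map. On such elements the claim reduces to
  \<open>pull_push_inj\<close>.\<close>

lemma push_pull_bij:
  assumes S: "finite_gset G S" and T: "finite_gset G T" and f: "\<phi> \<in> gmaps G S T" and bij: "bij_betw \<phi> (gpts S) (gpts T)"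
    and y: "y \<in> V T"
  shows "push M S T \<phi> (pull M S T \<phi> y) = y"
proof -
  define \<psi> where "\<psi> = (\<lambda>y\<in>gpts T. inv_into (gpts S) \<phi> y)"
  have pp: "\<psi> z \<in> gpts S" "\<phi> (\<psi> z) = z" if "z \<in> gpts T" for z
    using that bij inv_into_into[of z \<phi> "gpts S"] f_inv_into_f[of z \<phi> "gpts S"]
    by (simp_all add: \<psi>_def bij_betw_def)
  have inj: "inj_on \<phi> (gpts S)" using bij by (simp add: bij_betw_def)
  have psi: "\<psi> \<in> gmaps G T S"
  proof (rule gmapsI)
    show "\<psi> \<in> extensional (gpts T)" by (simp add: \<psi>_def)
    show "\<psi> z \<in> gpts S" if "z \<in> gpts T" for z using pp(1)[OF that] .
    show "\<psi> (gact T g z) = gact S g (\<psi> z)" if z: "g \<in> carrier G" "z \<in> gpts T" for g z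
    proof (rule inj_onD[OF inj])
      show "\<phi> (\<psi> (gact T g z)) = \<phi> (gact S g (\<psi> z))"
        using pp(2)[OF gsetD(2)[OF T z]] gmapsD(2)[OF f z(1) pp(1)[OF z(2)]] pp(2)[OF z(2)] by simp
      show "\<psi> (gact T g z) \<in> gpts S" by (rule pp(1)[OF gsetD(2)[OF T z]])
      show "gact S g (\<psi> z) \<in> gpts S" by (rule gsetD(2)[OF S z(1) pp(1)[OF z(2)]])
    qed
  qed
  have "compose (gpts T) \<phi> \<psi> = gid T"
    by (rule gmaps_eqI[OF compose_gmaps[OF T psi f] gid_gmaps[OF T]]) (simp add: compose_eq pp)
  then have "push M S T \<phi> (push M T S \<psi> y) = y"
    using push_comp[OF T S T psi f y] push_gid[OF T y] by simp
  then show ?thesis using pull_push_inj[OF S T f inj push_closed[OF T S psi y]] by simp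
qed

section \<open>Inner automorphisms act trivially on conjugation invariant Mackey functors\<close>

definition acts_trivially :: "('a, 'p) Gset \<Rightarrow> bool" where
  "acts_trivially R \<longleftrightarrow> (\<forall>\<alpha> u x. inner_map R \<alpha> u \<longrightarrow> x \<in> V R \<longrightarrow> push M R R \<alpha> x = x)"

text \<open>An element h of H fixes the coset H, so the conjugation rule gives z = h z h^-1 for z
  the value of \<open>u\<close> there. Hence z centralizes H, and conjugation invariance applies to
  \<open>\<alpha>\<close>.\<close>

lemma trivial_coset:
  assumes H: "subgroup H G"
  shows "acts_trivially (coset_gset G H)"
  unfolding acts_trivially_def
proof (intro allI impI)
  let ?S = "coset_gset G H :: ('a, 'p) Gset"
  fix \<alpha> u x assume a: "inner_map ?S \<alpha> u" and x: "x \<in> V ?S"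
  note aD = inner_mapD[OF a]
  have mem: "Cs H \<in> gpts ?S" using based_nth[OF based_coset(1)[OF H], of 0] by simp
  let ?z = "u (Cs H)"
  have z: "?z \<in> carrier G" by (rule aD(2)[OF mem])
  have comm: "?z \<otimes> h = h \<otimes> ?z" if h: "h \<in> H" for h
  proof -
    have hG: "h \<in> carrier G" using subgroup.mem_carrier[OF H h] .
    have "gact ?S h (Cs H) = Cs H" using base_coset_act[OF H hG] lcos_eq_self_iff[OF H hG] h by simp
    then have "?z = h \<otimes> ?z \<otimes> inv h" using aD(4)[OF mem hG] by simp
    then have "?z \<otimes> h = h \<otimes> ?z \<otimes> inv h \<otimes> h" by simp
    then show ?thesis using z hG by (simp add: m_assoc)
  qed
  have eq: "\<alpha> (Cs H) = Cs (?z <# H)" using aD(3)[OF mem] base_coset_act[OF H z] by simp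
  have "push M ?S ?S \<alpha> = Idn Ab (BOb M ?S)"
    by (rule conj_inv[unfolded conj_invariant_def, rule_format, of H ?z]) (use H z comm aD(1) eq in simp_all)
  then show "push M ?S ?S \<alpha> x = x" using x by simp
qed

text \<open>An inner automorphism moves each point within its orbit, so it preserves both summands
  and restricts to inner automorphisms \<open>\<beta>\<close> and \<open>\<gamma>\<close>. By
  \<open>val_sum_decompose\<close> it is enough to know its effect on elements transferred from a
  summand.\<close>

lemma trivial_sum:
  assumes R: "finite_gset G R" and R': "finite_gset G R'" and tR: "acts_trivially R" and tR': "acts_trivially R'"
  shows "acts_trivially (gset_sum G R R')"
  unfolding acts_trivially_def
proof (intro allI impI)
  let ?U = "gset_sum G R R'" and ?l = "gset_inl R" and ?r = "gset_inr R'"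
  note U = finite_gset_sum[OF R R']
  have l: "?l \<in> gmaps G R ?U" and r: "?r \<in> gmaps G R' ?U" using gmaps_sum(2,3)[OF R R'] by simp_all
  fix \<alpha> u x assume a: "inner_map ?U \<alpha> u" and x: "x \<in> V ?U"
  note aD = inner_mapD[OF a]
  define \<beta> where "\<beta> = (\<lambda>z\<in>gpts R. gact R (u (InL z)) z)"
  define \<gamma> where "\<gamma> = (\<lambda>z\<in>gpts R'. gact R' (u (InR z)) z)"
  have uL: "u (InL z) \<in> carrier G" "g \<in> carrier G \<Longrightarrow> u (InL (gact R g z)) = g \<otimes> u (InL z) \<otimes> inv g"
    if "z \<in> gpts R" for z g
    using aD(2)[of "InL z"] aD(4)[of "InL z" g] that by simp_all
  have uR: "u (InR z) \<in> carrier G" "g \<in> carrier G \<Longrightarrow> u (InR (gact R' g z)) = g \<otimes> u (InR z) \<otimes> inv g"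
    if "z \<in> gpts R'" for z g
    using aD(2)[of "InR z"] aD(4)[of "InR z" g] that by simp_all
  have b: "inner_map R \<beta> (u \<circ> InL)"
    unfolding inner_map_def
    using uL by (auto intro!: gmapsI simp: \<beta>_def gsetD[OF R] m_assoc)
  have c: "inner_map R' \<gamma> (u \<circ> InR)"
    unfolding inner_map_def
    using uR by (auto intro!: gmapsI simp: \<gamma>_def gsetD[OF R'] m_assoc)
  note bm = inner_mapD(1)[OF b] and cm = inner_mapD(1)[OF c]
  have ab: "compose (gpts R) \<alpha> ?l = compose (gpts R) ?l \<beta>"
    by (rule gmaps_eqI[OF compose_gmaps[OF R l aD(1)] compose_gmaps[OF R bm l]])
       (use aD(3) uL(1) in \<open>auto simp: compose_eq gset_inl_def \<beta>_def gsetD[OF R]\<close>)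
  have ac: "compose (gpts R') \<alpha> ?r = compose (gpts R') ?r \<gamma>"
    by (rule gmaps_eqI[OF compose_gmaps[OF R' r aD(1)] compose_gmaps[OF R' cm r]])
       (use aD(3) uR(1) in \<open>auto simp: compose_eq gset_inr_def \<gamma>_def gsetD[OF R']\<close>)
  have L: "push M ?U ?U \<alpha> (push M R ?U ?l y) = push M R ?U ?l y" if y: "y \<in> V R" for y
    using push_comp[OF R U U l aD(1) y] push_comp[OF R R U bm l y] tR b y unfolding ab acts_trivially_def by metis
  have Rr: "push M ?U ?U \<alpha> (push M R' ?U ?r y) = push M R' ?U ?r y" if y: "y \<in> V R'" for y
    using push_comp[OF R' U U r aD(1) y] push_comp[OF R' R' U cm r y] tR' c y unfolding ac acts_trivially_def by metis
  have pl: "pull M R ?U ?l x \<in> V R" and pr: "pull M R' ?U ?r x \<in> V R'"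
    using pull_closed[OF R U l x] pull_closed[OF R' U r x] .
  show "push M ?U ?U \<alpha> x = x"
    using val_sum_decompose[OF R R' x] L[OF pl] Rr[OF pr]
      push_mult[OF U U aD(1) push_closed[OF R U l pl] push_closed[OF R' U r pr]] by metis
qed

text \<open>Conjugating an inner automorphism with an isomorphism \<open>\<phi>\<close> gives an
  inner automorphism again, with \<open>u\<close> composed with \<open>\<phi>\<close>, because
  \<open>\<phi>\<close> commutes with the action.\<close>

lemma trivial_transfer:
  assumes R: "finite_gset G R" and R': "finite_gset G R'" and tR: "acts_trivially R"
    and f: "\<phi> \<in> gmaps G R R'" "\<psi> \<in> gmaps G R' R" "\<And>x. x \<in> gpts R \<Longrightarrow> \<psi> (\<phi> x) = x" "\<And>x. x \<in> gpts R' \<Longrightarrow> \<phi> (\<psi> x) = x"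
  shows "acts_trivially R'"
  unfolding acts_trivially_def
proof (intro allI impI)
  fix \<alpha> u x assume a: "inner_map R' \<alpha> u" and x: "x \<in> V R'"
  note aD = inner_mapD[OF a] and fD = gmapsD[OF f(1)] and gD = gmapsD[OF f(2)]
  let ?\<beta> = "compose (gpts R) \<psi> (compose (gpts R) \<alpha> \<phi>)"
  note cm = compose_gmaps[OF R f(1) aD(1)]
  have bm: "?\<beta> \<in> gmaps G R R" by (rule compose_gmaps[OF R cm f(2)])
  have b: "inner_map R ?\<beta> (u \<circ> \<phi>)"
    unfolding inner_map_def using bm aD(2,4) by (auto simp: compose_eq fD gD aD(3) f(3))
  have eq: "compose (gpts R) \<phi> ?\<beta> = compose (gpts R) \<alpha> \<phi>"
    by (rule gmaps_eqI[OF compose_gmaps[OF R bm f(1)] cm]) (simp add: compose_eq f(4) gmapsD(1)[OF aD(1)] fD)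
  let ?y = "push M R' R \<psi> x"
  have y: "?y \<in> V R" by (rule push_closed[OF R' R f(2) x])
  have "compose (gpts R') \<phi> \<psi> = gid R'"
    by (rule gmaps_eqI[OF compose_gmaps[OF R' f(2,1)] gid_gmaps[OF R']]) (simp add: compose_eq f(4))
  then have xy: "push M R R' \<phi> ?y = x" using push_comp[OF R' R R' f(2,1) x] push_gid[OF R' x] by simp
  have "push M R' R' \<alpha> (push M R R' \<phi> ?y) = push M R R' \<phi> (push M R R ?\<beta> ?y)"
    using push_comp[OF R R' R' f(1) aD(1) y] push_comp[OF R R R' bm f(1) y] unfolding eq by simp
  also have "push M R R ?\<beta> ?y = ?y" using tR b y unfolding acts_trivially_def by blast
  finally show "push M R' R' \<alpha> x = x" unfolding xy .
qed

lemma trivial_std: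
  assumes "t \<in> tuples"
  shows "acts_trivially (std_gset t)"
  using assms
proof (induction t)
  case Nil
  have "push M (gset_empty G) (gset_empty G) \<alpha> x = x"
    if "inner_map (gset_empty G) \<alpha> u" "x \<in> V (gset_empty G)" for \<alpha> u x
    using val_empty[OF push_closed[OF finite_gset_empty finite_gset_empty inner_mapD(1)[OF that(1)] that(2)]]
      val_empty[OF that(2)] by simp
  then show ?case unfolding acts_trivially_def by simp
next
  case (Cons H t)
  then have H: "subgroup H G" and t: "t \<in> tuples" by (simp_all add: Bdot_Ob)
  show ?case unfolding std_gset.simps
    by (intro trivial_sum finite_coset_gset trivial_coset H Cons.IH t based_gset[OF conjunct1[OF std_gset[OF t]]])
qed

text \<open>For any choice of base points, R is isomorphic to the standard G-set of its stabilizers.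
  That one is built from coset spaces by disjoint unions, where the claim is known.\<close>

lemma inner_push:
  assumes R: "finite_gset G R" and a: "inner_map R \<alpha> u" and x: "x \<in> V R"
  shows "push M R R \<alpha> x = x"
proof -
  obtain b :: "('a, 'p) Gset \<Rightarrow> ('a, 'p) pt list" where b: "base_points G b"
    using base_points_exist[OF is_group] by blast
  note B = base_points_based[OF b R]
  let ?t = "stabs R (b R)"
  have t: "?t \<in> tuples" by (rule stabs_Ob[OF B])
  note S = conjunct1[OF std_gset[OF t]] and st = conjunct2[OF std_gset[OF t]]
  have "acts_trivially R"
    by (rule trivial_transfer[OF based_gset[OF S] R trivial_std[OF t] base_map_gmaps[OF S B st] base_map_gmaps[OF B S st[symmetric]]
        base_map_inverse[OF S B st] base_map_inverse[OF B S st[symmetric]]])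
  then show ?thesis using a x unfolding acts_trivially_def by blast
qed

text \<open>Since \<open>\<alpha>\<close> is injective, restricting the transfer of x gives x; and
  the transfer of x is x itself.\<close>

lemma inner_pull:
  assumes R: "finite_gset G R" and a: "inner_map R \<alpha> u" and x: "x \<in> V R"
  shows "pull M R R \<alpha> x = x"
proof -
  have "inj_on \<alpha> (gpts R)" using inner_map_inj[OF R a] by (simp add: inj_on_def)
  then show ?thesis using pull_push_inj[OF R R inner_mapD(1)[OF a] _ x] inner_push[OF assms] by simp
qed

section \<open>Evaluation of a Mackey functor on spans\<close>

definition sval where
  "sval S R T q p x = push M R T p (pull M R S q x)"

lemma sval_closed: "gspan S R T q p \<Longrightarrow> x \<in> V S \<Longrightarrow> sval S R T q p x \<in> V T"
  unfolding sval_def by (intro push_closed pull_closed gspanD[of S R T q p])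

lemma sval_mult: "gspan S R T q p \<Longrightarrow> x \<in> V S \<Longrightarrow> y \<in> V S \<Longrightarrow>
    sval S R T q p (x \<otimes>\<^bsub>BOb M S\<^esub> y) = sval S R T q p x \<otimes>\<^bsub>BOb M T\<^esub> sval S R T q p y"
  unfolding sval_def by (simp add: gspanD pull_mult push_mult pull_closed)

lemma sval_comp:
  assumes R: "gspan S R T q p" and R': "gspan T R' W q' p'" and P: "gset_pullback P R R' T p q' u v" and x: "x \<in> V S"
  shows "sval S P W (compose (gpts P) q u) (compose (gpts P) p' v) x = sval T R' W q' p' (sval S R T q p x)"
proof -
  note r = gspanD[OF R] and r' = gspanD[OF R'] and D = gset_pullbackD[OF P]
  have y: "pull M R S q x \<in> V R" by (rule pull_closed[OF r(2,1,4) x])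
  have z: "pull M P R u (pull M R S q x) \<in> V P" by (rule pull_closed[OF D(1) r(2) D(2) y])
  show ?thesis
    unfolding sval_def
    using pull_comp[OF D(1) r(2,1) D(2) r(4) x] push_comp[OF D(1) r'(2,3) D(3) r'(5) z]
      mackey_formula[OF r(2) r'(2) r(3,5) r'(4) P y] by simp
qed

text \<open>The element restricted to the apex decomposes into the transfers of its restrictions to
  both summands. By functoriality these restrictions are the ones along \<open>q\<close> and
  \<open>q'\<close>, and the transfers combine with those along \<open>p\<close> and
  \<open>p'\<close>.\<close>

lemma sval_sum:
  assumes R: "gspan S R T q p" and R': "gspan S R' T q' p'" and x: "x \<in> V S"
  shows "sval S (gset_sum G R R') T (copair R R' q q') (copair R R' p p') x =
    sval S R T q p x \<otimes>\<^bsub>BOb M T\<^esub> sval S R' T q' p' x"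
proof -
  note r = gspanD[OF R] and r' = gspanD[OF R'] and s = gspanD[OF gspan_sum[OF R R']]
  let ?U = "gset_sum G R R'" and ?l = "gset_inl R" and ?r = "gset_inr R'"
  have l: "?l \<in> gmaps G R ?U" and rr: "?r \<in> gmaps G R' ?U" using gmaps_sum(2,3)[OF r(2) r'(2)] by simp_all
  have cl: "compose (gpts R) (copair R R' f f') ?l = f" if "f \<in> gmaps G R A" "f' \<in> gmaps G R' A" for f f' A
    by (rule gmaps_eqI[OF compose_gmaps[OF r(2) l gmaps_sum(1)[OF r(2) r'(2) that]] that(1)])
       (simp add: compose_eq gset_inl_def)
  have cr: "compose (gpts R') (copair R R' f f') ?r = f'" if "f \<in> gmaps G R A" "f' \<in> gmaps G R' A" for f f' A
    by (rule gmaps_eqI[OF compose_gmaps[OF r'(2) rr gmaps_sum(1)[OF r(2) r'(2) that]] that(2)])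
       (simp add: compose_eq gset_inr_def)
  let ?y = "pull M ?U S (copair R R' q q') x"
  have y: "?y \<in> V ?U" by (rule pull_closed[OF s(2,1,4) x])
  have yl: "pull M R ?U ?l ?y = pull M R S q x" and yr: "pull M R' ?U ?r ?y = pull M R' S q' x"
    using pull_comp[OF r(2) s(2,1) l s(4) x] pull_comp[OF r'(2) s(2,1) rr s(4) x] cl[OF r(4) r'(4)] cr[OF r(4) r'(4)] by simp_all
  have ql: "pull M R S q x \<in> V R" and qr: "pull M R' S q' x \<in> V R'"
    using pull_closed[OF r(2,1,4) x] pull_closed[OF r'(2,1,4) x] .
  have "sval S ?U T (copair R R' q q') (copair R R' p p') x =
      push M ?U T (copair R R' p p') (push M R ?U ?l (pull M R S q x) \<otimes>\<^bsub>BOb M ?U\<^esub> push M R' ?U ?r (pull M R' S q' x))"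
    unfolding sval_def using val_sum_decompose[OF r(2) r'(2) y] unfolding yl yr by simp
  also have "\<dots> = sval S R T q p x \<otimes>\<^bsub>BOb M T\<^esub> sval S R' T q' p' x"
    using push_mult[OF s(2,3,5) push_closed[OF r(2) s(2) l ql] push_closed[OF r'(2) s(2) rr qr]]
      push_comp[OF r(2) s(2,3) l s(5) ql] push_comp[OF r'(2) s(2,3) rr s(5) qr] cl[OF r(5) r'(5)] cr[OF r(5) r'(5)]
    by (simp add: sval_def)
  finally show ?thesis .
qed

end

section \<open>Spans with isomorphic bisets\<close>

context fin_group
begin

text \<open>The points of the bisets represent all orbits of R: a point is first translated so that
  its right image becomes a base point, and the left image then supplies the element g.\<close>

lemma span_biset_cover:
  assumes S: "based S b" and T: "based T c" and R: "gspan S R T q p" and r: "r \<in> gpts R"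
  obtains a i k r0 g where "a < length c" "i < length b" "k \<in> carrier G"
    "(r0, g) \<in> bpts (span_biset S R q p (b ! i) (c ! a))" "r = gact R k r0"
proof -
  note D = gsetD[OF gspanD(2)[OF R]] and q = gmapsD[OF gspanD(4)[OF R]] and p = gmapsD[OF gspanD(5)[OF R]]
  note DT = gsetD[OF gspanD(3)[OF R]]
  obtain k where a: "bidx T c (p r) < length c" and k: "k \<in> carrier G" "p r = gact T k (c ! bidx T c (p r))"
    using bidx[OF T p(1)[OF r]] by blast
  let ?r = "gact R (inv k) r"
  have r0: "?r \<in> gpts R" using D(2) k(1) r by simp
  obtain g where i: "bidx S b (q ?r) < length b" and g: "g \<in> carrier G" "q ?r = gact S g (b ! bidx S b (q ?r))"
    using bidx[OF S q(1)[OF r0]] by blast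
  have "p ?r = gact T (inv k) (gact T k (c ! bidx T c (p r)))" using p(2)[of "inv k" r] k r by simp
  also have "\<dots> = c ! bidx T c (p r)" by (rule DT(5)[OF k(1) based_nth[OF T a]])
  finally have "(?r, g) \<in> bpts (span_biset S R q p (b ! bidx S b (q ?r)) (c ! bidx T c (p r)))"
    using r0 g by simp
  moreover have "r = gact R k ?r" using D(6)[OF k(1) r] by simp
  ultimately show thesis using that[OF a i k(1)] by blast
qed

text \<open>The ambiguity in writing a point of R as a translate \<open>k r0\<close> of a biset
  point. It is an element of the stabilizer of \<open>c ! a\<close> acting from the left and one of
  the stabilizer of \<open>b ! i\<close> acting from the right, and maps of bisets commute with
  both.\<close>

lemma span_biset_same_point:
  assumes S: "based S b" and T: "based T c" and R: "gspan S R T q p"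
    and a: "a < length c" "a2 < length c" and i: "i < length b" "i2 < length b" and k: "k \<in> carrier G" "k2 \<in> carrier G"
    and X: "(r, g) \<in> bpts (span_biset S R q p (b ! i) (c ! a))" "(r2, g2) \<in> bpts (span_biset S R q p (b ! i2) (c ! a2))"
    and eq: "gact R k r = gact R k2 r2"
  shows "a2 = a" "i2 = i" "inv k2 \<otimes> k \<in> stab T (c ! a)" "inv (inv k2 \<otimes> k \<otimes> g) \<otimes> g2 \<in> stab S (b ! i)"
    "r2 = gact R (inv k2 \<otimes> k) r"
proof -
  note D = gsetD[OF gspanD(2)[OF R]] and q = gmapsD[OF gspanD(4)[OF R]] and p = gmapsD[OF gspanD(5)[OF R]]
  note DT = gsetD[OF gspanD(3)[OF R]] and DS = gsetD[OF gspanD(1)[OF R]]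
  have r: "r \<in> gpts R" "g \<in> carrier G" "p r = c ! a" "q r = gact S g (b ! i)"
    and r2: "r2 \<in> gpts R" "g2 \<in> carrier G" "p r2 = c ! a2" "q r2 = gact S g2 (b ! i2)"
    using X by simp_all
  let ?h = "inv k2 \<otimes> k"
  have h: "?h \<in> carrier G" using k by simp
  have "gact R (inv k2) (gact R k r) = r2" using eq D(5)[OF k(2) r2(1)] by simp
  then show r2h: "r2 = gact R ?h r" using D(4)[of "inv k2" k r] k r(1) by simp
  have pc: "c ! a2 = gact T ?h (c ! a)" unfolding r2(3)[symmetric] r2h p(2)[OF h r(1)] r(3) ..
  have "bidx T c (c ! a2) = a" unfolding pc by (rule bidx_eq[OF T a(1) h])
  then show aa: "a2 = a" using bidx_nth[OF T a(2)] by simp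
  show "?h \<in> stab T (c ! a)" using h pc aa by (simp add: stab_iff)
  have hg: "?h \<otimes> g \<in> carrier G" using h r by simp
  have qb: "gact S g2 (b ! i2) = gact S (?h \<otimes> g) (b ! i)"
    unfolding r2(4)[symmetric] r2h q(2)[OF h r(1)] r(4) by (rule DS(4)[OF h r(2) based_nth[OF S i(1)], symmetric])
  show ii: "i2 = i" using bidx_eq[OF S i(2) r2(2)] bidx_eq[OF S i(1) hg] qb by simp
  note bi = based_nth[OF S i(1)]
  have "gact S (inv (?h \<otimes> g) \<otimes> g2) (b ! i) = gact S (inv (?h \<otimes> g)) (gact S (?h \<otimes> g) (b ! i))"
    using DS(4)[of "inv (?h \<otimes> g)" g2 "b ! i"] hg r2(2) bi qb ii by simp
  also have "\<dots> = b ! i" by (rule DS(5)[OF hg bi])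
  finally show "inv (?h \<otimes> g) \<otimes> g2 \<in> stab S (b ! i)" using hg r2(2) by (simp add: stab_iff)
qed

text \<open>An isomorphism \<open>f\<close> of the bisets of two spans need not respect the projections to \<open>G\<close>; it
  changes \<open>g\<close> to some \<open>g'\<close>, and \<open>g' g\<^sup>-\<^sup>1\<close> is the inner automorphism by which the two spans differ.\<close>

lemma span_iso_up_to_inner:
  assumes S: "based S b" and T: "based T c" and R: "gspan S R T q p" and R': "gspan S R' T q' p'"
    and iso: "\<And>a i. a < length c \<Longrightarrow> i < length b \<Longrightarrow> biset_iso (stab S (b ! i)) (stab T (c ! a))
      (span_biset S R q p (b ! i) (c ! a)) (span_biset S R' q' p' (b ! i) (c ! a))"
  shows "\<exists>\<beta> \<alpha> u. \<beta> \<in> gmaps G R R' \<and> bij_betw \<beta> (gpts R) (gpts R') \<and> inner_map R \<alpha> u \<and>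
    (\<forall>r\<in>gpts R. p' (\<beta> r) = p r \<and> q' (\<beta> r) = q (\<alpha> r))"
proof -
  let ?X = "\<lambda>a i. span_biset S R q p (b ! i) (c ! a)" and ?X' = "\<lambda>a i. span_biset S R' q' p' (b ! i) (c ! a)"
  note D = gsetD[OF gspanD(2)[OF R]] and q = gmapsD[OF gspanD(4)[OF R]] and p = gmapsD[OF gspanD(5)[OF R]]
  note D' = gsetD[OF gspanD(2)[OF R']] and q' = gmapsD[OF gspanD(4)[OF R']] and p' = gmapsD[OF gspanD(5)[OF R']]
  note DT = gsetD[OF gspanD(3)[OF R]] and DS = gsetD[OF gspanD(1)[OF R]]
  have "\<forall>a i. \<exists>f. a < length c \<longrightarrow> i < length b \<longrightarrow> bij_betw f (bpts (?X a i)) (bpts (?X' a i)) \<and>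
      biset_hom (stab S (b ! i)) (stab T (c ! a)) (?X a i) (?X' a i) f"
    using iso unfolding biset_iso_hom by blast
  then obtain f where f: "\<And>a i. a < length c \<Longrightarrow> i < length b \<Longrightarrow> bij_betw (f a i) (bpts (?X a i)) (bpts (?X' a i))"
    "\<And>a i. a < length c \<Longrightarrow> i < length b \<Longrightarrow> biset_hom (stab S (b ! i)) (stab T (c ! a)) (?X a i) (?X' a i) (f a i)"
    by metis
  have f_act: "f a i (gact R h r, h \<otimes> g \<otimes> e) = (gact R' h r', h \<otimes> g' \<otimes> e)"
    if ai: "a < length c" "i < length b" and X: "(r, g) \<in> bpts (?X a i)" and fr: "f a i (r, g) = (r', g')"
      and h: "h \<in> stab T (c ! a)" and e: "e \<in> stab S (b ! i)" for a i r g r' g' h e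
  proof -
    note fD = biset_homD[OF f(2)[OF ai]] and XD = finite_bisetD[OF finite_span_biset[OF R based_nth[OF S ai(2)] based_nth[OF T ai(1)]]]
    have "f a i (ract (?X a i) (lact (?X a i) h (r, g)) e) = ract (?X' a i) (lact (?X' a i) h (f a i (r, g))) e"
      using fD(3)[OF e XD(2)[OF h X]] fD(2)[OF h X] by simp
    then show ?thesis unfolding fr by simp
  qed
  have f_mem: "(r', g') \<in> bpts (?X' a i)"
    if "a < length c" "i < length b" "(r, g) \<in> bpts (?X a i)" "f a i (r, g) = (r', g')" for a i r g r' g'
    using biset_homD(1)[OF f(2)[OF that(1,2)] that(3)] that(4) by simp
  \<comment> \<open>The graph of the sought map together with its conjugator: \<open>s\<close> will
    be \<open>\<beta> r\<close> and \<open>w\<close> will be \<open>u r\<close>. It extends the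
    change from (r0, g) to (r0', g') to all translates, and so g' g^-1 has to be conjugated by
    k.\<close>
  define Rel where "Rel r s w \<longleftrightarrow> (\<exists>a i k r0 g r0' g'. a < length c \<and> i < length b \<and> k \<in> carrier G \<and>
     (r0, g) \<in> bpts (?X a i) \<and> f a i (r0, g) = (r0', g') \<and> r = gact R k r0 \<and> s = gact R' k r0' \<and>
     w = k \<otimes> g' \<otimes> inv g \<otimes> inv k)" for r s w
  have RelE: "\<exists>a i k r0 g r0' g'. a < length c \<and> i < length b \<and> k \<in> carrier G \<and>
     (r0, g) \<in> bpts (?X a i) \<and> f a i (r0, g) = (r0', g') \<and> (r0', g') \<in> bpts (?X' a i) \<and>
     r = gact R k r0 \<and> s = gact R' k r0' \<and> w = k \<otimes> g' \<otimes> inv g \<otimes> inv k" if "Rel r s w" for r s w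
    using that f_mem unfolding Rel_def by metis
  have total: "\<exists>s w. Rel r s w" if r: "r \<in> gpts R" for r
  proof -
    obtain a i k r0 g where *: "a < length c" "i < length b" "k \<in> carrier G"
      "(r0, g) \<in> bpts (?X a i)" "r = gact R k r0" using span_biset_cover[OF S T R r] .
    obtain r0' g' where "f a i (r0, g) = (r0', g')" by (metis surj_pair)
    then show ?thesis unfolding Rel_def using * by blast
  qed
  have onto: "\<exists>r\<in>gpts R. \<exists>w. Rel r s w" if s: "s \<in> gpts R'" for s
  proof -
    obtain a i k r0' g' where *: "a < length c" "i < length b" "k \<in> carrier G"
      "(r0', g') \<in> bpts (?X' a i)" "s = gact R' k r0'" using span_biset_cover[OF S T R' s] .
    obtain r0 g where fr: "(r0, g) \<in> bpts (?X a i)" "f a i (r0, g) = (r0', g')"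
      using f(1)[OF *(1,2)] *(4) unfolding bij_betw_def by (metis imageE surj_pair)
    then have "Rel (gact R k r0) s (k \<otimes> g' \<otimes> inv g \<otimes> inv k)" unfolding Rel_def using * by blast
    moreover have "gact R k r0 \<in> gpts R" using fr(1) *(3) D(2) by simp
    ultimately show ?thesis by blast
  qed
  \<comment> \<open>Another presentation has g and g' replaced by h g e and h g' e, with the same h
    and e. In g' g^-1 the factor e cancels, and h is absorbed into the translating element
    k.\<close>
  have functional: "s = s2 \<and> w = w2" if rel: "Rel r s w" "Rel r s2 w2" for r s w s2 w2
  proof -
    obtain a i k r0 g r0' g' where 1: "a < length c" "i < length b" "k \<in> carrier G"
     "(r0, g) \<in> bpts (?X a i)" "f a i (r0, g) = (r0', g')" "(r0', g') \<in> bpts (?X' a i)"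
     "r = gact R k r0" "s = gact R' k r0'" "w = k \<otimes> g' \<otimes> inv g \<otimes> inv k" using RelE[OF rel(1)] by blast
    obtain a2 i2 k2 r1 g1 r1' g1' where 2: "a2 < length c" "i2 < length b" "k2 \<in> carrier G"
     "(r1, g1) \<in> bpts (?X a2 i2)" "f a2 i2 (r1, g1) = (r1', g1')" "(r1', g1') \<in> bpts (?X' a2 i2)"
     "r = gact R k2 r1" "s2 = gact R' k2 r1'" "w2 = k2 \<otimes> g1' \<otimes> inv g1 \<otimes> inv k2" using RelE[OF rel(2)] by blast
    have "gact R k r0 = gact R k2 r1" using 1(7) 2(7) by simp
    note same = span_biset_same_point[OF S T R 1(1) 2(1) 1(2) 2(2) 1(3) 2(3) 1(4) 2(4) this]
    let ?h = "inv k2 \<otimes> k" let ?e = "inv (?h \<otimes> g) \<otimes> g1"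
    have c: "g \<in> carrier G" "g1 \<in> carrier G" "g' \<in> carrier G" "r0' \<in> gpts R'"
      using 1(4,6) 2(4) by simp_all
    have g1: "g1 = ?h \<otimes> g \<otimes> ?e" using c 1(3) 2(3) by (simp add: mult_inv_cancel)
    have "(r1', g1') = (gact R' ?h r0', ?h \<otimes> g' \<otimes> ?e)"
      using f_act[OF 1(1,2,4,5) same(3,4)] 2(5) same(1,2,5) g1 by simp
    then have r1': "r1' = gact R' ?h r0'" and g1': "g1' = ?h \<otimes> g' \<otimes> ?e" by simp_all
    have "s2 = gact R' (k2 \<otimes> ?h) r0'" unfolding 2(8) r1' using c 1(3) 2(3) by (intro D'(4)[symmetric]) simp_all
    then have "s2 = s" unfolding 1(8) using 1(3) 2(3) by (simp add: mult_inv_cancel)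
    moreover have "w2 = w"
      unfolding 1(9) 2(9) g1' using c 1(3) 2(3) by (simp add: m_assoc inv_mult_group mult_inv_cancel)
    ultimately show ?thesis by simp
  qed
  \<comment> \<open>The same comparison with the roles of the two spans exchanged: the ambiguity of
    presenting s in \<open>R'\<close> is carried back to \<open>R\<close>, because f is injective
    and commutes with both actions.\<close>
  have injective: "r = r2" if rel: "Rel r s w" "Rel r2 s w2" for r r2 s w w2
  proof -
    obtain a i k r0 g r0' g' where 1: "a < length c" "i < length b" "k \<in> carrier G"
     "(r0, g) \<in> bpts (?X a i)" "f a i (r0, g) = (r0', g')" "(r0', g') \<in> bpts (?X' a i)"
     "r = gact R k r0" "s = gact R' k r0'" using RelE[OF rel(1)] by blast
    obtain a2 i2 k2 r1 g1 r1' g1' where 2: "a2 < length c" "i2 < length b" "k2 \<in> carrier G"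
     "(r1, g1) \<in> bpts (?X a2 i2)" "f a2 i2 (r1, g1) = (r1', g1')" "(r1', g1') \<in> bpts (?X' a2 i2)"
     "r2 = gact R k2 r1" "s = gact R' k2 r1'" using RelE[OF rel(2)] by blast
    have "gact R' k r0' = gact R' k2 r1'" using 1(8) 2(8) by simp
    note same = span_biset_same_point[OF S T R' 1(1) 2(1) 1(2) 2(2) 1(3) 2(3) 1(6) 2(6) this]
    let ?h = "inv k2 \<otimes> k" let ?e = "inv (?h \<otimes> g') \<otimes> g1'"
    have c: "g \<in> carrier G" "g1' \<in> carrier G" "g' \<in> carrier G" "r0 \<in> gpts R"
      using 1(4,6) 2(6) by simp_all
    have g1': "g1' = ?h \<otimes> g' \<otimes> ?e" using c 1(3) 2(3) by (simp add: mult_inv_cancel)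
    have "f a i (r1, g1) = f a i (gact R ?h r0, ?h \<otimes> g \<otimes> ?e)"
      using f_act[OF 1(1,2,4,5) same(3,4)] 2(5) same(1,2,5) g1' by simp
    moreover have "(gact R ?h r0, ?h \<otimes> g \<otimes> ?e) \<in> bpts (?X a i)"
    proof -
      note XD = finite_bisetD[OF finite_span_biset[OF R based_nth[OF S 1(2)] based_nth[OF T 1(1)]]]
      show ?thesis using XD(5)[OF same(4) XD(2)[OF same(3) 1(4)]] by simp
    qed
    moreover have "(r1, g1) \<in> bpts (?X a i)" using 2(4) unfolding same(1,2) .
    ultimately have "(r1, g1) = (gact R ?h r0, ?h \<otimes> g \<otimes> ?e)"
      using f(1)[OF 1(1,2)] unfolding bij_betw_def by (blast dest: inj_onD)
    then have "r2 = gact R (k2 \<otimes> ?h) r0" unfolding 2(7) using c 1(3) 2(3) D(4)[of k2 ?h r0] by simp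
    then show ?thesis unfolding 1(7) using 1(3) 2(3) by (simp add: mult_inv_cancel)
  qed
  have props: "s \<in> gpts R' \<and> w \<in> carrier G \<and> p' s = p r \<and> q' s = q (gact R w r)" if rel: "Rel r s w" for r s w
  proof -
    obtain a i k r0 g r0' g' where 1: "a < length c" "i < length b" "k \<in> carrier G"
     "(r0, g) \<in> bpts (?X a i)" "f a i (r0, g) = (r0', g')" "(r0', g') \<in> bpts (?X' a i)"
     "r = gact R k r0" "s = gact R' k r0'" "w = k \<otimes> g' \<otimes> inv g \<otimes> inv k" using RelE[OF rel] by blast
    have c: "g \<in> carrier G" "r0 \<in> gpts R" "p r0 = c ! a" "q r0 = gact S g (b ! i)"
      "g' \<in> carrier G" "r0' \<in> gpts R'" "p' r0' = c ! a" "q' r0' = gact S g' (b ! i)"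
      using 1(4,6) by simp_all
    have w: "w \<in> carrier G" unfolding 1(9) using 1(3) c by simp
    \<comment> \<open>As w k = k g' g^-1, applying w before \<open>q\<close> replaces g by g': the
      result k g' b_i is the image of s under \<open>q'\<close>.\<close>
    have "gact R w r = gact R (w \<otimes> k) r0" unfolding 1(7) using D(4)[OF w 1(3) c(2)] by simp
    also have "w \<otimes> k = k \<otimes> g' \<otimes> inv g" unfolding 1(9) using 1(3) c by (simp add: m_assoc)
    finally have "q (gact R w r) = gact S (k \<otimes> g' \<otimes> inv g) (gact S g (b ! i))"
      using q(2)[of "k \<otimes> g' \<otimes> inv g" r0] 1(3) c by simp
    also have "\<dots> = gact S (k \<otimes> g') (b ! i)"
      using DS(4)[of "k \<otimes> g' \<otimes> inv g" g "b ! i"] 1(3) c based_nth[OF S 1(2)] by (simp add: m_assoc)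
    also have "\<dots> = q' s" unfolding 1(8) using q'(2)[OF 1(3) c(6)] c(8) DS(4)[OF 1(3) c(5) based_nth[OF S 1(2)]] by simp
    finally have "q' s = q (gact R w r)" by simp
    then show ?thesis using w 1(3,7,8) c by (simp add: D'(2) p p')
  qed
  have equivariant: "Rel (gact R y r) (gact R' y s) (y \<otimes> w \<otimes> inv y)" if rel: "Rel r s w" and y: "y \<in> carrier G" for r s w y
  proof -
    obtain a i k r0 g r0' g' where 1: "a < length c" "i < length b" "k \<in> carrier G"
     "(r0, g) \<in> bpts (?X a i)" "f a i (r0, g) = (r0', g')" "(r0', g') \<in> bpts (?X' a i)"
     "r = gact R k r0" "s = gact R' k r0'" "w = k \<otimes> g' \<otimes> inv g \<otimes> inv k" using RelE[OF rel] by blast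
    have c: "g \<in> carrier G" "r0 \<in> gpts R" "g' \<in> carrier G" "r0' \<in> gpts R'" using 1(4,6) by simp_all
    have "gact R y r = gact R (y \<otimes> k) r0" "gact R' y s = gact R' (y \<otimes> k) r0'"
      unfolding 1(7,8) using D(4)[OF y 1(3) c(2)] D'(4)[OF y 1(3) c(4)] by simp_all
    moreover have "y \<otimes> w \<otimes> inv y = (y \<otimes> k) \<otimes> g' \<otimes> inv g \<otimes> inv (y \<otimes> k)"
      unfolding 1(9) using c 1(3) y by (simp add: m_assoc inv_mult_group)
    moreover have "y \<otimes> k \<in> carrier G" using y 1(3) by simp
    ultimately show ?thesis unfolding Rel_def using 1(1,2,4,5) by blast
  qed
  have "\<forall>r\<in>gpts R. \<exists>s w. Rel r s w" using total by blast
  then obtain \<beta>0 u where bu: "\<And>r. r \<in> gpts R \<Longrightarrow> Rel r (\<beta>0 r) (u r)" by metis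
  define \<beta> where "\<beta> = (\<lambda>r\<in>gpts R. \<beta>0 r)"
  define \<alpha> where "\<alpha> = (\<lambda>r\<in>gpts R. gact R (u r) r)"
  have rel: "Rel r (\<beta> r) (u r)" if "r \<in> gpts R" for r using bu[OF that] that by (simp add: \<beta>_def)
  \<comment> \<open>Both parts follow at once since \<open>Rel\<close> is equivariant and
    single-valued.\<close>
  have act: "\<beta> (gact R y r) = gact R' y (\<beta> r) \<and> u (gact R y r) = y \<otimes> u r \<otimes> inv y" if "r \<in> gpts R" "y \<in> carrier G" for r y
    using functional[OF rel[OF D(2)[OF that(2,1)]] equivariant[OF rel[OF that(1)] that(2)]] .
  have ug: "u r \<in> carrier G" if "r \<in> gpts R" for r using props[OF rel[OF that]] by blast
  have "\<beta> \<in> gmaps G R R'"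
    using act props[OF rel] by (intro gmapsI) (simp_all add: \<beta>_def)
  moreover have "bij_betw \<beta> (gpts R) (gpts R')"
  proof (rule bij_betw_imageI)
    show "inj_on \<beta> (gpts R)"
    proof (rule inj_onI)
      fix x y assume "x \<in> gpts R" "y \<in> gpts R" "\<beta> x = \<beta> y"
      then show "x = y" using injective[of x "\<beta> x" "u x" y "u y"] rel[of x] rel[of y] by simp
    qed
    show "\<beta> ` gpts R = gpts R'"
    proof (intro equalityI subsetI)
      fix s assume "s \<in> gpts R'"
      then obtain r w where r: "r \<in> gpts R" "Rel r s w" using onto by blast
      then have "\<beta> r = s" using functional[OF rel[OF r(1)] r(2)] by simp
      then show "s \<in> \<beta> ` gpts R" using r(1) by blast
    qed (use props[OF rel] in blast)
  qed
  moreover have "inner_map R \<alpha> u"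
  proof -
    have "\<alpha> \<in> gmaps G R R"
    proof (rule gmapsI)
      show "\<alpha> \<in> extensional (gpts R)" by (simp add: \<alpha>_def)
      show "\<alpha> r \<in> gpts R" if "r \<in> gpts R" for r using that ug D(2) by (simp add: \<alpha>_def)
      show "\<alpha> (gact R y r) = gact R y (\<alpha> r)" if "y \<in> carrier G" "r \<in> gpts R" for y r
      proof -
        have "\<alpha> (gact R y r) = gact R (y \<otimes> u r \<otimes> inv y) (gact R y r)"
          using that act[OF that(2,1)] D(2) by (simp add: \<alpha>_def)
        also have "\<dots> = gact R (y \<otimes> u r \<otimes> inv y \<otimes> y) r"
          using that ug[OF that(2)] by (intro D(4)[symmetric]) simp_all
        also have "y \<otimes> u r \<otimes> inv y \<otimes> y = y \<otimes> u r" using that ug[OF that(2)] by (simp add: m_assoc)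
        also have "gact R (y \<otimes> u r) r = gact R y (\<alpha> r)" using that ug[OF that(2)] D(4) by (simp add: \<alpha>_def)
        finally show ?thesis .
      qed
    qed
    then show ?thesis unfolding inner_map_def using ug act by (simp add: \<alpha>_def)
  qed
  moreover have "p' (\<beta> r) = p r \<and> q' (\<beta> r) = q (\<alpha> r)" if "r \<in> gpts R" for r
    using props[OF rel[OF that]] that by (simp add: \<alpha>_def)
  ultimately show ?thesis by blast
qed

end

context mackey
begin

text \<open>Restriction along \<open>\<alpha>\<close> is the identity, so restriction along q equals
  restriction along q \<open>\<alpha>\<close> = q' \<open>\<beta>\<close>. Transfer along p = p'
  \<open>\<beta>\<close> then meets restriction along the bijection \<open>\<beta>\<close>, and the
  two cancel.\<close>

lemma sval_eq_of_biset_iso: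
  assumes S: "based S b" and T: "based T c" and R: "gspan S R T q p" and R': "gspan S R' T q' p'"
    and iso: "\<And>a i. a < length c \<Longrightarrow> i < length b \<Longrightarrow> biset_iso (stab S (b ! i)) (stab T (c ! a))
      (span_biset S R q p (b ! i) (c ! a)) (span_biset S R' q' p' (b ! i) (c ! a))"
    and x: "x \<in> V S"
  shows "sval S R T q p x = sval S R' T q' p' x"
proof -
  obtain \<beta> \<alpha> u where b: "\<beta> \<in> gmaps G R R'" "bij_betw \<beta> (gpts R) (gpts R')" "inner_map R \<alpha> u"
    "\<And>r. r \<in> gpts R \<Longrightarrow> p' (\<beta> r) = p r" "\<And>r. r \<in> gpts R \<Longrightarrow> q' (\<beta> r) = q (\<alpha> r)"
    using span_iso_up_to_inner[OF S T R R' iso] by blast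
  note r = gspanD[OF R] and r' = gspanD[OF R'] and a = inner_mapD(1)[OF b(3)]
  have p: "compose (gpts R) p' \<beta> = p"
    by (rule gmaps_eqI[OF compose_gmaps[OF r(2) b(1) r'(5)] r(5)]) (simp add: compose_eq b(4))
  have q: "compose (gpts R) q' \<beta> = compose (gpts R) q \<alpha>"
    by (rule gmaps_eqI[OF compose_gmaps[OF r(2) b(1) r'(4)] compose_gmaps[OF r(2) a r(4)]]) (simp add: compose_eq b(5))
  have y: "pull M R' S q' x \<in> V R'" by (rule pull_closed[OF r'(2,1,4) x])
  have "pull M R S q x = pull M R R \<alpha> (pull M R S q x)"
    by (rule inner_pull[OF r(2) b(3) pull_closed[OF r(2,1,4) x], symmetric])
  also have "\<dots> = pull M R R' \<beta> (pull M R' S q' x)"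
    using pull_comp[OF r(2,2,1) a r(4) x] pull_comp[OF r(2) r'(2,1) b(1) r'(4) x] q by simp
  finally have "sval S R T q p x = push M R T p (pull M R R' \<beta> (pull M R' S q' x))" by (simp add: sval_def)
  also have "\<dots> = push M R' T p' (push M R R' \<beta> (pull M R R' \<beta> (pull M R' S q' x)))"
    using push_comp[OF r(2) r'(2,3) b(1) r'(5) pull_closed[OF r(2) r'(2) b(1) y]] p by simp
  also have "\<dots> = sval S R' T q' p' x"
    using push_pull_bij[OF r(2) r'(2) b(1,2) y] by (simp add: sval_def)
  finally show ?thesis .
qed

text \<open>By \<open>smat_eqD\<close> the bisets are isomorphic after adding a span E on both
  sides. Its contribution is the same on both sides and is cancelled in the group M(T).\<close>

lemma sval_eq_of_smat:
  assumes S: "based S b" and T: "based T c" and R: "gspan S R T q p" and R': "gspan S R' T q' p'"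
    and eq: "smat S b T c R q p = smat S b T c R' q' p'" and x: "x \<in> V S"
  shows "sval S R T q p x = sval S R' T q' p' x"
proof -
  interpret VT: group "BOb M T" by (rule group_val[OF gspanD(3)[OF R]])
  obtain E s t where E: "gspan S E T s t" "\<And>a i. a < length c \<Longrightarrow> i < length b \<Longrightarrow>
    biset_iso (stab S (b ! i)) (stab T (c ! a))
      (span_biset S (gset_sum G R E) (copair R E q s) (copair R E p t) (b ! i) (c ! a))
      (span_biset S (gset_sum G R' E) (copair R' E q' s) (copair R' E p' t) (b ! i) (c ! a))"
    using smat_eqD[OF S T R R' eq] by blast
  have "sval S R T q p x \<otimes>\<^bsub>BOb M T\<^esub> sval S E T s t x = sval S R' T q' p' x \<otimes>\<^bsub>BOb M T\<^esub> sval S E T s t x"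
    using sval_eq_of_biset_iso[OF S T gspan_sum[OF R E(1)] gspan_sum[OF R' E(1)] E(2) x]
    unfolding sval_sum[OF R E(1) x] sval_sum[OF R' E(1) x] .
  then show ?thesis using sval_closed[OF R x] sval_closed[OF R' x] sval_closed[OF E(1) x] by simp
qed

end

section \<open>Additive functors restrict to Mackey functors\<close>

context fin_group
begin

text \<open>A span is restriction along q followed by transfer along p. Hence the value of a functor
  on the matrix of a span is known as soon as its composite with j is known.\<close>

lemma smat_factor:
  assumes S: "based S b" and R0: "based R r" and T: "based T c" and R: "gspan S R T q p"
  shows "smat S b T c R q p = bcomp (stabs S b) (stabs R r) (stabs T c)
    (smat R r T c R (gid R) p) (smat S b R r R q (gid R))"
proof -
  note g = gspanD[OF R]
  have 1: "gspan S R R q (gid R)" and 2: "gspan R R T (gid R) p" using g by (simp_all add: gspan_def gid_gmaps)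
  show ?thesis
    using smat_comp[OF S R0 T 1 2 pullback_id_right[OF 1]] compose_gid(1)[OF g(4)] compose_gid(1)[OF g(5)] by simp
qed

lemma smat_comp_push:
  assumes "based S b" "based T c" "based U d" "gspan S R T q p" "\<psi> \<in> gmaps G T U" "finite_gset G U"
  shows "bcomp (stabs S b) (stabs T c) (stabs U d) (smat T c U d T (gid T) \<psi>) (smat S b T c R q p) =
    smat S b U d R q (compose (gpts R) \<psi> p)"
proof -
  note g = gspanD[OF assms(4)]
  have 2: "gspan T T U (gid T) \<psi>" using g assms(5,6) by (simp add: gspan_def gid_gmaps)
  show ?thesis
    using smat_comp[OF assms(1-4) 2 pullback_id_right[OF assms(4)]] compose_gid(1)[OF g(4)] by simp
qed

lemma smat_comp_pull:
  assumes "based S b" "based T c" "based U d" "gspan T R U q p" "\<psi> \<in> gmaps G T S" "finite_gset G S"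
  shows "bcomp (stabs S b) (stabs T c) (stabs U d) (smat T c U d R q p) (smat S b T c T \<psi> (gid T)) =
    smat S b U d R (compose (gpts R) \<psi> q) p"
proof -
  note g = gspanD[OF assms(4)]
  have 2: "gspan S T T \<psi> (gid T)" using g assms(5,6) by (simp add: gspan_def gid_gmaps)
  show ?thesis
    using smat_comp[OF assms(1-3) 2 assms(4) pullback_id_left[OF assms(4)]] compose_gid(1)[OF g(5)] by simp
qed

text \<open>The test objects \<open>G/1\<close> turn the categorical pullback property into the pointwise one.\<close>

lemma pullback_square_pointwise:
  fixes S :: "('a, 'p) Gset"
  assumes sq: "pullback_square (DG G) S S1 S2 T \<Psi> \<Phi> \<phi> \<psi>"
  shows "gset_pullback S S2 S1 T \<psi> \<phi> \<Phi> \<Psi>"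
proof -
  have g: "finite_gset G S" "finite_gset G S1" "finite_gset G S2" "finite_gset G T"
    and m: "\<Psi> \<in> gmaps G S S1" "\<Phi> \<in> gmaps G S S2" "\<phi> \<in> gmaps G S1 T" "\<psi> \<in> gmaps G S2 T"
    and com: "compose (gpts S) \<phi> \<Psi> = compose (gpts S) \<psi> \<Phi>"
    using sq unfolding pullback_square_def by simp_all
  have univ: "\<exists>!\<gamma>. \<gamma> \<in> gmaps G W S \<and> compose (gpts W) \<Psi> \<gamma> = \<alpha> \<and> compose (gpts W) \<Phi> \<gamma> = \<beta>"
    if "finite_gset G W" "\<alpha> \<in> gmaps G W S1" "\<beta> \<in> gmaps G W S2" "compose (gpts W) \<phi> \<alpha> = compose (gpts W) \<psi> \<beta>" for W \<alpha> \<beta>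
    using sq that unfolding pullback_square_def DG_simps mem_Collect_eq by blast
  \<comment> \<open>The free orbit, with the singletons \<open>{a}\<close> as the cosets of the
    trivial subgroup.\<close>
  let ?W = "mk_gset (Cs ` (\<lambda>a. {a}) ` carrier G) (\<lambda>g z. case z of Cs A \<Rightarrow> Cs ((\<lambda>a. g \<otimes> a) ` A)) :: ('a, 'p) Gset"
  have W: "finite_gset G ?W"
    by (rule finite_mk_gset) (auto simp: finite_carrier m_assoc)
  have Wp: "Cs {a} \<in> gpts ?W" if "a \<in> carrier G" for a using that by simp
  have Wa: "gact ?W g (Cs {a}) = Cs {g \<otimes> a}" if "a \<in> carrier G" "g \<in> carrier G" for a g using that by simp
  \<comment> \<open>A G-map out of \<open>?W\<close> is determined by its value at
    \<open>Cs {\<one>}\<close>, which is arbitrary; \<open>ev A x\<close> is the one with value x.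
    Points of a G-set thus become morphisms to which the universal property applies.\<close>
  define ev :: "('a, 'p) Gset \<Rightarrow> ('a, 'p) pt \<Rightarrow> ('a, 'p) pt \<Rightarrow> ('a, 'p) pt" where
    "ev A x = (\<lambda>z\<in>gpts ?W. gact A (the_elem (case z of Cs B \<Rightarrow> B)) x)" for A x
  have ev1: "ev A x (Cs {a}) = gact A a x" if "a \<in> carrier G" for A x a using that by (simp add: ev_def)
  have ev: "ev A x \<in> gmaps G ?W A" if "finite_gset G A" "x \<in> gpts A" for A x
  proof (rule gmapsI)
    show "ev A x \<in> extensional (gpts ?W)" by (simp add: ev_def)
    fix z assume "z \<in> gpts ?W"
    then obtain a where a: "a \<in> carrier G" "z = Cs {a}" by auto
    show "ev A x z \<in> gpts A" using a ev1 gsetD(2)[OF that(1)] that(2) by simp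
    show "ev A x (gact ?W g z) = gact A g (ev A x z)" if g: "g \<in> carrier G" for g
      using a g ev1[of "g \<otimes> a"] ev1[of a] Wa[OF a(1) g] gsetD(4)[OF \<open>finite_gset G A\<close> g a(1) \<open>x \<in> gpts A\<close>] by simp
  qed
  have ev_comp: "compose (gpts ?W) f (ev A x) = ev B (f x)" if "finite_gset G A" "x \<in> gpts A" "f \<in> gmaps G A B" "finite_gset G B" for A B x f
  proof (rule gmaps_eqI[OF compose_gmaps[OF W ev[OF that(1,2)] that(3)] ev[OF that(4) gmapsD(1)[OF that(3,2)]]])
    fix z assume "z \<in> gpts ?W"
    then obtain a where a: "a \<in> carrier G" "z = Cs {a}" by auto
    show "compose (gpts ?W) f (ev A x) z = ev B (f x) z"
      unfolding a(2) compose_eq[OF Wp[OF a(1)]] ev1[OF a(1)] using gmapsD(2)[OF that(3) a(1) that(2)] .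
  qed
  have evx: "ev A x (Cs {\<one>}) = x" if "finite_gset G A" "x \<in> gpts A" for A x
    using ev1[OF one_closed] gsetD(3)[OF that] by simp
  have "\<exists>!z. z \<in> gpts S \<and> \<Phi> z = r \<and> \<Psi> z = r'" if r: "r \<in> gpts S2" "r' \<in> gpts S1" "\<psi> r = \<phi> r'" for r r'
  proof -
    have "compose (gpts ?W) \<phi> (ev S1 r') = compose (gpts ?W) \<psi> (ev S2 r)"
      using ev_comp[OF g(2) r(2) m(3) g(4)] ev_comp[OF g(3) r(1) m(4) g(4)] r(3) by simp
    note ex = univ[OF W ev[OF g(2) r(2)] ev[OF g(3) r(1)] this]
    then obtain \<gamma> where \<gamma>: "\<gamma> \<in> gmaps G ?W S" "compose (gpts ?W) \<Psi> \<gamma> = ev S1 r'" "compose (gpts ?W) \<Phi> \<gamma> = ev S2 r" by blast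
    show ?thesis
    proof (rule ex1I[of _ "\<gamma> (Cs {\<one>})"])
      have "\<Psi> (\<gamma> (Cs {\<one>})) = r'" "\<Phi> (\<gamma> (Cs {\<one>})) = r"
        using fun_cong[OF \<gamma>(2), of "Cs {\<one>}"] fun_cong[OF \<gamma>(3), of "Cs {\<one>}"] evx[OF g(2) r(2)] evx[OF g(3) r(1)]
        unfolding compose_eq[OF Wp[OF one_closed]] by simp_all
      then show "\<gamma> (Cs {\<one>}) \<in> gpts S \<and> \<Phi> (\<gamma> (Cs {\<one>})) = r \<and> \<Psi> (\<gamma> (Cs {\<one>})) = r'"
        using gmapsD(1)[OF \<gamma>(1) Wp[OF one_closed]] by blast
      fix z assume z: "z \<in> gpts S \<and> \<Phi> z = r \<and> \<Psi> z = r'"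
      then have "ev S z \<in> gmaps G ?W S" "compose (gpts ?W) \<Psi> (ev S z) = ev S1 r'" "compose (gpts ?W) \<Phi> (ev S z) = ev S2 r"
        using ev[OF g(1)] ev_comp[OF g(1) _ m(1) g(2)] ev_comp[OF g(1) _ m(2) g(3)] by auto
      then have "ev S z = \<gamma>" using ex \<gamma> by blast
      then show "z = \<gamma> (Cs {\<one>})" using evx[OF g(1)] z by metis
    qed
  qed
  moreover have "\<psi> (\<Phi> z) = \<phi> (\<Psi> z)" if "z \<in> gpts S" for z
    using fun_cong[OF com, of z] that by (simp add: compose_eq)
  ultimately show ?thesis unfolding gset_pullback_def using g m by simp
qed

end

locale additive_on = fin_group G for G (structure) +
  fixes F :: "('a set list, 'a bimor mat, 'v monoid, 'v \<Rightarrow> 'v) func"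
    and b :: "('a, 'p) Gset \<Rightarrow> ('a, 'p) pt list"
  assumes additive: "additive_functor (Bdot G) Ab F" and base: "base_points G b"
begin

abbreviation "J S \<equiv> stabs S (b S)"
abbreviation "N \<equiv> func_bifunc F (j_functor G b)"
abbreviation "fmat S c T d R q p \<equiv> FMor F (stabs S c) (stabs T d) (smat S c T d R q p)"

lemmas bb = base_points_based[OF base]
lemmas J_Ob = stabs_Ob[OF bb]

lemma F_group: "t \<in> tuples \<Longrightarrow> comm_group (FOb F t)"
  using additive unfolding additive_functor_def is_functor_def by simp

lemma F_hom:
  assumes "s \<in> tuples" "t \<in> tuples" "A \<in> carrier (BHom s t)"
  shows "FMor F s t A \<in> hom (FOb F s) (FOb F t)" "FMor F s t A \<in> extensional (carrier (FOb F s))"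
  using additive assms unfolding additive_functor_def is_functor_def Bdot_Mor[symmetric] by simp_all

lemma F_closed:
  "s \<in> tuples \<Longrightarrow> t \<in> tuples \<Longrightarrow> A \<in> carrier (BHom s t) \<Longrightarrow> x \<in> carrier (FOb F s) \<Longrightarrow>
    FMor F s t A x \<in> carrier (FOb F t)"
  using F_hom(1) by (auto simp: hom_def)

lemma F_id: "t \<in> tuples \<Longrightarrow> FMor F t t (Idn (Bdot G) t) = (\<lambda>x\<in>carrier (FOb F t). x)"
  using additive unfolding additive_functor_def is_functor_def by simp

lemma F_comp:
  "s \<in> tuples \<Longrightarrow> t \<in> tuples \<Longrightarrow> u \<in> tuples \<Longrightarrow> A \<in> carrier (BHom s t) \<Longrightarrow>
    B \<in> carrier (BHom t u) \<Longrightarrow>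
    FMor F s u (bcomp s t u B A) = compose (carrier (FOb F s)) (FMor F t u B) (FMor F s t A)"
  using additive unfolding additive_functor_def is_functor_def Bdot_Mor[symmetric] by simp

lemma F_add:
  assumes "s \<in> tuples" "t \<in> tuples" "A \<in> carrier (BHom s t)" "B \<in> carrier (BHom s t)" "x \<in> carrier (FOb F s)"
  shows "FMor F s t (A \<otimes>\<^bsub>BHom s t\<^esub> B) x = FMor F s t A x \<otimes>\<^bsub>FOb F t\<^esub> FMor F s t B x"
proof -
  have "FMor F s t \<in> hom (BHom s t) (HGrp Ab (FOb F s) (FOb F t))"
    using additive assms(1,2) unfolding additive_functor_def by blast
  from hom_mult[OF this assms(3,4)] show ?thesis using assms(5) by simp
qed

lemma fmat_comp:
  assumes "based S c" "based T d" "based U e" "gspan S R T q p" "gspan T R' U q' p'" "x \<in> carrier (FOb F (stabs S c))"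
  shows "FMor F (stabs S c) (stabs U e) (bcomp (stabs S c) (stabs T d) (stabs U e) (smat T d U e R' q' p') (smat S c T d R q p)) x
    = fmat T d U e R' q' p' (fmat S c T d R q p x)"
  using F_comp[OF stabs_Ob[OF assms(1)] stabs_Ob[OF assms(2)] stabs_Ob[OF assms(3)] smat_closed[OF assms(1,2,4)] smat_closed[OF assms(2,3,5)]]
    assms(6) by (simp add: compose_eq)

lemma fmat_closed: "based S c \<Longrightarrow> based T d \<Longrightarrow> gspan S R T q p \<Longrightarrow> x \<in> carrier (FOb F (stabs S c)) \<Longrightarrow>
    fmat S c T d R q p x \<in> carrier (FOb F (stabs T d))"
  using F_closed stabs_Ob smat_closed by blast

lemma N_simps:
  "BOb N S = FOb F (J S)"
  "finite_gset G S \<Longrightarrow> finite_gset G T \<Longrightarrow> \<phi> \<in> gmaps G S T \<Longrightarrow> push N S T \<phi> = fmat S (b S) T (b T) S (gid S) \<phi>"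
  "finite_gset G S \<Longrightarrow> finite_gset G T \<Longrightarrow> \<phi> \<in> gmaps G S T \<Longrightarrow> pull N S T \<phi> = fmat T (b T) S (b S) S \<phi> (gid S)"
  by (simp_all add: func_bifunc_def j_BOb j_push[OF base] j_pull[OF base])

lemma N_bivariant: "bivariant_functor (DG G) Ab N"
proof -
  note push = gspan_push and pull = gspan_pull
  have hom: "fmat S (b S) T (b T) R q p \<in> hom (FOb F (J S)) (FOb F (J T)) \<inter> extensional (carrier (FOb F (J S)))"
    if "finite_gset G S" "finite_gset G T" "gspan S R T q p" for S T R q p
    using F_hom[OF J_Ob[OF that(1)] J_Ob[OF that(2)] smat_closed[OF bb[OF that(1)] bb[OF that(2)] that(3)]] by blast
  have idn: "fmat S (b S) S (b S) S (gid S) (gid S) = (\<lambda>x\<in>carrier (FOb F (J S)). x)" if "finite_gset G S" for S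
    unfolding smat_gid[OF bb[OF that]] by (rule F_id[OF J_Ob[OF that]])
  have comp: "fmat S (b S) U (b U) S (gid S) (compose (gpts S) \<psi> \<phi>) =
      compose (carrier (FOb F (J S))) (fmat T (b T) U (b U) T (gid T) \<psi>) (fmat S (b S) T (b T) S (gid S) \<phi>)"
    if S: "finite_gset G S" and T: "finite_gset G T" and U: "finite_gset G U" and f: "\<phi> \<in> gmaps G S T" "\<psi> \<in> gmaps G T U" for S T U \<phi> \<psi>
    using F_comp[OF J_Ob[OF S] J_Ob[OF T] J_Ob[OF U] smat_closed[OF bb[OF S] bb[OF T] push[OF S T f(1)]] smat_closed[OF bb[OF T] bb[OF U] push[OF T U f(2)]]]
    unfolding smat_comp_push[OF bb[OF S] bb[OF T] bb[OF U] push[OF S T f(1)] f(2) U] .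
  have comp': "fmat U (b U) S (b S) S (compose (gpts S) \<psi> \<phi>) (gid S) =
      compose (carrier (FOb F (J U))) (fmat T (b T) S (b S) S \<phi> (gid S)) (fmat U (b U) T (b T) T \<psi> (gid T))"
    if S: "finite_gset G S" and T: "finite_gset G T" and U: "finite_gset G U" and f: "\<phi> \<in> gmaps G S T" "\<psi> \<in> gmaps G T U" for S T U \<phi> \<psi>
    using F_comp[OF J_Ob[OF U] J_Ob[OF T] J_Ob[OF S] smat_closed[OF bb[OF U] bb[OF T] pull[OF T U f(2)]] smat_closed[OF bb[OF T] bb[OF S] pull[OF S T f(1)]]]
    unfolding smat_comp_pull[OF bb[OF U] bb[OF T] bb[OF S] pull[OF S T f(1)] f(2) U] .
  show ?thesis
    unfolding bivariant_functor_def is_functor_def is_cofunctor_def func.select_convs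
    by (simp add: N_simps F_group J_Ob hom[THEN IntD1] hom[THEN IntD2] push pull idn comp comp' gid_gmaps compose_gmaps)
qed

text \<open>Both sides are F of the matrix of the span with legs u and v: the left one by the
  product formula \<open>smat_comp\<close>, the right one by \<open>smat_factor\<close>.\<close>

lemma N_formula:
  assumes R: "finite_gset G R" and R': "finite_gset G R'" and T: "finite_gset G T"
    and p: "p \<in> gmaps G R T" and q': "q' \<in> gmaps G R' T" and P: "gset_pullback P R R' T p q' u v"
    and x: "x \<in> carrier (BOb N R)"
  shows "pull N R' T q' (push N R T p x) = push N P R' v (pull N P R u x)"
proof -
  note D = gset_pullbackD(1-3)[OF P]
  note x = x[unfolded N_simps]
  have "pull N R' T q' (push N R T p x) = fmat R (b R) R' (b R') P (compose (gpts P) (gid R) u) (compose (gpts P) (gid R') v) x"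
    unfolding N_simps(2)[OF R T p] N_simps(3)[OF R' T q']
      fmat_comp[OF bb[OF R] bb[OF T] bb[OF R'] gspan_push[OF R T p] gspan_pull[OF R' T q'] x, symmetric]
      smat_comp[OF bb[OF R] bb[OF T] bb[OF R'] gspan_push[OF R T p] gspan_pull[OF R' T q'] P] ..
  also have "\<dots> = fmat R (b R) R' (b R') P u v x"
    unfolding compose_gid(2)[OF D(2)] compose_gid(2)[OF D(3)] ..
  also have "\<dots> = push N P R' v (pull N P R u x)"
    unfolding N_simps(2)[OF D(1) R' D(3)] N_simps(3)[OF D(1) R D(2)]
      fmat_comp[OF bb[OF R] bb[OF D(1)] bb[OF R'] gspan_pull[OF D(1) R D(2)] gspan_push[OF D(1) R' D(3)] x, symmetric]
    using smat_factor[OF bb[OF R] bb[OF D(1)] bb[OF R'], of u v] D R R' by (simp add: gspan_def)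
  finally show ?thesis .
qed

text \<open>The identity of the empty tuple is the empty matrix, which equals its own double.
  Additivity of F turns this into x = x + x.\<close>

lemma N_empty:
  assumes x: "x \<in> carrier (BOb N (gset_empty G))"
  shows "x = \<one>\<^bsub>BOb N (gset_empty G)\<^esub>"
proof -
  let ?E = "gset_empty G :: ('a, 'p) Gset"
  note E = finite_gset_empty
  have "b ?E = []" using bb[OF E] by (simp add: based_def)
  then have J: "J ?E = []" by (simp add: stabs_def)
  note x = x[unfolded N_simps J]
  have Ob: "[] \<in> tuples" by (simp add: Bdot_Ob)
  let ?I = "Idn (Bdot G) []"
  have I: "?I \<in> carrier (BHom [] [])" by (simp add: Bdot_carrier addcompl_def Let_def)
  have "?I \<otimes>\<^bsub>BHom [] []\<^esub> ?I = ?I" by (rule eq_matI) (simp_all add: Bdot_mult addcompl_def Let_def)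
  then have xx: "x = x \<otimes>\<^bsub>FOb F []\<^esub> x" using F_add[OF Ob Ob I I x] F_id[OF Ob] x by simp
  interpret g: comm_group "FOb F []" by (rule F_group[OF Ob])
  have "x = \<one>\<^bsub>FOb F []\<^esub>" using x xx g.l_cancel_one by metis
  then show ?thesis by (simp add: N_simps J)
qed

sublocale N: premackey G N
  by unfold_locales (fact N_bivariant, rule N_formula, assumption+, rule N_empty, assumption)

text \<open>The identity span of the disjoint union is the sum of the spans through the two
  embeddings. By additivity each x is the sum of the transfers of its two restrictions, which gives
  injectivity; surjectivity follows from the Mackey formula for the embeddings.\<close>

lemma N_sum_iso:
  assumes S: "finite_gset G S" and S': "finite_gset G S'"
  shows "(\<lambda>x. (pull N S (gset_sum G S S') (gset_inl S) x, pull N S' (gset_sum G S S') (gset_inr S') x))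
    \<in> iso (BOb N (gset_sum G S S')) (BOb N S \<times>\<times> BOb N S')"
proof -
  let ?U = "gset_sum G S S'" and ?l = "gset_inl S" and ?r = "gset_inr S'"
  note U = finite_gset_sum[OF S S']
  have l: "?l \<in> gmaps G S ?U" and r: "?r \<in> gmaps G S' ?U" using gmaps_sum(2,3)[OF S S'] by simp_all
  have li: "inj_on ?l (gpts S)" and ri: "inj_on ?r (gpts S')" by (auto simp: inj_on_def gset_inl_def gset_inr_def)
  have lr: "?l ` gpts S \<inter> ?r ` gpts S' = {}" and rl: "?r ` gpts S' \<inter> ?l ` gpts S = {}"
    by (auto simp: gset_inl_def gset_inr_def)
  interpret VU: group "BOb N ?U" by (rule N.group_val[OF U])
  interpret VS: group "BOb N S" by (rule N.group_val[OF S])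
  interpret VS': group "BOb N S'" by (rule N.group_val[OF S'])
  have gl: "gspan ?U S ?U ?l ?l" and gr: "gspan ?U S' ?U ?r ?r" using U S S' l r by (simp_all add: gspan_def)
  have cop: "copair S S' ?l ?r = gid ?U"
    by (rule gmaps_eqI[OF gmaps_sum(1)[OF S S' l r] gid_gmaps[OF U]]) (auto simp: gset_inl_def gset_inr_def)
  have fact_val: "fmat ?U (b ?U) ?U (b ?U) R q q x = push N R ?U q (pull N R ?U q x)"
    if "finite_gset G R" "q \<in> gmaps G R ?U" "x \<in> N.V ?U" for R q x
  proof -
    have sp: "gspan ?U R ?U q q" using that U by (simp add: gspan_def)
    show ?thesis
      unfolding N_simps(2)[OF that(1) U that(2)] N_simps(3)[OF that(1) U that(2)]
        fmat_comp[OF bb[OF U] bb[OF that(1)] bb[OF U] gspan_pull[OF that(1) U that(2)] gspan_push[OF that(1) U that(2)] that(3)[unfolded N_simps(1)], symmetric]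
        smat_factor[OF bb[OF U] bb[OF that(1)] bb[OF U] sp, symmetric] ..
  qed
  have dec: "x = push N S ?U ?l (pull N S ?U ?l x) \<otimes>\<^bsub>BOb N ?U\<^esub> push N S' ?U ?r (pull N S' ?U ?r x)" if x: "x \<in> N.V ?U" for x
  proof -
    have "x = fmat ?U (b ?U) ?U (b ?U) ?U (gid ?U) (gid ?U) x"
      unfolding smat_gid[OF bb[OF U]] F_id[OF J_Ob[OF U]] using x by (simp add: N_simps)
    also have "\<dots> = fmat ?U (b ?U) ?U (b ?U) S ?l ?l x \<otimes>\<^bsub>FOb F (J ?U)\<^esub> fmat ?U (b ?U) ?U (b ?U) S' ?r ?r x"
      using smat_add[OF bb[OF U] bb[OF U] gl gr] unfolding cop
      using F_add[OF J_Ob[OF U] J_Ob[OF U] smat_closed[OF bb[OF U] bb[OF U] gl] smat_closed[OF bb[OF U] bb[OF U] gr] x[unfolded N_simps(1)]]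
      by simp
    finally show ?thesis unfolding fact_val[OF S l x] fact_val[OF S' r x] N_simps(1)[of ?U] .
  qed
  let ?f = "\<lambda>x. (pull N S ?U ?l x, pull N S' ?U ?r x)"
  have hom: "?f \<in> hom (BOb N ?U) (BOb N S \<times>\<times> BOb N S')"
    by (rule homI) (simp_all add: N.pull_closed[OF S U l] N.pull_closed[OF S' U r] N.pull_mult[OF S U l] N.pull_mult[OF S' U r])
  moreover have "inj_on ?f (N.V ?U)"
  proof (rule inj_onI)
    fix x y assume "x \<in> N.V ?U" "y \<in> N.V ?U" "?f x = ?f y"
    then show "x = y" using dec[of x] dec[of y] by simp
  qed
  moreover have "?f ` N.V ?U = carrier (BOb N S \<times>\<times> BOb N S')"
  proof (intro equalityI subsetI)
    fix z assume "z \<in> carrier (BOb N S \<times>\<times> BOb N S')"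
    then obtain y y' where z: "z = (y, y')" and y: "y \<in> N.V S" and y': "y' \<in> N.V S'" by (auto simp: DirProd_def)
    let ?x = "push N S ?U ?l y \<otimes>\<^bsub>BOb N ?U\<^esub> push N S' ?U ?r y'"
    have pl: "push N S ?U ?l y \<in> N.V ?U" and pr: "push N S' ?U ?r y' \<in> N.V ?U"
      using N.push_closed[OF S U l y] N.push_closed[OF S' U r y'] .
    have fx: "z = ?f ?x"
      using N.pull_mult[OF S U l pl pr] N.pull_mult[OF S' U r pl pr] N.pull_push_inj[OF S U l li y] N.pull_push_inj[OF S' U r ri y']
        N.pull_push_disjoint[OF S S' U l r lr y] N.pull_push_disjoint[OF S' S U r l rl y'] y y' z by simp
    have "?x \<in> N.V ?U" using pl pr by simp
    with fx show "z \<in> ?f ` N.V ?U" by (rule image_eqI)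
  qed (use hom in \<open>auto simp: hom_def\<close>)
  ultimately show ?thesis by (simp add: iso_def bij_betw_def)
qed

lemma N_mackey: "mackey_functor G N"
  unfolding mackey_functor_def
proof (intro conjI allI impI ballI)
  show "bivariant_functor (DG G) Ab N" by (rule N_bivariant)
  show "(\<lambda>x. (pull N S (gset_sum G S S') (gset_inl S) x, pull N S' (gset_sum G S S') (gset_inr S') x))
    \<in> iso (BOb N (gset_sum G S S')) (BOb N S \<times>\<times> BOb N S')" if "S \<in> Ob (DG G)" "S' \<in> Ob (DG G)" for S S'
    using that by (intro N_sum_iso) simp_all
  interpret g: comm_group "BOb N (gset_empty G)" by (rule N.comm_group_val[OF finite_gset_empty])
  show "carrier (BOb N (gset_empty G)) = {\<one>\<^bsub>BOb N (gset_empty G)\<^esub>}" using N_empty g.one_closed by blast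
  fix S S1 S2 T \<Psi> \<Phi> \<phi> \<psi> assume sq: "pullback_square (DG G) S S1 S2 T \<Psi> \<Phi> \<phi> (\<psi> :: ('a, 'p) pt \<Rightarrow> ('a, 'p) pt)"
  have g: "finite_gset G S" "finite_gset G S1" "finite_gset G S2" "finite_gset G T"
    and m: "\<Psi> \<in> gmaps G S S1" "\<Phi> \<in> gmaps G S S2" "\<phi> \<in> gmaps G S1 T" "\<psi> \<in> gmaps G S2 T"
    using sq unfolding pullback_square_def by simp_all
  show "Cmp Ab (BOb N S2) (BOb N T) (BOb N S1) (pull N S1 T \<phi>) (push N S2 T \<psi>) =
      Cmp Ab (BOb N S2) (BOb N S) (BOb N S1) (push N S S1 \<Psi>) (pull N S S2 \<Phi>)"
    using N_formula[OF g(3,2,4) m(4,3) pullback_square_pointwise[OF sq]]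
    by (simp add: compose_def fun_eq_iff restrict_def)
qed

text \<open>The map eH -> zH is an inner automorphism of G/H, so by \<open>smat_inner\<close> its
  matrix is that of the identity.\<close>

lemma N_conj: "conj_invariant G N"
  unfolding conj_invariant_def
proof (intro allI impI ballI)
  fix H z \<phi>
  let ?S = "coset_gset G H :: ('a, 'p) Gset"
  assume Hz: "subgroup H G \<and> z \<in> carrier G \<and> (\<forall>h\<in>H. z \<otimes> h = h \<otimes> z)"
    and f: "\<phi> \<in> Mor (DG G) ?S ?S" and fz: "\<phi> (Cs H) = Cs (z <# H)"
  have H: "subgroup H G" and z: "z \<in> carrier G" and comm: "\<And>h. h \<in> H \<Longrightarrow> z \<otimes> h = h \<otimes> z" using Hz by blast+
  note S = finite_coset_gset[OF H, where 'p = 'p]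
  have f: "\<phi> \<in> gmaps G ?S ?S" using f by simp
  have mem: "Cs H \<in> gpts ?S" using based_nth[OF based_coset(1)[OF H], of 0] by simp
  \<comment> \<open>The conjugator at the coset aH is a z a^-1. Another representative a h gives the
    same element because z commutes with H.\<close>
  define u where "u x = (let a = (SOME a. a \<in> carrier G \<and> x = Cs (a <# H)) in a \<otimes> z \<otimes> inv a)" for x :: "('a, 'p) pt"
  have u: "u (Cs (a <# H)) = a \<otimes> z \<otimes> inv a" if a: "a \<in> carrier G" for a
  proof -
    define c where "c = (SOME c. c \<in> carrier G \<and> (Cs (a <# H) :: ('a, 'p) pt) = Cs (c <# H))"
    have c: "c \<in> carrier G \<and> (Cs (a <# H) :: ('a, 'p) pt) = Cs (c <# H)"
      unfolding c_def by (rule someI[of _ a]) (use a in simp)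
    have "c \<otimes> \<one> \<in> c <# H" unfolding l_coset_def using subgroup.one_closed[OF H] by blast
    then have "c \<in> a <# H" using c by simp
    then obtain h where h: "h \<in> H" "c = a \<otimes> h" unfolding l_coset_def by blast
    have hG: "h \<in> carrier G" by (rule subgroup.mem_carrier[OF H h(1)])
    have "c \<otimes> z \<otimes> inv c = a \<otimes> (h \<otimes> z) \<otimes> (inv h \<otimes> inv a)"
      unfolding h(2) using a hG z by (simp add: m_assoc inv_mult_group)
    also have "\<dots> = a \<otimes> z \<otimes> inv a" unfolding comm[OF h(1), symmetric] using a hG z by (simp add: m_assoc mult_inv_cancel)
    finally show ?thesis unfolding u_def c_def[symmetric] Let_def .
  qed
  have cos: "\<exists>a\<in>carrier G. x = Cs (a <# H) \<and> x = gact ?S a (Cs H)" if "x \<in> gpts ?S" for x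
    using that by (auto simp: coset_gset_pts base_coset_act[OF H])
  have "u x \<in> carrier G \<and> \<phi> x = gact ?S (u x) x \<and> (\<forall>g\<in>carrier G. u (gact ?S g x) = g \<otimes> u x \<otimes> inv g)"
    if x: "x \<in> gpts ?S" for x
  proof -
    obtain a where a: "a \<in> carrier G" "x = Cs (a <# H)" "x = gact ?S a (Cs H)" using cos[OF x] by blast
    have "\<phi> x = gact ?S a (Cs (z <# H))" using gmapsD(2)[OF f a(1) mem] fz a(3) by simp
    also have "\<dots> = Cs ((a \<otimes> z) <# H)" by (rule coset_gset_act[OF H a(1) z])
    also have "a \<otimes> z = u x \<otimes> a" unfolding a(2) u[OF a(1)] using a(1) z by (simp add: m_assoc)
    finally have 1: "\<phi> x = Cs ((u x \<otimes> a) <# H)" .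
    have ux: "u x \<in> carrier G" unfolding a(2) u[OF a(1)] using a(1) z by simp
    have "gact ?S (u x) x = Cs ((u x \<otimes> a) <# H)" using coset_gset_act[OF H ux a(1)] a(2) by metis
    moreover have "u (gact ?S g x) = g \<otimes> u x \<otimes> inv g" if g: "g \<in> carrier G" for g
    proof -
      have "gact ?S g x = Cs ((g \<otimes> a) <# H)" using coset_gset_act[OF H g a(1)] a(2) by simp
      then show ?thesis using u[of "g \<otimes> a"] u[OF a(1)] a g z by (simp add: m_assoc inv_mult_group)
    qed
    ultimately show ?thesis using 1 ux by simp
  qed
  note ux = this
  have sp: "gspan ?S ?S ?S (gid ?S) (gid ?S)" using S by (simp add: gspan_def gid_gmaps)
  have "smat ?S (b ?S) ?S (b ?S) ?S (gid ?S) (compose (gpts ?S) (gid ?S) \<phi>) = smat ?S (b ?S) ?S (b ?S) ?S (gid ?S) (gid ?S)"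
    by (rule smat_inner[OF bb[OF S] bb[OF S] sp f, of u]) (use ux in blast)+
  then have "push N ?S ?S \<phi> = fmat ?S (b ?S) ?S (b ?S) ?S (gid ?S) (gid ?S)"
    unfolding N_simps(2)[OF S S f] compose_gid(2)[OF f] by simp
  then show "push N ?S ?S \<phi> = Idn Ab (BOb N ?S)"
    unfolding smat_gid[OF bb[OF S]] F_id[OF J_Ob[OF S]] by (simp add: N_simps)
qed

end

section \<open>The functor determined by a conjugation invariant Mackey functor\<close>

lemma isos_AbD:
  assumes "f \<in> isos Ab A B"
  shows "f \<in> hom A B" "f \<in> extensional (carrier A)" "bij_betw f (carrier A) (carrier B)"
proof -
  obtain g where f: "f \<in> hom A B" "f \<in> extensional (carrier A)" and g: "g \<in> hom B A"
    "compose (carrier A) g f = (\<lambda>x\<in>carrier A. x)" "compose (carrier B) f g = (\<lambda>x\<in>carrier B. x)"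
    using assms by (auto simp: isos_def)
  show "f \<in> hom A B" "f \<in> extensional (carrier A)" by fact+
  have "g (f x) = x" if "x \<in> carrier A" for x using fun_cong[OF g(2), of x] that by (simp add: compose_eq)
  moreover have "f (g y) = y" if "y \<in> carrier B" for y using fun_cong[OF g(3), of y] that by (simp add: compose_eq)
  ultimately show "bij_betw f (carrier A) (carrier B)"
    using f(1) g(1) by (intro bij_betwI[of _ _ _ g]) (auto simp: hom_def)
qed

lemma isos_AbI:
  assumes A: "group A" and B: "group B" and f: "f \<in> hom A B" "f \<in> extensional (carrier A)" "bij_betw f (carrier A) (carrier B)"
  shows "f \<in> isos Ab A B"
proof -
  have "f \<in> iso A B" using f by (simp add: iso_def)
  then have "inv_into (carrier A) f \<in> iso B A" by (rule group.iso_set_sym[OF A])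
  then have inv: "inv_into (carrier A) f \<in> hom B A" by (simp add: iso_def)
  let ?g = "restrict (inv_into (carrier A) f) (carrier B)"
  have "?g \<in> hom B A" using inv monoid.m_closed[OF group.is_monoid[OF B]] by (auto simp: hom_def)
  moreover have "inv_into (carrier A) f (f x) = x" "f x \<in> carrier B" if "x \<in> carrier A" for x
    using f(1,3) that by (auto simp: bij_betw_def hom_def)
  then have "compose (carrier A) ?g f = (\<lambda>x\<in>carrier A. x)" by (auto simp: compose_def)
  moreover have "f (inv_into (carrier A) f y) = y" if "y \<in> carrier B" for y
    using f(3) that by (simp add: bij_betw_def f_inv_into_f)
  then have "compose (carrier B) f ?g = (\<lambda>x\<in>carrier B. x)" by (auto simp: compose_def)
  ultimately show ?thesis using f(1,2) unfolding isos_def by auto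
qed

context fin_group
begin

lemma base_map_comp:
  assumes S: "based S b" and T: "based T c" and st: "stabs S b = stabs T c"
  shows "compose (gpts S) (base_map T c S b) (base_map S b T c) = gid S"
  by (rule gmaps_eqI[OF compose_gmaps[OF based_gset[OF S] base_map_gmaps[OF assms] base_map_gmaps[OF T S st[symmetric]]]
        gid_gmaps[OF based_gset[OF S]]]) (simp add: compose_eq base_map_inverse[OF assms])

lemma base_map_eq_iff:
  assumes S: "based S b" and T: "based T c" and st: "stabs S b = stabs T c" and i: "i < length b" and g: "g \<in> carrier G"
    and x: "x \<in> gpts S"
  shows "base_map S b T c x = gact T g (c ! i) \<longleftrightarrow> x = gact S g (b ! i)"
proof
  assume "base_map S b T c x = gact T g (c ! i)"
  then have "base_map S b T c x = base_map S b T c (gact S g (b ! i))" using base_map_apply[OF S T st i g] by simp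
  moreover have "gact S g (b ! i) \<in> gpts S" using gsetD(2)[OF based_gset[OF S] g based_nth[OF S i]] .
  ultimately show "x = gact S g (b ! i)" using base_map_inverse[OF S T st] x by metis
qed (simp add: base_map_apply[OF S T st i g])

text \<open>Since \<open>base_map\<close> carries g b_i to g b'_i and nothing else there, the sets
  of points (r, g) are literally the same. This is how spans between arbitrary G-sets are replaced
  by spans between standard ones.\<close>

lemma smat_rebase_source:
  assumes S: "based S b" and S': "based S' b'" and st: "stabs S b = stabs S' b'" and T: "based T c" and R: "gspan S R T q p"
  shows "smat S b T c R q p = smat S' b' T c R (compose (gpts R) (base_map S b S' b') q) p"
proof -
  have len: "length b' = length b" using arg_cong[OF st, of length] by simp
  have "stab S (b ! i) = stab S' (b' ! i)" if "i < length b" for i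
    using arg_cong[OF st, of "\<lambda>l. l ! i"] that len by simp
  moreover have "span_biset S R q p (b ! i) y = span_biset S' R (compose (gpts R) (base_map S b S' b') q) p (b' ! i) y"
    if i: "i < length b" for i y
  proof -
    have "base_map S b S' b' (q r) = gact S' g (b' ! i) \<longleftrightarrow> q r = gact S g (b ! i)" if "r \<in> gpts R" "g \<in> carrier G" for r g
      by (rule base_map_eq_iff[OF S S' st i that(2) gmapsD(1)[OF gspanD(4)[OF R] that(1)]])
    then show ?thesis unfolding span_biset_def by (simp add: compose_eq cong: conj_cong)
  qed
  ultimately show ?thesis unfolding smat_def len by (intro eq_matI) simp_all
qed

lemma smat_rebase_target:
  assumes S: "based S b" and T: "based T c" and T': "based T' c'" and st: "stabs T c = stabs T' c'" and R: "gspan S R T q p"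
  shows "smat S b T c R q p = smat S b T' c' R q (compose (gpts R) (base_map T c T' c') p)"
proof -
  have len: "length c' = length c" using arg_cong[OF st, of length] by simp
  have "stab T (c ! a) = stab T' (c' ! a)" if "a < length c" for a
    using arg_cong[OF st, of "\<lambda>l. l ! a"] that len by simp
  moreover have "span_biset S R q p x (c ! a) = span_biset S R q (compose (gpts R) (base_map T c T' c') p) x (c' ! a)"
    if a: "a < length c" for a x
  proof -
    have "base_map T c T' c' (p r) = c' ! a \<longleftrightarrow> p r = c ! a" if "r \<in> gpts R" for r
      using base_map_eq_iff[OF T T' st a one_closed gmapsD(1)[OF gspanD(5)[OF R] that]]
        gsetD(3)[OF based_gset[OF T] based_nth[OF T a]] gsetD(3)[OF based_gset[OF T'] based_nth[OF T']] a len by simp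
    then show ?thesis unfolding span_biset_def by (simp add: compose_eq cong: conj_cong)
  qed
  ultimately show ?thesis unfolding smat_def len by (intro eq_matI) simp_all
qed

end

context mackey
begin

abbreviation "SG \<equiv> (std_gset :: 'a set list \<Rightarrow> ('a, 'p) Gset)"
abbreviation "SB \<equiv> (std_base :: 'a set list \<Rightarrow> ('a, 'p) pt list)"
abbreviation "std_smat s t R q p \<equiv> smat (SG s) (SB s) (SG t) (SB t) R q p"
abbreviation "std_span s t R q p \<equiv> gspan (SG s) R (SG t) q p"
abbreviation "std_val s t R q p \<equiv> sval (SG s) R (SG t) q p"

lemma std: "t \<in> tuples \<Longrightarrow> based (SG t) (SB t)" "t \<in> tuples \<Longrightarrow> stabs (SG t) (SB t) = t"
  "t \<in> tuples \<Longrightarrow> finite_gset G (SG t)"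
  using std_gset based_gset by blast+

lemma std_smat_closed:
  "s \<in> tuples \<Longrightarrow> t \<in> tuples \<Longrightarrow> std_span s t R q p \<Longrightarrow> std_smat s t R q p \<in> carrier (BHom s t)"
  using smat_closed[OF std(1) std(1)] std(2) by metis

lemma std_smat_sum:
  assumes "s \<in> tuples" "t \<in> tuples" "std_span s t R q p" "std_span s t R' q' p'"
  shows "std_smat s t (gset_sum G R R') (copair R R' q q') (copair R R' p p') =
    std_smat s t R q p \<otimes>\<^bsub>BHom s t\<^esub> std_smat s t R' q' p'"
  using smat_add[OF std(1)[OF assms(1)] std(1)[OF assms(2)] assms(3,4)] unfolding std(2)[OF assms(1)] std(2)[OF assms(2)] .

text \<open>\<open>v\<close> is the value at \<open>x\<close> of the morphism \<open>A\<close>: it is pinned down by any presentation of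
  \<open>A\<close> as a difference of two spans.\<close>

definition is_value :: "'a set list \<Rightarrow> 'a set list \<Rightarrow> 'a bimor mat \<Rightarrow> 'v \<Rightarrow> 'v \<Rightarrow> bool" where
  "is_value s t A x v \<longleftrightarrow> v \<in> V (SG t) \<and> (\<forall>R q p R' q' p'. std_span s t R q p \<longrightarrow> std_span s t R' q' p' \<longrightarrow>
     A \<otimes>\<^bsub>BHom s t\<^esub> std_smat s t R' q' p' = std_smat s t R q p \<longrightarrow>
     v \<otimes>\<^bsub>BOb M (SG t)\<^esub> std_val s t R' q' p' x = std_val s t R q p x)"

text \<open>One presentation of A suffices. If A = R - R' and A = Q - Q', then R + Q' and Q + R'
  have the same matrix and therefore the same value at x; the value of R' is cancelled at the
  end.\<close>

lemma is_valueI: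
  assumes s: "s \<in> tuples" and t: "t \<in> tuples" and A: "A \<in> carrier (BHom s t)" and x: "x \<in> V (SG s)"
    and R: "std_span s t R q p" and R': "std_span s t R' q' p'"
    and eq: "A \<otimes>\<^bsub>BHom s t\<^esub> std_smat s t R' q' p' = std_smat s t R q p"
    and v: "v \<in> V (SG t)" "v \<otimes>\<^bsub>BOb M (SG t)\<^esub> std_val s t R' q' p' x = std_val s t R q p x"
  shows "is_value s t A x v"
  unfolding is_value_def
proof (intro conjI allI impI v(1))
  fix Q f g Q' f' g'
  assume Q: "std_span s t Q f g" and Q': "std_span s t Q' f' g'"
    and eq': "A \<otimes>\<^bsub>BHom s t\<^esub> std_smat s t Q' f' g' = std_smat s t Q f g"
  interpret H: comm_group "BHom s t" by (rule comm_group_Bdot[OF s t])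
  interpret W: comm_group "BOb M (SG t)" by (rule comm_group_val[OF std(3)[OF t]])
  note cl = std_smat_closed[OF s t R] std_smat_closed[OF s t R'] std_smat_closed[OF s t Q] std_smat_closed[OF s t Q']
  note vl = sval_closed[OF R x] sval_closed[OF R' x] sval_closed[OF Q x] sval_closed[OF Q' x]
  have "std_smat s t R q p \<otimes>\<^bsub>BHom s t\<^esub> std_smat s t Q' f' g' =
      std_smat s t Q f g \<otimes>\<^bsub>BHom s t\<^esub> std_smat s t R' q' p'"
    unfolding eq[symmetric] eq'[symmetric] using A cl by (simp add: H.m_ac)
  then have "std_val s t R q p x \<otimes>\<^bsub>BOb M (SG t)\<^esub> std_val s t Q' f' g' x =
      std_val s t Q f g x \<otimes>\<^bsub>BOb M (SG t)\<^esub> std_val s t R' q' p' x"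
    unfolding std_smat_sum[OF s t R Q', symmetric] std_smat_sum[OF s t Q R', symmetric]
      sval_sum[OF R Q' x, symmetric] sval_sum[OF Q R' x, symmetric]
    by (rule sval_eq_of_smat[OF std(1)[OF s] std(1)[OF t] gspan_sum[OF R Q'] gspan_sum[OF Q R'] _ x])
  then have "(v \<otimes>\<^bsub>BOb M (SG t)\<^esub> std_val s t Q' f' g' x) \<otimes>\<^bsub>BOb M (SG t)\<^esub> std_val s t R' q' p' x =
      std_val s t Q f g x \<otimes>\<^bsub>BOb M (SG t)\<^esub> std_val s t R' q' p' x"
    unfolding v(2)[symmetric] using v(1) vl by (simp add: W.m_ac)
  then show "v \<otimes>\<^bsub>BOb M (SG t)\<^esub> std_val s t Q' f' g' x = std_val s t Q f g x"
    using v(1) vl by simp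
qed

lemma difference:
  assumes s: "s \<in> tuples" and t: "t \<in> tuples" and A: "A \<in> carrier (BHom s t)"
  obtains R q p R' q' p' where "std_span s t R q p" "std_span s t R' q' p'"
    "A \<otimes>\<^bsub>BHom s t\<^esub> std_smat s t R' q' p' = std_smat s t R q p"
  using smat_difference[OF std(1)[OF s] std(1)[OF t]] A unfolding std(2)[OF s] std(2)[OF t] by blast

lemma is_value_unique:
  assumes s: "s \<in> tuples" and t: "t \<in> tuples" and A: "A \<in> carrier (BHom s t)" and x: "x \<in> V (SG s)"
    and v: "is_value s t A x v" "is_value s t A x w"
  shows "v = w"
proof -
  interpret W: comm_group "BOb M (SG t)" by (rule comm_group_val[OF std(3)[OF t]])
  obtain R q p R' q' p' where R: "std_span s t R q p" "std_span s t R' q' p'"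
    "A \<otimes>\<^bsub>BHom s t\<^esub> std_smat s t R' q' p' = std_smat s t R q p" using difference[OF s t A] .
  have "v \<otimes>\<^bsub>BOb M (SG t)\<^esub> std_val s t R' q' p' x = w \<otimes>\<^bsub>BOb M (SG t)\<^esub> std_val s t R' q' p' x"
    using v R unfolding is_value_def by simp
  then show ?thesis using v sval_closed[OF R(2) x] unfolding is_value_def by simp
qed

lemma is_value_ex:
  assumes s: "s \<in> tuples" and t: "t \<in> tuples" and A: "A \<in> carrier (BHom s t)" and x: "x \<in> V (SG s)"
  shows "\<exists>v. is_value s t A x v"
proof -
  interpret W: comm_group "BOb M (SG t)" by (rule comm_group_val[OF std(3)[OF t]])
  obtain R q p R' q' p' where R: "std_span s t R q p" "std_span s t R' q' p'"
    "A \<otimes>\<^bsub>BHom s t\<^esub> std_smat s t R' q' p' = std_smat s t R q p" using difference[OF s t A] .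
  note vl = sval_closed[OF R(1) x] sval_closed[OF R(2) x]
  have "is_value s t A x (std_val s t R q p x \<otimes>\<^bsub>BOb M (SG t)\<^esub> inv\<^bsub>BOb M (SG t)\<^esub> std_val s t R' q' p' x)"
    using vl by (intro is_valueI[OF s t A x R]) (simp_all add: W.m_assoc)
  then show ?thesis by blast
qed

definition ext_functor :: "('a set list, 'a bimor mat, 'v monoid, 'v \<Rightarrow> 'v) func" where
  "ext_functor = \<lparr>FOb = (\<lambda>t. BOb M (SG t)), FMor = (\<lambda>s t A. \<lambda>x\<in>V (SG s). THE v. is_value s t A x v)\<rparr>"

lemma ext_FOb [simp]: "FOb ext_functor t = BOb M (SG t)"
  by (simp add: ext_functor_def)

lemma ext_eqI:
  assumes "s \<in> tuples" "t \<in> tuples" "A \<in> carrier (BHom s t)" "x \<in> V (SG s)" "is_value s t A x v"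
  shows "FMor ext_functor s t A x = v"
  unfolding ext_functor_def func.select_convs
  using assms by (simp, intro the_equality) (auto intro: is_value_unique)

lemma ext_value:
  assumes "s \<in> tuples" "t \<in> tuples" "A \<in> carrier (BHom s t)" "x \<in> V (SG s)"
  shows "is_value s t A x (FMor ext_functor s t A x)"
  using is_value_ex[OF assms] ext_eqI[OF assms] by metis

lemma ext_spec:
  assumes "s \<in> tuples" "t \<in> tuples" "A \<in> carrier (BHom s t)" "x \<in> V (SG s)"
  shows "FMor ext_functor s t A x \<in> V (SG t)"
    and "std_span s t R q p \<Longrightarrow> std_span s t R' q' p' \<Longrightarrow> A \<otimes>\<^bsub>BHom s t\<^esub> std_smat s t R' q' p' = std_smat s t R q p \<Longrightarrow>
      FMor ext_functor s t A x \<otimes>\<^bsub>BOb M (SG t)\<^esub> std_val s t R' q' p' x = std_val s t R q p x"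
  using ext_value[OF assms] unfolding is_value_def by blast+

text \<open>The matrix of R is presented as (R + R) - R, which needs no further span.\<close>

lemma ext_span:
  assumes s: "s \<in> tuples" and t: "t \<in> tuples" and R: "std_span s t R q p" and x: "x \<in> V (SG s)"
  shows "FMor ext_functor s t (std_smat s t R q p) x = std_val s t R q p x"
  by (rule ext_eqI[OF s t std_smat_closed[OF s t R] x
      is_valueI[OF s t std_smat_closed[OF s t R] x gspan_sum[OF R R] R std_smat_sum[OF s t R R, symmetric] sval_closed[OF R x]
        sval_sum[OF R R x, symmetric]]])

text \<open>With A = R - R' and B = Q - Q' the product is (Q R + Q' R') - (Q R' + Q' R). The four
  composites are again spans, by pullback, and their values compose; expanding the values bilinearly
  in the same way identifies the value of the product.\<close>

lemma ext_comp:
  assumes s: "s \<in> tuples" and t: "t \<in> tuples" and u: "u \<in> tuples"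
    and A: "A \<in> carrier (BHom s t)" and B: "B \<in> carrier (BHom t u)" and x: "x \<in> V (SG s)"
  shows "bcomp s t u B A \<in> carrier (BHom s u)"
    and "FMor ext_functor s u (bcomp s t u B A) x = FMor ext_functor t u B (FMor ext_functor s t A x)"
proof -
  let ?c = "bcomp s t u"
  interpret H: comm_group "BHom s u" by (rule comm_group_Bdot[OF s u])
  interpret W: comm_group "BOb M (SG u)" by (rule comm_group_val[OF std(3)[OF u]])
  have closed: "?c B A \<in> carrier (BHom s u)"
    if "A \<in> carrier (BHom s t)" "B \<in> carrier (BHom t u)" for A B
  proof -
    have "finprod (groth (conj_biset_monoid G (s ! j) (u ! i)))
       (\<lambda>k. groth_bilinear (conj_biset_monoid G (s ! j) (u ! i)) (balanced_cls G (s ! j) (t ! k) (u ! i))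
              (B $$ (i, k)) (A $$ (k, j))) {..<length t} \<in> carrier (groth (conj_biset_monoid G (s ! j) (u ! i)))"
      if ij: "i < length u" "j < length s" for i j
    proof -
      interpret g: comm_group "groth (conj_biset_monoid G (s ! j) (u ! i))"
        using ij s u by (intro comm_group_Hom Bdot_Ob_nth)
      show ?thesis
        using Bdot_bilinear_closed[OF s t u \<open>A \<in> _\<close> \<open>B \<in> _\<close> ij] by (intro g.finprod_closed) auto
    qed
    then show ?thesis unfolding Bdot_carrier Bdot_Cmp by simp
  qed
  show cBA: "?c B A \<in> carrier (BHom s u)" using closed[OF A B] .
  obtain R q p R' q' p' where R: "std_span s t R q p" and R': "std_span s t R' q' p'"
    and eqA: "A \<otimes>\<^bsub>BHom s t\<^esub> std_smat s t R' q' p' = std_smat s t R q p" using difference[OF s t A] .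
  obtain Q f g Q' f' g' where Q: "std_span t u Q f g" and Q': "std_span t u Q' f' g'"
    and eqB: "B \<otimes>\<^bsub>BHom t u\<^esub> std_smat t u Q' f' g' = std_smat t u Q f g" using difference[OF t u B] .
  have comp: "\<exists>P l r. std_span s u P l r \<and> std_smat s u P l r = ?c (std_smat t u Q f g) (std_smat s t R q p) \<and>
      (\<forall>x\<in>V (SG s). std_val s u P l r x = std_val t u Q f g (std_val s t R q p x))"
    if R: "std_span s t R q p" and Q: "std_span t u Q f g" for R q p Q f g
  proof -
    obtain P :: "('a, 'p) Gset" and h k where P: "gset_pullback P R Q (SG t) p f h k" using pullback_exists[OF R Q] by blast
    show ?thesis
      using gspan_pullback[OF R Q P] sval_comp[OF R Q P]
        smat_comp[OF std(1)[OF s] std(1)[OF t] std(1)[OF u] R Q P] unfolding std(2)[OF s] std(2)[OF t] std(2)[OF u]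
      by metis
  qed
  obtain P1 l1 r1 where P1: "std_span s u P1 l1 r1" "std_smat s u P1 l1 r1 = ?c (std_smat t u Q f g) (std_smat s t R q p)"
    "std_val s u P1 l1 r1 x = std_val t u Q f g (std_val s t R q p x)" using comp[OF R Q] x by blast
  obtain P2 l2 r2 where P2: "std_span s u P2 l2 r2" "std_smat s u P2 l2 r2 = ?c (std_smat t u Q f g) (std_smat s t R' q' p')"
    "std_val s u P2 l2 r2 x = std_val t u Q f g (std_val s t R' q' p' x)" using comp[OF R' Q] x by blast
  obtain P3 l3 r3 where P3: "std_span s u P3 l3 r3" "std_smat s u P3 l3 r3 = ?c (std_smat t u Q' f' g') (std_smat s t R q p)"
    "std_val s u P3 l3 r3 x = std_val t u Q' f' g' (std_val s t R q p x)" using comp[OF R Q'] x by blast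
  obtain P4 l4 r4 where P4: "std_span s u P4 l4 r4" "std_smat s u P4 l4 r4 = ?c (std_smat t u Q' f' g') (std_smat s t R' q' p')"
    "std_val s u P4 l4 r4 x = std_val t u Q' f' g' (std_val s t R' q' p' x)" using comp[OF R' Q'] x by blast
  let ?R = "std_smat s t R q p" and ?R' = "std_smat s t R' q' p'" and ?Q = "std_smat t u Q f g" and ?Q' = "std_smat t u Q' f' g'"
  note cR = std_smat_closed[OF s t R] and cR' = std_smat_closed[OF s t R']
    and cQ = std_smat_closed[OF t u Q] and cQ' = std_smat_closed[OF t u Q']
  note addl = Bdot_Cmp_addl[OF s t u] and addr = Bdot_Cmp_addr[OF s t u]
  have e2: "?c ?Q ?R' = ?c B ?R' \<otimes>\<^bsub>BHom s u\<^esub> ?c ?Q' ?R'"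
    unfolding eqB[symmetric] by (rule addl[OF cR' B cQ'])
  have e3: "?c ?Q' ?R = ?c ?Q' A \<otimes>\<^bsub>BHom s u\<^esub> ?c ?Q' ?R'"
    unfolding eqA[symmetric] by (rule addr[OF A cR' cQ'])
  have e1: "?c ?Q ?R = (?c B A \<otimes>\<^bsub>BHom s u\<^esub> ?c B ?R') \<otimes>\<^bsub>BHom s u\<^esub> ?c ?Q' ?R"
    using addl[OF cR B cQ'] addr[OF A cR' B] unfolding eqA eqB by simp
  \<comment> \<open>The expansion of the product, with the negative terms moved to the left so that
    only sums occur; this is the shape demanded by \<open>is_valueI\<close>.\<close>
  have key: "?c B A \<otimes>\<^bsub>BHom s u\<^esub> (?c ?Q ?R' \<otimes>\<^bsub>BHom s u\<^esub> ?c ?Q' ?R) =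
      ?c ?Q ?R \<otimes>\<^bsub>BHom s u\<^esub> ?c ?Q' ?R'"
    unfolding e1 e2 using closed[OF A B] closed[OF cR' B] closed[OF cR' cQ'] closed[OF cR cQ'] by (simp add: H.m_ac)
  let ?y = "FMor ext_functor s t A x" and ?r = "std_val s t R q p x" and ?r' = "std_val s t R' q' p' x"
  note y = ext_spec[OF s t A x]
  have r: "?r \<in> V (SG t)" "?r' \<in> V (SG t)" using sval_closed[OF R x] sval_closed[OF R' x] .
  have yr: "?r = ?y \<otimes>\<^bsub>BOb M (SG t)\<^esub> ?r'" using y(2)[OF R R' eqA] by simp
  let ?v = "FMor ext_functor t u B ?y"
  note v = ext_spec[OF t u B y(1)]
  have vq: "std_val t u Q f g ?y = ?v \<otimes>\<^bsub>BOb M (SG u)\<^esub> std_val t u Q' f' g' ?y" using v(2)[OF Q Q' eqB] by simp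
  have qr: "std_val t u Q f g ?r = std_val t u Q f g ?y \<otimes>\<^bsub>BOb M (SG u)\<^esub> std_val t u Q f g ?r'"
    "std_val t u Q' f' g' ?r = std_val t u Q' f' g' ?y \<otimes>\<^bsub>BOb M (SG u)\<^esub> std_val t u Q' f' g' ?r'"
    unfolding yr by (rule sval_mult[OF Q y(1) r(2)], rule sval_mult[OF Q' y(1) r(2)])
  have "is_value s u (?c B A) x ?v"
  proof (rule is_valueI[OF s u cBA x gspan_sum[OF P1(1) P4(1)] gspan_sum[OF P2(1) P3(1)] _ v(1)])
    show "?c B A \<otimes>\<^bsub>BHom s u\<^esub> std_smat s u (gset_sum G P2 P3) (copair P2 P3 l2 l3) (copair P2 P3 r2 r3) =
        std_smat s u (gset_sum G P1 P4) (copair P1 P4 l1 l4) (copair P1 P4 r1 r4)"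
      unfolding std_smat_sum[OF s u P2(1) P3(1)] std_smat_sum[OF s u P1(1) P4(1)] P1(2) P2(2) P3(2) P4(2) by (rule key)
    show "?v \<otimes>\<^bsub>BOb M (SG u)\<^esub> std_val s u (gset_sum G P2 P3) (copair P2 P3 l2 l3) (copair P2 P3 r2 r3) x =
        std_val s u (gset_sum G P1 P4) (copair P1 P4 l1 l4) (copair P1 P4 r1 r4) x"
      unfolding sval_sum[OF P2(1) P3(1) x] sval_sum[OF P1(1) P4(1) x] P1(3) P2(3) P3(3) P4(3) qr vq
      using v(1) sval_closed[OF Q' y(1)] sval_closed[OF Q r(2)] sval_closed[OF Q' r(2)] by (simp add: W.m_ac)
  qed
  then show "FMor ext_functor s u (?c B A) x = ?v" by (rule ext_eqI[OF s u cBA x])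
qed

lemma ext_additive: "additive_functor (Bdot G) Ab ext_functor"
proof -
  have hom: "FMor ext_functor s t A \<in> hom (BOb M (SG s)) (BOb M (SG t)) \<inter> extensional (V (SG s))"
    if s: "s \<in> tuples" and t: "t \<in> tuples" and A: "A \<in> carrier (BHom s t)" for s t A
  proof
    interpret W: comm_group "BOb M (SG t)" by (rule comm_group_val[OF std(3)[OF t]])
    interpret X: comm_group "BOb M (SG s)" by (rule comm_group_val[OF std(3)[OF s]])
    obtain R q p R' q' p' where R: "std_span s t R q p" and R': "std_span s t R' q' p'"
      and eq: "A \<otimes>\<^bsub>BHom s t\<^esub> std_smat s t R' q' p' = std_smat s t R q p" using difference[OF s t A] .
    show "FMor ext_functor s t A \<in> hom (BOb M (SG s)) (BOb M (SG t))"
    proof (rule homI)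
      fix x y assume x: "x \<in> V (SG s)" and y: "y \<in> V (SG s)"
      note fx = ext_spec[OF s t A x] and fy = ext_spec[OF s t A y]
      show "FMor ext_functor s t A x \<in> V (SG t)" by (rule fx(1))
      show "FMor ext_functor s t A (x \<otimes>\<^bsub>BOb M (SG s)\<^esub> y) = FMor ext_functor s t A x \<otimes>\<^bsub>BOb M (SG t)\<^esub> FMor ext_functor s t A y"
      proof (rule ext_eqI[OF s t A X.m_closed[OF x y] is_valueI[OF s t A X.m_closed[OF x y] R R' eq W.m_closed[OF fx(1) fy(1)]]])
        show "FMor ext_functor s t A x \<otimes>\<^bsub>BOb M (SG t)\<^esub> FMor ext_functor s t A y \<otimes>\<^bsub>BOb M (SG t)\<^esub>
            std_val s t R' q' p' (x \<otimes>\<^bsub>BOb M (SG s)\<^esub> y) = std_val s t R q p (x \<otimes>\<^bsub>BOb M (SG s)\<^esub> y)"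
          unfolding sval_mult[OF R x y] sval_mult[OF R' x y] fx(2)[OF R R' eq, symmetric] fy(2)[OF R R' eq, symmetric]
          using fx(1) fy(1) sval_closed[OF R' x] sval_closed[OF R' y] by (simp add: W.m_ac)
      qed
    qed
    show "FMor ext_functor s t A \<in> extensional (V (SG s))" by (simp add: ext_functor_def)
  qed
  have add: "FMor ext_functor s t (A \<otimes>\<^bsub>BHom s t\<^esub> B) x = FMor ext_functor s t A x \<otimes>\<^bsub>BOb M (SG t)\<^esub> FMor ext_functor s t B x"
    if s: "s \<in> tuples" and t: "t \<in> tuples" and A: "A \<in> carrier (BHom s t)"
      and B: "B \<in> carrier (BHom s t)" and x: "x \<in> V (SG s)" for s t A B x
  proof -
    interpret H: comm_group "BHom s t" by (rule comm_group_Bdot[OF s t])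
    interpret W: comm_group "BOb M (SG t)" by (rule comm_group_val[OF std(3)[OF t]])
    obtain R q p R' q' p' where R: "std_span s t R q p" and R': "std_span s t R' q' p'"
      and eqA: "A \<otimes>\<^bsub>BHom s t\<^esub> std_smat s t R' q' p' = std_smat s t R q p" using difference[OF s t A] .
    obtain Q f g Q' f' g' where Q: "std_span s t Q f g" and Q': "std_span s t Q' f' g'"
      and eqB: "B \<otimes>\<^bsub>BHom s t\<^esub> std_smat s t Q' f' g' = std_smat s t Q f g" using difference[OF s t B] .
    note fA = ext_spec[OF s t A x] and fB = ext_spec[OF s t B x]
    \<comment> \<open>Presentations of A and of B add up to one of their sum.\<close>
    show ?thesis
    proof (rule ext_eqI[OF s t H.m_closed[OF A B] x is_valueI[OF s t H.m_closed[OF A B] x gspan_sum[OF R Q] gspan_sum[OF R' Q'] _ W.m_closed[OF fA(1) fB(1)]]])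
      show "A \<otimes>\<^bsub>BHom s t\<^esub> B \<otimes>\<^bsub>BHom s t\<^esub> std_smat s t (gset_sum G R' Q') (copair R' Q' q' f') (copair R' Q' p' g') =
          std_smat s t (gset_sum G R Q) (copair R Q q f) (copair R Q p g)"
        unfolding std_smat_sum[OF s t R Q] std_smat_sum[OF s t R' Q'] eqA[symmetric] eqB[symmetric]
        using A B std_smat_closed[OF s t R'] std_smat_closed[OF s t Q'] by (simp add: H.m_ac)
      show "FMor ext_functor s t A x \<otimes>\<^bsub>BOb M (SG t)\<^esub> FMor ext_functor s t B x \<otimes>\<^bsub>BOb M (SG t)\<^esub>
          std_val s t (gset_sum G R' Q') (copair R' Q' q' f') (copair R' Q' p' g') x =
          std_val s t (gset_sum G R Q) (copair R Q q f) (copair R Q p g) x"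
        unfolding sval_sum[OF R Q x] sval_sum[OF R' Q' x] fA(2)[OF R R' eqA, symmetric] fB(2)[OF Q Q' eqB, symmetric]
        using fA(1) fB(1) sval_closed[OF R' x] sval_closed[OF Q' x] by (simp add: W.m_ac)
    qed
  qed
  have idn: "FMor ext_functor t t (Idn (Bdot G) t) = (\<lambda>x\<in>V (SG t). x)" if t: "t \<in> tuples" for t
  proof
    fix x
    note S = std(3)[OF t]
    have sp: "std_span t t (SG t) (gid (SG t)) (gid (SG t))" using S by (simp add: gspan_def gid_gmaps)
    have "FMor ext_functor t t (std_smat t t (SG t) (gid (SG t)) (gid (SG t))) x = x" if "x \<in> V (SG t)"
      using ext_span[OF t t sp that] that S by (simp add: sval_def push_gid pull_gid)
    then show "FMor ext_functor t t (Idn (Bdot G) t) x = (\<lambda>x\<in>V (SG t). x) x"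
      unfolding smat_gid[OF std(1)[OF t]] std(2)[OF t] by (simp add: ext_functor_def)
  qed
  have comp: "FMor ext_functor s u (bcomp s t u B A) =
      compose (V (SG s)) (FMor ext_functor t u B) (FMor ext_functor s t A)"
    if s: "s \<in> tuples" and t: "t \<in> tuples" and u: "u \<in> tuples"
    and A: "A \<in> carrier (BHom s t)" and B: "B \<in> carrier (BHom t u)" for s t u A B
  proof
    fix x show "FMor ext_functor s u (bcomp s t u B A) x = compose (V (SG s)) (FMor ext_functor t u B) (FMor ext_functor s t A) x"
      using ext_comp(2)[OF s t u A B] by (cases "x \<in> V (SG s)") (simp_all add: compose_def ext_functor_def)
  qed
  have "FMor ext_functor s t \<in> hom (BHom s t) (HGrp Ab (BOb M (SG s)) (BOb M (SG t)))"
    if s: "s \<in> tuples" and t: "t \<in> tuples" for s t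
  proof (rule homI)
    show "FMor ext_functor s t A \<in> carrier (HGrp Ab (BOb M (SG s)) (BOb M (SG t)))" if "A \<in> carrier (BHom s t)" for A
      using hom[OF s t that] by simp
    fix A B assume A: "A \<in> carrier (BHom s t)" and B: "B \<in> carrier (BHom s t)"
    show "FMor ext_functor s t (A \<otimes>\<^bsub>BHom s t\<^esub> B) =
        FMor ext_functor s t A \<otimes>\<^bsub>HGrp Ab (BOb M (SG s)) (BOb M (SG t))\<^esub> FMor ext_functor s t B"
    proof
      fix x show "FMor ext_functor s t (A \<otimes>\<^bsub>BHom s t\<^esub> B) x =
        (FMor ext_functor s t A \<otimes>\<^bsub>HGrp Ab (BOb M (SG s)) (BOb M (SG t))\<^esub> FMor ext_functor s t B) x"
        using add[OF s t A B] by (cases "x \<in> V (SG s)") (simp_all, simp add: ext_functor_def)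
    qed
  qed
  then show ?thesis
    unfolding additive_functor_def is_functor_def
    using hom idn comp comm_group_val[OF std(3)] by (simp add: Bdot_Mor)
qed

section \<open>Comparison of M with the constructed functor along j\<close>

definition to_std :: "(('a, 'p) Gset \<Rightarrow> ('a, 'p) pt list) \<Rightarrow> ('a, 'p) Gset \<Rightarrow> ('a, 'p) pt \<Rightarrow> ('a, 'p) pt" where
  "to_std b S = base_map S (b S) (SG (stabs S (b S))) (SB (stabs S (b S)))"

definition from_std :: "(('a, 'p) Gset \<Rightarrow> ('a, 'p) pt list) \<Rightarrow> ('a, 'p) Gset \<Rightarrow> ('a, 'p) pt \<Rightarrow> ('a, 'p) pt" where
  "from_std b S = base_map (SG (stabs S (b S))) (SB (stabs S (b S))) S (b S)"

lemma to_from_std: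
  assumes b: "base_points G b" and S: "finite_gset G S"
  shows "to_std b S \<in> gmaps G S (SG (stabs S (b S)))" "from_std b S \<in> gmaps G (SG (stabs S (b S))) S"
    and "compose (gpts S) (from_std b S) (to_std b S) = gid S"
    and "compose (gpts (SG (stabs S (b S)))) (to_std b S) (from_std b S) = gid (SG (stabs S (b S)))"
    and "bij_betw (from_std b S) (gpts (SG (stabs S (b S)))) (gpts S)"
proof -
  note bS = base_points_based[OF b S]
  note t = stabs_Ob[OF bS]
  note st = std(2)[OF t]
  show "to_std b S \<in> gmaps G S (SG (stabs S (b S)))" "from_std b S \<in> gmaps G (SG (stabs S (b S))) S"
    unfolding to_std_def from_std_def using base_map_gmaps[OF bS std(1)[OF t] st[symmetric]] base_map_gmaps[OF std(1)[OF t] bS st] by simp_all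
  show "compose (gpts S) (from_std b S) (to_std b S) = gid S"
    unfolding to_std_def from_std_def by (rule base_map_comp[OF bS std(1)[OF t] st[symmetric]])
  show "compose (gpts (SG (stabs S (b S)))) (to_std b S) (from_std b S) = gid (SG (stabs S (b S)))"
    unfolding to_std_def from_std_def by (rule base_map_comp[OF std(1)[OF t] bS st])
  show "bij_betw (from_std b S) (gpts (SG (stabs S (b S)))) (gpts S)"
    unfolding from_std_def by (rule base_map_bij[OF std(1)[OF t] bS st])
qed

text \<open>The constructed functor composed with j has at S the value of M at the standard G-set
  with the same stabilizers, not at S itself. The comparison is restriction along the identification
  of the two G-sets.\<close>

definition ext_iso :: "(('a, 'p) Gset \<Rightarrow> ('a, 'p) pt list) \<Rightarrow> ('a, 'p) Gset \<Rightarrow> 'v \<Rightarrow> 'v" where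
  "ext_iso b S = pull M (SG (stabs S (b S))) S (from_std b S)"

text \<open>Stated for all spans, so that naturality for the covariant and for the contravariant
  part are the cases in which one leg is an identity.\<close>

lemma ext_iso_natural:
  assumes b: "base_points G b" and R: "gspan S R T q p" and x: "x \<in> V S"
  shows "FMor ext_functor (stabs S (b S)) (stabs T (b T)) (smat S (b S) T (b T) R q p) (ext_iso b S x) =
    ext_iso b T (sval S R T q p x)"
proof -
  note g = gspanD[OF R]
  note S = to_from_std[OF b g(1)] and T = to_from_std[OF b g(3)]
  note bS = base_points_based[OF b g(1)] and bT = base_points_based[OF b g(3)]
  let ?s = "stabs S (b S)" and ?t = "stabs T (b T)"
  note s = stabs_Ob[OF bS] and t = stabs_Ob[OF bT]
  let ?q = "compose (gpts R) (to_std b S) q" and ?p = "compose (gpts R) (to_std b T) p"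
  have R': "gspan (SG ?s) R T ?q p" using g S std(3)[OF s] by (simp add: gspan_def compose_gmaps)
  have R'': "std_span ?s ?t R ?q ?p" using g S T std(3)[OF s] std(3)[OF t] by (simp add: gspan_def compose_gmaps)
  have "smat S (b S) T (b T) R q p = std_smat ?s ?t R ?q ?p"
    using smat_rebase_source[OF bS std(1)[OF s] std(2)[OF s, symmetric] bT R]
      smat_rebase_target[OF std(1)[OF s] bT std(1)[OF t] std(2)[OF t, symmetric] R']
    by (simp add: to_std_def)
  moreover have ex: "ext_iso b S x \<in> V (SG ?s)"
    unfolding ext_iso_def by (rule pull_closed[OF std(3)[OF s] g(1) S(2) x])
  ultimately have "FMor ext_functor ?s ?t (smat S (b S) T (b T) R q p) (ext_iso b S x) = std_val ?s ?t R ?q ?p (ext_iso b S x)"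
    using ext_span[OF s t R''] by simp
  also have "pull M R (SG ?s) ?q (ext_iso b S x) = pull M R S q (pull M S (SG ?s) (to_std b S) (ext_iso b S x))"
    by (rule pull_comp[OF g(2,1) std(3)[OF s] g(4) S(1) ex])
  then have "std_val ?s ?t R ?q ?p (ext_iso b S x) =
      push M R (SG ?t) ?p (pull M R S q (pull M S (SG ?s) (to_std b S) (ext_iso b S x)))" by (simp add: sval_def)
  also have "pull M S (SG ?s) (to_std b S) (ext_iso b S x) = x"
    unfolding ext_iso_def using pull_comp[OF g(1) std(3)[OF s] g(1) S(1,2) x] pull_gid[OF g(1) x] S(3) by simp
  also have "push M R (SG ?t) ?p (pull M R S q x) = push M T (SG ?t) (to_std b T) (sval S R T q p x)"
    unfolding sval_def by (rule push_comp[OF g(2,3) std(3)[OF t] g(5) T(1) pull_closed[OF g(2,1,4) x]])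
  \<comment> \<open>Transfer along \<open>to_std\<close> is the same as restriction along its
    inverse \<open>from_std\<close>.\<close>
  also have "\<dots> = ext_iso b T (sval S R T q p x)"
  proof -
    let ?y = "sval S R T q p x"
    note y = sval_closed[OF R x]
    have "?y = push M (SG ?t) T (from_std b T) (push M T (SG ?t) (to_std b T) ?y)"
      using push_comp[OF g(3) std(3)[OF t] g(3) T(1,2) y] push_gid[OF g(3) y] T(3) by simp
    then have "ext_iso b T ?y = pull M (SG ?t) T (from_std b T) (push M (SG ?t) T (from_std b T) (push M T (SG ?t) (to_std b T) ?y))"
      by (simp add: ext_iso_def)
    also have "\<dots> = push M T (SG ?t) (to_std b T) ?y"
      using T(5) by (intro pull_push_inj[OF std(3)[OF t] g(3) T(2) _ push_closed[OF g(3) std(3)[OF t] T(1) y]]) (simp add: bij_betw_def)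
    finally show ?thesis by simp
  qed
  finally show ?thesis .
qed

end

text \<open>A factorization of M through the completed biset category. Existence provides one
  instance, and uniqueness compares any two.\<close>

locale mackey_iso = mackey G M + additive_on G F b
  for G (structure) and M :: "('a, 'p, 'v) abfunctors"
    and F :: "('a set list, 'a bimor mat, 'v monoid, 'v \<Rightarrow> 'v) func" and b :: "('a, 'p) Gset \<Rightarrow> ('a, 'p) pt list" +
  fixes \<theta> :: "('a, 'p) Gset \<Rightarrow> 'v \<Rightarrow> 'v"
  assumes iso: "bivariant_iso (DG G) Ab M N \<theta>"

context mackey
begin

lemma ext_mackey_iso:
  assumes b: "base_points G b"
  shows "mackey_iso G M ext_functor b (ext_iso b)"
proof -
  interpret a: additive_on G ext_functor b by unfold_locales (fact ext_additive, fact b)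
  have "bivariant_iso (DG G) Ab M a.N (ext_iso b)"
    unfolding bivariant_iso_def
  proof (intro conjI ballI)
    fix S :: "('a, 'p) Gset" assume "S \<in> Ob (DG G)"
    then have S: "finite_gset G S" by simp
    note s = to_from_std[OF b S]
    note t = stabs_Ob[OF base_points_based[OF b S]]
    note U = std(3)[OF t]
    have inj: "inj_on (from_std b S) (gpts (SG (stabs S (b S))))" using s(5) by (simp add: bij_betw_def)
    have "bij_betw (ext_iso b S) (V S) (V (SG (stabs S (b S))))"
      unfolding ext_iso_def
      by (intro bij_betwI[of _ _ _ "push M (SG (stabs S (b S))) S (from_std b S)"])
        (simp_all add: push_pull_bij[OF U S s(2,5)] pull_push_inj[OF U S s(2) inj] pull_closed[OF U S s(2)] push_closed[OF U S s(2)])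
    then show "ext_iso b S \<in> isos Ab (BOb M S) (BOb a.N S)"
      using pull_hom[OF U S s(2)] bivariantD(5)[OF biv U S s(2)]
      by (intro isos_AbI group_val S) (simp_all add: a.N_simps ext_iso_def group_val U)
    fix T :: "('a, 'p) Gset" and f assume "T \<in> Ob (DG G)" and f: "f \<in> Mor (DG G) S T"
    then have T: "finite_gset G T" and f: "f \<in> gmaps G S T" by simp_all
    have "sval S S T (gid S) f x = push M S T f x" if "x \<in> V S" for x
      using that S by (simp add: sval_def pull_gid)
    then show "Cmp Ab (BOb M S) (BOb M T) (BOb a.N T) (ext_iso b T) (push M S T f) =
        Cmp Ab (BOb M S) (BOb a.N S) (BOb a.N T) (push a.N S T f) (ext_iso b S)"
      using ext_iso_natural[OF b gspan_push[OF S T f]]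
      by (auto simp: a.N_simps(2)[OF S T f] compose_def fun_eq_iff)
    have "sval T S S f (gid S) x = pull M S T f x" if "x \<in> V T" for x
      using that S T f by (simp add: sval_def push_gid pull_closed)
    then show "Cmp Ab (BOb M T) (BOb M S) (BOb a.N S) (ext_iso b S) (pull M S T f) =
        Cmp Ab (BOb M T) (BOb a.N T) (BOb a.N S) (pull a.N S T f) (ext_iso b T)"
      using ext_iso_natural[OF b gspan_pull[OF S T f]]
      by (auto simp: a.N_simps(3)[OF S T f] compose_def fun_eq_iff)
  qed
  then show ?thesis
    by (intro mackey_iso.intro mackey_iso_axioms.intro mackey_axioms a.additive_on_axioms)
qed

end

section \<open>Uniqueness\<close>

context mackey_iso
begin

lemma theta:
  assumes S: "finite_gset G S"
  shows "\<theta> S \<in> hom (BOb M S) (FOb F (J S))" "bij_betw (\<theta> S) (V S) (carrier (FOb F (J S)))"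
    and "\<theta> S \<in> extensional (V S)"
proof -
  have "\<theta> S \<in> isos Ab (BOb M S) (FOb F (J S))" using iso S unfolding bivariant_iso_def by (simp add: N_simps)
  then show "\<theta> S \<in> hom (BOb M S) (FOb F (J S))" "bij_betw (\<theta> S) (V S) (carrier (FOb F (J S)))"
    "\<theta> S \<in> extensional (V S)"
    using isos_AbD by blast+
qed

lemma theta_closed: "finite_gset G S \<Longrightarrow> x \<in> V S \<Longrightarrow> \<theta> S x \<in> carrier (FOb F (J S))"
  using theta(1) by (auto simp: hom_def)

lemma theta_push:
  assumes "finite_gset G S" "finite_gset G T" "f \<in> gmaps G S T" "x \<in> V S"
  shows "\<theta> T (push M S T f x) = fmat S (b S) T (b T) S (gid S) f (\<theta> S x)"
proof -
  have "compose (V S) (\<theta> T) (push M S T f) = compose (V S) (push N S T f) (\<theta> S)"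
    using iso assms(1-3) unfolding bivariant_iso_def by simp
  from fun_cong[OF this, of x] show ?thesis using assms by (simp add: compose_eq N_simps)
qed

lemma theta_pull:
  assumes "finite_gset G S" "finite_gset G T" "f \<in> gmaps G S T" "x \<in> V T"
  shows "\<theta> S (pull M S T f x) = fmat T (b T) S (b S) S f (gid S) (\<theta> T x)"
proof -
  have "compose (V T) (\<theta> S) (pull M S T f) = compose (V T) (pull N S T f) (\<theta> T)"
    using iso assms(1-3) unfolding bivariant_iso_def by simp
  from fun_cong[OF this, of x] show ?thesis using assms by (simp add: compose_eq N_simps)
qed

lemma theta_span:
  assumes R: "gspan S R T q p" and x: "x \<in> V S"
  shows "\<theta> T (sval S R T q p x) = fmat S (b S) T (b T) R q p (\<theta> S x)"
proof -
  note g = gspanD[OF R]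
  note B = bb[OF g(1)] bb[OF g(2)] bb[OF g(3)]
  have "\<theta> T (sval S R T q p x) = fmat R (b R) T (b T) R (gid R) p (fmat S (b S) R (b R) R q (gid R) (\<theta> S x))"
    unfolding sval_def using theta_push[OF g(2,3,5) pull_closed[OF g(2,1,4) x]] theta_pull[OF g(2,1,4) x] by simp
  also have "\<dots> = fmat S (b S) T (b T) R q p (\<theta> S x)"
    unfolding fmat_comp[OF B gspan_pull[OF g(2,1,4)] gspan_push[OF g(2,3,5)] theta_closed[OF g(1) x], symmetric]
      smat_factor[OF B R, symmetric] ..
  finally show ?thesis .
qed

text \<open>The identity span of T, taken with respect to two lists of base points, relates the two
  tuples of stabilizers. It composes strictly with other spans, so under F it is a change of base
  points.\<close>

lemma fmat_rebase_target:
  assumes "based S c" "based T d" "based T d'" "gspan S R T q p" "x \<in> carrier (FOb F (stabs S c))"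
  shows "fmat T d T d' T (gid T) (gid T) (fmat S c T d R q p x) = fmat S c T d' R q p x"
proof -
  note g = gspanD[OF assms(4)]
  have sp: "gspan T T T (gid T) (gid T)" using g by (simp add: gspan_def gid_gmaps)
  show ?thesis
    unfolding fmat_comp[OF assms(1-3,4) sp assms(5), symmetric]
      smat_comp_push[OF assms(1-4) gid_gmaps[OF g(3)] g(3)] compose_gid(2)[OF g(5)] ..
qed

lemma fmat_rebase_source:
  assumes "based T d" "based T d'" "based U e" "gspan T R U q p" "x \<in> carrier (FOb F (stabs T d))"
  shows "fmat T d' U e R q p (fmat T d T d' T (gid T) (gid T) x) = fmat T d U e R q p x"
proof -
  note g = gspanD[OF assms(4)]
  have sp: "gspan T T T (gid T) (gid T)" using g by (simp add: gspan_def gid_gmaps)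
  show ?thesis
    unfolding fmat_comp[OF assms(1-3) sp assms(4,5), symmetric]
      smat_comp_pull[OF assms(1-4) gid_gmaps[OF g(1)] g(1)] compose_gid(2)[OF g(4)] ..
qed

lemma fmat_gid: "based S c \<Longrightarrow> x \<in> carrier (FOb F (stabs S c)) \<Longrightarrow> fmat S c S c S (gid S) (gid S) x = x"
  by (simp add: smat_gid F_id[OF stabs_Ob])

text \<open>\<open>\<theta>\<close> transported to all tuples \<open>t\<close>, whether or not they are of the form \<open>j(S)\<close>: the base points
  chosen by \<open>b\<close> in the standard \<open>G\<close>-set of \<open>t\<close> are exchanged for the standard ones.\<close>

definition xi :: "'a set list \<Rightarrow> 'v \<Rightarrow> 'v" where
  "xi t = (\<lambda>y\<in>V (SG t). fmat (SG t) (b (SG t)) (SG t) (SB t) (SG t) (gid (SG t)) (gid (SG t)) (\<theta> (SG t) y))"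

lemma gspan_gid: "finite_gset G S \<Longrightarrow> gspan S S S (gid S) (gid S)"
  by (simp add: gspan_def gid_gmaps)

text \<open>\<open>\<theta>\<close> is bijective by assumption, and the change of base points is
  inverted by the change in the opposite direction.\<close>

lemma xi_iso:
  assumes t: "t \<in> tuples"
  shows "xi t \<in> iso (BOb M (SG t)) (FOb F t)"
proof -
  let ?U = "SG t" and ?e = "SB t"
  note U = std(3)[OF t] and e = std(1)[OF t] and st = std(2)[OF t]
  note bU = bb[OF U] and sp = gspan_gid[OF U]
  interpret A: comm_group "BOb M ?U" by (rule comm_group_val[OF U])
  let ?k = "fmat ?U ?e ?U (b ?U) ?U (gid ?U) (gid ?U)" and ?k' = "fmat ?U (b ?U) ?U ?e ?U (gid ?U) (gid ?U)"
  have k: "?k x \<in> carrier (FOb F (J ?U))" "?k' (?k x) = x" if "x \<in> carrier (FOb F t)" for x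
    using fmat_closed[OF e bU sp] fmat_rebase_target[OF e bU e sp] fmat_gid[OF e] that by (simp_all add: st)
  have k': "?k' x \<in> carrier (FOb F t)" "?k (?k' x) = x" if "x \<in> carrier (FOb F (J ?U))" for x
    using fmat_closed[OF bU e sp] fmat_rebase_target[OF bU e bU sp] fmat_gid[OF bU] that by (simp_all add: st)
  have "bij_betw ?k' (carrier (FOb F (J ?U))) (carrier (FOb F t))"
    using k k' by (intro bij_betwI[of _ _ _ ?k]) auto
  from bij_betw_trans[OF theta(2)[OF U] this]
  have "bij_betw (xi t) (V ?U) (carrier (FOb F t))"
    by (rule bij_betw_cong[THEN iffD1, rotated]) (simp add: xi_def)
  moreover have "xi t \<in> hom (BOb M ?U) (FOb F t)"
  proof (rule homI)
    fix x y assume x: "x \<in> V ?U" and y: "y \<in> V ?U"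
    show "xi t x \<in> carrier (FOb F t)" using x k'(1)[OF theta_closed[OF U x]] by (simp add: xi_def)
    have "?k' \<in> hom (FOb F (J ?U)) (FOb F t)"
      using F_hom(1)[OF J_Ob[OF U] t] smat_closed[OF bU e sp] by (simp add: st)
    from hom_mult[OF this theta_closed[OF U x] theta_closed[OF U y]]
    show "xi t (x \<otimes>\<^bsub>BOb M ?U\<^esub> y) = xi t x \<otimes>\<^bsub>FOb F t\<^esub> xi t y"
      using hom_mult[OF theta(1)[OF U] x y] x y by (simp add: xi_def)
  qed
  ultimately show ?thesis by (simp add: iso_def)
qed

lemma xi_closed: "t \<in> tuples \<Longrightarrow> y \<in> V (SG t) \<Longrightarrow> xi t y \<in> carrier (FOb F t)"
  using xi_iso by (auto simp: iso_def hom_def)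

text \<open>Expresses F on all spans between standard G-sets through M alone. Since every morphism
  is a difference of two spans, F has no freedom left on morphisms beyond \<open>xi\<close>.\<close>

lemma xi_span:
  assumes s: "s \<in> tuples" and t: "t \<in> tuples" and R: "std_span s t R q p" and y: "y \<in> V (SG s)"
  shows "FMor F s t (std_smat s t R q p) (xi s y) = xi t (std_val s t R q p y)"
proof -
  note es = std(1)[OF s] and et = std(1)[OF t] and Us = std(3)[OF s] and Ut = std(3)[OF t]
  note th = theta_closed[OF Us y]
  have "FMor F s t (std_smat s t R q p) (xi s y) = fmat (SG s) (b (SG s)) (SG t) (SB t) R q p (\<theta> (SG s) y)"
    using fmat_rebase_source[OF bb[OF Us] es et R th] y unfolding std(2)[OF s] std(2)[OF t] by (simp add: xi_def std(2)[OF s])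
  also have "\<dots> = xi t (std_val s t R q p y)"
    using fmat_rebase_target[OF bb[OF Us] bb[OF Ut] et R th] theta_span[OF R y] sval_closed[OF R y]
    unfolding std(2)[OF t] by (simp add: xi_def std(2)[OF t])
  finally show ?thesis .
qed

text \<open>On a tuple j(S) the transported map is \<open>\<theta>\<close> at S again, up to the
  identification of S with its standard G-set. From this the isomorphism between two factorizations
  is seen to respect \<open>\<theta>\<close>.\<close>

lemma xi_J:
  assumes S: "finite_gset G S" and y: "y \<in> V S"
  shows "xi (J S) (pull M (SG (J S)) S (from_std b S) y) = \<theta> S y"
proof -
  let ?t = "J S" and ?U = "SG (J S)" and ?f = "from_std b S"
  note t = J_Ob[OF S] note e = std(1)[OF t] and U = std(3)[OF t] and st = std(2)[OF t]
  note fs = to_from_std[OF base S]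
  note th = theta_closed[OF S y] and py = pull_closed[OF U S fs(2) y]
  note sp = gspan_pull[OF U S fs(2)]
  have "xi ?t (pull M ?U S ?f y) = fmat ?U (b ?U) ?U (SB ?t) ?U (gid ?U) (gid ?U) (fmat S (b S) ?U (b ?U) ?U ?f (gid ?U) (\<theta> S y))"
    using py theta_pull[OF U S fs(2) y] by (simp add: xi_def)
  also have "\<dots> = fmat S (b S) ?U (SB ?t) ?U ?f (gid ?U) (\<theta> S y)"
    by (rule fmat_rebase_target[OF bb[OF S] bb[OF U] e sp th])
  \<comment> \<open>Passing from S to its standard G-set composes the leg \<open>from_std\<close>
    with its inverse, which leaves the identity.\<close>
  also have "smat S (b S) ?U (SB ?t) ?U ?f (gid ?U) = smat ?U (SB ?t) ?U (SB ?t) ?U (gid ?U) (gid ?U)"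
    using smat_rebase_source[OF bb[OF S] e st[symmetric] e sp] fs(4) by (simp add: to_std_def)
  also have "FMor F ?t (stabs ?U (SB ?t)) (smat ?U (SB ?t) ?U (SB ?t) ?U (gid ?U) (gid ?U)) (\<theta> S y) = \<theta> S y"
    using fmat_gid[OF e] th unfolding st by simp
  finally show ?thesis .
qed

end

text \<open>Both functors are compared with M on standard G-sets, and this comparison is natural for
  spans, hence for their differences. Conversely the condition on \<open>\<theta>\<close> prescribes
  a natural isomorphism on tuples j(S), and each tuple t is isomorphic to j of its standard
  G-set.\<close>

lemma mackey_iso_unique:
  assumes X: "mackey_iso G M F b \<theta>" and Y: "mackey_iso G M F' b \<theta>'"
  shows "\<exists>!\<eta>. \<eta> \<in> extensional (Ob (Bdot G)) \<and> natural_iso (Bdot G) Ab F F' \<eta> \<and>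
    (\<forall>S\<in>Ob (DG G). Cmp Ab (BOb M S) (FOb F (BOb (j_functor G b) S)) (FOb F' (BOb (j_functor G b) S))
       (\<eta> (BOb (j_functor G b) S)) (\<theta> S) = \<theta>' S)"
proof -
  interpret X: mackey_iso G M F b \<theta> by (rule X)
  interpret Y: mackey_iso G M F' b \<theta>' by (rule Y)
  let ?O = "Ob (Bdot G)"
  \<comment> \<open>From F(t) back to M at the standard G-set of t, and from there to F'(t).\<close>
  define \<eta> where "\<eta> = (\<lambda>t\<in>?O. compose (carrier (FOb F t)) (Y.xi t) (inv_into (X.V (X.SG t)) (X.xi t)))"
  have bijX: "bij_betw (X.xi t) (X.V (X.SG t)) (carrier (FOb F t))" if "t \<in> ?O" for t
    using X.xi_iso[OF that] by (simp add: iso_def)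
  have surjX: "\<exists>y\<in>X.V (X.SG t). z = X.xi t y" if "t \<in> ?O" "z \<in> carrier (FOb F t)" for t z
    using bijX[OF that(1)] that(2) unfolding bij_betw_def by blast
  have eta: "\<eta> t (X.xi t y) = Y.xi t y" if t: "t \<in> ?O" and y: "y \<in> X.V (X.SG t)" for t y
    using bijX[OF t] X.xi_closed[OF t y] t y by (simp add: \<eta>_def compose_eq bij_betw_def)
  have eta_iso: "\<eta> t \<in> isos Ab (FOb F t) (FOb F' t)" if t: "t \<in> ?O" for t
  proof -
    interpret A: comm_group "FOb F t" by (rule X.F_group[OF t])
    interpret B: comm_group "FOb F' t" by (rule Y.F_group[OF t])
    have "inv_into (X.V (X.SG t)) (X.xi t) \<in> iso (FOb F t) (BOb M (X.SG t))"
      using group.iso_set_sym[OF X.group_val[OF X.std(3)[OF t]] X.xi_iso[OF t]] .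
    then have c: "Y.xi t \<circ> inv_into (X.V (X.SG t)) (X.xi t) \<in> iso (FOb F t) (FOb F' t)"
      by (rule iso_set_trans[OF _ Y.xi_iso[OF t]])
    have eq: "\<eta> t x = (Y.xi t \<circ> inv_into (X.V (X.SG t)) (X.xi t)) x" if "x \<in> carrier (FOb F t)" for x
      using t that by (simp add: \<eta>_def compose_eq)
    have "\<eta> t \<in> hom (FOb F t) (FOb F' t)"
      using c by (intro homI) (auto simp: iso_def hom_def eq)
    moreover have "bij_betw (\<eta> t) (carrier (FOb F t)) (carrier (FOb F' t))"
      using c eq by (simp add: iso_def cong: bij_betw_cong)
    moreover have "\<eta> t \<in> extensional (carrier (FOb F t))" using t by (simp add: \<eta>_def)
    ultimately show ?thesis
      by (intro isos_AbI A.is_group B.is_group)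
  qed
  have nat: "\<eta> t (FMor F s t A x) = FMor F' s t A (\<eta> s x)"
    if s: "s \<in> ?O" and t: "t \<in> ?O" and A: "A \<in> carrier (HGrp (Bdot G) s t)" and x: "x \<in> carrier (FOb F s)" for s t A x
  proof -
    interpret B: comm_group "FOb F' t" by (rule Y.F_group[OF t])
    obtain y where y: "y \<in> X.V (X.SG s)" "x = X.xi s y" using surjX[OF s x] by blast
    obtain R q p R' q' p' where R: "X.std_span s t R q p" and R': "X.std_span s t R' q' p'"
      and eq: "A \<otimes>\<^bsub>HGrp (Bdot G) s t\<^esub> X.std_smat s t R' q' p' = X.std_smat s t R q p" using X.difference[OF s t A] .
    note cR' = X.std_smat_closed[OF s t R']
    note vR = X.sval_closed[OF R y(1)] and vR' = X.sval_closed[OF R' y(1)]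
    have e1: "FMor F s t A x \<otimes>\<^bsub>FOb F t\<^esub> X.xi t (X.std_val s t R' q' p' y) = X.xi t (X.std_val s t R q p y)"
      using X.F_add[OF s t A cR' x] X.xi_span[OF s t R y(1)] X.xi_span[OF s t R' y(1)] unfolding eq y(2) by simp
    have e2: "FMor F' s t A (Y.xi s y) \<otimes>\<^bsub>FOb F' t\<^esub> Y.xi t (X.std_val s t R' q' p' y) = Y.xi t (X.std_val s t R q p y)"
      using Y.F_add[OF s t A cR' Y.xi_closed[OF s y(1)]] Y.xi_span[OF s t R y(1)] Y.xi_span[OF s t R' y(1)] unfolding eq by simp
    have h: "\<eta> t \<in> hom (FOb F t) (FOb F' t)" using isos_AbD(1)[OF eta_iso[OF t]] .
    have cl: "FMor F s t A x \<in> carrier (FOb F t)" by (rule X.F_closed[OF s t A x])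
    \<comment> \<open>With A + R' = R both functors agree, through \<open>\<eta>\<close>, on R and
      on R'; so they agree on A once the contribution of R' is cancelled.\<close>
    have "\<eta> t (FMor F s t A x) \<otimes>\<^bsub>FOb F' t\<^esub> Y.xi t (X.std_val s t R' q' p' y) =
        FMor F' s t A (Y.xi s y) \<otimes>\<^bsub>FOb F' t\<^esub> Y.xi t (X.std_val s t R' q' p' y)"
      using hom_mult[OF h cl X.xi_closed[OF t vR']] eta[OF t vR] eta[OF t vR'] unfolding e1 e2 by simp
    moreover have "\<eta> t (FMor F s t A x) \<in> carrier (FOb F' t)" using h cl by (auto simp: hom_def)
    ultimately show ?thesis
      unfolding y(2) eta[OF s y(1)] using Y.F_closed[OF s t A Y.xi_closed[OF s y(1)]] Y.xi_closed[OF t vR'] y(2) by simp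
  qed
  have etaJ: "\<eta> (X.J S) (\<theta> S x) = \<theta>' S x" if "finite_gset G S" "x \<in> X.V S" for S x
    using eta[OF X.J_Ob[OF that(1)] X.pull_closed[OF X.std(3)[OF X.J_Ob[OF that(1)]] that(1) X.to_from_std(2)[OF X.base that(1)] that(2)]]
      X.xi_J[OF that] Y.xi_J[OF that] by simp
  have comp_iff: "(\<forall>S\<in>Ob (DG G). Cmp Ab (BOb M S) (FOb F (BOb (j_functor G b) S)) (FOb F' (BOb (j_functor G b) S))
       (e (BOb (j_functor G b) S)) (\<theta> S) = \<theta>' S) \<longleftrightarrow>
      (\<forall>S. finite_gset G S \<longrightarrow> (\<forall>x\<in>X.V S. e (X.J S) (\<theta> S x) = \<theta>' S x))" for e
  proof -
    have "compose (X.V S) (e (X.J S)) (\<theta> S) = \<theta>' S \<longleftrightarrow> (\<forall>x\<in>X.V S. e (X.J S) (\<theta> S x) = \<theta>' S x)"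
      if "finite_gset G S" for S
      using Y.theta(3)[OF that] by (auto simp: compose_def fun_eq_iff extensional_def)
    then show ?thesis by (simp add: X.j_BOb)
  qed
  show ?thesis
  proof (rule ex1I[of _ \<eta>])
    have "natural_iso (Bdot G) Ab F F' \<eta>"
      unfolding natural_iso_def using eta_iso nat by (simp add: X.Bdot_Mor compose_def fun_eq_iff)
    then show "\<eta> \<in> extensional ?O \<and> natural_iso (Bdot G) Ab F F' \<eta> \<and>
      (\<forall>S\<in>Ob (DG G). Cmp Ab (BOb M S) (FOb F (BOb (j_functor G b) S)) (FOb F' (BOb (j_functor G b) S))
       (\<eta> (BOb (j_functor G b) S)) (\<theta> S) = \<theta>' S)"
      unfolding comp_iff using etaJ by (simp add: \<eta>_def)
  next
    fix e assume e: "e \<in> extensional ?O \<and> natural_iso (Bdot G) Ab F F' e \<and>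
      (\<forall>S\<in>Ob (DG G). Cmp Ab (BOb M S) (FOb F (BOb (j_functor G b) S)) (FOb F' (BOb (j_functor G b) S))
       (e (BOb (j_functor G b) S)) (\<theta> S) = \<theta>' S)"
    have eJ: "e (X.J S) (\<theta> S x) = \<theta>' S x" if "finite_gset G S" "x \<in> X.V S" for S x
      using e that unfolding comp_iff by blast
    have e_iso: "e t \<in> isos Ab (FOb F t) (FOb F' t)" if "t \<in> ?O" for t
      using e that unfolding natural_iso_def by blast
    have e_nat: "e t (FMor F s t A x) = FMor F' s t A (e s x)"
      if "s \<in> ?O" "t \<in> ?O" "A \<in> carrier (HGrp (Bdot G) s t)" "x \<in> carrier (FOb F s)" for s t A x
    proof -
      have "compose (carrier (FOb F s)) (e t) (FMor F s t A) = compose (carrier (FOb F s)) (FMor F' s t A) (e s)"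
        using e that(1-3) unfolding natural_iso_def X.Bdot_Mor by simp
      from fun_cong[OF this, of x] show ?thesis using that(4) by (simp add: compose_eq)
    qed
    show "e = \<eta>"
    proof (rule extensionalityI[of _ ?O])
      show "e \<in> extensional ?O" using e by blast
      show "\<eta> \<in> extensional ?O" by (simp add: \<eta>_def)
      fix t assume t: "t \<in> ?O"
      let ?U = "X.SG t"
      note U = X.std(3)[OF t] and st = X.std(2)[OF t]
      show "e t = \<eta> t"
      proof (rule extensionalityI[OF isos_AbD(2)[OF e_iso[OF t]] isos_AbD(2)[OF eta_iso[OF t]]])
        fix z assume "z \<in> carrier (FOb F t)"
        then obtain y where y: "y \<in> X.V ?U" "z = X.xi t y" using surjX[OF t] by blast
        \<comment> \<open>The change of base points from j of the standard G-set of t to t.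
          Naturality of \<open>e\<close> along it turns the prescribed value on the former into the
          value at t.\<close>
        have k: "X.smat ?U (b ?U) ?U (X.SB t) ?U (X.gid ?U) (X.gid ?U) \<in> carrier (HGrp (Bdot G) (X.J ?U) t)"
          using X.smat_closed[OF X.bb[OF U] X.std(1)[OF t] X.gspan_gid[OF U]] by (simp add: st)
        have "e t z = Y.xi t y"
          using e_nat[OF X.J_Ob[OF U] t k X.theta_closed[OF U y(1)]] eJ[OF U y(1)] y
          by (simp add: X.xi_def Y.xi_def st)
        then show "e t z = \<eta> t z" using eta[OF t y(1)] y(2) by simp
      qed
    qed
  qed
qed

theorem theorem8p1:
  fixes G :: "('g, 'b) monoid_scheme"
    and b :: "('g, 'p) Gset \<Rightarrow> ('g, 'p) pt list"
  assumes "group G" and "finite (carrier G)" and "base_points G b"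
  shows "(\<forall>F :: ('g set list, 'g bimor mat, 'a monoid, 'a \<Rightarrow> 'a) func.
            additive_functor (Bdot G) Ab F \<longrightarrow>
              mackey_functor G (func_bifunc F (j_functor G b)) \<and>
              conj_invariant G (func_bifunc F (j_functor G b))) \<and>
         (\<forall>M :: ('g, 'p, 'a) abfunctors.
            mackey_functor G M \<and> conj_invariant G M \<longrightarrow>
              (\<exists>(F :: ('g set list, 'g bimor mat, 'a monoid, 'a \<Rightarrow> 'a) func) \<theta>.
                 additive_functor (Bdot G) Ab F \<and>
                 bivariant_iso (DG G) Ab M (func_bifunc F (j_functor G b)) \<theta> \<and>
                 (\<forall>F' \<theta>'. additive_functor (Bdot G) Ab F' \<and>
                    bivariant_iso (DG G) Ab M (func_bifunc F' (j_functor G b)) \<theta>' \<longrightarrow>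
                    (\<exists>!\<eta>. \<eta> \<in> extensional (Ob (Bdot G)) \<and>
                       natural_iso (Bdot G) Ab F F' \<eta> \<and>
                       (\<forall>S\<in>Ob (DG G).
                          Cmp Ab (BOb M S) (FOb F (BOb (j_functor G b) S)) (FOb F' (BOb (j_functor G b) S))
                            (\<eta> (BOb (j_functor G b) S)) (\<theta> S) = \<theta>' S)))))"
proof (intro conjI allI impI)
  have fg: "fin_group G" using assms(1,2) by (simp add: fin_group_def fin_group_axioms_def)
  show "mackey_functor G (func_bifunc F (j_functor G b))" "conj_invariant G (func_bifunc F (j_functor G b))"
    if "additive_functor (Bdot G) Ab F" for F :: "('g set list, 'g bimor mat, 'a monoid, 'a \<Rightarrow> 'a) func"
  proof -
    interpret additive_on G F b using fg that assms(3) by (intro additive_on.intro additive_on_axioms.intro)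
    show "mackey_functor G N" "conj_invariant G N" by (fact N_mackey, fact N_conj)
  qed
  fix M :: "('g, 'p, 'a) abfunctors" assume M: "mackey_functor G M \<and> conj_invariant G M"
  interpret mackey G M using fg M by (intro mackey.intro mackey_axioms.intro) simp_all
  note X = ext_mackey_iso[OF assms(3)]
  interpret X: mackey_iso G M ext_functor b "ext_iso b" by (rule X)
  show "\<exists>(F :: ('g set list, 'g bimor mat, 'a monoid, 'a \<Rightarrow> 'a) func) \<theta>.
                 additive_functor (Bdot G) Ab F \<and>
                 bivariant_iso (DG G) Ab M (func_bifunc F (j_functor G b)) \<theta> \<and>
                 (\<forall>F' \<theta>'. additive_functor (Bdot G) Ab F' \<and>
                    bivariant_iso (DG G) Ab M (func_bifunc F' (j_functor G b)) \<theta>' \<longrightarrow>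
                    (\<exists>!\<eta>. \<eta> \<in> extensional (Ob (Bdot G)) \<and>
                       natural_iso (Bdot G) Ab F F' \<eta> \<and>
                       (\<forall>S\<in>Ob (DG G).
                          Cmp Ab (BOb M S) (FOb F (BOb (j_functor G b) S)) (FOb F' (BOb (j_functor G b) S))
                            (\<eta> (BOb (j_functor G b) S)) (\<theta> S) = \<theta>' S)))"
  proof (rule exI[of _ ext_functor], rule exI[of _ "ext_iso b"], intro conjI allI impI X.additive X.iso)
    fix F' :: "('g set list, 'g bimor mat, 'a monoid, 'a \<Rightarrow> 'a) func" and \<theta>'
    assume F': "additive_functor (Bdot G) Ab F' \<and> bivariant_iso (DG G) Ab M (func_bifunc F' (j_functor G b)) \<theta>'"
    then have "mackey_iso G M F' b \<theta>'"
      using fg assms(3)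
      by (intro mackey_iso.intro mackey_iso_axioms.intro additive_on.intro additive_on_axioms.intro mackey_axioms) simp_all
    from mackey_iso_unique[OF X this]
    show "\<exists>!\<eta>. \<eta> \<in> extensional (Ob (Bdot G)) \<and> natural_iso (Bdot G) Ab ext_functor F' \<eta> \<and>
        (\<forall>S\<in>Ob (DG G). Cmp Ab (BOb M S) (FOb ext_functor (BOb (j_functor G b) S)) (FOb F' (BOb (j_functor G b) S))
           (\<eta> (BOb (j_functor G b) S)) (ext_iso b S) = \<theta>' S)" .
  qed
qed

end
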